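(* Let $p_n=\sum_{h\ge0}p_n^{(h)}$ and let $H_n$ be the random variable with $\mathbb{P}(H_n=h)=p_n^{(h)}/p_n$. As $n\to\infty$: \[ p_n=\sqrt{\frac{\pi}{2n}}-\frac{5\sqrt{2\pi}}{24\sqrt{n^3}}+\frac{127\sqrt{2\pi}}{960\sqrt{n^5}}-\frac{1571\sqrt{2\pi}}{16128\sqrt{n^7}}-\frac{1896913\sqrt{2\pi}}{184320\sqrt{n^9}}+O\Big(\frac1{\sqrt{n^{11}}}\Big), \] \[ \mathbb{E}H_n=2G\sqrt{\frac{2n}{\pi}}-1+\frac{5\sqrt2G}{6\sqrt{\pi n}}-\frac{131\sqrt2G}{720\sqrt{\pi n^3}}+\frac{1129\sqrt2G}{12096\sqrt{\pi n^5}}+O\Big(\frac1{\sqrt{n^7}}\Big), \] \[ \mathbb{V}H_n=\frac{\pi^3-32G^2}{4\pi}n+\frac{\pi^3-40G^2}{6\pi}-\frac{\pi^3-12G^2}{180\pi n}+\frac{11\pi^3-265G^2}{1890\pi n^2}+O\Big(\frac1{n^3}\Big), \] and for every $r\in\mathbb{N}$, \[ \mathbb{E}H_n^r\sim\frac{2^{r/2+2}}{\pi}\Gamma\Big(\frac r2+1\Big)\beta(r+1)n^{r/2}. \] Moreover, if $\eta=h/\sqrt n$ satisfies $3/\sqrt{\log n}<\eta<\sqrt{\log n}/2$ and $h\equiv n\bmod 2$, then \[ \mathbb{P}(H_n=h)\sim\frac{2\phi(\eta)}{\sqrt n},\qquad \phi(\eta)=\frac{4\eta}{\pi}\sum_{k\ge0}(-1)^k(2k+1)\exp\Big(-\frac{(2k+1)^2\eta^2}{2}\Big)=\frac{\sqrt{2\pi}}{\eta^2}\sum_{k\ge0}(-1)^k(2k+1)\exp\Big(-\frac{\pi^2(2k+1)^2}{8\eta^2}\Big).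 \]
   Context: $p_n^{(h)}$ is the probability that the random walk $(S_k)_{0\le k\le n}$ on $\mathbb{N}_0$ with reflecting barrier at $0$ (i.e. $S_0=0$; from $j\ge1$ step to $j\pm1$ with probability $\tfrac12$ each; from $0$ step to $1$ with probability $1$) satisfies $0\le S_k\le h$ for all $k$ and $S_n=h$; thus $p_n$ is the probability that the walk ends at its maximum. $G=\beta(2)$ is Catalan's constant and $\beta(s)=\sum_{k\ge0}(-1)^k(2k+1)^{-s}$ is the Dirichlet beta function. $a_n\sim b_n$ means $a_n/b_n\to1$; in the local limit statement this holds uniformly over the stated range of $h$.
   Formalization: In the expansion of p_n the printed term −1896913√(2π)/(184320√(n^9)) is wrong and makes the claim false; it is replaced by the correct term +43661√(2π)/(552960√(n^9)). All else is as stated. *)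

theory Defs
  imports "HOL-Probability.Probability" "HOL-Library.Landau_Symbols"
begin

definition reflecting_step :: "nat \<Rightarrow> nat pmf" where
  "reflecting_step j = (if j = 0 then return_pmf 1 else pmf_of_set {j - 1, j + 1})"

text \<open>The law of the trajectory \<open>[S\<^sub>0, \<dots>, S\<^sub>n]\<close>, as a list of length \<open>n + 1\<close>.\<close>

primrec reflecting_walk :: "nat \<Rightarrow> nat list pmf" where
  "reflecting_walk 0 = return_pmf [0]"
| "reflecting_walk (Suc n) =
     bind_pmf (reflecting_walk n) (\<lambda>s. map_pmf (\<lambda>j. s @ [j]) (reflecting_step (last s)))"

definition prob_max_at :: "nat \<Rightarrow> nat \<Rightarrow> real" where
  "prob_max_at n h = measure_pmf.prob (reflecting_walk n) {s. (\<forall>k\<le>n. s ! k \<le> h) \<and> s ! n = h}"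

definition prob_max :: "nat \<Rightarrow> real" where
  "prob_max n = (\<Sum>h. prob_max_at n h)"

text \<open>The law of \<open>H\<^sub>n\<close>. That the given weights form a probability distribution, so that
  \<open>embed_pmf\<close> is meaningful here, is the lemma \<open>pmf_height_pmf\<close> below.\<close>

definition height_pmf :: "nat \<Rightarrow> nat pmf" where
  "height_pmf n = embed_pmf (\<lambda>h. prob_max_at n h / prob_max n)"

abbreviation E_height_power :: "nat \<Rightarrow> nat \<Rightarrow> real" where
  "E_height_power n r \<equiv> measure_pmf.expectation (height_pmf n) (\<lambda>h. real h ^ r)"

abbreviation E_height :: "nat \<Rightarrow> real" where
  "E_height n \<equiv> measure_pmf.expectation (height_pmf n) real"

abbreviation Var_height :: "nat \<Rightarrow> real" where
  "Var_height n \<equiv> measure_pmf.variance (height_pmf n) real"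

definition dirichlet_beta :: "real \<Rightarrow> real" where
  "dirichlet_beta s = (\<Sum>k. (-1) ^ k * (2 * real k + 1) powr (- s))"

definition catalan_const :: real where
  "catalan_const = dirichlet_beta 2"

definition height_density :: "real \<Rightarrow> real" where
  "height_density \<eta> =
     4 * \<eta> / pi * (\<Sum>k. (-1) ^ k * (2 * real k + 1) * exp (- ((2 * real k + 1)\<^sup>2 * \<eta>\<^sup>2 / 2)))"

text \<open>Erratum. In the published expansion of \<open>prob_max n\<close> the coefficient of
  \<open>sqrt (2 * pi) / sqrt (n ^ 9)\<close> is printed as \<open>- 1896913 / 184320\<close>, for which the expansion
  with error \<open>O(1 / sqrt (n ^ 11))\<close> is false. The correct coefficient is
  \<open>43661 / 552960\<close>: up to errors smaller than every power of \<open>n\<close>, and with \<open>M = n + 1\<close>,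
  \<open>prob_max n\<close> equals \<open>sqrt (2 * pi) / 2\<close> times
  \<open>M powr (-1/2) * (1 + 1 / (12 * M) + 7 / (480 * M^2) - 17 / (8064 * M^3) - 1219 / (276480 * M^4) + \<dots>)\<close>,
  and re-expanding in powers of \<open>n\<close> gives the first four published coefficients and then
  \<open>43661 / 552960\<close>. The theorem is stated with the corrected coefficient.\<close>

lemma set_reflecting_walk:
  "s \<in> set_pmf (reflecting_walk n) \<Longrightarrow> length s = Suc n \<and> last s \<le> n"
proof (induction n arbitrary: s)
  case (Suc n)
  from Suc.prems obtain t j where t: "t \<in> set_pmf (reflecting_walk n)"
    and j: "j \<in> set_pmf (reflecting_step (last t))" and s: "s = t @ [j]"
    by auto
  have "j \<le> last t + 1"
    using j by (auto simp: reflecting_step_def split: if_splits)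
  with Suc.IH[OF t] s show ?case by auto
qed auto

lemma prob_max_at_eq_0:
  assumes "h > n"
  shows "prob_max_at n h = 0"
proof -
  have "s ! n \<noteq> h" if "s \<in> set_pmf (reflecting_walk n)" for s
    using set_reflecting_walk[OF that] assms
    by (cases s rule: rev_cases) auto
  then show ?thesis
    unfolding prob_max_at_def measure_pmf_zero_iff by auto
qed

lemma upt_in_reflecting_walk: "[0..<Suc n] \<in> set_pmf (reflecting_walk n)"
proof (induction n)
  case (Suc n)
  have "Suc n \<in> set_pmf (reflecting_step (last [0..<Suc n]))"
    by (auto simp: reflecting_step_def)
  then have "[0..<Suc n] @ [Suc n] \<in> set_pmf (reflecting_walk (Suc n))"
    using Suc.IH by (simp only: reflecting_walk.simps set_bind_pmf set_map_pmf) blast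
  then show ?case by simp
qed auto

lemma prob_max_at_nonneg: "prob_max_at n h \<ge> 0"
  by (simp add: prob_max_at_def)

lemma prob_max_at_self_pos: "prob_max_at n n > 0"
proof -
  have "[0..<Suc n] \<in> {s. (\<forall>k\<le>n. s ! k \<le> n) \<and> s ! n = n}"
    by (simp del: upt_Suc)
  with upt_in_reflecting_walk have "prob_max_at n n \<noteq> 0"
    unfolding prob_max_at_def measure_pmf_zero_iff by blast
  with prob_max_at_nonneg[of n n] show ?thesis by simp
qed

lemma prob_max_eq_sum: "prob_max n = (\<Sum>h\<le>n. prob_max_at n h)"
  unfolding prob_max_def by (rule suminf_finite) (auto simp: prob_max_at_eq_0)

lemma prob_max_pos: "prob_max n > 0"
  unfolding prob_max_eq_sum
  by (rule sum_pos2[of _ n]) (auto simp: prob_max_at_self_pos prob_max_at_nonneg)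

lemma pmf_height_pmf: "pmf (height_pmf n) h = prob_max_at n h / prob_max n"
  unfolding height_pmf_def
proof (rule pmf_embed_pmf)
  show "0 \<le> prob_max_at n h / prob_max n" for h
    using prob_max_at_nonneg prob_max_pos[of n] by simp
  have "(\<integral>\<^sup>+h. ennreal (prob_max_at n h / prob_max n) \<partial>count_space UNIV)
      = (\<Sum>h\<le>n. ennreal (prob_max_at n h / prob_max n))"
    by (subst nn_integral_count_space'[of "{..n}"]) (auto simp: prob_max_at_eq_0)
  also have "\<dots> = ennreal (\<Sum>h\<le>n. prob_max_at n h / prob_max n)"
    using prob_max_at_nonneg prob_max_pos[of n] by (intro sum_ennreal) simp
  also have "(\<Sum>h\<le>n. prob_max_at n h / prob_max n) = 1"
    using prob_max_pos[of n] by (simp add: prob_max_eq_sum flip: sum_divide_distrib)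
  finally show "(\<integral>\<^sup>+h. ennreal (prob_max_at n h / prob_max n) \<partial>count_space UNIV) = 1"
    by simp
qed

end

theory Submission
  imports Defs "HOL-Real_Asymp.Real_Asymp"
begin

text \<open>Write \<open>H = h + 1\<close>. Expanding the walk killed above \<open>h\<close> in eigenfunctions gives, for
  \<open>n + h\<close> even, \<open>prob_max_at n h = 4 / H * (\<Sum>k. (-1)^k * s\<^sub>n ((2 * k + 1) * pi / (2 * H)))\<close>, where \<open>s\<^sub>n x = sin x * cos x ^ n\<close>
  is cut off at \<open>\<bar>x\<bar> = pi / 2\<close>. As a function of a real variable \<open>H\<close>, the summand of the \<open>r\<close>-th moment of \<open>H\<close> is smooth
  and varies on the scale \<open>sqrt n\<close>, so the sum over one parity class of \<open>H\<close> agrees with half of its integral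
  up to errors smaller than every power of \<open>n\<close>. For \<open>r = 0\<close> and \<open>r = 2\<close> the integrand has a primitive that is again
  an alternating sum, and the value of that primitive at infinity reduces to the integral of
  \<open>sin x / x * cos x ^ n\<close> over \<open>{0..pi / 2}\<close>, which Wallis integrals expand. For \<open>r = 1\<close> only the difference
  between \<open>n\<close> and \<open>n + 2\<close> has such a primitive, and it vanishes at infinity; so the integral does not depend on
  \<open>n\<close> within a parity class and equals its limit, Catalan's constant. That limit, and the leading order
  of every moment, follow by dominated convergence from \<open>sqrt n * s\<^sub>n (x / sqrt n) \<longlonglongrightarrow> x * exp (- x\<^sup>2 / 2)\<close>, and the
  functional equation of a theta series identifies the limit density. The same comparison, made
  quantitative, gives the local limit.\<close>

section \<open>Spectral formula\<close>

text \<open>The comparison of sum and integral is exact to all orders for two reasons. For an odd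
  kernel the alternating sum over odd multiples of an angle e is a plain sum over a progression of
  step 4 e, whose mean is the integral of an odd function, hence 0; so the summand dies rapidly as
  \<open>H\<close> grows, while for small \<open>H\<close> the kernel is already tiny, and
  Euler-Maclaurin has no boundary terms. A derivative in \<open>H\<close> of
  \<open>H powi e * alt_sum g (pi / (2 * H))\<close> lowers e by one and turns g into e g - x g', a
  kernel of the same size, so each derivative gains a factor 1 / sqrt n. The primitives invert that
  rule: e g - x g' = s is solved by x^e times the integral of s(t) / t^(e+1) beyond x. For e = 0
  this is smooth, for e = 2 it becomes so after integrating by parts, but for e = 1 the integrand
  behaves like 1 / t at 0 and leaves a logarithm; the difference of the kernels for n and n + 2 has
  the missing factor sin^2. The last coefficient for \<open>prob_max n\<close> is also needed for
  the variance, since the second moment multiplies the expansion by n^2.\<close>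

definition stay_prob :: "nat \<Rightarrow> nat \<Rightarrow> nat \<Rightarrow> real" where
  "stay_prob h n x = measure_pmf.prob (reflecting_walk n) {s. (\<forall>k\<le>n. s ! k \<le> h) \<and> s ! n = x}"

lemma pmf_reflecting_step:
  "pmf (reflecting_step y) x =
     indicator {x + 1} y / 2 + (if x = 0 then 0 else (if x = 1 then 1 else 1/2) * indicator {x - 1} y)"
proof (cases "y = 0")
  case False
  then have "card {y - 1, y + 1} = 2" by simp
  moreover have "pmf (pmf_of_set {y - 1, y + 1}) x = indicator {y - 1, y + 1} x / real (card {y - 1, y + 1})"
    by (rule pmf_of_set) auto
  ultimately show ?thesis using False by (auto simp: reflecting_step_def indicator_def)
qed (auto simp: reflecting_step_def indicator_def pmf_return)

lemma prob_bind_pmf: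
  "measure_pmf.prob (bind_pmf M f) A = (\<integral>x. measure_pmf.prob (f x) A \<partial>M)"
proof -
  have "(\<integral>x. measure_pmf.prob (f x) A \<partial>M) = enn2real (\<integral>\<^sup>+x. ennreal (measure_pmf.prob (f x) A) \<partial>M)"
    by (rule integral_eq_nn_integral) auto
  also have "\<dots> = enn2real (emeasure (bind_pmf M f) A)"
    by (simp flip: measure_pmf.emeasure_eq_measure)
  finally show ?thesis by (simp add: measure_def)
qed

text \<open>Decomposition by the last step. The weight 1 at \<open>x = 1\<close> is the forced step
  out of 0. At \<open>x = h\<close> the term for \<open>x + 1\<close> is the probability of an
  impossible event, so killing above \<open>h\<close> needs no separate case.\<close>

lemma stay_prob_Suc:
  assumes "x \<le> h"
  shows "stay_prob h (Suc n) x = stay_prob h n (x + 1) / 2 +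
    (if x = 0 then 0 else (if x = 1 then 1 else 1/2) * stay_prob h n (x - 1))"
proof -
  let ?W = "reflecting_walk n" and ?c = "if x = 0 then 0 else (if x = 1 then 1 else 1/2) :: real"
  let ?E = "\<lambda>y. {s. (\<forall>k\<le>n. s ! k \<le> h) \<and> s ! n = y}"
  have int: "integrable (measure_pmf M) (indicator A :: nat list \<Rightarrow> real)" for M A
    by (rule measure_pmf.integrable_const_bound[of _ 1]) (auto simp: indicator_def)
  have "stay_prob h (Suc n) x =
    (\<integral>s. measure_pmf.prob (map_pmf (\<lambda>j. s @ [j]) (reflecting_step (last s)))
       {s. (\<forall>k\<le>Suc n. s ! k \<le> h) \<and> s ! Suc n = x} \<partial>?W)"
    unfolding stay_prob_def reflecting_walk.simps by (rule prob_bind_pmf)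
  also have "\<dots> = (\<integral>s. (indicator (?E (x + 1)) s / 2 + ?c * indicator (?E (x - 1)) s :: real) \<partial>?W)"
  proof (rule integral_cong_AE)
    show "AE s in ?W. measure_pmf.prob (map_pmf (\<lambda>j. s @ [j]) (reflecting_step (last s)))
       {s. (\<forall>k\<le>Suc n. s ! k \<le> h) \<and> s ! Suc n = x} =
       indicator (?E (x + 1)) s / 2 + ?c * indicator (?E (x - 1)) s"
    proof (rule AE_pmfI)
      fix s assume "s \<in> set_pmf ?W"
      then have len: "length s = Suc n" using set_reflecting_walk by blast
      then have last: "last s = s ! n" by (metis last_conv_nth diff_Suc_1 list.size(3) nat.distinct(1))
      have ev: "(\<lambda>j. s @ [j]) -` {s. (\<forall>k\<le>Suc n. s ! k \<le> h) \<and> s ! Suc n = x} =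
          (if \<forall>k\<le>n. s ! k \<le> h then {x} else {})"
        using len assms by (auto simp: nth_append le_Suc_eq)
      show "measure_pmf.prob (map_pmf (\<lambda>j. s @ [j]) (reflecting_step (last s)))
          {s. (\<forall>k\<le>Suc n. s ! k \<le> h) \<and> s ! Suc n = x} =
          indicator (?E (x + 1)) s / 2 + ?c * indicator (?E (x - 1)) s"
        unfolding measure_map_pmf ev last
        by (auto simp: measure_pmf_single pmf_reflecting_step indicator_def)
    qed
  qed auto
  also have "\<dots> = stay_prob h n (x + 1) / 2 + ?c * stay_prob h n (x - 1)"
    unfolding stay_prob_def by (subst Bochner_Integration.integral_add) (auto simp: int)
  finally show ?thesis by auto
qed

section \<open>Eigenfunction expansion of the killed walk\<close>

text \<open>The walk is the absolute value of the simple walk on the integers, here killed at -H and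
  H with H = h + 1. The even eigenfunctions vanishing at both ends are cos (a x) with cos (a H) = 0
  and eigenvalue cos a; these are the \<open>Suc h\<close> solutions a in (0, pi).\<close>

definition box_angle :: "nat \<Rightarrow> nat \<Rightarrow> real" where
  "box_angle h i = pi * (2 * real i + 1) / (2 * real (Suc h))"

definition box_kernel :: "nat \<Rightarrow> nat \<Rightarrow> real \<Rightarrow> real" where
  "box_kernel h n x = (\<Sum>i<Suc h. cos (box_angle h i) ^ n * cos (box_angle h i * x)) / real (Suc h)"

lemma box_kernel_Suc:
  "box_kernel h (Suc n) x = (box_kernel h n (x + 1) + box_kernel h n (x - 1)) / 2"
proof -
  have "cos (a * (x + 1)) + cos (a * (x - 1)) = 2 * (cos a * cos (a * x))" for a :: real
    by (simp add: distrib_left right_diff_distrib cos_add cos_diff)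
  then have "cos a ^ n * cos (a * (x + 1)) + cos a ^ n * cos (a * (x - 1)) = 2 * (cos a ^ Suc n * cos (a * x))" for a :: real
    by (simp only: power_Suc mult_ac flip: distrib_left)
  then have "box_kernel h n (x + 1) + box_kernel h n (x - 1) = 2 * box_kernel h (Suc n) x"
    unfolding box_kernel_def
    by (simp only: times_divide_eq_right sum_distrib_left flip: sum.distrib add_divide_distrib)
  then show ?thesis by simp
qed

lemma box_kernel_minus: "box_kernel h n (- x) = box_kernel h n x"
  by (simp add: box_kernel_def)

lemma box_angle_times: "box_angle h i * real (Suc h) = real i * pi + pi / 2"
  unfolding box_angle_def by (simp add: field_simps del: of_nat_Suc)

lemma box_kernel_boundary: "box_kernel h n (real (Suc h)) = 0"
  unfolding box_kernel_def box_angle_times by (simp add: cos_add)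

lemma sum_cos_odd_multiples:
  fixes a :: real
  shows "2 * sin a * (\<Sum>i<m. cos ((2 * real i + 1) * a)) = sin (2 * real m * a)"
proof (induction m)
  case (Suc m)
  have "sin (2 * real (Suc m) * a) = sin ((2 * real m + 1) * a + a)" by (simp add: algebra_simps)
  moreover have "sin (2 * real m * a) = sin ((2 * real m + 1) * a - a)" by (simp add: algebra_simps)
  ultimately have "sin (2 * real (Suc m) * a) - sin (2 * real m * a) = 2 * sin a * cos ((2 * real m + 1) * a)"
    by (simp add: sin_add sin_diff)
  with Suc show ?case by (simp add: algebra_simps)
qed auto

text \<open>Completeness of the eigenfunctions, tested on the starting point: the cosines at odd
  multiples of a sum to sin (2 H a) / (2 sin a), and here 2 H a is a multiple of pi.\<close>

lemma box_kernel_0: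
  assumes "x \<le> h"
  shows "box_kernel h 0 (real x) = (if x = 0 then 1 else 0)"
proof (cases "x = 0")
  case False
  define a where "a = pi * real x / (2 * real (Suc h))"
  have "0 < a" using False by (simp add: a_def)
  have "pi * real x < pi * (2 * real (Suc h))" using assms by (intro mult_strict_left_mono) auto
  then have "a < pi" by (simp add: a_def divide_less_eq)
  with \<open>0 < a\<close> have "sin a \<noteq> 0" using sin_gt_zero by force
  moreover have "2 * sin a * (\<Sum>i<Suc h. cos ((2 * real i + 1) * a)) = sin (2 * real (Suc h) * a)"
    by (rule sum_cos_odd_multiples)
  moreover have "2 * real (Suc h) * a = real x * pi" by (simp add: a_def field_simps del: of_nat_Suc)
  ultimately have "(\<Sum>i<Suc h. cos ((2 * real i + 1) * a)) = 0" by simp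
  moreover have "(2 * real i + 1) * a = box_angle h i * real x" for i
    by (simp add: a_def box_angle_def)
  ultimately show ?thesis using False by (simp add: box_kernel_def)
qed (simp add: box_kernel_def)

lemma stay_prob_beyond: "x > h \<Longrightarrow> stay_prob h n x = 0"
  unfolding stay_prob_def measure_pmf_zero_iff by auto

text \<open>Both sides obey the same recurrence with the same initial value; the factor 2 collects
  the mass of the simple walk at x and -x. The range includes \<open>Suc h\<close>, where both sides
  vanish, because the recurrence at \<open>x = h\<close> looks one site further.\<close>

lemma stay_prob_eq_box_kernel:
  assumes "x \<le> Suc h"
  shows "stay_prob h n x = (if x = 0 then 1 else 2) * box_kernel h n (real x)"
  using assms
proof (induction n arbitrary: x)
  case 0
  show ?case
  proof (cases "x = Suc h")
    case True
    then show ?thesis using box_kernel_boundary[of h 0] by (simp add: stay_prob_beyond)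
  next
    case False
    with 0 have "x \<le> h" by simp
    then show ?thesis
      unfolding box_kernel_0[OF \<open>x \<le> h\<close>] by (simp add: stay_prob_def indicator_def)
  qed
next
  case (Suc n)
  show ?case
  proof (cases "x = Suc h")
    case True
    then show ?thesis using box_kernel_boundary[of h "Suc n"] by (simp add: stay_prob_beyond)
  next
    case False
    then have x: "x \<le> h" using Suc.prems by simp
    have up: "stay_prob h n (x + 1) = 2 * box_kernel h n (real x + 1)"
      using Suc.IH[of "x + 1"] x by (simp add: add.commute)
    show ?thesis
    proof (cases "x = 0")
      case True
      then show ?thesis
        unfolding stay_prob_Suc[OF x] up box_kernel_Suc using box_kernel_minus[of h n 1] by simp
    next
      case False
      then have "stay_prob h n (x - 1) = (if x = 1 then 1 else 2) * box_kernel h n (real x - 1)"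
        using Suc.IH[of "x - 1"] x by (simp add: of_nat_diff)
      then show ?thesis using False
        unfolding stay_prob_Suc[OF x] up box_kernel_Suc by auto
    qed
  qed
qed

section \<open>Folding onto the acute angles\<close>

text \<open>Vanishing beyond pi / 2 makes the alternating sums finite without an explicit range of
  summation. Unlike such a range, it keeps high powers smooth, so that the sums can be
  differentiated in the angle.\<close>

definition cos_cut :: "real \<Rightarrow> real" where
  "cos_cut x = (if \<bar>x\<bar> < pi / 2 then cos x else 0)"

definition alt_sum :: "(real \<Rightarrow> real) \<Rightarrow> real \<Rightarrow> real" where
  "alt_sum g e = (\<Sum>k. (-1) ^ k * g ((2 * real k + 1) * e))"

definition spectral :: "nat \<Rightarrow> real \<Rightarrow> real" where
  "spectral n x = sin x * cos_cut x ^ n"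

lemma alt_sum_finite:
  assumes "\<And>x. x \<ge> c \<Longrightarrow> g x = 0" and "(2 * real m + 1) * e \<ge> c" "e \<ge> 0"
  shows "alt_sum g e = (\<Sum>k<m. (-1) ^ k * g ((2 * real k + 1) * e))"
  unfolding alt_sum_def
proof (rule suminf_finite)
  fix k assume "k \<notin> {..<m}"
  then have "(2 * real m + 1) * e \<le> (2 * real k + 1) * e"
    using assms(3) by (intro mult_right_mono) auto
  then have "c \<le> (2 * real k + 1) * e" using assms(2) by linarith
  then show "(-1) ^ k * g ((2 * real k + 1) * e) = 0" using assms(1) by simp
qed auto

lemma prob_max_at_eq_sum:
  assumes "n > 0"
  shows "prob_max_at n h = 2 / real (Suc h) *
    (\<Sum>i<Suc h. (-1) ^ i * (sin (box_angle h i) * cos (box_angle h i) ^ n))"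
proof -
  have c: "cos (box_angle h i * real h) = (-1) ^ i * sin (box_angle h i)" for i
  proof -
    have "box_angle h i * real h = real i * pi + pi / 2 - box_angle h i"
      using box_angle_times[of h i] by (simp add: algebra_simps)
    then show ?thesis by (simp add: cos_diff cos_add sin_add)
  qed
  \<comment> \<open>For \<open>h = 0\<close> the endpoint is the origin and the factor would be 1
    instead of 2; the formula survives because the only angle is pi / 2 and \<open>n > 0\<close>, so
    both sides are 0.\<close>
  have "prob_max_at n h = 2 * box_kernel h n (real h)"
  proof (cases "h = 0")
    case True
    then have "box_kernel h n (real h) = 0"
      using assms by (simp add: box_kernel_def box_angle_def)
    then show ?thesis using stay_prob_eq_box_kernel[of h h n] by (simp add: prob_max_at_def stay_prob_def)
  next
    case False
    then show ?thesis using stay_prob_eq_box_kernel[of h h n] by (simp add: prob_max_at_def stay_prob_def)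
  qed
  then show ?thesis unfolding box_kernel_def c by (simp add: mult.commute mult.left_commute)
qed

lemma box_angle_reflect: "i < Suc h \<Longrightarrow> box_angle h (h - i) = pi - box_angle h i"
  unfolding box_angle_def by (simp add: of_nat_diff field_simps)

lemma box_angle_bounds: "i < Suc h \<Longrightarrow> 0 < box_angle h i \<and> box_angle h i < pi"
proof -
  assume "i < Suc h"
  then have "pi * (2 * real i + 1) < pi * (2 * real (Suc h))" by (intro mult_strict_left_mono) auto
  moreover have "0 < pi * (2 * real i + 1)" by simp
  ultimately show ?thesis unfolding box_angle_def by (simp add: divide_less_eq del: of_nat_Suc)
qed

text \<open>Reflecting the index, i to h - i, sends an angle to its supplement and multiplies the
  term by (-1)^(n + h). For odd n + h the sum therefore cancels; for even n + h the obtuse angles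
  repeat the acute ones, which doubles the constant 2 and leaves only angles below the cut.\<close>

theorem prob_max_at_eq_alt_sum:
  assumes "n > 0"
  shows "prob_max_at n h = (if even (n + h)
    then 4 / real (Suc h) * alt_sum (spectral n) (pi / (2 * real (Suc h))) else 0)"
proof -
  define a where "a i = (-1) ^ i * (sin (box_angle h i) * cos (box_angle h i) ^ n)" for i
  define b where "b i = (-1) ^ i * spectral n (box_angle h i)" for i
  have refl: "a (h - i) = (-1) ^ (n + h) * a i" if "i < Suc h" for i
  proof -
    have "a (h - i) = (-1) ^ (h - i) * (sin (box_angle h i) * (- cos (box_angle h i)) ^ n)"
      unfolding a_def box_angle_reflect[OF that] by simp
    also have "(-1) ^ (h - i) = (-1) ^ h * ((-1) ^ i :: real)"
      using neg_one_power_add_eq_neg_one_power_diff[of i h, where 'a = real] that by (simp add: power_add)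
    also have "(- cos (box_angle h i)) ^ n = (-1) ^ n * cos (box_angle h i) ^ n"
      by (rule power_minus)
    finally show ?thesis by (simp add: a_def power_add mult_ac)
  qed
  have rs: "(\<Sum>i<Suc h. g (h - i)) = (\<Sum>i<Suc h. g i)" for g :: "nat \<Rightarrow> real"
    using sum.nat_diff_reindex[of g "Suc h"] by simp
  show ?thesis
  proof (cases "even (n + h)")
    case False
    then have "(\<Sum>i<Suc h. a (h - i)) = - (\<Sum>i<Suc h. a i)"
      by (simp add: refl sum_negf del: sum.lessThan_Suc)
    then have "(\<Sum>i<Suc h. a i) = 0" using rs[of a] by simp
    then show ?thesis using False prob_max_at_eq_sum[OF assms, of h] unfolding a_def by (simp del: sum.lessThan_Suc)
  next
    case True
    \<comment> \<open>Of an angle and its supplement exactly one survives the cut, unless both are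
      pi / 2, where all terms vanish because \<open>n > 0\<close>.\<close>
    have ab: "a i = b i + b (h - i)" if i: "i < Suc h" for i
    proof -
      have i': "h - i < Suc h" by simp
      have ai: "a i = a (h - i)" using refl[OF i] True by simp
      note B = box_angle_bounds[OF i] and R = box_angle_reflect[OF i]
      consider "box_angle h i < pi / 2" | "box_angle h i = pi / 2" | "box_angle h i > pi / 2" by linarith
      then show ?thesis
      proof cases
        case 1
        then have "b (h - i) = 0" using B assms unfolding b_def spectral_def cos_cut_def R by auto
        with 1 B show ?thesis by (simp add: a_def b_def spectral_def cos_cut_def)
      next
        case 2
        then have "box_angle h (h - i) = pi / 2" using R by simp
        have "cos (box_angle h i) = 0" unfolding 2 by simp
        then have "a i = 0" using assms by (simp add: a_def)
        moreover have "cos_cut (box_angle h i) = 0" "cos_cut (box_angle h (h - i)) = 0"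
          unfolding 2 \<open>box_angle h (h - i) = pi / 2\<close> by (simp_all add: cos_cut_def)
        then have "b i = 0" "b (h - i) = 0"
          using assms by (simp_all add: b_def spectral_def)
        ultimately show ?thesis by simp
      next
        case 3
        then have "b i = 0" using B assms unfolding b_def spectral_def cos_cut_def by auto
        moreover have "b (h - i) = a (h - i)" using 3 B unfolding a_def b_def spectral_def cos_cut_def R by auto
        ultimately show ?thesis using ai by simp
      qed
    qed
    have "(\<Sum>i<Suc h. a i) = (\<Sum>i<Suc h. b i + b (h - i))" by (rule sum.cong) (auto intro: ab)
    also have "\<dots> = 2 * (\<Sum>i<Suc h. b i)" by (simp only: sum.distrib rs mult_2)
    also have "(\<Sum>i<Suc h. b i) = alt_sum (spectral n) (pi / (2 * real (Suc h)))"
    proof -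
      have "(2 * real (Suc h) + 1) * (pi / (2 * real (Suc h))) \<ge> pi / 2"
        by (simp add: field_simps)
      then have "alt_sum (spectral n) (pi / (2 * real (Suc h))) =
          (\<Sum>i<Suc h. (-1) ^ i * spectral n ((2 * real i + 1) * (pi / (2 * real (Suc h)))))"
        using assms by (intro alt_sum_finite[where c = "pi / 2"]) (auto simp: spectral_def cos_cut_def)
      then show ?thesis by (simp add: b_def box_angle_def mult.commute)
    qed
    finally show ?thesis using True prob_max_at_eq_sum[OF assms, of h] unfolding a_def by (simp del: sum.lessThan_Suc)
  qed
qed

section \<open>Kernels of Gaussian type\<close>

lemma cos_cut_minus [simp]: "cos_cut (- x) = cos_cut x"
  by (simp add: cos_cut_def)

lemma cos_cut_eq_0: "\<bar>x\<bar> \<ge> pi / 2 \<Longrightarrow> cos_cut x = 0"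
  by (simp add: cos_cut_def)

lemma cos_cut_nonneg: "cos_cut x \<ge> 0"
  unfolding cos_cut_def using cos_ge_zero[of x] by (auto simp: abs_less_iff)

lemma x_cos_le_sin:
  fixes x :: real
  assumes "0 \<le> x" "x \<le> pi"
  shows "x * cos x \<le> sin x"
proof -
  have "sin 0 - 0 * cos 0 \<le> sin x - x * cos x"
  proof (rule DERIV_nonneg_imp_nondecreasing[OF assms(1)])
    fix t assume t: "0 \<le> t" "t \<le> x"
    have "((\<lambda>t. sin t - t * cos t) has_real_derivative t * sin t) (at t)"
      by (auto intro!: derivative_eq_intros)
    moreover have "t * sin t \<ge> 0" using t assms sin_ge_zero[of t] by simp
    ultimately show "\<exists>y. ((\<lambda>t. sin t - t * cos t) has_real_derivative y) (at t) \<and> 0 \<le> y" by blast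
  qed
  then show ?thesis by simp
qed

lemma cos_cut_le_exp: "cos_cut x \<le> exp (- (x\<^sup>2 / 2))"
proof -
  have *: "cos y \<le> exp (- (y\<^sup>2 / 2))" if "0 \<le> y" "y \<le> pi / 2" for y
  proof -
    have "exp (y\<^sup>2 / 2) * cos y \<le> exp (0\<^sup>2 / 2) * cos 0"
    proof (rule DERIV_nonpos_imp_nonincreasing[OF that(1)])
      fix t assume t: "0 \<le> t" "t \<le> y"
      have "((\<lambda>t. exp (t\<^sup>2 / 2) * cos t) has_real_derivative exp (t\<^sup>2 / 2) * (t * cos t - sin t)) (at t)"
        by (auto intro!: derivative_eq_intros simp: algebra_simps)
      moreover have "exp (t\<^sup>2 / 2) * (t * cos t - sin t) \<le> 0"
        using x_cos_le_sin[of t] t that by (intro mult_nonneg_nonpos) auto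
      ultimately show "\<exists>z. ((\<lambda>t. exp (t\<^sup>2 / 2) * cos t) has_real_derivative z) (at t) \<and> z \<le> 0" by blast
    qed
    then show ?thesis by (simp add: exp_minus field_simps)
  qed
  show ?thesis
  proof (cases "\<bar>x\<bar> < pi / 2")
    case True
    then have "cos \<bar>x\<bar> \<le> exp (- (\<bar>x\<bar>\<^sup>2 / 2))" by (intro *) auto
    then show ?thesis using True by (simp add: cos_cut_def)
  qed (simp add: cos_cut_def)
qed

lemma cos_cut_le_1: "cos_cut x \<le> 1"
  by (simp add: cos_cut_def)

lemma cos_cut_power_le_exp: "cos_cut x ^ m \<le> exp (- (real m * x\<^sup>2 / 2))"
proof -
  have "cos_cut x ^ m \<le> exp (- (x\<^sup>2 / 2)) ^ m"
    by (intro power_mono cos_cut_le_exp cos_cut_nonneg)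
  then show ?thesis by (simp flip: exp_of_nat_mult)
qed

lemma cos_cut_lipschitz_boundary:
  assumes "\<bar>x\<bar> = pi / 2"
  shows "cos_cut y \<le> \<bar>y - x\<bar>"
proof (cases "\<bar>y\<bar> < pi / 2")
  case True
  have "cos \<bar>y\<bar> = sin (pi / 2 - \<bar>y\<bar>)" by (simp add: cos_sin_eq)
  also have "\<dots> \<le> pi / 2 - \<bar>y\<bar>" using True by (intro sin_x_le_x) auto
  also have "\<dots> \<le> \<bar>y - x\<bar>" using assms by arith
  finally show ?thesis using True by (simp add: cos_cut_def)
qed (simp add: cos_cut_def)

lemma DERIV_zero_of_quadratic_bound:
  fixes f :: "real \<Rightarrow> real"
  assumes "\<And>y. \<bar>f y - f x\<bar> \<le> (y - x)\<^sup>2"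
  shows "(f has_real_derivative 0) (at x)"
proof -
  have "((\<lambda>y. (f y - f x) / (y - x)) \<longlongrightarrow> 0) (at x)"
  proof (rule Lim_null_comparison)
    show "\<forall>\<^sub>F y in at x. norm ((f y - f x) / (y - x)) \<le> \<bar>y - x\<bar>"
    proof (rule eventually_at_topological[THEN iffD2], intro exI conjI ballI impI)
      show "open (UNIV :: real set)" "x \<in> UNIV" by auto
      fix y assume "y \<noteq> x"
      then show "norm ((f y - f x) / (y - x)) \<le> \<bar>y - x\<bar>"
        using assms[of y] by (simp add: divide_le_eq power2_eq_square)
    qed
    show "((\<lambda>y. \<bar>y - x\<bar>) \<longlongrightarrow> 0) (at x)" by (auto intro!: tendsto_eq_intros)
  qed
  then show ?thesis by (simp add: has_field_derivative_iff)
qed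

text \<open>Only the points where x is pi / 2 or - pi / 2 need an argument. There the cut cosine is
  at most the distance to the point, so a power of order at least 2 is at most its square and has
  derivative 0.\<close>

lemma DERIV_cos_cut_power:
  assumes "m \<ge> 2"
  shows "((\<lambda>x. cos_cut x ^ m) has_real_derivative - (real m * sin x * cos_cut x ^ (m - 1))) (at x)"
proof -
  consider "\<bar>x\<bar> < pi / 2" | "\<bar>x\<bar> > pi / 2" | "\<bar>x\<bar> = pi / 2" by linarith
  then show ?thesis
  proof cases
    case 1
    have "((\<lambda>x. cos x ^ m) has_real_derivative - (real m * sin x * cos_cut x ^ (m - 1))) (at x)"
      using 1 assms by (auto intro!: derivative_eq_intros simp: cos_cut_def)
    then show ?thesis
    proof (rule has_field_derivative_transform_within_open)
      show "open {-(pi/2)<..<pi/2}" "x \<in> {-(pi/2)<..<pi/2}" using 1 by auto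
    qed (auto simp: cos_cut_def)
  next
    case 2
    have "((\<lambda>x. 0) has_real_derivative - (real m * sin x * cos_cut x ^ (m - 1))) (at x)"
      using 2 assms by (auto simp: cos_cut_def power_0_left)
    moreover have "open {x. pi / 2 < \<bar>x\<bar>}" by (intro open_Collect_less continuous_intros)
    ultimately show ?thesis
    proof (rule has_field_derivative_transform_within_open)
      show "x \<in> {x. pi / 2 < \<bar>x\<bar>}" using 2 by simp
    qed (use assms in \<open>auto simp: cos_cut_def\<close>)
  next
    case 3
    have "\<bar>cos_cut y ^ m - cos_cut x ^ m\<bar> \<le> (y - x)\<^sup>2" for y
    proof -
      have z: "cos_cut x ^ m = 0" using 3 assms by (simp add: cos_cut_eq_0)
      have "cos_cut y ^ m \<le> cos_cut y ^ 2"
        using assms by (intro power_decreasing cos_cut_nonneg cos_cut_le_1)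
      moreover have "cos_cut y ^ 2 \<le> \<bar>y - x\<bar> ^ 2"
        using cos_cut_lipschitz_boundary[OF 3] cos_cut_nonneg by (intro power_mono)
      ultimately show ?thesis unfolding z using cos_cut_nonneg[of y] by simp
    qed
    moreover have "- (real m * sin x * cos_cut x ^ (m - 1)) = 0" using 3 assms by (simp add: cos_cut_eq_0)
    ultimately show ?thesis using DERIV_zero_of_quadratic_bound[of "\<lambda>x. cos_cut x ^ m" x] by (simp only:)
  qed
qed

lemma cos_times_cos_cut_power: "m \<ge> 1 \<Longrightarrow> cos x * cos_cut x ^ m = cos_cut x ^ Suc m"
  by (cases "\<bar>x\<bar> < pi / 2") (auto simp: cos_cut_def)

text \<open>\<open>wclass p w g\<close>: \<open>g n x\<close> is a combination of terms \<open>n^j * x^l * sin x ^ a * cos_cut x ^ (n + c - b)\<close>. The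
  flag \<open>p\<close> records that \<open>g n\<close> is odd. The weight \<open>w = a + l - 2 * j\<close> is the order of \<open>g n x\<close> in \<open>1 / sqrt n\<close>
  when \<open>x\<close> is of size \<open>1 / sqrt n\<close>. The truncation in \<open>n + c - b\<close> affects finitely many \<open>n\<close> only.\<close>

inductive wclass :: "bool \<Rightarrow> int \<Rightarrow> (nat \<Rightarrow> real \<Rightarrow> real) \<Rightarrow> bool" where
  wclass_mono: "p = odd (a + l) \<Longrightarrow> w = int a + int l \<Longrightarrow>
    wclass p w (\<lambda>n x. x ^ l * sin x ^ a * cos_cut x ^ (n + c - b))"
| wclass_zero: "wclass p w (\<lambda>n x. 0)"
| wclass_scale: "wclass p w g \<Longrightarrow> wclass p w (\<lambda>n x. r * g n x)"
| wclass_n: "wclass p w g \<Longrightarrow> wclass p (w - 2) (\<lambda>n x. real n * g n x)"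
| wclass_add: "wclass p w g \<Longrightarrow> wclass p w h \<Longrightarrow> wclass p w (\<lambda>n x. g n x + h n x)"
| wclass_weaken: "wclass p w g \<Longrightarrow> wclass p (w - 2) g"

lemma wclass_diff:
  assumes "wclass p w g" "wclass p w h"
  shows "wclass p w (\<lambda>n x. g n x - h n x)"
  using wclass_add[OF assms(1) wclass_scale[OF assms(2), of "-1"]] by simp

lemma wclass_times_x: "wclass p w g \<Longrightarrow> wclass (\<not> p) (w + 1) (\<lambda>n x. x * g n x)"
proof (induction rule: wclass.induct)
  case (wclass_mono p a l w c b)
  have "wclass (\<not> p) (w + 1) (\<lambda>n x. x ^ Suc l * sin x ^ a * cos_cut x ^ (n + c - b))"
    using wclass_mono by (intro wclass.wclass_mono) auto
  then show ?case by (simp add: mult.assoc)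
next
  case (wclass_scale p w g r)
  from wclass.wclass_scale[OF this(2), of r] show ?case by (simp add: mult_ac)
next
  case (wclass_n p w g)
  from wclass.wclass_n[OF this(2)] show ?case by (simp add: mult_ac)
next
  case (wclass_add p w g h)
  from wclass.wclass_add[OF this(3,4)] show ?case by (simp add: distrib_left)
next
  case (wclass_weaken p w g)
  from wclass.wclass_weaken[OF this(2)] show ?case by simp
qed (auto intro: wclass.wclass_zero)

lemma wclass_support: "wclass p w g \<Longrightarrow> \<forall>\<^sub>F n in sequentially. \<forall>x. \<bar>x\<bar> \<ge> pi / 2 \<longrightarrow> g n x = 0"
proof (induction rule: wclass.induct)
  case (wclass_mono p a l w c b)
  show ?case using eventually_gt_at_top[of b] by eventually_elim (auto simp: cos_cut_eq_0)
next
  case (wclass_add p w g h)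
  show ?case using wclass_add(3,4) by eventually_elim auto
qed (auto elim: eventually_mono)

lemma wclass_parity: "wclass p w g \<Longrightarrow> g n (- x) = (if p then - g n x else g n x)"
  by (induction rule: wclass.induct) (auto simp: power_minus' uminus_power_if split: if_splits)

text \<open>Differentiating a power of x or of the sine lowers the weight by one. Differentiating
  the cosine power adds a sine, which raises it by one, and a factor n + c - b: the part with n
  lowers the weight by two, and the constant part is weakened by two to match. The cosine created
  from the sine power merges with the cut power, so the class is closed.\<close>

lemma wclass_deriv:
  "wclass p w g \<Longrightarrow> \<exists>g'. wclass (\<not> p) (w - 1) g' \<and>
     (\<forall>\<^sub>F n in sequentially. \<forall>x. (g n has_real_derivative g' n x) (at x))"
proof (induction rule: wclass.induct)
  case (wclass_mono p a l w c b)
  define A where "A = (\<lambda>n x :: real. if l = 0 then 0 else real l * (x ^ (l - 1) * sin x ^ a * cos_cut x ^ (n + c - b)))"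
  define B where "B = (\<lambda>n x :: real. if a = 0 then 0 else real a * (x ^ l * sin x ^ (a - 1) * cos_cut x ^ (n + (c + 1) - b)))"
  define E where "E = (\<lambda>n x :: real. x ^ l * sin x ^ Suc a * cos_cut x ^ (n + c - Suc b))"
  have A: "wclass (\<not> p) (w - 1) A"
  proof (cases l)
    case (Suc l')
    then show ?thesis
      using wclass_mono unfolding A_def by (auto intro!: wclass_scale wclass.wclass_mono)
  qed (auto simp: A_def intro: wclass.wclass_zero)
  have B: "wclass (\<not> p) (w - 1) B"
  proof (cases a)
    case (Suc a')
    have "wclass (\<not> p) (w - 1) (\<lambda>n x. x ^ l * sin x ^ a' * cos_cut x ^ (n + (c + 1) - b))"
      using wclass_mono Suc by (intro wclass.wclass_mono) auto
    from wclass_scale[OF this, of "real a"] show ?thesis using Suc unfolding B_def by simp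
  qed (auto simp: B_def intro: wclass.wclass_zero)
  have E: "wclass (\<not> p) (w + 1) E"
    using wclass_mono unfolding E_def by (intro wclass.wclass_mono) auto
  have "w + 1 - 2 = w - 1" by simp
  then have E': "wclass (\<not> p) (w - 1) E" "wclass (\<not> p) (w - 1) (\<lambda>n x. real n * E n x)"
    using wclass_weaken[OF E] wclass_n[OF E] by auto
  define g' where "g' = (\<lambda>n x. (A n x + B n x) + ((real b - real c) * E n x - real n * E n x))"
  have "wclass (\<not> p) (w - 1) g'"
    unfolding g'_def by (intro wclass_add wclass_diff wclass_scale A B E')
  moreover have "\<forall>\<^sub>F n in sequentially. \<forall>x.
      ((\<lambda>x. x ^ l * sin x ^ a * cos_cut x ^ (n + c - b)) has_real_derivative g' n x) (at x)"
    using eventually_ge_at_top[of "b + 2"]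
  proof eventually_elim
    case (elim n)
    define m where "m = n + c - b"
    have m: "m \<ge> 2" "n + (c + 1) - b = Suc m" "n + c - Suc b = m - 1" "real m = real n + real c - real b"
      using elim by (auto simp: m_def)
    show ?case
    proof
      fix x :: real
      have "((\<lambda>x. x ^ l * sin x ^ a * cos_cut x ^ m) has_real_derivative
         (real l * x ^ (l - 1) * sin x ^ a + x ^ l * (real a * sin x ^ (a - 1) * cos x)) * cos_cut x ^ m
          + x ^ l * sin x ^ a * (- (real m * sin x * cos_cut x ^ (m - 1)))) (at x)"
        by (rule DERIV_cong, rule DERIV_mult', rule DERIV_mult', rule DERIV_pow, rule DERIV_fun_pow[OF DERIV_sin],
            rule DERIV_cos_cut_power[OF m(1)]) (simp add: algebra_simps)
      also have "(real l * x ^ (l - 1) * sin x ^ a + x ^ l * (real a * sin x ^ (a - 1) * cos x)) * cos_cut x ^ m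
          + x ^ l * sin x ^ a * (- (real m * sin x * cos_cut x ^ (m - 1))) =
          real l * x ^ (l - 1) * sin x ^ a * cos_cut x ^ m + real a * x ^ l * sin x ^ (a - 1) * (cos x * cos_cut x ^ m)
          - real m * (x ^ l * sin x ^ Suc a * cos_cut x ^ (m - 1))"
        by (simp add: algebra_simps)
      also have "\<dots> = g' n x"
        using m(1) unfolding g'_def A_def B_def E_def m(2,3) m_def[symmetric]
        by (subst cos_times_cos_cut_power) (auto simp: m(4) algebra_simps)
      finally show "((\<lambda>x. x ^ l * sin x ^ a * cos_cut x ^ (n + c - b)) has_real_derivative g' n x) (at x)"
        by (simp add: m_def)
    qed
  qed
  ultimately show ?case by blast
next
  case (wclass_zero p w)
  show ?case by (rule exI[of _ "\<lambda>n x. 0"]) (auto intro: wclass.wclass_zero)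
next
  case (wclass_scale p w g r)
  then obtain g' where g': "wclass (\<not> p) (w - 1) g'"
    "\<forall>\<^sub>F n in sequentially. \<forall>x. (g n has_real_derivative g' n x) (at x)" by blast
  from g'(2) have "\<forall>\<^sub>F n in sequentially. \<forall>x. ((\<lambda>x. r * g n x) has_real_derivative r * g' n x) (at x)"
    by eventually_elim (auto intro: DERIV_cmult)
  with wclass.wclass_scale[OF g'(1)] show ?case by blast
next
  case (wclass_n p w g)
  then obtain g' where g': "wclass (\<not> p) (w - 1) g'"
    "\<forall>\<^sub>F n in sequentially. \<forall>x. (g n has_real_derivative g' n x) (at x)" by blast
  from g'(2) have "\<forall>\<^sub>F n in sequentially. \<forall>x. ((\<lambda>x. real n * g n x) has_real_derivative real n * g' n x) (at x)"
    by eventually_elim (auto intro: DERIV_cmult)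
  moreover have "wclass (\<not> p) (w - 2 - 1) (\<lambda>n x. real n * g' n x)"
    using wclass.wclass_n[OF g'(1)] by (simp add: algebra_simps)
  ultimately show ?case by blast
next
  case (wclass_add p w g h)
  then obtain g' h' where g': "wclass (\<not> p) (w - 1) g'"
    "\<forall>\<^sub>F n in sequentially. \<forall>x. (g n has_real_derivative g' n x) (at x)"
    and h': "wclass (\<not> p) (w - 1) h'"
    "\<forall>\<^sub>F n in sequentially. \<forall>x. (h n has_real_derivative h' n x) (at x)" by blast
  from g'(2) h'(2) have "\<forall>\<^sub>F n in sequentially. \<forall>x. ((\<lambda>x. g n x + h n x) has_real_derivative g' n x + h' n x) (at x)"
    by eventually_elim (auto intro: DERIV_add)
  with wclass.wclass_add[OF g'(1) h'(1)] show ?case by blast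
next
  case (wclass_weaken p w g)
  then obtain g' where g': "wclass (\<not> p) (w - 1) g'"
    "\<forall>\<^sub>F n in sequentially. \<forall>x. (g n has_real_derivative g' n x) (at x)" by blast
  moreover have "wclass (\<not> p) (w - 2 - 1) g'"
    using wclass.wclass_weaken[OF g'(1)] by (simp add: algebra_simps)
  ultimately show ?case by blast
qed

text \<open>(1 + s)^k is at most exp (k s), and completing the square in k s - s^2 / 4 gives k^2.
  All constants of the form exp of a square below come from here.\<close>

lemma power_times_gaussian_le:
  assumes "(s :: real) \<ge> 0"
  shows "(1 + s) ^ k * exp (- (s\<^sup>2 / 4)) \<le> exp ((real k)\<^sup>2)"
proof -
  have "(1 + s) ^ k \<le> exp s ^ k" using assms exp_ge_add_one_self[of s] by (intro power_mono) auto
  then have "(1 + s) ^ k * exp (- (s\<^sup>2 / 4)) \<le> exp (real k * s) * exp (- (s\<^sup>2 / 4))"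
    by (simp add: exp_of_nat_mult)
  also have "\<dots> = exp (real k * s - s\<^sup>2 / 4)" by (simp flip: exp_add)
  also have "real k * s - s\<^sup>2 / 4 \<le> (real k)\<^sup>2"
  proof -
    have "(s / 2 - real k)\<^sup>2 = s\<^sup>2 / 4 - real k * s + (real k)\<^sup>2" by (simp add: power2_diff power_divide)
    then show ?thesis using zero_le_power2[of "s / 2 - real k"] by linarith
  qed
  finally show ?thesis by simp
qed

text \<open>In the variable s = sqrt n |x| a term is at most n^(-w/2) s^(a + l) times a Gaussian in
  s, and the Gaussian pays for every further power of 1 + s.\<close>

lemma wclass_bound:
  "wclass p w g \<Longrightarrow> \<exists>C. \<forall>\<^sub>F n in sequentially. \<forall>x.
     \<bar>g n x\<bar> * (1 + sqrt n * \<bar>x\<bar>) ^ L \<le> C * sqrt n powi (- w)"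
proof (induction rule: wclass.induct)
  case (wclass_mono p a l w c b)
  let ?k = "l + a + L"
  have "\<forall>\<^sub>F n in sequentially. \<forall>x. \<bar>x ^ l * sin x ^ a * cos_cut x ^ (n + c - b)\<bar> * (1 + sqrt n * \<bar>x\<bar>) ^ L
      \<le> exp ((real ?k)\<^sup>2) * sqrt n powi (- w)"
    \<comment> \<open>From here on the exponent \<open>n + c - b\<close> is at least n / 2; halving
      the exponent weakens exp (- s^2 / 2) to exp (- s^2 / 4).\<close>
    using eventually_ge_at_top[of "2 * b + 1"]
  proof eventually_elim
    case n: (elim n)
    show ?case
    proof
    fix x :: real
    define s where "s = sqrt n * \<bar>x\<bar>"
    have s0: "s \<ge> 0" by (simp add: s_def)
    have sx: "\<bar>x\<bar> = s / sqrt n" using n by (simp add: s_def)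
    have "real n \<le> 2 * real (n + c - b)" using n by linarith
    then have "real n * x\<^sup>2 \<le> 2 * real (n + c - b) * x\<^sup>2" by (intro mult_right_mono) auto
    then have m: "s\<^sup>2 / 4 \<le> real (n + c - b) * x\<^sup>2 / 2"
      by (simp add: s_def power_mult_distrib)
    have cc: "cos_cut x ^ (n + c - b) \<le> exp (- (s\<^sup>2 / 4))"
    proof (rule order_trans[OF cos_cut_power_le_exp])
      show "exp (- (real (n + c - b) * x\<^sup>2 / 2)) \<le> exp (- (s\<^sup>2 / 4))" using m by simp
    qed
    have "\<bar>x ^ l * sin x ^ a * cos_cut x ^ (n + c - b)\<bar> = \<bar>x\<bar> ^ l * \<bar>sin x\<bar> ^ a * cos_cut x ^ (n + c - b)"
      by (simp add: abs_mult power_abs cos_cut_nonneg)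
    also have "\<dots> \<le> \<bar>x\<bar> ^ l * \<bar>x\<bar> ^ a * exp (- (s\<^sup>2 / 4))"
      using cc by (intro mult_mono power_mono abs_sin_x_le_abs_x) (auto simp: cos_cut_nonneg)
    also have "\<dots> = s ^ (l + a) * exp (- (s\<^sup>2 / 4)) * sqrt n powi (- w)"
    proof -
      have "w = int (l + a)" using wclass_mono by simp
      then have "sqrt n powi (- w) = inverse (sqrt n ^ (l + a))" by (simp only: power_int_minus power_int_of_nat)
      moreover have "\<bar>x\<bar> ^ l * \<bar>x\<bar> ^ a = s ^ (l + a) * inverse (sqrt n ^ (l + a))"
        by (simp only: sx power_mult_distrib power_inverse power_add divide_inverse inverse_mult_distrib mult_ac)
      ultimately show ?thesis by (simp only: mult_ac)
    qed
    finally have "\<bar>x ^ l * sin x ^ a * cos_cut x ^ (n + c - b)\<bar> * (1 + s) ^ L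
       \<le> s ^ (l + a) * exp (- (s\<^sup>2 / 4)) * sqrt n powi (- w) * (1 + s) ^ L"
      using s0 by (intro mult_right_mono) auto
    also have "\<dots> = (s ^ (l + a) * (1 + s) ^ L * exp (- (s\<^sup>2 / 4))) * sqrt n powi (- w)" by (simp add: mult_ac)
    also have "\<dots> \<le> ((1 + s) ^ (l + a) * (1 + s) ^ L * exp (- (s\<^sup>2 / 4))) * sqrt n powi (- w)"
      using s0 by (intro mult_right_mono power_mono) auto
    also have "\<dots> = ((1 + s) ^ ?k * exp (- (s\<^sup>2 / 4))) * sqrt n powi (- w)" by (simp add: power_add)
    also have "\<dots> \<le> exp ((real ?k)\<^sup>2) * sqrt n powi (- w)"
      using s0 by (intro mult_right_mono power_times_gaussian_le) auto
    finally show "\<bar>x ^ l * sin x ^ a * cos_cut x ^ (n + c - b)\<bar> * (1 + sqrt n * \<bar>x\<bar>) ^ L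
       \<le> exp ((real ?k)\<^sup>2) * sqrt n powi (- w)" by (simp add: s_def)
    qed
  qed
  then show ?case by blast
next
  case (wclass_zero p w)
  show ?case by (rule exI[of _ 0]) auto
next
  case (wclass_scale p w g r)
  then obtain C where "\<forall>\<^sub>F n in sequentially. \<forall>x. \<bar>g n x\<bar> * (1 + sqrt n * \<bar>x\<bar>) ^ L \<le> C * sqrt n powi (- w)" by blast
  then have "\<forall>\<^sub>F n in sequentially. \<forall>x. \<bar>r * g n x\<bar> * (1 + sqrt n * \<bar>x\<bar>) ^ L \<le> (\<bar>r\<bar> * C) * sqrt n powi (- w)"
  proof eventually_elim
    case (elim n)
    show ?case
    proof
      fix x
      from elim have "\<bar>r\<bar> * (\<bar>g n x\<bar> * (1 + sqrt n * \<bar>x\<bar>) ^ L) \<le> \<bar>r\<bar> * (C * sqrt n powi (- w))"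
        by (intro mult_left_mono) auto
      then show "\<bar>r * g n x\<bar> * (1 + sqrt n * \<bar>x\<bar>) ^ L \<le> (\<bar>r\<bar> * C) * sqrt n powi (- w)"
        by (simp add: abs_mult mult_ac)
    qed
  qed
  then show ?case by blast
next
  case (wclass_n p w g)
  then obtain C where "\<forall>\<^sub>F n in sequentially. \<forall>x. \<bar>g n x\<bar> * (1 + sqrt n * \<bar>x\<bar>) ^ L \<le> C * sqrt n powi (- w)" by blast
  then have "\<forall>\<^sub>F n in sequentially. \<forall>x. \<bar>real n * g n x\<bar> * (1 + sqrt n * \<bar>x\<bar>) ^ L \<le> C * sqrt n powi (- (w - 2))"
    using eventually_gt_at_top[of 0]
  proof eventually_elim
    case (elim n)
    have w: "- (w - 2) = 2 + (- w)" by simp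
    have e: "sqrt n powi (- (w - 2)) = real n * sqrt n powi (- w)"
      unfolding w by (subst power_int_add) (use elim in simp_all)
    show ?case
    proof
      fix x
      from elim have "real n * (\<bar>g n x\<bar> * (1 + sqrt n * \<bar>x\<bar>) ^ L) \<le> real n * (C * sqrt n powi (- w))"
        by (intro mult_left_mono) auto
      then show "\<bar>real n * g n x\<bar> * (1 + sqrt n * \<bar>x\<bar>) ^ L \<le> C * sqrt n powi (- (w - 2))"
        unfolding e by (simp add: abs_mult mult_ac)
    qed
  qed
  then show ?case by blast
next
  case (wclass_add p w g h)
  then obtain C D where "\<forall>\<^sub>F n in sequentially. \<forall>x. \<bar>g n x\<bar> * (1 + sqrt n * \<bar>x\<bar>) ^ L \<le> C * sqrt n powi (- w)"
    "\<forall>\<^sub>F n in sequentially. \<forall>x. \<bar>h n x\<bar> * (1 + sqrt n * \<bar>x\<bar>) ^ L \<le> D * sqrt n powi (- w)" by blast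
  then have "\<forall>\<^sub>F n in sequentially. \<forall>x. \<bar>g n x + h n x\<bar> * (1 + sqrt n * \<bar>x\<bar>) ^ L \<le> (C + D) * sqrt n powi (- w)"
  proof eventually_elim
    case (elim n)
    show ?case
    proof
      fix x
      have "\<bar>g n x + h n x\<bar> * (1 + sqrt n * \<bar>x\<bar>) ^ L \<le> (\<bar>g n x\<bar> + \<bar>h n x\<bar>) * (1 + sqrt n * \<bar>x\<bar>) ^ L"
        by (intro mult_right_mono) auto
      also have "\<dots> \<le> C * sqrt n powi (- w) + D * sqrt n powi (- w)"
        unfolding distrib_right using elim by (intro add_mono) auto
      finally show "\<bar>g n x + h n x\<bar> * (1 + sqrt n * \<bar>x\<bar>) ^ L \<le> (C + D) * sqrt n powi (- w)"
        by (simp add: distrib_right)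
    qed
  qed
  then show ?case by blast
next
  case (wclass_weaken p w g)
  then obtain C where "\<forall>\<^sub>F n in sequentially. \<forall>x. \<bar>g n x\<bar> * (1 + sqrt n * \<bar>x\<bar>) ^ L \<le> C * sqrt n powi (- w)" by blast
  then have "\<forall>\<^sub>F n in sequentially. \<forall>x. \<bar>g n x\<bar> * (1 + sqrt n * \<bar>x\<bar>) ^ L \<le> \<bar>C\<bar> * sqrt n powi (- (w - 2))"
    using eventually_gt_at_top[of 0]
  proof eventually_elim
    case (elim n)
    have "sqrt n powi (- w) \<le> sqrt n powi (- (w - 2))"
      using elim by (intro power_int_increasing) simp_all
    then have "C * sqrt n powi (- w) \<le> \<bar>C\<bar> * sqrt n powi (- (w - 2))"
      by (intro mult_mono) simp_all
    with elim show ?case by (blast intro: order_trans[of _ "C * sqrt n powi (- w)"])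
  qed
  then show ?case by blast
qed

section \<open>Sums over arithmetic progressions\<close>

lemma DERIV_shift_plus:
  "(f has_real_derivative y) (at (x + z)) \<Longrightarrow> ((\<lambda>x. f (x + z)) has_real_derivative y) (at x)"
  by (simp add: DERIV_shift)

lemma DERIV_shift_minus:
  "(f has_real_derivative y) (at (x - z)) \<Longrightarrow> ((\<lambda>x. f (x - z)) has_real_derivative y) (at x)"
  using DERIV_shift_plus[of f y x "- z"] by simp

text \<open>Euler-Maclaurin without Bernoulli polynomials. The sum of \<open>h 1\<close> along the
  progression, as a function of its offset, has a mean over one period that telescopes to boundary
  values of \<open>h 0\<close> and is attained somewhere. Its deviation from the mean is at most T
  times the supremum of the sum of \<open>h 2\<close>, to which the same argument applies; the means
  met on the way are the boundary differences on the right.\<close>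

lemma periodization_mean_bound:
  fixes h :: "nat \<Rightarrow> real \<Rightarrow> real"
  assumes T: "T > 0"
    and deriv: "\<And>i x. i \<le> K \<Longrightarrow> x \<ge> 0 \<Longrightarrow> (h i has_real_derivative h (Suc i) x) (at x)"
    and B: "\<And>y. 0 \<le> y \<Longrightarrow> y \<le> T \<Longrightarrow> \<bar>\<Sum>k<m. h (Suc K) (y + real k * T)\<bar> \<le> B"
    and x: "0 \<le> x" "x \<le> T"
  shows "\<bar>(\<Sum>k<m. h 1 (x + real k * T)) - (h 0 (real m * T) - h 0 0) / T\<bar>
    \<le> T ^ K * (2 * B) + (\<Sum>j<K. T ^ j * \<bar>h (Suc j) (real m * T) - h (Suc j) 0\<bar>)"
  using deriv B x
proof (induction K arbitrary: h x)
  case (0 h x)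
  have "\<exists>\<xi>. 0 < \<xi> \<and> \<xi> < T \<and> (\<Sum>k<m. h 0 (T + real k * T)) - (\<Sum>k<m. h 0 (0 + real k * T)) =
      (T - 0) * (\<Sum>k<m. h 1 (\<xi> + real k * T))"
  proof (rule MVT2[OF T])
    fix y assume "0 \<le> y" "y \<le> T"
    then show "((\<lambda>y. \<Sum>k<m. h 0 (y + real k * T)) has_real_derivative (\<Sum>k<m. h 1 (y + real k * T))) (at y)"
      using 0(1)[of 0] T by (intro DERIV_sum DERIV_shift_plus) simp
  qed
  then obtain \<xi> where \<xi>: "0 < \<xi>" "\<xi> < T"
    "(\<Sum>k<m. h 0 (T + real k * T)) - (\<Sum>k<m. h 0 (0 + real k * T)) = T * (\<Sum>k<m. h 1 (\<xi> + real k * T))" by auto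
  have "(\<Sum>k<m. h 0 (T + real k * T)) - (\<Sum>k<m. h 0 (0 + real k * T)) =
      (\<Sum>k<m. h 0 (real (Suc k) * T) - h 0 (real k * T))"
    by (simp add: sum_subtractf distrib_right)
  also have "\<dots> = h 0 (real m * T) - h 0 0" using sum_lessThan_telescope[of "\<lambda>k. h 0 (real k * T)" m] by simp
  finally have "(h 0 (real m * T) - h 0 0) / T = (\<Sum>k<m. h 1 (\<xi> + real k * T))" using \<xi>(3) T by (simp add: field_simps)
  then show ?case using 0(2)[of \<xi>] 0(2)[of x] \<xi> 0(3,4) by (simp add: One_nat_def)
next
  case (Suc K h x)
  let ?U = "\<lambda>i y. \<Sum>k<m. h i (y + real k * T)"
  have DU: "(?U i has_real_derivative ?U (Suc i) y) (at y)" if "i \<le> 1" "0 \<le> y" for i y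
    using Suc.prems(1)[of i] T that by (intro DERIV_sum DERIV_shift_plus) simp
  let ?R = "T ^ K * (2 * B) + (\<Sum>j<K. T ^ j * \<bar>h (Suc (Suc j)) (real m * T) - h (Suc (Suc j)) 0\<bar>)"
  let ?D = "h 1 (real m * T) - h 1 0"
  have R: "\<bar>?U 2 y\<bar> \<le> ?R + \<bar>?D\<bar> / T" if "0 \<le> y" "y \<le> T" for y
  proof -
    have "\<bar>(\<Sum>k<m. h (Suc 1) (y + real k * T)) - (h (Suc 0) (real m * T) - h (Suc 0) 0) / T\<bar> \<le> ?R"
      using Suc.prems that by (intro Suc.IH[of "\<lambda>i. h (Suc i)" y]) auto
    moreover have "\<bar>?D / T\<bar> = \<bar>?D\<bar> / T" using T by (simp add: abs_divide)
    ultimately show ?thesis unfolding numeral_2_eq_2 One_nat_def by linarith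
  qed
  have "\<exists>\<xi>. 0 < \<xi> \<and> \<xi> < T \<and> ?U 0 T - ?U 0 0 = (T - 0) * ?U 1 \<xi>"
    using DU[of 0] by (intro MVT2[OF T]) auto
  then obtain \<xi> where \<xi>: "0 < \<xi>" "\<xi> < T" "?U 0 T - ?U 0 0 = T * ?U 1 \<xi>" by auto
  have "?U 0 T - ?U 0 0 = (\<Sum>k<m. h 0 (real (Suc k) * T) - h 0 (real k * T))"
    by (simp add: sum_subtractf distrib_right)
  also have "\<dots> = h 0 (real m * T) - h 0 0" using sum_lessThan_telescope[of "\<lambda>k. h 0 (real k * T)" m] by simp
  finally have mean: "(h 0 (real m * T) - h 0 0) / T = ?U 1 \<xi>" using \<xi>(3) T by (simp add: field_simps)
  have "norm (?U 1 x - ?U 1 \<xi>) \<le> (?R + \<bar>?D\<bar> / T) * norm (x - \<xi>)"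
  proof (rule field_differentiable_bound[where S = "{0..T}" and f' = "?U 2"])
    fix z assume z: "z \<in> {0..T}"
    show "(?U 1 has_field_derivative ?U 2 z) (at z within {0..T})"
      using DU[of 1 z] z by (auto simp: numeral_2_eq_2 intro: has_field_derivative_at_within)
    show "norm (?U 2 z) \<le> ?R + \<bar>?D\<bar> / T" using R z by simp
  qed (use Suc.prems \<xi> in auto)
  also have "\<dots> \<le> (?R + \<bar>?D\<bar> / T) * T"
    using Suc.prems(3,4) \<xi> R[of x] by (intro mult_left_mono) auto
  also have "\<dots> = T ^ Suc K * (2 * B) +
      (\<Sum>j<Suc K. T ^ j * \<bar>h (Suc j) (real m * T) - h (Suc j) 0\<bar>)"
    unfolding sum.lessThan_Suc_shift using T by (simp add: algebra_simps sum_distrib_left)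
  finally show ?case by (simp add: mean)
qed

text \<open>Each square is compared with the product of neighbouring denominators, and the
  reciprocals of these products telescope. The step size b stays explicit because 1 / b will be a
  power of n.\<close>

lemma sum_inverse_squares_le:
  assumes "(b :: real) > 0"
  shows "(\<Sum>k<m. 1 / (1 + b * real k)\<^sup>2) \<le> 1 + 1 / b"
proof -
  have "(\<Sum>k<Suc m. 1 / (1 + b * real k)\<^sup>2) \<le> 1 + 1 / b - 1 / (b * (1 + b * real m))" for m
  proof (induction m)
    case (Suc m)
    let ?u = "1 + b * real m"
    have u: "?u > 0" using assms by (simp add: add_pos_nonneg)
    have "1 / (?u + b)\<^sup>2 \<le> 1 / (?u * (?u + b))"
      using assms u by (intro divide_left_mono) (auto simp: power2_eq_square intro!: mult_right_mono)
    also have "\<dots> = 1 / (b * ?u) - 1 / (b * (?u + b))"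
      using assms u by (simp add: divide_simps)
    finally have "1 / (?u + b)\<^sup>2 \<le> 1 / (b * ?u) - 1 / (b * (?u + b))" .
    moreover have e: "1 + b * real (Suc m) = ?u + b" by (simp add: algebra_simps)
    ultimately show ?case using Suc unfolding sum.lessThan_Suc[of _ "Suc m"] e by linarith
  qed auto
  moreover have "1 + 1 / b - 1 / (b * (1 + b * real m)) \<le> 1 + 1 / b" for m using assms by simp
  ultimately have "(\<Sum>k<Suc m. 1 / (1 + b * real k)\<^sup>2) \<le> 1 + 1 / b" for m by (rule order_trans)
  then show ?thesis
    using assms by (cases m) auto
qed

lemma sum_lessThan_add:
  "(\<Sum>k<N + M. f k) = (\<Sum>k<N. f k) + (\<Sum>k<M. f (N + k))" for f :: "nat \<Rightarrow> 'a :: comm_monoid_add"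
  by (induction M) (auto simp: add_ac)

lemma sum_lessThan_double:
  "(\<Sum>k<2 * N. f k) = (\<Sum>k<N. f (2 * k) + f (2 * k + 1))" for f :: "nat \<Rightarrow> 'a :: comm_monoid_add"
  by (induction N) (auto simp: add_ac)

lemma sum_lessThan_centered:
  "(\<Sum>k<2 * N. f (real k - real N)) = (\<Sum>k<N. f (real k)) + (\<Sum>k<N. f (- (real k + 1)))"
  for f :: "real \<Rightarrow> 'a :: comm_monoid_add"
proof -
  have "(\<Sum>k<N. f (real k - real N)) = (\<Sum>k<N. f (real (N - Suc k) - real N))"
    by (rule sum.nat_diff_reindex[symmetric])
  also have "\<dots> = (\<Sum>k<N. f (- (real k + 1)))"
    by (rule sum.cong) (auto simp: of_nat_diff algebra_simps)
  finally show ?thesis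
    using sum_lessThan_add[of "\<lambda>k. f (real k - real N)" N N] by (simp add: mult_2 add.commute)
qed

lemma wclass_deriv_chain:
  assumes "wclass p w g"
  obtains G where "G 0 = g" "\<And>i. wclass (p \<noteq> odd i) (w - int i) (G i)"
    "\<And>i. \<forall>\<^sub>F n in sequentially. \<forall>x. (G i n has_real_derivative G (Suc i) n x) (at x)"
proof -
  have "\<exists>G. \<forall>i. (wclass (p \<noteq> odd i) (w - int i) (G i) \<and> (i = 0 \<longrightarrow> G i = g)) \<and>
    (\<forall>\<^sub>F n in sequentially. \<forall>x. (G i n has_real_derivative G (Suc i) n x) (at x))"
  proof (rule dependent_nat_choice)
    show "\<exists>x. wclass (p \<noteq> odd 0) (w - int 0) x \<and> (0 = (0::nat) \<longrightarrow> x = g)" using assms by auto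
    fix x i assume "wclass (p \<noteq> odd i) (w - int i) x \<and> (i = 0 \<longrightarrow> x = g)"
    then obtain y where "wclass (\<not> (p \<noteq> odd i)) (w - int i - 1) y"
      "\<forall>\<^sub>F n in sequentially. \<forall>t. (x n has_real_derivative y n t) (at t)"
      using wclass_deriv by blast
    moreover have "w - int i - 1 = w - int (Suc i)" "(\<not> (p \<noteq> odd i)) = (p \<noteq> odd (Suc i))" by auto
    ultimately show "\<exists>y. (wclass (p \<noteq> odd (Suc i)) (w - int (Suc i)) y \<and> (Suc i = 0 \<longrightarrow> y = g)) \<and>
        (\<forall>\<^sub>F n in sequentially. \<forall>t. (x n has_real_derivative y n t) (at t))"
      by auto
  qed
  then show ?thesis using that by auto
qed

lemma DERIV_integral_lower:
  fixes f :: "real \<Rightarrow> real"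
  assumes "continuous_on UNIV f" "a < x"
  shows "((\<lambda>x. integral {a..x} f) has_real_derivative f x) (at x)"
proof -
  have "((\<lambda>x. integral {a..x} f) has_real_derivative f x) (at x within {a..x + 1})"
    using assms by (intro integral_has_real_derivative) (auto intro: continuous_on_subset)
  moreover have "at x within {a..x + 1} = at x"
    using assms by (intro at_within_interior) auto
  ultimately show ?thesis by simp
qed

lemma integral_odd_eq_0:
  fixes f :: "real \<Rightarrow> real"
  assumes "\<And>x. f (- x) = - f x"
  shows "integral {-c..c} f = 0"
  using Henstock_Kurzweil_Integration.integral_reflect_real[of c "-c" f] assms by simp

section \<open>Rapid decay of alternating sums\<close>

text \<open>The points e, 3 e, 5 e, 7 e with alternating signs become, by oddness of the kernel, e,
  -3 e, 5 e, -7 e without signs. These are the points e + 4 e j with j running through all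
  integers.\<close>

lemma alt_sum_eq_periodization:
  assumes odd: "\<And>x. g (- x) = - g x" and supp: "\<And>x. \<bar>x\<bar> \<ge> c \<Longrightarrow> g x = 0"
    and "(4 * real N + 1) * e \<ge> c" "e \<ge> 0"
  shows "(\<Sum>k<2 * N. g (e + (real k - real N) * (4 * e))) = alt_sum g e"
proof -
  have "g (e + (- real k - 1) * (4 * e)) = - g ((4 * real k + 3) * e)" for k
    using odd[of "(4 * real k + 3) * e"] by (simp add: algebra_simps)
  then have "(\<Sum>k<2 * N. g (e + (real k - real N) * (4 * e))) =
     (\<Sum>k<N. g (e + real k * (4 * e)) - g ((4 * real k + 3) * e))"
    using sum_lessThan_centered[of "\<lambda>t. g (e + t * (4 * e))" N] by (simp add: sum_negf sum_subtractf)
  also have "\<dots> = (\<Sum>k<2 * N. (-1) ^ k * g ((2 * real k + 1) * e))"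
    unfolding sum_lessThan_double by (rule sum.cong) (auto simp: algebra_simps)
  also have "\<dots> = alt_sum g e"
    using assms by (intro alt_sum_finite[symmetric, of c]) auto
  finally show ?thesis .
qed

text \<open>The natural scale of the step e is 1 / sqrt n. Above it the first point already lies in
  the Gaussian tail of the kernel. Below it the sum is a periodization with period 4 e whose mean,
  the integral of an odd function, is 0; only the remainder after \<open>K\<close> derivatives is
  left, and each derivative contributes a factor sqrt n e.\<close>

lemma alt_sum_decay:
  assumes "wclass True w g"
  shows "\<exists>C\<ge>0. \<forall>\<^sub>F n in sequentially. \<forall>e>0.
    \<bar>alt_sum (g n) e\<bar> * (sqrt n * e + 1 / (sqrt n * e)) ^ L \<le> C * sqrt n powi (- w)"
proof -
  obtain G where G0: "G 0 = g" and G: "\<And>i. wclass (True \<noteq> odd i) (w - int i) (G i)"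
    and DG: "\<And>i. \<forall>\<^sub>F n in sequentially. \<forall>x. (G i n has_real_derivative G (Suc i) n x) (at x)"
    using wclass_deriv_chain[OF assms] by blast
  \<comment> \<open>One derivative more than the wanted power: summing the bound for the
    \<open>K\<close>-th derivative along the progression costs a factor of order 1 / s.\<close>
  define K where "K = Suc L"
  obtain C1 where C1: "\<forall>\<^sub>F n in sequentially. \<forall>x. \<bar>G K n x\<bar> * (1 + sqrt n * \<bar>x\<bar>) ^ 2 \<le> C1 * sqrt n powi (- (w - int K))"
    using wclass_bound[OF G] by blast
  obtain C2 where C2: "\<forall>\<^sub>F n in sequentially. \<forall>x. \<bar>g n x\<bar> * (1 + sqrt n * \<bar>x\<bar>) ^ (L + 2) \<le> C2 * sqrt n powi (- w)"
    using wclass_bound[OF assms] by blast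
  have DG': "\<forall>\<^sub>F n in sequentially. \<forall>i\<in>{..K}. \<forall>x. (G i n has_real_derivative G (Suc i) n x) (at x)"
    using DG by (intro eventually_ball_finite) auto
  have SG: "\<forall>\<^sub>F n in sequentially. \<forall>i\<in>{..K}. \<forall>x. \<bar>x\<bar> \<ge> pi / 2 \<longrightarrow> G i n x = 0"
    using wclass_support[OF G] by (intro eventually_ball_finite) auto
  define C where "C = max (2 ^ L * (2 * \<bar>C2\<bar>)) (2 ^ L * (4 ^ K * (8 * \<bar>C1\<bar>)))"
  have "\<forall>\<^sub>F n in sequentially. \<forall>e>0.
    \<bar>alt_sum (g n) e\<bar> * (sqrt n * e + 1 / (sqrt n * e)) ^ L \<le> C * sqrt n powi (- w)"
    using C1 C2 DG' SG eventually_gt_at_top[of 0]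
  proof eventually_elim
    case (elim n)
    show ?case
    proof (intro allI impI)
      fix e :: real assume e: "e > 0"
      define s where "s = sqrt n * e"
      define W where "W = sqrt n powi (- w)"
      have s: "s > 0" using e elim(5) by (simp add: s_def)
      have W: "W > 0" using elim(5) by (simp add: W_def)
      have supp: "g n x = 0" if "\<bar>x\<bar> \<ge> pi / 2" for x using elim(4) that G0 by auto
      obtain N :: nat where N: "real N > pi / (2 * e)" using reals_Archimedean2 by blast
      then have Ne: "real N * e > pi / 2" using e by (simp add: field_simps)
      have "real N * e \<le> (2 * real N + 1) * e" "real N * e \<le> (4 * real N + 1) * e" "real N * e \<le> real N * (4 * e)"
        using e by (simp_all add: distrib_right)
      with Ne have lim: "(2 * real N + 1) * e \<ge> pi / 2" "(4 * real N + 1) * e \<ge> pi / 2" "real N * (4 * e) \<ge> pi / 2"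
        by (meson less_imp_le order_trans)+
      have "\<bar>alt_sum (g n) e\<bar> * (s + 1 / s) ^ L \<le> C * W"
      proof (cases "s \<ge> 1")
        case True
        have summand: "\<bar>g n ((2 * real k + 1) * e)\<bar> * s ^ L \<le> \<bar>C2\<bar> * W * (1 / (1 + 1 * real k)\<^sup>2)" for k
        proof -
          let ?t = "1 + sqrt n * \<bar>(2 * real k + 1) * e\<bar>"
          have "sqrt n * \<bar>(2 * real k + 1) * e\<bar> = (2 * real k + 1) * s" using e by (simp add: s_def abs_mult)
          moreover have "real k * 1 \<le> real k * s" by (intro mult_left_mono) (use True in auto)
          then have "(2 * real k + 1) * s \<ge> 2 * real k + s" by (simp add: distrib_right)
          moreover have "real k \<ge> 0" by simp
          moreover note True
          ultimately have t: "?t \<ge> s" "?t \<ge> 1 + real k" by linarith+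
          have "\<bar>g n ((2 * real k + 1) * e)\<bar> * s ^ L * (1 + real k)\<^sup>2 \<le> \<bar>g n ((2 * real k + 1) * e)\<bar> * ?t ^ L * ?t\<^sup>2"
            using t s by (intro mult_mono power_mono) (simp_all add: add_nonneg_nonneg)
          also have "\<dots> = \<bar>g n ((2 * real k + 1) * e)\<bar> * ?t ^ (L + 2)" by (simp add: power_add power2_eq_square)
          also have "\<dots> \<le> C2 * W" using elim(2) by (simp only: W_def)
          also have "\<dots> \<le> \<bar>C2\<bar> * W" using W by (intro mult_right_mono) auto
          finally show ?thesis by (simp add: pos_le_divide_eq)
        qed
        have "alt_sum (g n) e = (\<Sum>k<N. (-1) ^ k * g n ((2 * real k + 1) * e))"
          using supp lim e by (intro alt_sum_finite[of "pi / 2"]) auto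
        then have "\<bar>alt_sum (g n) e\<bar> \<le> (\<Sum>k<N. \<bar>g n ((2 * real k + 1) * e)\<bar>)"
          using sum_abs[of "\<lambda>k. (-1) ^ k * g n ((2 * real k + 1) * e)" "{..<N}"] by (simp add: abs_mult)
        then have "\<bar>alt_sum (g n) e\<bar> * s ^ L \<le> (\<Sum>k<N. \<bar>g n ((2 * real k + 1) * e)\<bar>) * s ^ L"
          using s by (intro mult_right_mono) auto
        also have "\<dots> = (\<Sum>k<N. \<bar>g n ((2 * real k + 1) * e)\<bar> * s ^ L)" by (rule sum_distrib_right)
        also have "\<dots> \<le> (\<Sum>k<N. \<bar>C2\<bar> * W * (1 / (1 + 1 * real k)\<^sup>2))" by (intro sum_mono summand)
        also have "\<dots> = \<bar>C2\<bar> * W * (\<Sum>k<N. 1 / (1 + 1 * real k)\<^sup>2)" by (rule sum_distrib_left[symmetric])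
        also have "\<dots> \<le> \<bar>C2\<bar> * W * (1 + 1 / 1)" using W by (intro mult_left_mono sum_inverse_squares_le) auto
        finally have *: "\<bar>alt_sum (g n) e\<bar> * s ^ L \<le> \<bar>C2\<bar> * W * 2" by simp
        have "1 / s \<le> 1" using True by simp
        then have "1 / s \<le> s" using True by linarith
        then have "(s + 1 / s) ^ L \<le> (2 * s) ^ L" using s by (intro power_mono) auto
        then have "\<bar>alt_sum (g n) e\<bar> * (s + 1 / s) ^ L \<le> \<bar>alt_sum (g n) e\<bar> * (2 * s) ^ L"
          by (intro mult_left_mono) auto
        also have "\<dots> = 2 ^ L * (\<bar>alt_sum (g n) e\<bar> * s ^ L)" by (simp add: power_mult_distrib)
        also have "\<dots> \<le> 2 ^ L * (\<bar>C2\<bar> * W * 2)" using * by (intro mult_left_mono) auto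
        also have "\<dots> = (2 ^ L * (2 * \<bar>C2\<bar>)) * W" by simp
        also have "\<dots> \<le> C * W" using W unfolding C_def by (intro mult_right_mono) auto
        finally show ?thesis .
      next
        case False
        define T where "T = 4 * e"
        have T: "T > 0" using e by (simp add: T_def)
        \<comment> \<open>The argument is shifted so that the progression starts at 0. The primitive
          starts one unit further left, which makes it differentiable at 0 itself.\<close>
        define h where "h i x = (case i of 0 \<Rightarrow> integral {- real N * T - 1..x - real N * T} (g n)
            | Suc j \<Rightarrow> G j n (x - real N * T))" for i x
        have cont: "continuous_on UNIV (g n)"
        proof (intro continuous_at_imp_continuous_on ballI)
          fix x :: real
          have "(G 0 n has_real_derivative G (Suc 0) n x) (at x)" using elim(3) by blast
          then show "isCont (g n) x" unfolding G0 by (rule DERIV_isCont)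
        qed
        have hderiv: "(h i has_real_derivative h (Suc i) x) (at x)" if "i \<le> K" "x \<ge> 0" for i x
        proof (cases i)
          case 0
          have "((\<lambda>x. integral {- real N * T - 1..x} (g n)) has_real_derivative g n (x - real N * T)) (at (x - real N * T))"
            using that by (intro DERIV_integral_lower[OF cont]) auto
          then show ?thesis using G0 DERIV_shift_minus by (simp add: h_def[abs_def] 0)
        next
          case (Suc j)
          then have "(G j n has_real_derivative G i n (x - real N * T)) (at (x - real N * T))"
            using elim(3) that by auto
          then show ?thesis using Suc DERIV_shift_minus by (simp add: h_def[abs_def])
        qed
        define B where "B = \<bar>C1\<bar> * (W * sqrt n ^ K) * (4 / s)"
        have sK: "sqrt n powi (- (w - int K)) = W * sqrt n ^ K"
        proof -
          have "- (w - int K) = - w + int K" by simp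
          then have "sqrt n powi (- (w - int K)) = sqrt n powi (- w + int K)" by (simp only:)
          also have "\<dots> = sqrt n powi (- w) * sqrt n powi (int K)" using elim(5) by (intro power_int_add) auto
          finally show ?thesis by (simp add: W_def)
        qed
        have GK: "\<bar>G K n x\<bar> \<le> \<bar>C1\<bar> * (W * sqrt n ^ K) * (1 / (1 + sqrt n * T * real j)\<^sup>2)"
          if "\<bar>x\<bar> \<ge> real j * T" for x j
        proof -
          have "sqrt n * (real j * T) \<le> sqrt n * \<bar>x\<bar>" using that by (intro mult_left_mono) auto
          then have "1 + sqrt n * T * real j \<le> 1 + sqrt n * \<bar>x\<bar>" by (simp add: mult_ac)
          then have "\<bar>G K n x\<bar> * (1 + sqrt n * T * real j)\<^sup>2 \<le> \<bar>G K n x\<bar> * (1 + sqrt n * \<bar>x\<bar>)\<^sup>2"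
            using T by (intro mult_left_mono power_mono) auto
          also have "\<dots> \<le> C1 * (W * sqrt n ^ K)" using elim(1) by (simp only: sK)
          also have "\<dots> \<le> \<bar>C1\<bar> * (W * sqrt n ^ K)" using W by (intro mult_right_mono) auto
          finally have "\<bar>G K n x\<bar> * (1 + sqrt n * T * real j)\<^sup>2 \<le> \<bar>C1\<bar> * (W * sqrt n ^ K)" .
          moreover have "1 + sqrt n * T * real j > 0" using T by (simp add: add_pos_nonneg)
          ultimately show ?thesis by (simp add: pos_le_divide_eq)
        qed
        have hB: "\<bar>\<Sum>k<2 * N. h (Suc K) (y + real k * T)\<bar> \<le> B" if y: "0 \<le> y" "y \<le> T" for y
        proof -
          let ?q = "\<lambda>j :: nat. \<bar>C1\<bar> * (W * sqrt n ^ K) * (1 / (1 + sqrt n * T * real j)\<^sup>2)"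
          have "(\<Sum>k<2 * N. h (Suc K) (y + real k * T)) = (\<Sum>k<2 * N. G K n (y + (real k - real N) * T))"
            by (rule sum.cong) (auto simp: h_def algebra_simps)
          also have "\<dots> = (\<Sum>k<N. G K n (y + real k * T)) + (\<Sum>k<N. G K n (y + (- (real k + 1)) * T))"
            by (rule sum_lessThan_centered)
          also have "\<bar>\<dots>\<bar> \<le> (\<Sum>k<N. \<bar>G K n (y + real k * T)\<bar>) + (\<Sum>k<N. \<bar>G K n (y + (- (real k + 1)) * T)\<bar>)"
            by (intro order_trans[OF abs_triangle_ineq] add_mono sum_abs)
          also have "\<dots> \<le> (\<Sum>k<N. ?q k) + (\<Sum>k<N. ?q k)"
          proof (intro add_mono sum_mono GK)
            fix k show "real k * T \<le> \<bar>y + real k * T\<bar>" using y T by (simp add: abs_of_nonneg)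
            have "y + - (real k + 1) * T = - (real k * T + (T - y))" by (simp add: algebra_simps)
            then show "real k * T \<le> \<bar>y + - (real k + 1) * T\<bar>" using y T by (simp only: abs_minus_cancel)
          qed
          also have "\<dots> = 2 * (\<bar>C1\<bar> * (W * sqrt n ^ K)) * (\<Sum>k<N. 1 / (1 + sqrt n * T * real k)\<^sup>2)"
            by (simp add: sum_distrib_left)
          also have "\<dots> \<le> 2 * (\<bar>C1\<bar> * (W * sqrt n ^ K)) * (1 + 1 / (sqrt n * T))"
            using W T elim(5) by (intro mult_left_mono sum_inverse_squares_le) auto
          also have "\<dots> \<le> 2 * (\<bar>C1\<bar> * (W * sqrt n ^ K)) * (2 / s)"
          proof (intro mult_left_mono)
            have "sqrt n * T = 4 * s" by (simp add: T_def s_def)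
            then show "1 + 1 / (sqrt n * T) \<le> 2 / s" using s False by (simp add: field_simps)
          qed (use W in auto)
          also have "\<dots> = B" by (simp add: B_def)
          finally show ?thesis .
        qed
        have "\<bar>(\<Sum>k<2 * N. h 1 (e + real k * T)) - (h 0 (real (2 * N) * T) - h 0 0) / T\<bar>
          \<le> T ^ K * (2 * B) + (\<Sum>j<K. T ^ j * \<bar>h (Suc j) (real (2 * N) * T) - h (Suc j) 0\<bar>)"
          using hderiv hB e by (intro periodization_mean_bound[OF T]) (auto simp: T_def)
        moreover have "h 0 (real (2 * N) * T) - h 0 0 = 0"
        proof -
          have "integral {- real N * T - 1..- real N * T} (g n) + integral {- real N * T..real N * T} (g n)
              = integral {- real N * T - 1..real N * T} (g n)"
            using T by (intro Henstock_Kurzweil_Integration.integral_combine integrable_continuous_interval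
                continuous_on_subset[OF cont]) auto
          moreover have "integral {- (real N * T)..real N * T} (g n) = 0"
            using wclass_parity[OF assms] by (intro integral_odd_eq_0) auto
          ultimately show ?thesis by (simp add: h_def algebra_simps)
        qed
        moreover have "h (Suc j) (real (2 * N) * T) - h (Suc j) 0 = 0" if "j < K" for j
        proof -
          have "\<bar>real (2 * N) * T - real N * T\<bar> \<ge> pi / 2" "\<bar>0 - real N * T\<bar> \<ge> pi / 2"
            using lim(3) e by (auto simp: T_def algebra_simps abs_if)
          then show ?thesis using elim(4) that by (simp add: h_def)
        qed
        moreover have "(\<Sum>k<2 * N. h 1 (e + real k * T)) = alt_sum (g n) e"
        proof -
          have "(\<Sum>k<2 * N. h 1 (e + real k * T)) = (\<Sum>k<2 * N. g n (e + (real k - real N) * (4 * e)))"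
            by (rule sum.cong) (auto simp: h_def G0 T_def algebra_simps)
          also have "\<dots> = alt_sum (g n) e"
            using supp lim e wclass_parity[OF assms] by (intro alt_sum_eq_periodization[of _ "pi / 2"]) auto
          finally show ?thesis .
        qed
        ultimately have "\<bar>alt_sum (g n) e\<bar> \<le> T ^ K * (2 * B)" by simp
        also have "\<dots> = (4 ^ K * (8 * \<bar>C1\<bar>)) * W * ((e * sqrt n) ^ K / s)"
          by (simp add: T_def B_def power_mult_distrib)
        also have "(e * sqrt n) ^ K / s = s ^ L"
        proof -
          have "e * sqrt n = s" by (simp add: s_def)
          then show ?thesis using s by (simp add: K_def)
        qed
        finally have *: "\<bar>alt_sum (g n) e\<bar> \<le> (4 ^ K * (8 * \<bar>C1\<bar>)) * W * s ^ L" .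
        have "1 \<le> 1 / s" using False s by simp
        then have "s \<le> 1 / s" using False by linarith
        then have "(s + 1 / s) ^ L \<le> (2 / s) ^ L" using s by (intro power_mono) auto
        then have "\<bar>alt_sum (g n) e\<bar> * (s + 1 / s) ^ L \<le> ((4 ^ K * (8 * \<bar>C1\<bar>)) * W * s ^ L) * (2 / s) ^ L"
          using * s W by (intro mult_mono) auto
        also have "\<dots> = (2 ^ L * (4 ^ K * (8 * \<bar>C1\<bar>))) * W" using s by (simp add: power_divide)
        also have "\<dots> \<le> C * W" using W unfolding C_def by (intro mult_right_mono) auto
        finally show ?thesis .
      qed
      then show "\<bar>alt_sum (g n) e\<bar> * (sqrt n * e + 1 / (sqrt n * e)) ^ L \<le> C * sqrt n powi (- w)"
        by (simp add: s_def W_def)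
    qed
  qed
  moreover have "C \<ge> 0" unfolding C_def by (simp add: le_max_iff_disj)
  ultimately show ?thesis by blast
qed

section \<open>Dependence on the barrier\<close>

text \<open>The summand of a moment as a function of a real barrier position, extended by \<open>0\<close>; for a
  kernel supported in \<open>\<bar>x\<bar> < pi / 2\<close> it vanishes for \<open>H \<le> 1\<close>, so the extension is as smooth as the
  kernel.\<close>

definition radial :: "int \<Rightarrow> (real \<Rightarrow> real) \<Rightarrow> real \<Rightarrow> real" where
  "radial e g H = (if H > 0 then H powi e * alt_sum g (pi / (2 * H)) else 0)"

lemma radial_eq_0:
  assumes "\<And>x. x \<ge> pi / 2 \<Longrightarrow> g x = 0" "H \<le> 1"
  shows "radial e g H = 0"
proof (cases "H > 0")
  case True
  then have "alt_sum g (pi / (2 * H)) = (\<Sum>k<0. (-1) ^ k * g ((2 * real k + 1) * (pi / (2 * H))))"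
    using assms by (intro alt_sum_finite[of "pi / 2"]) (auto simp: field_simps)
  then show ?thesis by (simp add: radial_def)
qed (simp add: radial_def)

lemma radial_eq_sum:
  assumes "\<And>x. x \<ge> pi / 2 \<Longrightarrow> g x = 0" "0 < H" "H < real N"
  shows "radial e g H = H powi e * (\<Sum>k<N. (-1) ^ k * g ((2 * real k + 1) * pi / 2 / H))"
proof -
  have "pi * H \<le> pi * (2 * real N + 1)" using assms by (intro mult_left_mono) auto
  then have "alt_sum g (pi / (2 * H)) = (\<Sum>k<N. (-1) ^ k * g ((2 * real k + 1) * (pi / (2 * H))))"
    using assms by (intro alt_sum_finite[of "pi / 2"]) (auto simp: field_simps)
  then show ?thesis using assms by (simp add: radial_def mult.assoc)
qed

text \<open>For \<open>H < real N\<close> only the terms with \<open>k < N\<close> can be nonzero,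
  so the sum is differentiated termwise: H d/dH of g (c / H) is - x g' (x) at x = c / H. Below 1 the
  function is identically 0, which settles the origin.\<close>

lemma DERIV_radial:
  assumes supp: "\<And>x. x \<ge> pi / 2 \<Longrightarrow> g x = 0" "\<And>x. x \<ge> pi / 2 \<Longrightarrow> g' x = 0"
    and deriv: "\<And>x. (g has_real_derivative g' x) (at x)"
  shows "(radial e g has_real_derivative radial (e - 1) (\<lambda>x. of_int e * g x - x * g' x) H) (at H)"
proof (cases "H < 1")
  case True
  have "((\<lambda>_. 0) has_real_derivative radial (e - 1) (\<lambda>x. of_int e * g x - x * g' x) H) (at H)"
    using True supp by (subst radial_eq_0) auto
  then show ?thesis
  proof (rule has_field_derivative_transform_within_open)
    show "open {..<1 :: real}" "H \<in> {..<1}" using True by auto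
  qed (use supp radial_eq_0 in auto)
next
  case False
  then have H: "H > 0" by simp
  obtain N :: nat where N: "H < real N" using reals_Archimedean2 by blast
  let ?c = "\<lambda>k. (2 * real k + 1) * pi / 2"
  have term_deriv: "((\<lambda>H. g (?c k / H)) has_real_derivative g' (?c k / H) * (- ?c k / H\<^sup>2)) (at H)" for k
  proof (rule DERIV_chain2[OF deriv])
    show "((\<lambda>H. ?c k / H) has_real_derivative - ?c k / H\<^sup>2) (at H)"
      using H by (auto intro!: derivative_eq_intros simp: power2_eq_square)
  qed
  have "((\<lambda>H. H powi e * (\<Sum>k<N. (-1) ^ k * g (?c k / H))) has_real_derivative
     (of_int e * H powi (e - 1)) * (\<Sum>k<N. (-1) ^ k * g (?c k / H)) +
     H powi e * (\<Sum>k<N. (-1) ^ k * (g' (?c k / H) * (- ?c k / H\<^sup>2)))) (at H)"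
  proof -
    have a: "((\<lambda>H. H powi e) has_real_derivative of_int e * H powi (e - 1)) (at H)"
      using H by (auto intro!: derivative_eq_intros)
    have b: "((\<lambda>H. \<Sum>k<N. (-1) ^ k * g (?c k / H)) has_real_derivative
        (\<Sum>k<N. (-1) ^ k * (g' (?c k / H) * (- ?c k / H\<^sup>2)))) (at H)"
      by (intro DERIV_sum DERIV_cmult term_deriv)
    show ?thesis using DERIV_mult'[OF a b] by (simp only: add.commute)
  qed
  also have "(of_int e * H powi (e - 1)) * (\<Sum>k<N. (-1) ^ k * g (?c k / H)) +
     H powi e * (\<Sum>k<N. (-1) ^ k * (g' (?c k / H) * (- ?c k / H\<^sup>2))) =
     H powi (e - 1) * (\<Sum>k<N. (-1) ^ k * (of_int e * g (?c k / H) - (?c k / H) * g' (?c k / H)))"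
  proof -
    have e: "H powi e = H powi (e - 1) * H" using H power_int_add_1[of H "e - 1"] by simp
    have "(g' (?c k / H) * (- ?c k / H\<^sup>2)) * H = - ((?c k / H) * g' (?c k / H))" for k
      using H by (simp add: power2_eq_square)
    then have "(\<Sum>k<N. (-1) ^ k * (g' (?c k / H) * (- ?c k / H\<^sup>2))) * H =
        (\<Sum>k<N. (-1) ^ k * - ((?c k / H) * g' (?c k / H)))"
      unfolding sum_distrib_right by (simp only: mult.assoc)
    moreover have "H powi e * X = H powi (e - 1) * (X * H)" for X by (simp only: e mult_ac)
    ultimately have "H powi e * (\<Sum>k<N. (-1) ^ k * (g' (?c k / H) * (- ?c k / H\<^sup>2))) =
        H powi (e - 1) * (\<Sum>k<N. (-1) ^ k * - ((?c k / H) * g' (?c k / H)))"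
      by (simp only:)
    then show ?thesis
      by (simp only: right_diff_distrib sum_subtractf sum_distrib_left sum_negf mult_minus_right) (simp add: mult_ac)
  qed
  also have "\<dots> = radial (e - 1) (\<lambda>x. of_int e * g x - x * g' x) H"
    using supp H N by (subst radial_eq_sum[where N = N]) auto
  finally show ?thesis
  proof (rule has_field_derivative_transform_within_open)
    show "open {0<..<real N}" "H \<in> {0<..<real N}" using H N by auto
  qed (use supp radial_eq_sum[of g _ N e] in auto)
qed

text \<open>With y = H / sqrt n the step of the alternating sum is s / sqrt n for s = pi / (2 y). A
  power of y of either sign, and the weight (1 + y)^2, are bounded by powers of s + 1 / s, which
  \<open>alt_sum_decay\<close> absorbs at both ends.\<close>

lemma radial_bound:
  assumes "wclass True w g"
  shows "\<exists>C\<ge>0. \<forall>\<^sub>F n in sequentially. \<forall>H>0.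
     \<bar>radial e (g n) H\<bar> \<le> C * sqrt n powi (e - w) * (1 / (1 + H / sqrt n)\<^sup>2)"
proof -
  define k where "k = nat \<bar>e\<bar>"
  obtain C where C: "C \<ge> 0" "\<forall>\<^sub>F n in sequentially. \<forall>e>0.
    \<bar>alt_sum (g n) e\<bar> * (sqrt n * e + 1 / (sqrt n * e)) ^ (k + 2) \<le> C * sqrt n powi (- w)"
    using alt_sum_decay[OF assms] by blast
  have "\<forall>\<^sub>F n in sequentially. \<forall>H>0.
     \<bar>radial e (g n) H\<bar> \<le> (9 * 2 ^ k * C) * sqrt n powi (e - w) * (1 / (1 + H / sqrt n)\<^sup>2)"
    using C(2) eventually_gt_at_top[of 0]
  proof eventually_elim
    case (elim n)
    show ?case
    proof (intro allI impI)
      fix H :: real assume H: "H > 0"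
      define s where "s = sqrt n * (pi / (2 * H))"
      define S where "S = s + 1 / s"
      define y where "y = H / sqrt n"
      have s: "s > 0" using H elim(2) by (simp add: s_def)
      have y: "y > 0" using H elim(2) by (simp add: y_def)
      have ys: "y = pi / 2 / s" using H elim(2) by (simp add: y_def s_def)
      have Hy: "H = sqrt n * y" using elim(2) by (simp add: y_def)
      have "1 / s > 0" using s by simp
      then have S: "S > 0" "s \<le> S" "1 / s \<le> S" using s unfolding S_def by linarith+
      have "S \<ge> 1"
      proof (cases "s \<ge> 1")
        case False
        then have "1 / s \<ge> 1" using s by simp
        then show ?thesis using S by linarith
      qed (use S in linarith)
      have "pi / 2 / s \<le> 2 / s" using s pi_less_4 by (intro divide_right_mono) auto
      also have "2 / s = 2 * (1 / s)" by simp
      finally have y1: "y \<le> 2 * S" using S ys by linarith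
      have "1 / y = s * (2 / pi)" using s by (simp add: ys)
      also have "\<dots> \<le> s * 1" using s pi_gt3 by (intro mult_left_mono) auto
      finally have y2: "1 / y \<le> 2 * S" using S by linarith
      have ye: "y powi e \<le> (2 * S) ^ k"
      proof (cases "e \<ge> 0")
        case True
        then have "y powi e = y ^ k" by (simp add: k_def power_int_def)
        then show ?thesis using y y1 by (simp only:) (intro power_mono; simp)
      next
        case False
        then have "y powi e = (1 / y) ^ k" by (simp add: k_def power_int_def field_simps)
        then show ?thesis using y y2 by (simp only:) (intro power_mono; simp)
      qed
      have y3: "(1 + y)\<^sup>2 \<le> (3 * S)\<^sup>2" using y y1 \<open>S \<ge> 1\<close> by (intro power_mono) auto
      have "\<bar>radial e (g n) H\<bar> * (1 + y)\<^sup>2 = sqrt n powi e * (y powi e * (1 + y)\<^sup>2 * \<bar>alt_sum (g n) (pi / (2 * H))\<bar>)"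
        using H y by (simp add: radial_def abs_mult Hy power_int_mult_distrib)
      also have "\<dots> \<le> sqrt n powi e * ((2 * S) ^ k * (3 * S)\<^sup>2 * \<bar>alt_sum (g n) (pi / (2 * H))\<bar>)"
        using ye y3 y S by (intro mult_left_mono mult_right_mono mult_mono) auto
      also have "\<dots> = (9 * 2 ^ k) * sqrt n powi e * (\<bar>alt_sum (g n) (pi / (2 * H))\<bar> * S ^ (k + 2))"
        by (simp add: power_mult_distrib power_add power2_eq_square)
      also have "\<dots> \<le> (9 * 2 ^ k) * sqrt n powi e * (C * sqrt n powi (- w))"
      proof (intro mult_left_mono)
        show "\<bar>alt_sum (g n) (pi / (2 * H))\<bar> * S ^ (k + 2) \<le> C * sqrt n powi (- w)"
          using elim(1)[rule_format, of "pi / (2 * H)"] H unfolding S_def s_def by simp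
      qed auto
      also have "\<dots> = (9 * 2 ^ k * C) * (sqrt n powi e * sqrt n powi (- w))" by (simp only: mult_ac)
      also have "sqrt n powi e * sqrt n powi (- w) = sqrt n powi (e - w)"
        using elim(2) power_int_add[of "sqrt n" e "- w"] by simp
      finally show "\<bar>radial e (g n) H\<bar> \<le> (9 * 2 ^ k * C) * sqrt n powi (e - w) * (1 / (1 + H / sqrt n)\<^sup>2)"
        using y by (simp add: pos_le_divide_eq flip: y_def)
    qed
  qed
  moreover have "9 * 2 ^ k * C \<ge> 0" using C by simp
  ultimately show ?thesis by blast
qed

lemma radial_tendsto_0:
  assumes "wclass True w g"
  shows "\<forall>\<^sub>F n in sequentially. (radial e (g n) \<longlongrightarrow> 0) at_top"
proof -
  obtain C where "C \<ge> 0" and C: "\<forall>\<^sub>F n in sequentially. \<forall>H>0.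
     \<bar>radial e (g n) H\<bar> \<le> C * sqrt n powi (e - w) * (1 / (1 + H / sqrt n)\<^sup>2)"
    using radial_bound[OF assms] by blast
  from C eventually_gt_at_top[of 0] show ?thesis
  proof eventually_elim
    case (elim n)
    have r: "sqrt n > 0" using elim by simp
    show ?case
    proof (rule Lim_null_comparison)
      show "\<forall>\<^sub>F H in at_top. norm (radial e (g n) H) \<le> C * sqrt n powi (e - w) * (1 / (1 + H / sqrt n)\<^sup>2)"
        using eventually_gt_at_top[of "0::real"] by eventually_elim (use elim in auto)
      have "((\<lambda>H. 1 / (1 + H / sqrt n)\<^sup>2) \<longlongrightarrow> 0) at_top" using r by real_asymp
      then show "((\<lambda>H. C * sqrt n powi (e - w) * (1 / (1 + H / sqrt n)\<^sup>2)) \<longlongrightarrow> 0) at_top"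
        by (intro tendsto_mult_right_zero)
    qed
  qed
qed

text \<open>Each derivative in H lowers the exponent by one and keeps the weight of the kernel, so K
  of them gain sqrt n to the power K; the + 1 in the exponent is the number of terms, of order sqrt
  n. The functions vanish at 0 and at infinity, so among the boundary differences only that of the
  primitive survives. \<open>J\<close>, \<open>l\<close>, \<open>t\<close> and \<open>A\<close> are
  quantified after n, with C uniform, because they depend on n in the applications.\<close>

theorem radial_sum_asymptotics:
  assumes "wclass True w g"
  shows "\<exists>C\<ge>0. \<forall>\<^sub>F n in sequentially. \<forall>J l t A.
     (\<forall>x\<ge>0. (J has_real_derivative radial e (g n) x) (at x)) \<longrightarrow> J 0 = 0 \<longrightarrow> (J \<longlongrightarrow> l) at_top \<longrightarrow>
     0 \<le> t \<longrightarrow> t \<le> 2 \<longrightarrow> (\<lambda>m. \<Sum>k<m. radial e (g n) (t + real k * 2)) \<longlonglongrightarrow> A \<longrightarrow>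
     \<bar>A - l / 2\<bar> \<le> C * sqrt n powi (e - w + 1 - int K)"
proof -
  have "\<exists>G. \<forall>i. (wclass True w (G i) \<and> (i = 0 \<longrightarrow> G i = g)) \<and>
    (\<forall>\<^sub>F n in sequentially. \<forall>x. (radial (e - int i) (G i n) has_real_derivative radial (e - int (Suc i)) (G (Suc i) n) x) (at x))"
  proof (rule dependent_nat_choice)
    show "\<exists>x. wclass True w x \<and> (0 = (0::nat) \<longrightarrow> x = g)" using assms by auto
    fix f :: "nat \<Rightarrow> real \<Rightarrow> real" and i :: nat
    assume f: "wclass True w f \<and> (i = 0 \<longrightarrow> f = g)"
    then obtain f' where f': "wclass (\<not> True) (w - 1) f'"
      "\<forall>\<^sub>F n in sequentially. \<forall>t. (f n has_real_derivative f' n t) (at t)"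
      using wclass_deriv by blast
    define q where "q n x = of_int (e - int i) * f n x - x * f' n x" for n x
    \<comment> \<open>The derivative loses one unit of weight and the factor x regains it; the
      parity is restored in the same way.\<close>
    have "wclass True w (\<lambda>n x. x * f' n x)" using wclass_times_x[OF f'(1)] by simp
    then have "wclass True w q"
      unfolding q_def using f by (intro wclass_diff wclass_scale) auto
    moreover have "\<forall>\<^sub>F n in sequentially. \<forall>x.
      (radial (e - int i) (f n) has_real_derivative radial (e - int (Suc i)) (q n) x) (at x)"
      using f'(2) wclass_support[OF conjunct1[OF f]] wclass_support[OF f'(1)]
    proof eventually_elim
      case (elim n)
      have "e - int i - 1 = e - int (Suc i)" by simp
      moreover have "\<forall>x. (radial (e - int i) (f n) has_real_derivative radial (e - int i - 1) (q n) x) (at x)"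
        unfolding q_def using elim by (intro allI DERIV_radial) auto
      ultimately show ?case by (simp only: simp_thms)
    qed
    ultimately show "\<exists>y. (wclass True w y \<and> (Suc i = 0 \<longrightarrow> y = g)) \<and> (\<forall>\<^sub>F n in sequentially. \<forall>x.
      (radial (e - int i) (f n) has_real_derivative radial (e - int (Suc i)) (y n) x) (at x))"
      by (intro exI[of _ q]) auto
  qed
  then obtain G where G0: "G 0 = g" and G: "\<And>i. wclass True w (G i)"
    and DG: "\<And>i. \<forall>\<^sub>F n in sequentially. \<forall>x. (radial (e - int i) (G i n) has_real_derivative radial (e - int (Suc i)) (G (Suc i) n) x) (at x)"
    by auto
  obtain C where C: "C \<ge> 0" "\<forall>\<^sub>F n in sequentially. \<forall>H>0.
     \<bar>radial (e - int K) (G K n) H\<bar> \<le> C * sqrt n powi (e - int K - w) * (1 / (1 + H / sqrt n)\<^sup>2)"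
    using radial_bound[OF G] by blast
  have DG': "\<forall>\<^sub>F n in sequentially. \<forall>i\<in>{..K}. \<forall>x.
      (radial (e - int i) (G i n) has_real_derivative radial (e - int (Suc i)) (G (Suc i) n) x) (at x)"
    using DG by (intro eventually_ball_finite) auto
  have lim0: "\<forall>\<^sub>F n in sequentially. \<forall>i\<in>{..K}. (radial (e - int i) (G i n) \<longlongrightarrow> 0) at_top"
    using radial_tendsto_0[OF G] by (intro eventually_ball_finite) auto
  show ?thesis
  proof (intro exI conjI)
    show "2 ^ K * (4 * C) \<ge> 0" using C by simp
    show "\<forall>\<^sub>F n in sequentially. \<forall>J l t A.
     (\<forall>x\<ge>0. (J has_real_derivative radial e (g n) x) (at x)) \<longrightarrow> J 0 = 0 \<longrightarrow> (J \<longlongrightarrow> l) at_top \<longrightarrow>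
     0 \<le> t \<longrightarrow> t \<le> 2 \<longrightarrow> (\<lambda>m. \<Sum>k<m. radial e (g n) (t + real k * 2)) \<longlonglongrightarrow> A \<longrightarrow>
     \<bar>A - l / 2\<bar> \<le> 2 ^ K * (4 * C) * sqrt n powi (e - w + 1 - int K)"
      using C(2) DG' lim0 eventually_gt_at_top[of 0]
    proof eventually_elim
      case (elim n)
      show ?case
      proof (intro allI impI)
        fix J l t A
        assume J: "\<forall>x\<ge>0. (J has_real_derivative radial e (g n) x) (at x)" "J 0 = 0" "(J \<longlongrightarrow> l) at_top"
          and t: "0 \<le> t" "t \<le> 2" and A: "(\<lambda>m. \<Sum>k<m. radial e (g n) (t + real k * 2)) \<longlonglongrightarrow> A"
        define h where "h i = (case i of 0 \<Rightarrow> J | Suc j \<Rightarrow> radial (e - int j) (G j n))" for i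
        have h1: "h 1 = radial e (g n)" by (simp add: h_def G0)
        define W where "W = sqrt n powi (e - int K - w)"
        have W: "W > 0" using elim(4) by (simp add: W_def)
        have r: "sqrt n \<ge> 1" using elim(4) by simp
        define B where "B = C * W * (2 * sqrt n)"
        have hB: "\<bar>\<Sum>k<m. h (Suc K) (y + real k * 2)\<bar> \<le> B" if y: "0 \<le> y" "y \<le> 2" for y m
        proof -
          have "\<bar>h (Suc K) (y + real k * 2)\<bar> \<le> C * W * (1 / (1 + 2 / sqrt n * real k)\<^sup>2)" for k
          proof (cases "y + real k * 2 > 0")
            case True
            then have "\<bar>h (Suc K) (y + real k * 2)\<bar> \<le> C * W * (1 / (1 + (y + real k * 2) / sqrt n)\<^sup>2)"
              using elim(1) by (auto simp: h_def W_def)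
            also have "\<dots> \<le> C * W * (1 / (1 + 2 / sqrt n * real k)\<^sup>2)"
            proof (intro mult_left_mono divide_left_mono power_mono add_left_mono)
              show "2 / sqrt n * real k \<le> (y + real k * 2) / sqrt n"
                using y r by (simp add: divide_right_mono mult.commute)
            qed (use C W r y in \<open>auto intro!: mult_pos_pos add_pos_nonneg zero_less_power simp: add_nonneg_nonneg\<close>)
            finally show ?thesis .
          next
            case False
            then show ?thesis using C W by (simp add: h_def radial_def)
          qed
          then have "\<bar>\<Sum>k<m. h (Suc K) (y + real k * 2)\<bar> \<le> (\<Sum>k<m. C * W * (1 / (1 + 2 / sqrt n * real k)\<^sup>2))"
            by (intro order_trans[OF sum_abs] sum_mono)
          also have "\<dots> = C * W * (\<Sum>k<m. 1 / (1 + 2 / sqrt n * real k)\<^sup>2)" by (rule sum_distrib_left[symmetric])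
          also have "\<dots> \<le> C * W * (1 + 1 / (2 / sqrt n))"
            using C W r by (intro mult_left_mono sum_inverse_squares_le) auto
          also have "\<dots> \<le> B"
          proof -
            have "1 / (2 / sqrt n) = sqrt n / 2" by simp
            then have "1 + 1 / (2 / sqrt n) \<le> 2 * sqrt n" using r by linarith
            then show ?thesis unfolding B_def using C W by (intro mult_left_mono) auto
          qed
          finally show ?thesis .
        qed
        have bound: "\<bar>(\<Sum>k<m. h 1 (t + real k * 2)) - (h 0 (real m * 2) - h 0 0) / 2\<bar>
          \<le> 2 ^ K * (2 * B) + (\<Sum>j<K. 2 ^ j * \<bar>h (Suc j) (real m * 2) - h (Suc j) 0\<bar>)" for m
        proof (rule periodization_mean_bound)
          fix i and x :: real assume "i \<le> K" "x \<ge> 0"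
          then show "(h i has_real_derivative h (Suc i) x) (at x)"
            using J(1) elim(2) by (cases i) (auto simp: h_def G0 simp del: of_nat_Suc)
        qed (use hB t in auto)
        have top: "filterlim (\<lambda>m. real m * 2) at_top sequentially" by real_asymp
        have "(\<lambda>m. \<bar>(\<Sum>k<m. h 1 (t + real k * 2)) - (h 0 (real m * 2) - h 0 0) / 2\<bar>) \<longlonglongrightarrow> \<bar>A - (l - h 0 0) / 2\<bar>"
          using A J(3) by (intro tendsto_intros) (auto simp: h_def G0 intro: filterlim_compose[OF _ top])
        moreover have "(\<lambda>m. 2 ^ K * (2 * B) + (\<Sum>j<K. 2 ^ j * \<bar>h (Suc j) (real m * 2) - h (Suc j) 0\<bar>)) \<longlonglongrightarrow>
            2 ^ K * (2 * B) + (\<Sum>j<K. 2 ^ j * \<bar>0 - 0\<bar>)"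
        proof (intro tendsto_intros)
          fix j assume "j \<in> {..<K}"
          then have "(radial (e - int j) (G j n) \<longlongrightarrow> 0) at_top" using elim(3) by auto
          then show "(\<lambda>m. h (Suc j) (real m * 2)) \<longlonglongrightarrow> 0"
            using filterlim_compose[OF _ top] by (auto simp: h_def)
          show "(\<lambda>m. h (Suc j) 0) \<longlonglongrightarrow> 0" by (simp add: h_def radial_def)
        qed
        ultimately have "\<bar>A - (l - h 0 0) / 2\<bar> \<le> 2 ^ K * (2 * B) + (\<Sum>j<K. 2 ^ j * \<bar>0 - 0\<bar>)"
          using bound by (intro LIMSEQ_le) auto
        then have "\<bar>A - l / 2\<bar> \<le> 2 ^ K * (4 * C) * (W * sqrt n)" by (simp add: h_def J(2) B_def mult_ac)
        also have "W * sqrt n = sqrt n powi (e - w + 1 - int K)"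
        proof -
          have "e - w + 1 - int K = (e - int K - w) + 1" by simp
          then show ?thesis unfolding W_def using elim(4) power_int_add_1[of "sqrt n" "e - int K - w"] by (simp only:) simp
        qed
        finally show "\<bar>A - l / 2\<bar> \<le> 2 ^ K * (4 * C) * sqrt n powi (e - w + 1 - int K)" .
      qed
    qed
  qed
qed

section \<open>Alternating sums at small scale\<close>

primrec smooth :: "nat \<Rightarrow> (real \<Rightarrow> real) \<Rightarrow> bool" where
  "smooth 0 f \<longleftrightarrow> continuous_on UNIV f"
| "smooth (Suc k) f \<longleftrightarrow> (\<exists>f'. (\<forall>x. (f has_real_derivative f' x) (at x)) \<and> smooth k f')"

lemma smooth_SucI: "(\<And>x. (f has_real_derivative f' x) (at x)) \<Longrightarrow> smooth k f' \<Longrightarrow> smooth (Suc k) f"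
  by auto

lemma continuous_of_DERIV:
  "(\<And>x. (f has_real_derivative f' x) (at x)) \<Longrightarrow> continuous_on UNIV f"
  by (intro continuous_at_imp_continuous_on ballI) (rule DERIV_isCont)

lemma smooth_Suc_imp: "smooth (Suc k) f \<Longrightarrow> smooth k f"
proof (induction k arbitrary: f)
  case 0
  then show ?case using continuous_of_DERIV by auto
next
  case (Suc k)
  from Suc.prems obtain f' where "\<forall>x. (f has_real_derivative f' x) (at x)" "smooth (Suc k) f'" by auto
  then show ?case using Suc.IH[of f'] by auto
qed

lemma smooth_mono: "smooth m f \<Longrightarrow> k \<le> m \<Longrightarrow> smooth k f"
proof (induction m)
  case (Suc m)
  then show ?case using smooth_Suc_imp[OF Suc.prems(1)] by (cases "k = Suc m") auto
qed auto

lemma smooth_imp_continuous: "smooth k f \<Longrightarrow> continuous_on UNIV f"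
  using smooth_mono[of k f 0] by simp

lemma smooth_const [simp]: "smooth k (\<lambda>x. c)"
  by (induction k arbitrary: c) (auto intro!: exI[of _ "\<lambda>x. 0"])

lemma smooth_id [simp]: "smooth k (\<lambda>x. x)"
  by (cases k) (auto intro!: exI[of _ "\<lambda>x. 1"])

lemma smooth_add: "smooth k f \<Longrightarrow> smooth k g \<Longrightarrow> smooth k (\<lambda>x. f x + g x)"
proof (induction k arbitrary: f g)
  case (Suc k)
  from Suc.prems obtain f' g' where d: "\<And>x. (f has_real_derivative f' x) (at x)" "smooth k f'"
    "\<And>x. (g has_real_derivative g' x) (at x)" "smooth k g'" by auto
  from DERIV_add[OF d(1,3)] Suc.IH[OF d(2,4)] show ?case by (rule smooth_SucI)
qed (auto intro: continuous_on_add)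

lemma smooth_mult: "smooth k f \<Longrightarrow> smooth k g \<Longrightarrow> smooth k (\<lambda>x. f x * g x)"
proof (induction k arbitrary: f g)
  case (Suc k)
  from Suc.prems obtain f' g' where d: "\<And>x. (f has_real_derivative f' x) (at x)" "smooth k f'"
    "\<And>x. (g has_real_derivative g' x) (at x)" "smooth k g'" by auto
  have "smooth k (\<lambda>x. f x * g' x + f' x * g x)"
    using Suc.prems d Suc.IH smooth_Suc_imp by (intro smooth_add) blast+
  with DERIV_mult'[OF d(1,3)] show ?case by (rule smooth_SucI)
qed (auto intro: continuous_on_mult)

lemma smooth_diff: "smooth k f \<Longrightarrow> smooth k g \<Longrightarrow> smooth k (\<lambda>x. f x - g x)"
  using smooth_add[of k f "\<lambda>x. -1 * g x"] smooth_mult[of k "\<lambda>x. -1" g] by simp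

lemma smooth_sin_cos: "smooth k (\<lambda>x. a * sin x + b * cos x)"
proof (induction k arbitrary: a b)
  case (Suc k)
  show ?case
  proof (rule smooth_SucI)
    show "((\<lambda>x. a * sin x + b * cos x) has_real_derivative (- b) * sin x + a * cos x) (at x)" for x
      by (auto intro!: derivative_eq_intros)
  qed (rule Suc.IH)
qed (auto intro!: continuous_intros)

lemma smooth_sin: "smooth k sin"
  using smooth_sin_cos[of k 1 0] by simp

lemma smooth_cos_cut_power: "m \<ge> k + 2 \<Longrightarrow> smooth k (\<lambda>x. cos_cut x ^ m)"
proof (induction k arbitrary: m)
  case 0
  then show ?case using continuous_of_DERIV[OF DERIV_cos_cut_power] by simp
next
  case (Suc k)
  show ?case
  proof (rule smooth_SucI)
    show "((\<lambda>x. cos_cut x ^ m) has_real_derivative (- real m) * (sin x * cos_cut x ^ (m - 1))) (at x)" for x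
      using DERIV_cos_cut_power[of m x] Suc.prems by (simp add: mult.assoc)
    show "smooth k (\<lambda>x. (- real m) * (sin x * cos_cut x ^ (m - 1)))"
      using Suc by (intro smooth_mult smooth_const smooth_sin) auto
  qed
qed

text \<open>The derivatives of \<open>sin x / x\<close>, written as moments of the cosine so that the origin needs
  no special treatment.\<close>

definition sinc_deriv :: "nat \<Rightarrow> real \<Rightarrow> real" where
  "sinc_deriv i x = integral {0..1} (\<lambda>t. t ^ i * cos (x * t + real i * pi / 2))"

lemma DERIV_sinc_deriv: "(sinc_deriv i has_real_derivative sinc_deriv (Suc i) x) (at x)"
proof -
  have "((\<lambda>x. integral (cbox 0 1) (\<lambda>t. t ^ i * cos (x * t + real i * pi / 2))) has_field_derivative
      integral (cbox 0 1) (\<lambda>t. t ^ Suc i * cos (x * t + real (Suc i) * pi / 2))) (at x within UNIV)"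
  proof (rule leibniz_rule_field_derivative)
    fix x t :: real
    have e: "x * t + real (Suc i) * pi / 2 = (x * t + real i * pi / 2) + pi / 2" by (simp add: field_simps)
    have c: "cos (x * t + real (Suc i) * pi / 2) = - sin (x * t + real i * pi / 2)"
      unfolding e using cos_add[of "x * t + real i * pi / 2" "pi / 2"] by simp
    show "((\<lambda>x. t ^ i * cos (x * t + real i * pi / 2)) has_field_derivative
        t ^ Suc i * cos (x * t + real (Suc i) * pi / 2)) (at x within UNIV)"
      unfolding c by (auto intro!: derivative_eq_intros)
  next
    fix x :: real
    show "(\<lambda>t. t ^ i * cos (x * t + real i * pi / 2)) integrable_on cbox 0 1"
      by (intro integrable_continuous continuous_intros)
    show "continuous_on (UNIV \<times> cbox 0 1) (\<lambda>(x, t). t ^ Suc i * cos (x * t + real (Suc i) * pi / 2))"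
      unfolding split_beta by (intro continuous_intros)
  qed auto
  then show ?thesis by (simp add: sinc_deriv_def[abs_def])
qed

lemma smooth_sinc_deriv: "smooth k (sinc_deriv i)"
proof (induction k arbitrary: i)
  case 0
  show ?case using continuous_of_DERIV[OF DERIV_sinc_deriv] by simp
next
  case (Suc k)
  from DERIV_sinc_deriv Suc show ?case by (rule smooth_SucI)
qed


lemma x_times_sinc: "x * sinc_deriv 0 x = sin x"
proof (cases "x = 0")
  case False
  have "((\<lambda>t. cos (x * t)) has_integral (sin (x * 1) / x - sin (x * 0) / x)) {0..1}"
    using False by (intro fundamental_theorem_of_calculus)
      (auto intro!: derivative_eq_intros simp: has_real_derivative_iff_has_vector_derivative[symmetric])
  then have "integral {0..1} (\<lambda>t. cos (x * t)) = sin x / x" by (simp add: integral_unique)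
  then show ?thesis using False by (simp add: sinc_deriv_def)
qed simp

text \<open>\<open>F\<close> is the integral of \<omega> from x to infinity. An integral over
  \<open>{-2..x}\<close> is differentiable only to the right of -2; since -2 lies left of the
  support, the function continues as a constant.\<close>

lemma tail_antiderivative:
  assumes c: "continuous_on UNIV \<omega>" and supp: "\<And>x. \<bar>x\<bar> \<ge> pi / 2 \<Longrightarrow> \<omega> x = 0"
  obtains F where "\<And>x. (F has_real_derivative - \<omega> x) (at x)"
    "\<And>x. x \<ge> pi / 2 \<Longrightarrow> F x = 0" "F 0 = integral {0..pi / 2} \<omega>"
proof -
  define Q where "Q x = integral {-2..x} \<omega>" for x
  define F where "F x = (if x > -2 then Q (pi / 2) - Q x else Q (pi / 2))" for x
  have int: "\<omega> integrable_on {a..b}" for a b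
    by (intro integrable_continuous_interval continuous_on_subset[OF c]) auto
  have zero: "integral {a..b} \<omega> = 0" if "\<And>x. a \<le> x \<Longrightarrow> x \<le> b \<Longrightarrow> \<omega> x = 0" for a b
    using integral_cong[of "{a..b}" \<omega> "\<lambda>_. 0"] that by auto
  have "pi / 2 < 2" using pi_less_4 by simp
  have dQ: "((\<lambda>x. Q (pi / 2) - Q x) has_real_derivative - \<omega> x) (at x)" if "x > -2" for x
    using DERIV_diff[OF DERIV_const DERIV_integral_lower[OF c that]] by (simp add: Q_def[abs_def])
  have "(F has_real_derivative - \<omega> x) (at x)" for x
  proof (cases "x > -2")
    case True
    from dQ[OF this] show ?thesis
    proof (rule has_field_derivative_transform_within_open)
      show "open {- 2 :: real<..}" "x \<in> {- 2<..}" using True by auto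
    qed (auto simp: F_def)
  next
    case False
    have "((\<lambda>_. Q (pi / 2)) has_real_derivative - \<omega> x) (at x)"
      using False supp \<open>pi / 2 < 2\<close> by simp
    then show ?thesis
    proof (rule has_field_derivative_transform_within_open)
      show "open {..<- (pi / 2)}" "x \<in> {..<- (pi / 2)}" using False \<open>pi / 2 < 2\<close> by auto
      fix y assume "y \<in> {..<- (pi / 2)}"
      then have "Q y = 0" unfolding Q_def by (intro zero supp) auto
      then show "Q (pi / 2) = F y" by (simp add: F_def)
    qed
  qed
  moreover have "F x = 0" if "x \<ge> pi / 2" for x
  proof -
    have "Q (pi / 2) + integral {pi / 2..x} \<omega> = Q x"
      unfolding Q_def using that pi_gt_zero by (intro Henstock_Kurzweil_Integration.integral_combine int) linarith+
    moreover have "integral {pi / 2..x} \<omega> = 0" by (intro zero supp) auto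
    moreover have "x > -2" using that pi_gt_zero by linarith
    ultimately show ?thesis by (simp add: F_def)
  qed
  moreover have "F 0 = integral {0..pi / 2} \<omega>"
  proof -
    have "Q 0 + integral {0..pi / 2} \<omega> = Q (pi / 2)"
      unfolding Q_def by (intro Henstock_Kurzweil_Integration.integral_combine int) auto
    then show ?thesis by (simp add: F_def)
  qed
  ultimately show ?thesis using that by blast
qed

section \<open>Boole summation to second order\<close>

text \<open>With D for differentiation, the average over c - e and c + e is the operator cosh (e D),
  and multiplying it by 1 - e^2 D^2 / 2 inverts it up to fourth order. The Taylor remainders total
  at most (1/4 + 1/24) M e^4.\<close>

lemma symmetric_average_bounds:
  fixes D :: "nat \<Rightarrow> real \<Rightarrow> real"
  assumes D: "\<And>i x. i < 4 \<Longrightarrow> (D i has_real_derivative D (Suc i) x) (at x)"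
    and M: "\<And>x. c - e \<le> x \<Longrightarrow> \<bar>D 4 x\<bar> \<le> M" and e: "e > 0"
  shows "\<bar>D 0 c - ((D 0 (c - e) + D 0 (c + e)) / 2 - e\<^sup>2 / 4 * (D 2 (c - e) + D 2 (c + e)))\<bar> \<le> M * e ^ 4"
proof -
  obtain t1 where t1: "c < t1" "D 0 (c + e) = (\<Sum>m<4. D m c / fact m * (c + e - c) ^ m) + D 4 t1 / fact 4 * (c + e - c) ^ 4"
    using Taylor_up[of 4 D "D 0" c "c + e" c] D e by auto
  obtain t2 where t2: "c - e < t2" "D 0 (c - e) = (\<Sum>m<4. D m c / fact m * (c - e - c) ^ m) + D 4 t2 / fact 4 * (c - e - c) ^ 4"
    using Taylor_down[of 4 D "D 0" "c - e" c c] D e by auto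
  obtain t3 where t3: "c < t3" "D 2 (c + e) = (\<Sum>m<2. D (m + 2) c / fact m * (c + e - c) ^ m) + D (2 + 2) t3 / fact 2 * (c + e - c) ^ 2"
    using Taylor_up[of 2 "\<lambda>m. D (m + 2)" "D 2" c "c + e" c] D e by (auto simp: numeral_2_eq_2)
  obtain t4 where t4: "c - e < t4" "D 2 (c - e) = (\<Sum>m<2. D (m + 2) c / fact m * (c - e - c) ^ m) + D (2 + 2) t4 / fact 2 * (c - e - c) ^ 2"
    using Taylor_down[of 2 "\<lambda>m. D (m + 2)" "D 2" "c - e" c c] D e by (auto simp: numeral_2_eq_2)
  have f4: "fact 3 = (6 :: real)" "fact 4 = (24 :: real)" by (simp_all add: fact_numeral)
  have e1: "D 0 (c + e) = D 0 c + D 1 c * e + D 2 c / 2 * e\<^sup>2 + D 3 c / 6 * e ^ 3 + D 4 t1 / 24 * e ^ 4"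
    using t1(2) by (simp add: eval_nat_numeral f4[simplified eval_nat_numeral])
  have e2: "D 0 (c - e) = D 0 c - D 1 c * e + D 2 c / 2 * e\<^sup>2 - D 3 c / 6 * e ^ 3 + D 4 t2 / 24 * e ^ 4"
    using t2(2) by (simp add: eval_nat_numeral f4[simplified eval_nat_numeral])
  have e3: "D 2 (c + e) = D 2 c + D 3 c * e + D 4 t3 / 2 * e\<^sup>2"
    using t3(2) by (simp add: eval_nat_numeral)
  have e4: "D 2 (c - e) = D 2 c - D 3 c * e + D 4 t4 / 2 * e\<^sup>2"
    using t4(2) by (simp add: eval_nat_numeral)
  have "D 0 c - ((D 0 (c - e) + D 0 (c + e)) / 2 - e\<^sup>2 / 4 * (D 2 (c - e) + D 2 (c + e)))
    = e ^ 4 * ((D 4 t3 + D 4 t4) / 8 - (D 4 t1 + D 4 t2) / 48)"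
    unfolding e1 e2 e3 e4 by (simp add: field_simps power2_eq_square power4_eq_xxxx power3_eq_cube)
  also have "\<bar>\<dots>\<bar> = e ^ 4 * \<bar>(D 4 t3 + D 4 t4) / 8 - (D 4 t1 + D 4 t2) / 48\<bar>" using e by (simp add: abs_mult)
  also have "\<dots> \<le> e ^ 4 * M"
  proof (intro mult_left_mono)
    have aux: "\<bar>(a3 + a4) / 8 - (a1 + a2) / 48\<bar> \<le> M"
      if "\<bar>a1\<bar> \<le> M" "\<bar>a2\<bar> \<le> M" "\<bar>a3\<bar> \<le> M" "\<bar>a4\<bar> \<le> M" for a1 a2 a3 a4 :: real
    proof -
      have "\<bar>a3 + a4\<bar> \<le> 2 * M" "\<bar>a1 + a2\<bar> \<le> 2 * M" "0 \<le> M"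
        using that abs_triangle_ineq[of a3 a4] abs_triangle_ineq[of a1 a2] abs_ge_zero[of a1] by linarith+
      note m = this
      have "\<bar>(a3 + a4) / 8 - (a1 + a2) / 48\<bar> \<le> \<bar>a3 + a4\<bar> / 8 + \<bar>a1 + a2\<bar> / 48"
        using abs_triangle_ineq4[of "(a3 + a4) / 8" "(a1 + a2) / 48"] by simp
      also have "\<dots> \<le> 2 * M / 8 + 2 * M / 48" by (intro add_mono divide_right_mono m) auto
      also have "\<dots> \<le> M" using m(3) by simp
      finally show ?thesis .
    qed
    show "\<bar>(D 4 t3 + D 4 t4) / 8 - (D 4 t1 + D 4 t2) / 48\<bar> \<le> M"
      using t1 t2 t3 t4 e by (intro aux M) auto
  qed (use e in auto)
  finally show ?thesis by (simp add: mult.commute)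
qed

lemma DERIV_zero_beyond:
  fixes f :: "real \<Rightarrow> real"
  assumes "\<And>x. x \<ge> c \<Longrightarrow> f x = 0" "(f has_real_derivative d) (at x)" "x > c"
  shows "d = 0"
proof -
  have "((\<lambda>_. 0) has_real_derivative d) (at x)"
    using assms(2)
  proof (rule has_field_derivative_transform_within_open)
    show "open {c<..}" "x \<in> {c<..}" using assms by auto
  qed (use assms(1) in auto)
  then show ?thesis using DERIV_unique[of "\<lambda>_. 0" d x 0] by simp
qed

lemma alternating_average_telescope:
  fixes a :: "nat \<Rightarrow> real"
  shows "(\<Sum>k<N. (-1) ^ k * (a k + a (Suc k))) = a 0 - (-1) ^ N * a N"
  by (induction N) (auto simp: algebra_simps)

text \<open>Each value at an odd multiple of e is expressed through the even multiples on both
  sides. With alternating signs these contributions telescope to the one at 0. There are about 3 / e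
  points in the support and each costs e^4, which leaves an error of order e^3.\<close>

lemma alt_sum_expansion:
  assumes D: "\<And>i x. i < 4 \<Longrightarrow> (D i has_real_derivative D (Suc i) x) (at x)"
    and cont: "continuous_on UNIV (D 4)" and supp: "\<And>x. x \<ge> pi / 2 \<Longrightarrow> D 0 x = 0"
  shows "\<exists>B. \<forall>e>0. e < 1 \<longrightarrow> \<bar>alt_sum (D 0) e - (D 0 0 / 2 - e\<^sup>2 / 4 * D 2 0)\<bar> \<le> B * e ^ 3"
proof -
  \<comment> \<open>The support ends before 2. One unit is given away per derivative, because a
    derivative is known to vanish only strictly beyond the point from which the function
    does.\<close>
  have vanish: "D i x = 0" if "i \<le> 4" "x \<ge> 2 + real i" for i x
    using that
  proof (induction i arbitrary: x)
    case 0
    then show ?case using supp pi_less_4 by auto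
  next
    case (Suc i)
    have "(D i has_real_derivative D (Suc i) x) (at x)" using D Suc by auto
    moreover have "D i y = 0" if "y \<ge> 2 + real i" for y using Suc.IH[of y] Suc.prems that by simp
    moreover have "x > 2 + real i" using Suc.prems by simp
    ultimately show ?case using DERIV_zero_beyond[of "2 + real i" "D i"] by blast
  qed
  have "compact (D 4 ` {0..6})" by (intro compact_continuous_image continuous_on_subset[OF cont]) auto
  then obtain M0 where "\<forall>y\<in>D 4 ` {0..6}. norm y \<le> M0"
    using compact_imp_bounded bounded_iff by blast
  then have M0: "\<bar>D 4 x\<bar> \<le> M0" if "x \<in> {0..6}" for x using that by auto
  define M where "M = max M0 0"
  have M: "\<bar>D 4 x\<bar> \<le> M" if "x \<ge> 0" for x
    using M0[of x] vanish[of 4 x] that unfolding M_def by (cases "x \<le> 6") auto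
  show ?thesis
  proof (intro exI allI impI)
    fix e :: real assume e: "e > 0" "e < 1"
    define N where "N = nat \<lceil>3 / e\<rceil>"
    have N: "real N \<ge> 3 / e" "real N \<le> 3 / e + 1" using e by (auto simp: N_def)
    then have Ne: "real N * e \<ge> 3" "real N * e \<le> 4" using e by (auto simp: field_simps)
    define a where "a k = D 0 (2 * real k * e) / 2 - e\<^sup>2 / 4 * D 2 (2 * real k * e)" for k
    have "2 * real N * e = 2 * (real N * e)" by simp
    then have q: "2 * real N * e \<ge> 4" using Ne by linarith
    have "D 0 (2 * real N * e) = 0" "D 2 (2 * real N * e) = 0" by (rule vanish; use q in linarith)+
    then have aN: "a N = 0" by (simp add: a_def)
    have "pi / 2 \<le> (2 * real N + 1) * e" using Ne e pi_less_4 by (simp add: algebra_simps)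
    then have "alt_sum (D 0) e = (\<Sum>k<N. (-1) ^ k * D 0 ((2 * real k + 1) * e))"
      using e supp by (intro alt_sum_finite[of "pi / 2"]) auto
    moreover have "(\<Sum>k<N. (-1) ^ k * (a k + a (Suc k))) = a 0"
      by (simp add: alternating_average_telescope aN)
    ultimately have "alt_sum (D 0) e - a 0 = (\<Sum>k<N. (-1) ^ k * (D 0 ((2 * real k + 1) * e) - (a k + a (Suc k))))"
      by (simp add: right_diff_distrib sum_subtractf)
    also have "\<bar>\<dots>\<bar> \<le> (\<Sum>k<N. M * e ^ 4)"
    proof (intro order_trans[OF sum_abs] sum_mono)
      fix k
      let ?c = "(2 * real k + 1) * e"
      have "\<bar>D 0 ?c - ((D 0 (?c - e) + D 0 (?c + e)) / 2 - e\<^sup>2 / 4 * (D 2 (?c - e) + D 2 (?c + e)))\<bar> \<le> M * e ^ 4"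
        using D e by (intro symmetric_average_bounds M) (auto simp: algebra_simps intro: order_trans[rotated])
      moreover have "(D 0 (?c - e) + D 0 (?c + e)) / 2 - e\<^sup>2 / 4 * (D 2 (?c - e) + D 2 (?c + e)) = a k + a (Suc k)"
        by (simp add: a_def algebra_simps add_divide_distrib)
      moreover have "\<bar>(-1) ^ k * X\<bar> = \<bar>X\<bar>" for X :: real by (simp add: abs_mult)
      ultimately show "\<bar>(-1) ^ k * (D 0 ?c - (a k + a (Suc k)))\<bar> \<le> M * e ^ 4"
        by (simp only:)
    qed
    also have "\<dots> = (real N * e) * (M * e ^ 3)" by (simp add: power4_eq_xxxx power3_eq_cube)
    also have "\<dots> \<le> 4 * (M * e ^ 3)" using Ne e by (intro mult_right_mono) (auto simp: M_def)
    finally have "\<bar>alt_sum (D 0) e - a 0\<bar> \<le> (4 * M) * e ^ 3" by simp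
    moreover have "a 0 = D 0 0 / 2 - e\<^sup>2 / 4 * D 2 0" by (simp add: a_def)
    ultimately show "\<bar>alt_sum (D 0) e - (D 0 0 / 2 - e\<^sup>2 / 4 * D 2 0)\<bar> \<le> (4 * M) * e ^ 3" by simp
  qed
qed

section \<open>Wallis integrals\<close>

definition sincos_int :: "nat \<Rightarrow> nat \<Rightarrow> real" where
  "sincos_int k n = integral {0..pi / 2} (\<lambda>x. sin x ^ k * cos x ^ n)"

abbreviation wallis :: "nat \<Rightarrow> real" where "wallis \<equiv> sincos_int 0"

lemma sincos_integrable: "(\<lambda>x :: real. sin x ^ k * cos x ^ n) integrable_on {0..pi / 2}"
  by (intro integrable_continuous_interval continuous_intros)

lemma sincos_int_cos2: "sincos_int k (n + 2) = sincos_int k n - sincos_int (k + 2) n"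
proof -
  have "sin x ^ k * cos x ^ (n + 2) = sin x ^ k * cos x ^ n - sin x ^ (k + 2) * cos x ^ n" for x :: real
    unfolding power_add cos_squared_eq by (simp only: right_diff_distrib left_diff_distrib mult_1_right mult_1_left mult_ac)
  then show ?thesis
    unfolding sincos_int_def by (simp only: Henstock_Kurzweil_Integration.integral_diff sincos_integrable)
qed

lemma sincos_int_rec: "real (k + n + 2) * sincos_int (k + 2) n = real (k + 1) * sincos_int k n"
proof -
  have "((\<lambda>x. real (k + 1) * (sin x ^ k * cos x ^ (n + 2)) - real (n + 1) * (sin x ^ (k + 2) * cos x ^ n))
     has_integral (sin (pi / 2) ^ (k + 1) * cos (pi / 2) ^ (n + 1) - sin 0 ^ (k + 1) * cos 0 ^ (n + 1))) {0..pi / 2}"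
  proof (rule fundamental_theorem_of_calculus)
    fix x :: real
    show "((\<lambda>x. sin x ^ (k + 1) * cos x ^ (n + 1)) has_vector_derivative
       real (k + 1) * (sin x ^ k * cos x ^ (n + 2)) - real (n + 1) * (sin x ^ (k + 2) * cos x ^ n)) (at x within {0..pi / 2})"
      unfolding has_real_derivative_iff_has_vector_derivative[symmetric]
    proof (rule has_field_derivative_at_within, rule DERIV_cong)
      show "((\<lambda>x. sin x ^ (k + 1) * cos x ^ (n + 1)) has_real_derivative
         sin x ^ (k + 1) * (real (n + 1) * cos x ^ (n + 1 - 1) * - sin x) +
         (real (k + 1) * sin x ^ (k + 1 - 1) * cos x) * cos x ^ (n + 1)) (at x)"
        by (intro DERIV_mult' DERIV_fun_pow DERIV_sin DERIV_cos)
    qed (simp add: power_add power2_eq_square algebra_simps)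
  qed simp
  then have "integral {0..pi / 2} (\<lambda>x. real (k + 1) * (sin x ^ k * cos x ^ (n + 2)) - real (n + 1) * (sin x ^ (k + 2) * cos x ^ n)) = 0"
    by (simp add: integral_unique)
  moreover have "integral {0..pi / 2} (\<lambda>x. real (k + 1) * (sin x ^ k * cos x ^ (n + 2)) - real (n + 1) * (sin x ^ (k + 2) * cos x ^ n))
     = real (k + 1) * sincos_int k (n + 2) - real (n + 1) * sincos_int (k + 2) n"
    unfolding sincos_int_def
    by (subst Henstock_Kurzweil_Integration.integral_diff)
       (simp_all only: integrable_on_mult_right sincos_integrable integral_mult_right)
  ultimately have "real (k + 1) * sincos_int k (n + 2) - real (n + 1) * sincos_int (k + 2) n = 0" by simp
  then show ?thesis unfolding sincos_int_cos2 by (simp add: algebra_simps)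
qed

lemma wallis_rec: "real (n + 2) * wallis (n + 2) = real (n + 1) * wallis n"
proof -
  have r: "real (n + 2) * sincos_int 2 n = wallis n"
    using sincos_int_rec[of 0 n] by (simp only: add_0 of_nat_1 mult_1)
  have "real (n + 2) * wallis (n + 2) = real (n + 2) * wallis n - real (n + 2) * sincos_int 2 n"
    using sincos_int_cos2[of 0 n] by (simp only: add_0 right_diff_distrib)
  then show ?thesis unfolding r by (simp add: distrib_right)
qed

lemma wallis_0: "wallis 0 = pi / 2"
  by (simp add: sincos_int_def)

lemma wallis_1: "wallis 1 = 1"
proof -
  have "((\<lambda>x. cos x) has_integral (sin (pi / 2) - sin 0)) {0..pi / 2}"
    by (rule fundamental_theorem_of_calculus)
       (auto intro!: derivative_eq_intros simp: has_real_derivative_iff_has_vector_derivative[symmetric])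
  then show ?thesis by (simp add: sincos_int_def integral_unique)
qed

lemma wallis_product: "real (n + 1) * (wallis n * wallis (n + 1)) = pi / 2"
proof (induction n)
  case (Suc n)
  have "real (Suc n + 1) * (wallis (Suc n) * wallis (Suc n + 1)) = wallis (n + 1) * (real (n + 2) * wallis (n + 2))"
  proof -
    have "Suc n + 1 = n + 2" "Suc n = n + 1" by simp_all
    then show ?thesis by (simp only: mult_ac)
  qed
  also have "\<dots> = real (n + 1) * (wallis n * wallis (n + 1))" unfolding wallis_rec by (simp only: mult_ac)
  finally show ?case using Suc.IH by (simp only:)
qed (use wallis_0 wallis_1 in simp)

lemma sincos_int_nonneg: "sincos_int k n \<ge> 0"
  unfolding sincos_int_def
  by (intro integral_nonneg sincos_integrable mult_nonneg_nonneg zero_le_power sin_ge_zero cos_ge_zero) auto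

lemma wallis_pos: "wallis n > 0"
proof -
  have "wallis n \<noteq> 0" using wallis_product[of n] by auto
  then show ?thesis using sincos_int_nonneg[of 0 n] by simp
qed

lemma wallis_Suc_le: "wallis (Suc n) \<le> wallis n"
  unfolding sincos_int_def
proof (intro integral_le sincos_integrable)
  fix x :: real assume "x \<in> {0..pi / 2}"
  then have "0 \<le> cos x" by (intro cos_ge_zero) auto
  then show "sin x ^ 0 * cos x ^ Suc n \<le> sin x ^ 0 * cos x ^ n" by (simp add: mult_left_le_one_le)
qed

text \<open>The product of two consecutive integrals is known exactly and the sequence decreases, so
  the square of one integral lies between two such products.\<close>

lemma wallis_bounds:
  assumes "n \<ge> 1"
  shows "sqrt (pi / 2) / sqrt (real n + 1) \<le> wallis n" "wallis n \<le> sqrt (pi / 2) / sqrt (real n)"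
proof -
  have "pi / 2 \<le> real (n + 1) * (wallis n * wallis n)"
    unfolding wallis_product[of n, symmetric] using wallis_Suc_le[of n] wallis_pos[of n]
    by (intro mult_left_mono) auto
  then have "pi / 2 / (real n + 1) \<le> (wallis n)\<^sup>2" by (simp add: field_simps power2_eq_square)
  then have "sqrt (pi / 2 / (real n + 1)) \<le> sqrt ((wallis n)\<^sup>2)" by (rule real_sqrt_le_mono)
  then show "sqrt (pi / 2) / sqrt (real n + 1) \<le> wallis n" 
    using wallis_pos[of n] real_sqrt_divide[of "pi / 2" "real n + 1"] by (simp only: real_sqrt_abs abs_of_pos)
  obtain m where m: "n = Suc m" using assms by (cases n) auto
  have "real n * (wallis n * wallis n) \<le> real (m + 1) * (wallis m * wallis (m + 1))"
    using wallis_Suc_le[of m] wallis_pos[of n] unfolding m by (intro mult_mono) auto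
  then have "real n * (wallis n * wallis n) \<le> pi / 2" unfolding wallis_product .
  then have "(wallis n)\<^sup>2 \<le> pi / 2 / n" using assms by (simp add: field_simps power2_eq_square)
  then have "sqrt ((wallis n)\<^sup>2) \<le> sqrt (pi / 2 / n)" by (rule real_sqrt_le_mono)
  then show "wallis n \<le> sqrt (pi / 2) / sqrt n" 
    using wallis_pos[of n] real_sqrt_divide[of "pi / 2" "n"] by (simp only: real_sqrt_abs abs_of_pos)
qed

lemma two_step_increasing_le_limit:
  fixes q :: "nat \<Rightarrow> real"
  assumes "\<And>n. n \<ge> n0 \<Longrightarrow> q n \<le> q (n + 2)" "q \<longlonglongrightarrow> l" "n \<ge> n0"
  shows "q n \<le> l"
proof -
  have "incseq (\<lambda>k. q (n + 2 * k))"
    using assms(1)[of "n + 2 * k" for k] assms(3) by (intro incseq_SucI) simp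
  moreover have "filterlim (\<lambda>k. n + 2 * k) at_top sequentially"
    by (rule filterlim_subseq) (auto simp: strict_mono_def)
  then have "(\<lambda>k. q (n + 2 * k)) \<longlonglongrightarrow> l" using assms(2) filterlim_compose by blast
  ultimately show ?thesis using incseq_le[of _ l 0] by fastforce
qed

text \<open>The asymptotic series of \<open>wallis\<close> divided by sqrt (pi / 2), with the
  coefficient of x^(-5) left open. Its true value lies strictly between -1 and 1, so these two
  choices of \<open>c\<close> give a lower and an upper bound.\<close>

definition wallis_approx :: "real \<Rightarrow> real \<Rightarrow> real" where
  "wallis_approx c x = (1 - 1 / (4 * x) + 1 / (32 * x^2) + 5 / (128 * x^3) - 21 / (2048 * x^4) + c / x^5) / sqrt x"

text \<open>The ratio of the integral to its approximant tends to 1 along all n, whatever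
  \<open>c\<close> is, and by the recurrence its monotonicity in steps of two is an inequality
  between elementary functions. It increases for \<open>c = 1\<close> and decreases for
  \<open>c = -1\<close>, so it stays on one side of its limit.\<close>

lemma wallis_approx_bounds:
  "\<forall>\<^sub>F n in sequentially. sqrt (pi / 2) * wallis_approx (-1) n \<le> wallis n \<and> wallis n \<le> sqrt (pi / 2) * wallis_approx 1 n"
proof -
  let ?s = "sqrt (pi / 2)"
  have s: "?s > 0" by simp
  have pos: "\<forall>\<^sub>F n in sequentially. wallis_approx c (real n) > 0" for c
    unfolding wallis_approx_def by real_asymp
  have lim: "(\<lambda>n. wallis n / (?s * wallis_approx c n)) \<longlonglongrightarrow> 1" for c
  proof (rule tendsto_sandwich)
    show "\<forall>\<^sub>F n in sequentially. 1 / sqrt (real n + 1) / wallis_approx c n \<le> wallis n / (?s * wallis_approx c n)"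
      using pos[of c] eventually_ge_at_top[of 1]
    proof eventually_elim
      case (elim n)
      have "1 / sqrt (real n + 1) \<le> wallis n / ?s" using wallis_bounds(1)[OF elim(2)] s by (simp add: field_simps)
      then have "1 / sqrt (real n + 1) / wallis_approx c n \<le> wallis n / ?s / wallis_approx c n"
        using elim by (intro divide_right_mono) auto
      then show ?case by simp
    qed
    show "\<forall>\<^sub>F n in sequentially. wallis n / (?s * wallis_approx c n) \<le> 1 / sqrt (real n) / wallis_approx c n"
      using pos[of c] eventually_ge_at_top[of 1]
    proof eventually_elim
      case (elim n)
      have "wallis n / ?s \<le> 1 / sqrt (real n)" using wallis_bounds(2)[OF elim(2)] s by (simp add: field_simps)
      then have "wallis n / ?s / wallis_approx c n \<le> 1 / sqrt (real n) / wallis_approx c n"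
        using elim by (intro divide_right_mono) auto
      then show ?case by simp
    qed
    show "(\<lambda>n. 1 / sqrt (real n + 1) / wallis_approx c (real n)) \<longlonglongrightarrow> 1"
      unfolding wallis_approx_def by real_asymp
    show "(\<lambda>n. 1 / sqrt (real n) / wallis_approx c (real n)) \<longlonglongrightarrow> 1"
      unfolding wallis_approx_def by real_asymp
  qed
  have ratio: "wallis (n + 2) / (?s * wallis_approx c (real (n + 2))) =
      (real n + 1) / (real n + 2) * wallis n / (?s * wallis_approx c (real n + 2))" for n c
  proof -
    have "(real n + 2) * wallis (n + 2) = (real n + 1) * wallis n"
      using wallis_rec[of n] by (simp only: of_nat_add of_nat_numeral of_nat_1)
    then have w: "wallis (n + 2) = (real n + 1) * wallis n / (real n + 2)"
      by (intro eq_divide_imp) (simp_all add: mult.commute del: add_2_eq_Suc add_2_eq_Suc')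
    have "real (n + 2) = real n + 2" by simp
    then show ?thesis unfolding w by (simp only: times_divide_eq_left)
  qed
  have frac: "1 / a1 \<le> m1 / m2 / a2" if "a1 > 0" "a2 > 0" "m2 > 0" "m2 * a2 \<le> m1 * a1" for a1 a2 m1 m2 :: real
    using that by (simp add: field_simps)
  have frac': "1 / a1 \<ge> m1 / m2 / a2" if "a1 > 0" "a2 > 0" "m2 > 0" "m2 * a2 \<ge> m1 * a1" for a1 a2 m1 m2 :: real
    using that by (simp add: field_simps)
  have up: "\<forall>\<^sub>F n in sequentially. (real n + 2) * wallis_approx 1 (real n + 2) \<le> (real n + 1) * wallis_approx 1 (real n)"
    unfolding wallis_approx_def by real_asymp
  have down: "\<forall>\<^sub>F n in sequentially. (real n + 2) * wallis_approx (-1) (real n + 2) \<ge> (real n + 1) * wallis_approx (-1) (real n)"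
    unfolding wallis_approx_def by real_asymp
  obtain n1 where n1: "\<And>n. n \<ge> n1 \<Longrightarrow> wallis_approx 1 (real n) > 0 \<and>
      (real n + 2) * wallis_approx 1 (real n + 2) \<le> (real n + 1) * wallis_approx 1 (real n)"
    using eventually_conj[OF pos[of 1] up] unfolding eventually_sequentially by auto
  obtain n2 where n2: "\<And>n. n \<ge> n2 \<Longrightarrow> wallis_approx (-1) (real n) > 0 \<and>
      (real n + 2) * wallis_approx (-1) (real n + 2) \<ge> (real n + 1) * wallis_approx (-1) (real n)"
    using eventually_conj[OF pos[of "-1"] down] unfolding eventually_sequentially by auto
  have "wallis n / (?s * wallis_approx 1 n) \<le> 1" if "n \<ge> n1" for n
  proof (rule two_step_increasing_le_limit[OF _ lim that])
    fix n assume n: "n \<ge> n1"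
    have p: "wallis_approx 1 (real n) > 0" "wallis_approx 1 (real n + 2) > 0"
      using n1[OF n] n1[of "n + 2"] n by (auto simp: add.commute)
    have "1 / wallis_approx 1 n \<le> (real n + 1) / (real n + 2) / wallis_approx 1 (real n + 2)"
      using n1[OF n] p by (intro frac) auto
    then have "wallis n / ?s * (1 / wallis_approx 1 n) \<le> wallis n / ?s * ((real n + 1) / (real n + 2) / wallis_approx 1 (real n + 2))"
      using wallis_pos[of n] by (intro mult_left_mono) auto
    then show "wallis n / (?s * wallis_approx 1 n) \<le> wallis (n + 2) / (?s * wallis_approx 1 (real (n + 2)))"
      unfolding ratio by (simp add: mult_ac)
  qed
  moreover have "- (wallis n / (?s * wallis_approx (-1) n)) \<le> -1" if "n \<ge> n2" for n
  proof (rule two_step_increasing_le_limit[OF _ tendsto_minus[OF lim] that])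
    fix n assume n: "n \<ge> n2"
    have p: "wallis_approx (-1) (real n) > 0" "wallis_approx (-1) (real n + 2) > 0"
      using n2[OF n] n2[of "n + 2"] n by (auto simp: add.commute)
    have "1 / wallis_approx (-1) n \<ge> (real n + 1) / (real n + 2) / wallis_approx (-1) (real n + 2)"
      using n2[OF n] p by (intro frac') auto
    then have "wallis n / ?s * (1 / wallis_approx (-1) n) \<ge> wallis n / ?s * ((real n + 1) / (real n + 2) / wallis_approx (-1) (real n + 2))"
      using wallis_pos[of n] by (intro mult_left_mono) auto
    then show "- (wallis n / (?s * wallis_approx (-1) n)) \<le> - (wallis (n + 2) / (?s * wallis_approx (-1) (real (n + 2))))"
      unfolding ratio by (simp add: mult_ac)
  qed
  ultimately have "\<forall>\<^sub>F n in sequentially. wallis n / (?s * wallis_approx 1 n) \<le> 1 \<and> 1 \<le> wallis n / (?s * wallis_approx (-1) n)"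
    unfolding eventually_sequentially by (intro exI[of _ "max n1 n2"]) (auto simp: minus_le_iff)
  then show ?thesis
    using pos[of 1] pos[of "-1"]
  proof eventually_elim
    case (elim n)
    then show ?case using s by (simp add: divide_le_eq le_divide_eq)
  qed
qed

section \<open>The sine quotient against cosine powers\<close>

text \<open>In u = sin x the quotient sin x / x is u / arcsin u, and the polynomial is its Taylor
  polynomial of degree 8. Powers of the sine are chosen because their integrals against cosine
  powers are rational multiples of \<open>wallis n\<close>. Away from 0 the sine is bounded below
  and compactness gives the constant.\<close>

lemma sinc_expansion_bound:
  "\<exists>C. \<forall>x\<in>{0..pi / 2}. \<bar>sinc_deriv 0 x - (1 - sin x ^ 2 / 6 - 17 * sin x ^ 4 / 360 - 367 * sin x ^ 6 / 15120
     - 27859 * sin x ^ 8 / 1814400)\<bar> \<le> C * sin x ^ 10"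
proof -
  define R where "R x = sinc_deriv 0 x - (1 - sin x ^ 2 / 6 - 17 * sin x ^ 4 / 360 - 367 * sin x ^ 6 / 15120
     - 27859 * sin x ^ 8 / 1814400)" for x :: real
  have "(\<lambda>x::real. sin x / x - (1 - sin x ^ 2 / 6 - 17 * sin x ^ 4 / 360 - 367 * sin x ^ 6 / 15120
     - 27859 * sin x ^ 8 / 1814400)) \<in> O[at_right 0](\<lambda>x. sin x ^ 10)"
    by real_asymp
  then obtain C1 where "\<forall>\<^sub>F x in at_right 0. norm (sin x / x - (1 - sin x ^ 2 / 6 - 17 * sin x ^ 4 / 360 - 367 * sin x ^ 6 / 15120
     - 27859 * sin x ^ 8 / 1814400)) \<le> C1 * norm (sin x ^ 10 :: real)"
    by (auto simp: bigo_def)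
  then obtain d where d: "d > 0" "\<And>x. 0 < x \<Longrightarrow> x < d \<Longrightarrow> norm (sin x / x - (1 - sin x ^ 2 / 6 - 17 * sin x ^ 4 / 360 - 367 * sin x ^ 6 / 15120
     - 27859 * sin x ^ 8 / 1814400)) \<le> C1 * norm (sin x ^ 10 :: real)"
    unfolding eventually_at_right_field by auto
  have near: "\<bar>R x\<bar> \<le> C1 * sin x ^ 10" if "0 < x" "x < d" for x
  proof -
    have "sinc_deriv 0 x = sin x / x" using x_times_sinc[of x] that by (simp add: field_simps)
    moreover have "norm (sin x ^ 10) = sin x ^ 10" by (simp add: power_even_abs_numeral power_abs)
    ultimately show ?thesis using d(2)[OF that] by (simp add: R_def)
  qed
  define d' where "d' = min d (pi / 2) / 2"
  have d': "0 < d'" "d' < d" "d' < pi / 2" using d(1) pi_gt_zero by (auto simp: d'_def min_def)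
  have "continuous_on {d'..pi / 2} R"
    unfolding R_def by (intro continuous_intros continuous_on_subset[OF smooth_imp_continuous[OF smooth_sinc_deriv[of 0 0]]]) auto
  then have "compact (R ` {d'..pi / 2})" by (rule compact_continuous_image) auto
  then obtain M where "\<forall>y\<in>R ` {d'..pi / 2}. norm y \<le> M"
    using compact_imp_bounded bounded_iff by blast
  then have M: "\<bar>R x\<bar> \<le> M" if "d' \<le> x" "x \<le> pi / 2" for x using that by auto
  have sd: "sin d' > 0" using d' by (intro sin_gt_zero) auto
  define C where "C = max C1 (\<bar>M\<bar> / sin d' ^ 10)"
  have "\<bar>R x\<bar> \<le> C * sin x ^ 10" if x: "x \<in> {0..pi / 2}" for x
  proof -
    have sx: "sin x \<ge> 0" using x by (intro sin_ge_zero) auto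
    consider "x = 0" | "0 < x" "x < d'" | "d' \<le> x" using x by fastforce
    then show ?thesis
    proof cases
      case 1
      have "sinc_deriv 0 0 = 1" by (simp add: sinc_deriv_def)
      then show ?thesis using 1 by (simp add: R_def)
    next
      case 2
      then have "\<bar>R x\<bar> \<le> C1 * sin x ^ 10" using d' by (intro near) auto
      also have "\<dots> \<le> C * sin x ^ 10" using sx unfolding C_def by (intro mult_right_mono) auto
      finally show ?thesis .
    next
      case 3
      have "sin d' \<le> sin x" using 3 d' x by (intro sin_monotone_2pi_le) auto
      then have "sin d' ^ 10 \<le> sin x ^ 10" using sd by (intro power_mono) auto
      then have "\<bar>M\<bar> / sin d' ^ 10 * sin d' ^ 10 \<le> \<bar>M\<bar> / sin d' ^ 10 * sin x ^ 10"
        using sd by (intro mult_left_mono) auto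
      then have "\<bar>M\<bar> \<le> \<bar>M\<bar> / sin d' ^ 10 * sin x ^ 10" using sd by simp
      also have "\<dots> \<le> C * sin x ^ 10" using sx unfolding C_def by (intro mult_right_mono) auto
      finally show ?thesis using M[of x] 3 x by auto
    qed
  qed
  then show ?thesis unfolding R_def by blast
qed

definition sinc_cos_int :: "nat \<Rightarrow> real" where
  "sinc_cos_int n = integral {0..pi / 2} (\<lambda>x. sinc_deriv 0 x * cos x ^ n)"

text \<open>The factors 3, 15 and 105 are the double factorials that appear when sin^4, sin^6 and
  sin^8 are integrated against cos^n and divided by \<open>wallis n\<close>.\<close>

definition sinc_poly :: "real \<Rightarrow> real" where
  "sinc_poly x = 1 - 1 / (6 * (x + 2)) - 17 * 3 / (360 * ((x + 2) * (x + 4)))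
     - 367 * 15 / (15120 * ((x + 2) * (x + 4) * (x + 6)))
     - 27859 * 105 / (1814400 * ((x + 2) * (x + 4) * (x + 6) * (x + 8)))"

text \<open>The remainder sin^10 contributes 945 / ((n + 2) (n + 4) (n + 6) (n + 8) (n + 10)) times
  the Wallis integral, that is five further powers of 1 / n.\<close>

lemma sinc_cos_int_wallis: "(\<lambda>n. sinc_cos_int n - wallis n * sinc_poly n) \<in> O(\<lambda>n. 1 / (sqrt n * real n ^ 5))"
proof -
  obtain C where C: "\<And>x. x \<in> {0..pi / 2} \<Longrightarrow> \<bar>sinc_deriv 0 x - (1 - sin x ^ 2 / 6 - 17 * sin x ^ 4 / 360 - 367 * sin x ^ 6 / 15120
     - 27859 * sin x ^ 8 / 1814400)\<bar> \<le> C * sin x ^ 10"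
    using sinc_expansion_bound by blast
  define p where "p x = 1 - sin x ^ 2 / 6 - 17 * sin x ^ 4 / 360 - 367 * sin x ^ 6 / 15120
     - 27859 * sin x ^ 8 / 1814400" for x :: real
  have sc: "continuous_on A (sinc_deriv 0)" for A
    using continuous_on_subset[OF smooth_imp_continuous[OF smooth_sinc_deriv[of 0 0]]] by auto
  have rec: "sincos_int (k + 2) n = real (k + 1) / real (k + n + 2) * sincos_int k n" for k n
    using sincos_int_rec[of k n] by (simp add: field_simps)
  have s2: "sincos_int 2 n = wallis n / (real n + 2)" for n using rec[of 0 n] unfolding add_0 by (simp add: add.commute)
  have s4: "sincos_int 4 n = wallis n * 3 / ((real n + 2) * (real n + 4))" for n using rec[of 2 n] s2[of n] by (simp add: add.commute mult_ac)
  have s6: "sincos_int 6 n = wallis n * 15 / ((real n + 2) * (real n + 4) * (real n + 6))" for n using rec[of 4 n] s4[of n] by (simp add: add.commute mult_ac)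
  have s8: "sincos_int 8 n = wallis n * 105 / ((real n + 2) * (real n + 4) * (real n + 6) * (real n + 8))" for n
    using rec[of 6 n] s6[of n] by (simp add: add.commute mult_ac)
  have s10: "sincos_int 10 n = wallis n * 945 / ((real n + 2) * (real n + 4) * (real n + 6) * (real n + 8) * (real n + 10))" for n
    using rec[of 8 n] s8[of n] by (simp add: add.commute mult_ac)
  have pint: "((\<lambda>x. p x * cos x ^ n) has_integral wallis n * sinc_poly n) {0..pi / 2}" for n
  proof -
    have hi: "((\<lambda>x. c * (sin x ^ k * cos x ^ n)) has_integral c * sincos_int k n) {0..pi / 2}" for c k
      unfolding sincos_int_def by (intro has_integral_mult_right integrable_integral sincos_integrable)
    have "((\<lambda>x. (sin x ^ 0 * cos x ^ n) - (1/6) * (sin x ^ 2 * cos x ^ n) - (17/360) * (sin x ^ 4 * cos x ^ n)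
        - (367/15120) * (sin x ^ 6 * cos x ^ n) - (27859/1814400) * (sin x ^ 8 * cos x ^ n)) has_integral
       (wallis n - (1/6) * sincos_int 2 n - (17/360) * sincos_int 4 n - (367/15120) * sincos_int 6 n
         - (27859/1814400) * sincos_int 8 n)) {0..pi / 2}"
      using hi[of 1 0] by (intro has_integral_diff hi) simp
    moreover have "(\<lambda>x. (sin x ^ 0 * cos x ^ n) - (1/6) * (sin x ^ 2 * cos x ^ n) - (17/360) * (sin x ^ 4 * cos x ^ n)
        - (367/15120) * (sin x ^ 6 * cos x ^ n) - (27859/1814400) * (sin x ^ 8 * cos x ^ n)) = (\<lambda>x. p x * cos x ^ n)"
      by (simp add: p_def fun_eq_iff algebra_simps)
    moreover have "wallis n - (1/6) * sincos_int 2 n - (17/360) * sincos_int 4 n - (367/15120) * sincos_int 6 n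
         - (27859/1814400) * sincos_int 8 n = wallis n * sinc_poly n"
    proof -
      have "W - (1/6) * (W / a) - (17/360) * (W * 3 / (a * b)) - (367/15120) * (W * 15 / (a * b * c))
          - (27859/1814400) * (W * 105 / (a * b * c * d)) = W * (1 - 1 / (6 * a) - 17 * 3 / (360 * (a * b))
          - 367 * 15 / (15120 * (a * b * c)) - 27859 * 105 / (1814400 * (a * b * c * d)))" for W a b c d :: real
        by (simp add: right_diff_distrib)
      then show ?thesis unfolding s2 s4 s6 s8 sinc_poly_def .
    qed
    ultimately show ?thesis by simp
  qed
  have "\<bar>sinc_cos_int n - wallis n * sinc_poly n\<bar> \<le> C * sincos_int 10 n" for n
  proof -
    have "sinc_cos_int n - wallis n * sinc_poly n = integral {0..pi / 2} (\<lambda>x. sinc_deriv 0 x * cos x ^ n - p x * cos x ^ n)"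
      unfolding sinc_cos_int_def using pint[of n]
      by (subst Henstock_Kurzweil_Integration.integral_diff)
         (auto simp: integral_unique has_integral_integrable intro!: integrable_continuous_interval continuous_intros sc)
    also have "norm \<dots> \<le> integral {0..pi / 2} (\<lambda>x. C * (sin x ^ 10 * cos x ^ n))"
    proof (rule integral_norm_bound_integral)
      fix x assume x: "x \<in> {0..pi / 2}"
      have "0 \<le> cos x" using x by (intro cos_ge_zero) auto
      then have "\<bar>sinc_deriv 0 x - p x\<bar> * cos x ^ n \<le> (C * sin x ^ 10) * cos x ^ n"
        using C[OF x] unfolding p_def by (intro mult_right_mono) auto
      then show "norm (sinc_deriv 0 x * cos x ^ n - p x * cos x ^ n) \<le> C * (sin x ^ 10 * cos x ^ n)"
        using \<open>0 \<le> cos x\<close> by (simp add: abs_mult mult.assoc flip: left_diff_distrib)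
    qed (auto intro!: integrable_continuous_interval continuous_intros sc simp: p_def)
    finally show ?thesis by (simp add: sincos_int_def)
  qed
  then have b: "\<bar>sinc_cos_int n - wallis n * sinc_poly n\<bar> \<le> \<bar>C\<bar> * sincos_int 10 n" for n
    using sincos_int_nonneg[of 10 n] by (meson abs_ge_self mult_right_mono order_trans)
  show ?thesis
  proof (rule bigoI)
    show "\<forall>\<^sub>F n in sequentially. norm (sinc_cos_int n - wallis n * sinc_poly n) \<le>
       (\<bar>C\<bar> * (sqrt (pi / 2) * 945)) * norm (1 / (sqrt n * real n ^ 5))"
      using eventually_ge_at_top[of 1]
    proof eventually_elim
      case (elim n)
      have "sincos_int 10 n \<le> (sqrt (pi / 2) / sqrt n) * 945 / real n ^ 5"
        unfolding s10
      proof (intro frac_le mult_right_mono wallis_bounds elim)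
        have "real n * real n * real n * real n * real n \<le> (real n + 2) * (real n + 4) * (real n + 6) * (real n + 8) * (real n + 10)"
          by (intro mult_mono) auto
        then show "real n ^ 5 \<le> (real n + 2) * (real n + 4) * (real n + 6) * (real n + 8) * (real n + 10)"
          by (simp add: eval_nat_numeral mult_ac)
      qed (use elim in auto)
      then have "\<bar>C\<bar> * sincos_int 10 n \<le> \<bar>C\<bar> * ((sqrt (pi / 2) / sqrt n) * 945 / real n ^ 5)"
        by (intro mult_left_mono) auto
      also have "\<dots> = (\<bar>C\<bar> * (sqrt (pi / 2) * 945)) * norm (1 / (sqrt n * real n ^ 5))" by simp
      finally show ?case using b[of n] by simp
    qed
  qed
qed

text \<open>The product of the Wallis series and \<open>sinc_poly\<close>, cut after five terms. The
  factor pulled out is sqrt (pi / 2), half of sqrt (2 * pi), so the coefficients are twice those of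
  the statement; the last is the corrected one.\<close>

definition prob_max_approx :: "real \<Rightarrow> real" where
  "prob_max_approx x = (1 - 5 / (12 * x) + 127 / (480 * x^2) - 1571 / (8064 * x^3) + 43661 / (276480 * x^4)) / sqrt x"

theorem sinc_cos_int_expansion:
  "(\<lambda>n. sinc_cos_int n - sqrt (pi / 2) * prob_max_approx n) \<in> O(\<lambda>n. 1 / (sqrt n * real n ^ 5))"
proof -
  let ?s = "sqrt (pi / 2)" and ?g = "\<lambda>n::nat. 1 / (sqrt n * real n ^ 5)"
  have w: "(\<lambda>n. wallis n - ?s * wallis_approx 0 n) \<in> O(?g)"
  proof (rule bigoI)
    show "\<forall>\<^sub>F n in sequentially. norm (wallis n - ?s * wallis_approx 0 n) \<le> ?s * norm (1 / (sqrt n * real n ^ 5))"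
      using wallis_approx_bounds eventually_gt_at_top[of 0]
    proof eventually_elim
      case (elim n)
      have "wallis_approx 1 n = wallis_approx 0 n + 1 / (sqrt n * real n ^ 5)"
        "wallis_approx (-1) n = wallis_approx 0 n - 1 / (sqrt n * real n ^ 5)"
        unfolding wallis_approx_def by (simp_all add: diff_divide_distrib add_divide_distrib)
      then have "?s * wallis_approx 1 n = ?s * wallis_approx 0 n + ?s * (1 / (sqrt n * real n ^ 5))"
        "?s * wallis_approx (-1) n = ?s * wallis_approx 0 n - ?s * (1 / (sqrt n * real n ^ 5))"
        by (simp_all only: distrib_left right_diff_distrib)
      then have "\<bar>wallis n - ?s * wallis_approx 0 n\<bar> \<le> ?s * (1 / (sqrt n * real n ^ 5))"
        using elim(1) by (intro abs_leI) linarith+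
      then show ?case by simp
    qed
  qed
  have "(\<lambda>n. sinc_poly (real n)) \<in> O(\<lambda>n. 1)" unfolding sinc_poly_def by real_asymp
  with w have "(\<lambda>n. (wallis n - ?s * wallis_approx 0 n) * sinc_poly n) \<in> O(\<lambda>n. ?g n * 1)"
    by (rule landau_o.big.mult)
  then have 1: "(\<lambda>n. wallis n * sinc_poly n - ?s * (wallis_approx 0 n * sinc_poly n)) \<in> O(?g)"
    by (simp add: left_diff_distrib mult.assoc)
  have "(\<lambda>n. wallis_approx 0 (real n) * sinc_poly (real n) - prob_max_approx (real n)) \<in> O(?g)"
    unfolding wallis_approx_def sinc_poly_def prob_max_approx_def by real_asymp
  then have "(\<lambda>n. ?s * (wallis_approx 0 (real n) * sinc_poly (real n) - prob_max_approx (real n))) \<in> O(?g)"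
    by simp
  then have 2: "(\<lambda>n. ?s * (wallis_approx 0 (real n) * sinc_poly (real n)) - ?s * prob_max_approx (real n)) \<in> O(?g)"
    by (simp only: right_diff_distrib)
  from sum_in_bigo(1)[OF sinc_cos_int_wallis sum_in_bigo(1)[OF 1 2]] show ?thesis by simp
qed

section \<open>Odd cosine series\<close>

lemma cos_odd_power_expansion:
  "cos x ^ (2 * N + 1) = (\<Sum>k<Suc N. real ((2 * N + 1) choose (N - k)) / 4 ^ N * cos (real (2 * k + 1) * x))"
proof -
  define m where "m = 2 * N + 1"
  define f where "f j = real (m choose j) * cos ((2 * real j - real m) * x)" for j
  have "complex_of_real (2 * cos x) = cis x + cis (- x)" by (simp add: complex_eq_iff)
  then have "complex_of_real ((2 * cos x) ^ m) = (cis x + cis (- x)) ^ m" by (simp only: of_real_power)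
  also have "\<dots> = (\<Sum>j\<le>m. of_nat (m choose j) * cis x ^ j * cis (- x) ^ (m - j))" by (rule binomial_ring)
  finally have "Re (complex_of_real ((2 * cos x) ^ m)) = (\<Sum>j\<le>m. Re (of_nat (m choose j) * cis x ^ j * cis (- x) ^ (m - j)))"
    by (simp only: Re_sum)
  also have "\<dots> = (\<Sum>j\<le>m. f j)"
  proof (rule sum.cong)
    fix j assume "j \<in> {..m}"
    then have "real j * x + real (m - j) * - x = (2 * real j - real m) * x" by (simp add: of_nat_diff algebra_simps)
    then have "cis x ^ j * cis (- x) ^ (m - j) = cis ((2 * real j - real m) * x)"
      by (simp only: Complex.DeMoivre cis_mult)
    then show "Re (of_nat (m choose j) * cis x ^ j * cis (- x) ^ (m - j)) = f j"
      by (simp add: f_def mult.assoc)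
  qed simp
  also have "\<dots> = (\<Sum>j<Suc N + Suc N. f j)" by (rule sum.cong) (auto simp: m_def)
  also have "\<dots> = (\<Sum>j<Suc N. f j) + (\<Sum>k<Suc N. f (Suc N + k))" by (rule sum_lessThan_add)
  also have "(\<Sum>j<Suc N. f j) = (\<Sum>k<Suc N. f (Suc N - Suc k))" by (rule sum.nat_diff_reindex[symmetric])
  also have "\<dots> + (\<Sum>k<Suc N. f (Suc N + k)) = (\<Sum>k<Suc N. f (N - k) + f (Suc N + k))"
    by (simp add: sum.distrib)
  also have "\<dots> = (\<Sum>k<Suc N. 2 * (real (m choose (N - k)) * cos (real (2 * k + 1) * x)))"
  proof (rule sum.cong)
    fix k assume k: "k \<in> {..<Suc N}"
    have "f (N - k) = real (m choose (N - k)) * cos (- (real (2 * k + 1) * x))"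
      using k unfolding f_def m_def by (simp add: of_nat_diff algebra_simps)
    moreover have "m choose (Suc N + k) = m choose (N - k)"
      using k binomial_symmetric[of "N - k" m] by (simp add: m_def)
    then have "f (Suc N + k) = real (m choose (N - k)) * cos (real (2 * k + 1) * x)"
      unfolding f_def by (simp add: m_def)
    ultimately show "f (N - k) + f (Suc N + k) = 2 * (real (m choose (N - k)) * cos (real (2 * k + 1) * x))"
      by (simp only: cos_minus)
  qed simp
  finally have e: "(2 * cos x) ^ m = 2 * (\<Sum>k<Suc N. real (m choose (N - k)) * cos (real (2 * k + 1) * x))"
    by (simp only: Re_complex_of_real sum_distrib_left)
  have "(2 * cos x) ^ m = 2 * (4 ^ N * cos x ^ m)" by (simp add: power_mult_distrib m_def power_mult)
  with e have "4 ^ N * cos x ^ m = (\<Sum>k<Suc N. real (m choose (N - k)) * cos (real (2 * k + 1) * x))"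
    by (simp only: mult_cancel_left) simp
  then have "cos x ^ m = (\<Sum>k<Suc N. real (m choose (N - k)) * cos (real (2 * k + 1) * x)) / 4 ^ N"
    by (simp add: field_simps)
  then show ?thesis unfolding m_def by (simp only: sum_divide_distrib times_divide_eq_left)
qed

text \<open>The integral is that of cos x against cos^(2 N + 1), so by orthogonality it is pi / 4
  times the coefficient of cos x in the preceding expansion. It normalizes the kernel below. The
  recurrence gives a direct induction.\<close>

lemma wallis_even_binomial: "wallis (2 * N + 2) = pi / 4 * (real ((2 * N + 1) choose N) / 4 ^ N)"
proof (induction N)
  case 0
  then show ?case using wallis_rec[of 0] wallis_0 by (simp add: numeral_2_eq_2)
next
  case (Suc N)
  have c1: "real ((2 * N + 1) choose N) = fact (2 * N + 1) / (fact N * fact (N + 1))"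
  proof -
    have "N \<le> 2 * N + 1" "2 * N + 1 - N = N + 1" by simp_all
    then show ?thesis using binomial_fact[of N "2 * N + 1", where 'a = real] by (simp only:)
  qed
  have c2: "real ((2 * N + 3) choose (N + 1)) = fact (2 * N + 3) / (fact (N + 1) * fact (N + 2))"
  proof -
    have "N + 1 \<le> 2 * N + 3" "2 * N + 3 - (N + 1) = N + 2" by simp_all
    then show ?thesis using binomial_fact[of "N + 1" "2 * N + 3", where 'a = real] by (simp only:)
  qed
  have f3: "fact (2 * N + 3) = (2 * real N + 3) * ((2 * (real N + 1)) * fact (2 * N + 1) :: real)"
    by (simp add: numeral_3_eq_3 numeral_2_eq_2 algebra_simps)
  have f2: "fact (N + 2) = (real N + 2) * (fact (N + 1) :: real)"
    by (simp add: numeral_2_eq_2 algebra_simps)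
  have f1: "fact (N + 1) = (real N + 1) * (fact N :: real)" by (simp add: algebra_simps)
  have alg: "t * (2 * y * F) / ((y * G) * (z * M)) * z = 2 * t * (F / (G * M))"
    if "y \<noteq> 0" "z \<noteq> 0" for t y z F G M :: real
    using that by simp
  have "real ((2 * N + 3) choose (N + 1)) * (real N + 2) =
      (2 * real N + 3) * (2 * (real N + 1) * fact (2 * N + 1)) / ((real N + 1) * fact N * ((real N + 2) * fact (N + 1))) * (real N + 2)"
    unfolding c2 f3 f2 by (subst f1) (rule refl)
  also have "\<dots> = 2 * (2 * real N + 3) * real ((2 * N + 1) choose N)"
    unfolding c1 by (rule alg) linarith+
  finally have "real ((2 * N + 3) choose (N + 1)) * (real N + 2) = 2 * (2 * real N + 3) * real ((2 * N + 1) choose N)" .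
  then have b: "real ((2 * N + 3) choose (N + 1)) = 2 * (2 * real N + 3) * real ((2 * N + 1) choose N) / (real N + 2)"
    by (simp add: field_simps)
  have "real (2 * N + 2 + 2) * wallis (2 * N + 2 + 2) = real (2 * N + 2 + 1) * wallis (2 * N + 2)"
    by (rule wallis_rec)
  then have "(2 * (real N + 2)) * wallis (2 * N + 2 + 2) = (2 * real N + 3) * wallis (2 * N + 2)"
    by (simp only: of_nat_add of_nat_mult of_nat_numeral of_nat_1) (simp add: algebra_simps)
  moreover have "2 * (real N + 2) \<noteq> 0" by (rule less_imp_neq[symmetric]) simp
  ultimately have "wallis (2 * N + 2 + 2) = (2 * real N + 3) * wallis (2 * N + 2) / (2 * (real N + 2))"
    by (intro eq_divide_imp) (simp_all only: mult.commute not_False_eq_True)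
  also have "\<dots> = pi / 4 * (real ((2 * N + 3) choose (N + 1)) / 4 ^ Suc N)"
  proof -
    have "t * (p / 4 * (c / P)) / (2 * z) = p / 4 * ((2 * t * c / z) / (4 * P))" for t p c P z :: real
      by simp
    then show ?thesis unfolding Suc b power_Suc .
  qed
  finally have "wallis (2 * N + 2 + 2) = pi / 4 * (real ((2 * N + 3) choose (N + 1)) / 4 ^ Suc N)" .
  moreover have "2 * N + 2 + 2 = 2 * Suc N + 2" "2 * N + 3 = 2 * Suc N + 1" "N + 1 = Suc N" by simp_all
  ultimately show ?case by (simp only:)
qed

text \<open>The cosine coefficients of cos^(2 N + 1) divided by the leading one: the summability
  weights with which the cosine series will be summed.\<close>

definition central_ratio :: "nat \<Rightarrow> nat \<Rightarrow> real" where
  "central_ratio N k = (if k \<le> N then real ((2 * N + 1) choose (N - k)) / real ((2 * N + 1) choose N) else 0)"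

lemma central_ratio_Suc:
  assumes "Suc k \<le> N"
  shows "central_ratio N (Suc k) = central_ratio N k * ((real N - real k) / (real N + real k + 2))"
proof -
  have "Suc (N - Suc k) * ((2 * N + 1) choose Suc (N - Suc k)) = (2 * N + 1) * ((2 * N) choose (N - Suc k))"
    using binomial_absorption[of "N - Suc k" "2 * N + 1"] by simp
  also have "\<dots> = (2 * N + 1 - (N - Suc k)) * ((2 * N + 1) choose (N - Suc k))"
    using binomial_absorb_comp[of "2 * N + 1" "N - Suc k"] by simp
  finally have "(N - k) * ((2 * N + 1) choose (N - k)) = (N + k + 2) * ((2 * N + 1) choose (N - Suc k))"
    using assms by (simp add: Suc_diff_Suc)
  then have "real (N - k) * real ((2 * N + 1) choose (N - k)) = real (N + k + 2) * real ((2 * N + 1) choose (N - Suc k))"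
    unfolding of_nat_mult[symmetric] by (simp only:)
  then have "real ((2 * N + 1) choose (N - Suc k)) = real ((2 * N + 1) choose (N - k)) * ((real N - real k) / (real N + real k + 2))"
    using assms by (simp add: of_nat_diff field_simps)
  then show ?thesis using assms by (simp add: central_ratio_def)
qed

lemma central_ratio_tendsto: "(\<lambda>N. central_ratio N k) \<longlonglongrightarrow> 1"
proof (induction k)
  case 0
  have "central_ratio N 0 = 1" for N by (simp add: central_ratio_def)
  then show ?case by simp
next
  case (Suc k)
  have "(\<lambda>N. (real N - real k) / (real N + real k + 2)) \<longlonglongrightarrow> 1" by real_asymp
  from tendsto_mult[OF Suc this] have "(\<lambda>N. central_ratio N k * ((real N - real k) / (real N + real k + 2))) \<longlonglongrightarrow> 1" by simp
  then show ?case
  proof (rule Lim_transform_eventually)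
    show "\<forall>\<^sub>F N in sequentially. central_ratio N k * ((real N - real k) / (real N + real k + 2)) = central_ratio N (Suc k)"
      using eventually_ge_at_top[of "Suc k"] by eventually_elim (simp add: central_ratio_Suc)
  qed
qed

lemma central_ratio_bounds: "0 \<le> central_ratio N k" "central_ratio N k \<le> 1"
proof -
  show "0 \<le> central_ratio N k" by (simp add: central_ratio_def)
  show "central_ratio N k \<le> 1"
  proof (induction k)
    case (Suc k)
    show ?case
    proof (cases "Suc k \<le> N")
      case True
      have "central_ratio N k * ((real N - real k) / (real N + real k + 2)) \<le> 1 * 1"
        using True Suc by (intro mult_mono) (auto simp: central_ratio_def)
      then show ?thesis using central_ratio_Suc[OF True] by simp
    qed (simp add: central_ratio_def)
  qed (simp add: central_ratio_def)
qed

text \<open>This majorant replaces splitting the integral near 0 and away from it: the constant and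
  the square of the sine both have explicit integrals against cosine powers.\<close>

lemma continuous_le_eps_plus_sin2:
  fixes V :: "real \<Rightarrow> real"
  assumes V: "continuous_on {0..pi / 2} V" "V 0 = 0" and "\<epsilon> > 0"
  obtains C where "C \<ge> 0" "\<And>x. x \<in> {0..pi / 2} \<Longrightarrow> \<bar>V x\<bar> \<le> \<epsilon> + C * sin x ^ 2"
proof -
  have "0 \<in> {0..pi / 2}" by simp
  then have "\<exists>d>0. \<forall>x\<in>{0..pi / 2}. dist x 0 < d \<longrightarrow> dist (V x) (V 0) < \<epsilon>"
    using V(1) assms(3) unfolding continuous_on_iff by blast
  then obtain d where d: "d > 0" "\<And>x. x \<in> {0..pi / 2} \<Longrightarrow> x < d \<Longrightarrow> \<bar>V x\<bar> < \<epsilon>"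
    using V(2) by (auto simp: dist_real_def)
  define d' where "d' = min d (pi / 2)"
  have d': "d' > 0" "d' \<le> pi / 2" "d' \<le> d" using d(1) by (auto simp: d'_def)
  have "compact (V ` {0..pi / 2})" using V(1) by (intro compact_continuous_image) auto
  then obtain M where "\<forall>y\<in>V ` {0..pi / 2}. norm y \<le> M" using compact_imp_bounded bounded_iff by blast
  then have M: "\<bar>V x\<bar> \<le> M" if "x \<in> {0..pi / 2}" for x using that by auto
  have sd: "sin d' > 0" using d' by (intro sin_gt_zero) auto
  have M0: "M \<ge> 0" using M[of 0] by auto
  have "\<bar>V x\<bar> \<le> \<epsilon> + M / sin d' ^ 2 * sin x ^ 2" if x: "x \<in> {0..pi / 2}" for x
  proof (cases "x < d'")
    case True
    then show ?thesis using d(2)[OF x] d' M0 by (auto intro: add_increasing2 less_imp_le order_trans[of _ \<epsilon>])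
  next
    case False
    have "sin d' \<le> sin x" using False d' x by (intro sin_monotone_2pi_le) auto
    then have "M / sin d' ^ 2 * sin d' ^ 2 \<le> M / sin d' ^ 2 * sin x ^ 2"
      using sd M0 by (intro mult_left_mono power_mono) auto
    then have "M \<le> M / sin d' ^ 2 * sin x ^ 2" using sd by simp
    then show ?thesis using M[OF x] assms(3) by linarith
  qed
  moreover have "M / sin d' ^ 2 \<ge> 0" using M0 by simp
  ultimately show ?thesis using that by blast
qed

text \<open>The normalization is the integral of cos x times the kernel, so W is compared with W(0)
  cos x. The difference vanishes at 0 and is bounded by r / 4 plus a multiple of sin^2, and the
  latter gains a factor 1 / (2 N + 3). Lowering the index of the Wallis integral by one costs at
  most a factor 2.\<close>

lemma cos_power_kernel_tendsto:
  fixes W :: "real \<Rightarrow> real"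
  assumes W: "continuous_on {0..pi / 2} W"
  shows "(\<lambda>N. integral {0..pi / 2} (\<lambda>x. W x * cos x ^ (2 * N + 1)) / wallis (2 * N + 2)) \<longlonglongrightarrow> W 0"
proof (rule LIMSEQ_I)
  fix r :: real assume r: "r > 0"
  define V where "V x = W x - W 0 * cos x" for x
  have cV: "continuous_on {0..pi / 2} V" unfolding V_def by (intro continuous_intros W)
  obtain C where C: "C \<ge> 0" "\<And>x. x \<in> {0..pi / 2} \<Longrightarrow> \<bar>V x\<bar> \<le> r / 4 + C * sin x ^ 2"
    using continuous_le_eps_plus_sin2[OF cV, of "r / 4"] r by (auto simp: V_def)
  have "(\<lambda>N. 2 * C / (2 * real N + 3)) \<longlonglongrightarrow> 0" by real_asymp
  then have "\<forall>\<^sub>F N in sequentially. 2 * C / (2 * real N + 3) < r / 2"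
    by (rule order_tendstoD) (use r in simp)
  then obtain N0 where N0: "\<And>N. N \<ge> N0 \<Longrightarrow> 2 * C / (2 * real N + 3) < r / 2"
    unfolding eventually_sequentially by blast
  show "\<exists>no. \<forall>N\<ge>no. norm (integral {0..pi / 2} (\<lambda>x. W x * cos x ^ (2 * N + 1)) / wallis (2 * N + 2) - W 0) < r"
  proof (intro exI allI impI)
    fix N assume N: "N \<ge> N0"
    let ?w = "wallis (2 * N + 2)"
    have "integral {0..pi / 2} (\<lambda>x. W x * cos x ^ (2 * N + 1)) - W 0 * ?w =
        integral {0..pi / 2} (\<lambda>x. W x * cos x ^ (2 * N + 1) - W 0 * (sin x ^ 0 * cos x ^ (2 * N + 2)))"
      unfolding sincos_int_def
      by (subst Henstock_Kurzweil_Integration.integral_diff)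
         (auto intro!: integrable_continuous_interval continuous_intros W)
    also have "\<dots> = integral {0..pi / 2} (\<lambda>x. V x * cos x ^ (2 * N + 1))"
      by (rule integral_cong) (simp add: V_def algebra_simps)
    also have "norm \<dots> \<le> integral {0..pi / 2} (\<lambda>x. r / 4 * (sin x ^ 0 * cos x ^ (2 * N + 1)) + C * (sin x ^ 2 * cos x ^ (2 * N + 1)))"
    proof (rule integral_norm_bound_integral)
      fix x assume x: "x \<in> {0..pi / 2}"
      have c: "cos x \<ge> 0" using x by (intro cos_ge_zero) auto
      then have "\<bar>V x\<bar> * cos x ^ (2 * N + 1) \<le> (r / 4 + C * sin x ^ 2) * cos x ^ (2 * N + 1)"
        using C(2)[OF x] by (intro mult_right_mono) auto
      then show "norm (V x * cos x ^ (2 * N + 1)) \<le> r / 4 * (sin x ^ 0 * cos x ^ (2 * N + 1)) + C * (sin x ^ 2 * cos x ^ (2 * N + 1))"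
        using c by (simp add: abs_mult algebra_simps)
    qed (auto intro!: integrable_continuous_interval continuous_intros cV)
    also have "\<dots> = r / 4 * wallis (2 * N + 1) + C * sincos_int 2 (2 * N + 1)"
      unfolding sincos_int_def
      by (subst Henstock_Kurzweil_Integration.integral_add) (simp_all only: integrable_on_mult_right sincos_integrable integral_mult_right)
    also have "sincos_int 2 (2 * N + 1) = wallis (2 * N + 1) / (2 * real N + 3)"
    proof -
      have "real (2 * N + 1 + 2) * sincos_int 2 (2 * N + 1) = wallis (2 * N + 1)"
        using sincos_int_rec[of 0 "2 * N + 1"] by (simp only: add_0 of_nat_1 mult_1)
      moreover have "real (2 * N + 1 + 2) = 2 * real N + 3" by simp
      moreover have "2 * real N + 3 \<noteq> 0" by (rule less_imp_neq[symmetric]) simp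
      ultimately show ?thesis by (intro eq_divide_imp) (simp_all only: mult.commute not_False_eq_True)
    qed
    finally have "\<bar>integral {0..pi / 2} (\<lambda>x. W x * cos x ^ (2 * N + 1)) - W 0 * ?w\<bar> \<le>
        wallis (2 * N + 1) * (r / 4 + C / (2 * real N + 3))" by (simp add: algebra_simps)
    also have "\<dots> \<le> (2 * ?w) * (r / 4 + C / (2 * real N + 3))"
    proof (intro mult_right_mono)
      have "wallis (2 * N + 1) \<le> wallis (2 * N)" using wallis_Suc_le[of "2 * N"] by simp
      moreover have "real (2 * N + 2) * ?w = real (2 * N + 1) * wallis (2 * N)" by (rule wallis_rec)
      then have "wallis (2 * N) = (2 * real N + 2) / (2 * real N + 1) * ?w" by (simp add: field_simps)
      moreover have "(2 * real N + 2) / (2 * real N + 1) * ?w \<le> 2 * ?w"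
        using wallis_pos[of "2 * N + 2"] by (intro mult_right_mono) (auto simp: field_simps)
      ultimately show "wallis (2 * N + 1) \<le> 2 * ?w" by linarith
    qed (use r C in auto)
    finally have b: "\<bar>integral {0..pi / 2} (\<lambda>x. W x * cos x ^ (2 * N + 1)) - W 0 * ?w\<bar> \<le> (2 * ?w) * (r / 4 + C / (2 * real N + 3))" .
    have w: "?w > 0" by (rule wallis_pos)
    have "integral {0..pi / 2} (\<lambda>x. W x * cos x ^ (2 * N + 1)) / ?w - W 0 =
        (integral {0..pi / 2} (\<lambda>x. W x * cos x ^ (2 * N + 1)) - W 0 * ?w) / ?w" using w by (simp add: diff_divide_distrib)
    then have "\<bar>integral {0..pi / 2} (\<lambda>x. W x * cos x ^ (2 * N + 1)) / ?w - W 0\<bar> =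
        \<bar>integral {0..pi / 2} (\<lambda>x. W x * cos x ^ (2 * N + 1)) - W 0 * ?w\<bar> / ?w" using w by simp
    also have "\<dots> \<le> (2 * ?w) * (r / 4 + C / (2 * real N + 3)) / ?w" using b w by (intro divide_right_mono) auto
    also have "\<dots> = 2 * (r / 4 + C / (2 * real N + 3))" using w by simp
    also have "\<dots> = r / 2 + 2 * C / (2 * real N + 3)" by simp
    also have "\<dots> < r" using N0[OF N] by linarith
    finally show "norm (integral {0..pi / 2} (\<lambda>x. W x * cos x ^ (2 * N + 1)) / ?w - W 0) < r" by simp
  qed
qed

text \<open>Up to normalization, \<open>cos x ^ (2 * N + 1)\<close> is an approximate identity at \<open>0\<close>, and its normalized cosine
  coefficients lie between \<open>0\<close> and \<open>1\<close> and tend to \<open>1\<close>.\<close>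

lemma odd_cosine_series_at_0:
  fixes W :: "real \<Rightarrow> real"
  assumes W: "continuous_on {0..pi / 2} W"
    and \<alpha>: "\<And>k. \<alpha> k = integral {0..pi / 2} (\<lambda>x. W x * cos (real (2 * k + 1) * x))"
    and sum: "summable (\<lambda>k. \<bar>\<alpha> k\<bar>)"
  shows "W 0 = 4 / pi * (\<Sum>k. \<alpha> k)"
proof -
  have "integral {0..pi / 2} (\<lambda>x. W x * cos x ^ (2 * N + 1)) / wallis (2 * N + 2) = 4 / pi * (\<Sum>k. central_ratio N k * \<alpha> k)" for N
  proof -
    have hi: "((\<lambda>x. W x * cos (real (2 * k + 1) * x)) has_integral \<alpha> k) {0..pi / 2}" for k
      unfolding \<alpha> by (intro integrable_integral integrable_continuous_interval continuous_intros W)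
    have "((\<lambda>x. \<Sum>k<Suc N. real ((2 * N + 1) choose (N - k)) / 4 ^ N * (W x * cos (real (2 * k + 1) * x))) has_integral
        (\<Sum>k<Suc N. real ((2 * N + 1) choose (N - k)) / 4 ^ N * \<alpha> k)) {0..pi / 2}"
      by (intro has_integral_sum has_integral_mult_right hi) auto
    moreover have "(\<Sum>k<Suc N. real ((2 * N + 1) choose (N - k)) / 4 ^ N * (W x * cos (real (2 * k + 1) * x))) = W x * cos x ^ (2 * N + 1)" for x
      unfolding cos_odd_power_expansion sum_distrib_left by (rule sum.cong) simp_all
    ultimately have "integral {0..pi / 2} (\<lambda>x. W x * cos x ^ (2 * N + 1)) = (\<Sum>k<Suc N. real ((2 * N + 1) choose (N - k)) / 4 ^ N * \<alpha> k)"
      by (simp add: integral_unique)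
    also have "\<dots> = (\<Sum>k<Suc N. 4 / pi * wallis (2 * N + 2) * (central_ratio N k * \<alpha> k))"
    proof (rule sum.cong)
      fix k assume "k \<in> {..<Suc N}"
      moreover have "real ((2 * N + 1) choose N) > 0" by simp
      ultimately show "real ((2 * N + 1) choose (N - k)) / 4 ^ N * \<alpha> k = 4 / pi * wallis (2 * N + 2) * (central_ratio N k * \<alpha> k)"
        unfolding wallis_even_binomial central_ratio_def by simp
    qed simp
    also have "\<dots> = 4 / pi * wallis (2 * N + 2) * (\<Sum>k. central_ratio N k * \<alpha> k)"
    proof -
      have "(\<Sum>k. central_ratio N k * \<alpha> k) = (\<Sum>k<Suc N. central_ratio N k * \<alpha> k)"
        by (rule suminf_finite) (auto simp: central_ratio_def)
      then show ?thesis by (simp only: sum_distrib_left)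
    qed
    finally show ?thesis using wallis_pos[of "2 * N + 2"] by simp
  qed
  then have "(\<lambda>N. 4 / pi * (\<Sum>k. central_ratio N k * \<alpha> k)) \<longlonglongrightarrow> W 0"
    using cos_power_kernel_tendsto[OF W] by simp
  moreover have "(\<lambda>N. \<Sum>k. central_ratio N k * \<alpha> k) \<longlonglongrightarrow> (\<Sum>k. \<alpha> k)"
  proof -
    have "(\<lambda>N. central_ratio N k * \<alpha> k) \<longlonglongrightarrow> \<alpha> k" for k
      using tendsto_mult[OF central_ratio_tendsto tendsto_const, of k "\<alpha> k"] by simp
    moreover have "norm (central_ratio N k * \<alpha> k) \<le> \<bar>\<alpha> k\<bar>" for N k
      using central_ratio_bounds[of N k] by (simp add: abs_mult mult_left_le_one_le)
    then have "\<forall>\<^sub>F (k, N) in at_top \<times>\<^sub>F sequentially. norm (central_ratio N k * \<alpha> k) \<le> \<bar>\<alpha> k\<bar>"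
      by (intro always_eventually) auto
    ultimately show ?thesis
      using tannerys_theorem[of "\<lambda>k N. central_ratio N k * \<alpha> k" \<alpha> sequentially "\<lambda>k. \<bar>\<alpha> k\<bar>"] sum
      by (simp only: sequentially_bot not_False_eq_True)
  qed
  then have "(\<lambda>N. 4 / pi * (\<Sum>k. central_ratio N k * \<alpha> k)) \<longlonglongrightarrow> 4 / pi * (\<Sum>k. \<alpha> k)"
    by (intro tendsto_intros)
  ultimately show ?thesis by (rule LIMSEQ_unique)
qed

section \<open>The theta functional equation\<close>

lemma std_normal_cosine:
  shows "integrable lborel (\<lambda>x. std_normal_density x * cos (t * x))"
    and "(\<integral>x. std_normal_density x * cos (t * x) \<partial>lborel) = exp (- (t\<^sup>2 / 2))"
proof -
  interpret real_distribution std_normal_distribution by (rule real_dist_normal_dist)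
  have 1: "integrable std_normal_distribution (\<lambda>x. iexp (t * x))"
    using integrable_iexp[of "\<lambda>x. complex_of_real (t * x)"] by simp
  show "integrable lborel (\<lambda>x. std_normal_density x * cos (t * x))"
  proof (rule Bochner_Integration.integrable_bound)
    show "integrable lborel std_normal_density" by (rule integrable_normal_density) simp
    have "\<bar>std_normal_density x * cos (t * x)\<bar> \<le> \<bar>std_normal_density x\<bar>" for x
      using abs_cos_le_one[of "t * x"] by (simp add: abs_mult mult_left_le)
    then show "AE x in lborel. norm (std_normal_density x * cos (t * x)) \<le> norm (std_normal_density x)" by simp
  qed simp
  have "exp (- (t\<^sup>2 / 2)) = Re (char std_normal_distribution t)"
    by (simp add: char_std_normal_distribution)
  also have "\<dots> = (\<integral>x. Re (iexp (t * x)) \<partial>std_normal_distribution)"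
    unfolding char_def using 1 by (rule integral_Re[symmetric])
  also have "\<dots> = (\<integral>x. cos (t * x) \<partial>std_normal_distribution)" by (simp add: Re_exp)
  also have "\<dots> = (\<integral>x. std_normal_density x * cos (t * x) \<partial>lborel)"
    by (subst integral_density) (auto simp: normal_density_nonneg)
  finally show "(\<integral>x. std_normal_density x * cos (t * x) \<partial>lborel) = exp (- (t\<^sup>2 / 2))" by simp
qed

lemma gaussian_cosine:
  assumes "\<eta> > 0"
  shows "integrable lborel (\<lambda>x. exp (- (\<eta>\<^sup>2 * x\<^sup>2 / 2)) * cos (b * x))"
    and "(\<integral>x. exp (- (\<eta>\<^sup>2 * x\<^sup>2 / 2)) * cos (b * x) \<partial>lborel) = sqrt (2 * pi) / \<eta> * exp (- (b\<^sup>2 / (2 * \<eta>\<^sup>2)))"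
proof -
  let ?f = "\<lambda>x. std_normal_density x * cos (b / \<eta> * x)"
  have e: "exp (- (\<eta>\<^sup>2 * x\<^sup>2 / 2)) * cos (b * x) = sqrt (2 * pi) * ?f (0 + \<eta> * x)" for x
    using assms by (simp add: std_normal_density_def power_mult_distrib)
  have "integrable lborel (\<lambda>x. ?f (0 + \<eta> * x))"
    using assms by (intro lborel_integrable_real_affine std_normal_cosine) auto
  then show "integrable lborel (\<lambda>x. exp (- (\<eta>\<^sup>2 * x\<^sup>2 / 2)) * cos (b * x))"
    unfolding e by (rule integrable_mult_right)
  have "exp (- ((b / \<eta>)\<^sup>2 / 2)) = \<bar>\<eta>\<bar> *\<^sub>R (\<integral>x. ?f (0 + \<eta> * x) \<partial>lborel)"
    unfolding std_normal_cosine(2)[symmetric] using assms by (intro lborel_integral_real_affine) auto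
  then have "(\<integral>x. ?f (0 + \<eta> * x) \<partial>lborel) = exp (- ((b / \<eta>)\<^sup>2 / 2)) / \<eta>"
    using assms by (simp add: field_simps)
  then show "(\<integral>x. exp (- (\<eta>\<^sup>2 * x\<^sup>2 / 2)) * cos (b * x) \<partial>lborel) = sqrt (2 * pi) / \<eta> * exp (- (b\<^sup>2 / (2 * \<eta>\<^sup>2)))"
    unfolding e by (simp add: power_divide mult.commute)
qed

lemma gaussian_cosine_half_line:
  assumes "\<eta> > 0"
  shows "((\<lambda>X. integral {0..X} (\<lambda>x. exp (- (\<eta>\<^sup>2 * x\<^sup>2 / 2)) * cos (b * x))) \<longlongrightarrow>
     sqrt (pi / 2) / \<eta> * exp (- (b\<^sup>2 / (2 * \<eta>\<^sup>2)))) at_top"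
proof -
  define h where "h x = exp (- (\<eta>\<^sup>2 * x\<^sup>2 / 2)) * cos (b * x)" for x
  note int = gaussian_cosine(1)[OF assms, of b, folded h_def]
  have cont: "continuous_on A h" for A unfolding h_def by (intro continuous_intros) auto
  have "((\<lambda>X. \<integral>x. indicator {-X..X} x *\<^sub>R h x \<partial>lborel) \<longlongrightarrow> (\<integral>x. h x \<partial>lborel)) at_top"
  proof (rule integral_dominated_convergence_at_top)
    show "integrable lborel (\<lambda>x. norm (h x))" using int by (rule integrable_norm)
    show "AE x in lborel. ((\<lambda>X. indicator {-X..X} x *\<^sub>R h x) \<longlongrightarrow> h x) at_top"
    proof (intro AE_I2 tendsto_eventually)
      fix x
      show "\<forall>\<^sub>F X in at_top. indicator {-X..X} x *\<^sub>R h x = h x"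
        using eventually_ge_at_top[of "\<bar>x\<bar>"] by eventually_elim (auto simp: indicator_def)
    qed
    show "\<forall>\<^sub>F X in at_top. AE x in lborel. norm (indicator {-X..X} x *\<^sub>R h x) \<le> norm (h x)"
      by (intro always_eventually allI AE_I2) (auto simp: indicator_def)
  qed (use int in auto)
  moreover have "\<forall>\<^sub>F X in at_top. (\<integral>x. indicator {-X..X} x *\<^sub>R h x \<partial>lborel) = 2 * integral {0..X} h"
    using eventually_ge_at_top[of 0]
  proof eventually_elim
    case (elim X)
    have "set_integrable lborel {-X..X} h"
      unfolding set_integrable_def by (rule integrable_mult_indicator) (use int in auto)
    then have "(\<integral>x. indicator {-X..X} x *\<^sub>R h x \<partial>lborel) = integral {-X..X} h"
      using set_borel_integral_eq_integral(2) unfolding set_lebesgue_integral_def by blast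
    also have "\<dots> = integral {-X..0} h + integral {0..X} h"
      using elim by (intro Henstock_Kurzweil_Integration.integral_combine[symmetric] integrable_continuous_interval cont) auto
    also have "integral {-X..0} h = integral {0..X} h"
    proof -
      have "(\<lambda>x. h (- x)) = h" by (simp add: h_def fun_eq_iff)
      then show ?thesis using Henstock_Kurzweil_Integration.integral_reflect_real[of X 0 h] by simp
    qed
    finally show ?case by simp
  qed
  ultimately have "((\<lambda>X. 2 * integral {0..X} h) \<longlongrightarrow> (\<integral>x. h x \<partial>lborel)) at_top"
    by (rule Lim_transform_eventually)
  then have "((\<lambda>X. 1 / 2 * (2 * integral {0..X} h)) \<longlongrightarrow> 1 / 2 * (\<integral>x. h x \<partial>lborel)) at_top" by (rule tendsto_mult_left)
  moreover have "1 / 2 * (\<integral>x. h x \<partial>lborel) = sqrt (pi / 2) / \<eta> * exp (- (b\<^sup>2 / (2 * \<eta>\<^sup>2)))"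
  proof -
    have "sqrt (2 * pi) = sqrt (4 * (pi / 2))" by simp
    also have "\<dots> = 2 * sqrt (pi / 2)" unfolding real_sqrt_mult by simp
    finally show ?thesis unfolding h_def gaussian_cosine(2)[OF assms] by simp
  qed
  ultimately show ?thesis by (simp add: h_def[abs_def])
qed

text \<open>Integration by parts: z exp (- \<eta>^2 z^2 / 2) is - 1 / \<eta>^2 times the derivative
  of the Gaussian, so the sine transform reduces to the cosine transform. The integral starts at -1
  to be differentiable at 0.\<close>

lemma gaussian_sine_primitive:
  assumes "\<eta> > 0"
  obtains S where "\<And>z. z > -1 \<Longrightarrow> (S has_real_derivative z * exp (- (\<eta>\<^sup>2 * z\<^sup>2 / 2)) * sin (b * z)) (at z)"
    "((\<lambda>z. S z - S 0) \<longlongrightarrow> b / \<eta> ^ 3 * sqrt (pi / 2) * exp (- (b\<^sup>2 / (2 * \<eta>\<^sup>2)))) at_top"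
proof -
  define h where "h x = exp (- (\<eta>\<^sup>2 * x\<^sup>2 / 2)) * cos (b * x)" for x
  define E where "E z = exp (- (\<eta>\<^sup>2 * z\<^sup>2 / 2))" for z
  define S where "S z = b / \<eta>\<^sup>2 * integral {-1..z} h - 1 / \<eta>\<^sup>2 * (E z * sin (b * z))" for z
  have cont: "continuous_on A h" for A unfolding h_def by (intro continuous_intros) auto
  have "(S has_real_derivative z * exp (- (\<eta>\<^sup>2 * z\<^sup>2 / 2)) * sin (b * z)) (at z)" if "z > -1" for z
  proof -
    have d1: "((\<lambda>z. integral {-1..z} h) has_real_derivative h z) (at z)"
      using that by (intro DERIV_integral_lower cont)
    have d2: "((\<lambda>z. E z * sin (b * z)) has_real_derivative E z * (b * cos (b * z)) - \<eta>\<^sup>2 * (z * E z * sin (b * z))) (at z)"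
      unfolding E_def by (auto intro!: derivative_eq_intros simp: algebra_simps)
    have "(S has_real_derivative b / \<eta>\<^sup>2 * h z - 1 / \<eta>\<^sup>2 * (E z * (b * cos (b * z)) - \<eta>\<^sup>2 * (z * E z * sin (b * z)))) (at z)"
      unfolding S_def[abs_def] by (intro DERIV_diff DERIV_cmult d1 d2)
    moreover have "b / \<eta>\<^sup>2 * h z - 1 / \<eta>\<^sup>2 * (E z * (b * cos (b * z)) - \<eta>\<^sup>2 * (z * E z * sin (b * z))) = z * E z * sin (b * z)"
      using assms by (simp add: h_def E_def right_diff_distrib)
    ultimately show ?thesis by (simp add: E_def)
  qed
  moreover have "((\<lambda>z. S z - S 0) \<longlongrightarrow> b / \<eta> ^ 3 * sqrt (pi / 2) * exp (- (b\<^sup>2 / (2 * \<eta>\<^sup>2)))) at_top"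
  proof -
    have "(E \<longlongrightarrow> 0) at_top" unfolding E_def[abs_def] using assms by real_asymp
    then have "((\<lambda>z. E z * sin (b * z)) \<longlongrightarrow> 0) at_top"
    proof (rule Lim_null_comparison[rotated])
      show "\<forall>\<^sub>F z in at_top. norm (E z * sin (b * z)) \<le> E z"
        by (intro always_eventually allI) (simp add: E_def abs_mult mult_left_le)
    qed
    then have "((\<lambda>z. b / \<eta>\<^sup>2 * integral {0..z} h - 1 / \<eta>\<^sup>2 * (E z * sin (b * z))) \<longlongrightarrow>
       b / \<eta>\<^sup>2 * (sqrt (pi / 2) / \<eta> * exp (- (b\<^sup>2 / (2 * \<eta>\<^sup>2)))) - 1 / \<eta>\<^sup>2 * 0) at_top"
      using gaussian_cosine_half_line[OF assms, of b] by (intro tendsto_intros) (auto simp: h_def[abs_def])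
    moreover have "\<forall>\<^sub>F z in at_top. b / \<eta>\<^sup>2 * integral {0..z} h - 1 / \<eta>\<^sup>2 * (E z * sin (b * z)) = S z - S 0"
      using eventually_ge_at_top[of 0]
    proof eventually_elim
      case (elim z)
      have "integral {-1..0} h + integral {0..z} h = integral {-1..z} h"
        using elim by (intro Henstock_Kurzweil_Integration.integral_combine integrable_continuous_interval cont) auto
      then have "integral {-1..z} h = integral {-1..0} h + integral {0..z} h" by simp
      then show ?case by (simp add: S_def distrib_left)
    qed
    ultimately have "((\<lambda>z. S z - S 0) \<longlongrightarrow> b / \<eta>\<^sup>2 * (sqrt (pi / 2) / \<eta> * exp (- (b\<^sup>2 / (2 * \<eta>\<^sup>2)))) - 1 / \<eta>\<^sup>2 * 0) at_top"
      by (rule Lim_transform_eventually)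
    moreover have "b / \<eta>\<^sup>2 * (sqrt (pi / 2) / \<eta> * exp (- (b\<^sup>2 / (2 * \<eta>\<^sup>2)))) - 1 / \<eta>\<^sup>2 * 0 = b / \<eta> ^ 3 * sqrt (pi / 2) * exp (- (b\<^sup>2 / (2 * \<eta>\<^sup>2)))"
      by (simp add: power2_eq_square power3_eq_cube)
    ultimately show ?thesis by simp
  qed
  ultimately show ?thesis using that by blast
qed

lemma summable_inverse_squares: "summable (\<lambda>k. 1 / (1 + real k)\<^sup>2)" "(\<Sum>k. 1 / (1 + real k)\<^sup>2) \<le> 2"
proof -
  have b: "(\<Sum>k<m. 1 / (1 + real k)\<^sup>2) \<le> 2" for m using sum_inverse_squares_le[of 1 m] by simp
  show s: "summable (\<lambda>k. 1 / (1 + real k)\<^sup>2)"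
    by (rule bounded_imp_summable[of _ 2]) (use b[of "Suc _"] in \<open>auto simp: lessThan_Suc_atMost[symmetric] simp del: sum.lessThan_Suc\<close>)
  show "(\<Sum>k. 1 / (1 + real k)\<^sup>2) \<le> 2" using s b by (rule suminf_le_const)
qed

lemma gauss_moment_bound:
  assumes "(c :: real) > 0"
  obtains C where "C \<ge> 0" "\<And>z. z \<ge> 0 \<Longrightarrow> z * exp (- (c\<^sup>2 * z\<^sup>2 / 2)) \<le> C / (1 + z)\<^sup>2"
proof
  \<comment> \<open>This scaling makes s^2 / 4 equal to c^2 z^2 / 2, so
    \<open>power_times_gaussian_le\<close> applies with k = 3; hence exp 9.\<close>
  define d where "d = sqrt 2 * c"
  have d: "d > 0" using assms by (simp add: d_def)
  let ?C = "(1 + 1 / d) ^ 3 * exp 9"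
  show "?C \<ge> 0" using d by simp
  fix z :: real assume z: "z \<ge> 0"
  define s where "s = d * z"
  have s: "s \<ge> 0" using d z by (simp add: s_def)
  have zs: "1 + z \<le> (1 + 1 / d) * (1 + s)" using d z by (simp add: s_def algebra_simps)
  have "z * (1 + z)\<^sup>2 \<le> (1 + z) * (1 + z)\<^sup>2" using z by (intro mult_right_mono) auto
  also have "\<dots> = (1 + z) ^ 3" by (simp add: power2_eq_square power3_eq_cube)
  also have "\<dots> \<le> ((1 + 1 / d) * (1 + s)) ^ 3" using zs z by (intro power_mono) auto
  finally have "z * (1 + z)\<^sup>2 * exp (- (s\<^sup>2 / 4)) \<le> ((1 + 1 / d) * (1 + s)) ^ 3 * exp (- (s\<^sup>2 / 4))"
    by (intro mult_right_mono) auto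
  also have "\<dots> = (1 + 1 / d) ^ 3 * ((1 + s) ^ 3 * exp (- (s\<^sup>2 / 4)))" by (simp add: power_mult_distrib)
  also have "\<dots> \<le> (1 + 1 / d) ^ 3 * exp ((real 3)\<^sup>2)"
    using d by (intro mult_left_mono power_times_gaussian_le s) auto
  finally have "z * (1 + z)\<^sup>2 * exp (- (s\<^sup>2 / 4)) \<le> ?C" by simp
  moreover have "s\<^sup>2 / 4 = c\<^sup>2 * z\<^sup>2 / 2" by (simp add: s_def d_def power_mult_distrib)
  ultimately have "z * exp (- (c\<^sup>2 * z\<^sup>2 / 2)) * (1 + z)\<^sup>2 \<le> ?C" by (simp only: mult_ac)
  then show "z * exp (- (c\<^sup>2 * z\<^sup>2 / 2)) \<le> ?C / (1 + z)\<^sup>2" using z by (subst pos_le_divide_eq) auto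
qed

lemma gauss_odd_bound:
  assumes "(c :: real) > 0"
  obtains C where "C \<ge> 0" "\<And>k::nat. (2 * real k + 1) * exp (- (c\<^sup>2 * (2 * real k + 1)\<^sup>2 / 2)) \<le> C * (1 / (1 + real k)\<^sup>2)"
proof -
  obtain C where C: "C \<ge> 0" "\<And>z. z \<ge> 0 \<Longrightarrow> z * exp (- (c\<^sup>2 * z\<^sup>2 / 2)) \<le> C / (1 + z)\<^sup>2"
    using gauss_moment_bound[OF assms] by blast
  have "(2 * real k + 1) * exp (- (c\<^sup>2 * (2 * real k + 1)\<^sup>2 / 2)) \<le> C * (1 / (1 + real k)\<^sup>2)" for k
  proof -
    have "(2 * real k + 1) * exp (- (c\<^sup>2 * (2 * real k + 1)\<^sup>2 / 2)) \<le> C / (1 + (2 * real k + 1))\<^sup>2" by (rule C) simp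
    also have "\<dots> \<le> C / (1 + real k)\<^sup>2" using C(1) by (intro divide_left_mono power_mono mult_pos_pos zero_less_power) auto
    finally show ?thesis by simp
  qed
  with C(1) that show ?thesis by blast
qed

lemma summable_gauss_odd:
  assumes "(c :: real) > 0"
  shows "summable (\<lambda>k. (2 * real k + 1) * exp (- (c\<^sup>2 * (2 * real k + 1)\<^sup>2 / 2)))"
proof -
  obtain C where C: "\<And>k::nat. (2 * real k + 1) * exp (- (c\<^sup>2 * (2 * real k + 1)\<^sup>2 / 2)) \<le> C * (1 / (1 + real k)\<^sup>2)"
    using gauss_odd_bound[OF assms] by blast
  have "summable (\<lambda>k. C * (1 / (1 + real k)\<^sup>2))" by (rule summable_mult[OF summable_inverse_squares(1)])
  then show ?thesis by (rule summable_comparison_test') (use C in simp)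
qed

text \<open>Poisson summation by hand. \<open>W\<close> is the signed periodization of the odd
  function g and equals twice the left side at 0. Its odd cosine coefficients unfold, because the
  intervals from 2 k to 2 k + 2 tile the half-line, to the sine transform of g, which is Gaussian
  again. Summing the cosine series at 0 gives the right side.\<close>

theorem theta_functional_equation:
  assumes \<eta>: "\<eta> > 0"
  shows "(\<Sum>k. (-1) ^ k * ((2 * real k + 1) * exp (- (\<eta>\<^sup>2 * (2 * real k + 1)\<^sup>2 / 2)))) =
    pi / 2 * sqrt (pi / 2) / \<eta> ^ 3 *
    (\<Sum>k. (-1) ^ k * ((2 * real k + 1) * exp (- ((pi / (2 * \<eta>))\<^sup>2 * (2 * real k + 1)\<^sup>2 / 2))))"
proof -
  define g where "g z = z * exp (- (\<eta>\<^sup>2 * z\<^sup>2 / 2))" for z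
  define f where "f k x = (-1) ^ k * (g (2 * real k + 1 + 2 * x / pi) + g (2 * real k + 1 - 2 * x / pi))" for k x
  define W where "W x = (\<Sum>k. f k x)" for x
  define \<beta> where "\<beta> i = (-1) ^ i * ((2 * real i + 1) * exp (- ((pi / (2 * \<eta>))\<^sup>2 * (2 * real i + 1)\<^sup>2 / 2)))" for i :: nat
  define \<alpha> where "\<alpha> k = integral {0..pi / 2} (\<lambda>x. W x * cos (real (2 * k + 1) * x))" for k
  obtain C where C: "C \<ge> 0" "\<And>z. z \<ge> 0 \<Longrightarrow> g z \<le> C / (1 + z)\<^sup>2"
    using gauss_moment_bound[OF \<eta>] unfolding g_def by blast
  have f_bound: "norm (f k x) \<le> 2 * C * (1 / (1 + real k)\<^sup>2)" if "x \<in> {0..pi / 2}" for k x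
  proof -
    have y: "0 \<le> 2 * x / pi" "2 * x / pi \<le> 1" using that by (auto simp: field_simps)
    have gb: "\<bar>g z\<bar> \<le> C * (1 / (1 + real k)\<^sup>2)" if "z \<ge> 2 * real k" for z
    proof -
      have z: "z \<ge> real k" "z \<ge> 0" using that by linarith+
      then have "\<bar>g z\<bar> = g z" by (simp add: g_def)
      also have "\<dots> \<le> C / (1 + z)\<^sup>2" using z by (intro C) auto
      also have "\<dots> \<le> C / (1 + real k)\<^sup>2" using C(1) z by (intro divide_left_mono power_mono mult_pos_pos zero_less_power) auto
      finally show ?thesis by simp
    qed
    have "\<bar>f k x\<bar> \<le> \<bar>g (2 * real k + 1 + 2 * x / pi)\<bar> + \<bar>g (2 * real k + 1 - 2 * x / pi)\<bar>"
      unfolding f_def abs_mult by simp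
    also have "\<dots> \<le> C * (1 / (1 + real k)\<^sup>2) + C * (1 / (1 + real k)\<^sup>2)"
      using y by (intro add_mono gb) linarith+
    finally show ?thesis by simp
  qed
  have sumM: "summable (\<lambda>k. 2 * C * (1 / (1 + real k)\<^sup>2))" by (rule summable_mult[OF summable_inverse_squares(1)])
  have cf: "continuous_on A (f k)" for A k unfolding f_def[abs_def] g_def by (intro continuous_intros) auto
  have "uniform_limit {0..pi / 2} (\<lambda>n x. \<Sum>k<n. f k x) W sequentially"
    unfolding W_def by (rule Weierstrass_m_test[OF f_bound sumM]) auto
  then have cW: "continuous_on {0..pi / 2} W"
    by (rule uniform_limit_theorem[rotated]) (auto intro!: always_eventually continuous_on_sum cf)
  have \<alpha>: "\<alpha> i = pi / 2 * ((pi / 2) / \<eta> ^ 3 * sqrt (pi / 2)) * \<beta> i" for i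
  proof -
    define m where "m = real (2 * i + 1)"
    define b where "b = m * pi / 2"
    obtain S where S: "\<And>z. z > -1 \<Longrightarrow> (S has_real_derivative z * exp (- (\<eta>\<^sup>2 * z\<^sup>2 / 2)) * sin (b * z)) (at z)"
      "((\<lambda>z. S z - S 0) \<longlongrightarrow> b / \<eta> ^ 3 * sqrt (pi / 2) * exp (- (b\<^sup>2 / (2 * \<eta>\<^sup>2)))) at_top"
      using gaussian_sine_primitive[OF \<eta>, of b] by blast
    \<comment> \<open>At the midpoint of a tile the sine is 1 or -1 and the cosine is 0. So at
      distance 2 x / pi on either side of the midpoint the sine takes the same value, a sign times
      cos (m x).\<close>
    have sin_odd: "sin (b * (2 * real k + 1)) = (-1) ^ (k + i)" "cos (b * (2 * real k + 1)) = 0" for k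
    proof -
      have e: "b * (2 * real k + 1) = pi / 2 + real (2 * k * i + k + i) * pi"
        by (simp add: b_def m_def algebra_simps)
      have "(-1 :: real) ^ (2 * k * i + k + i) = (-1) ^ (k + i)" by (simp add: power_add power_mult)
      then show "sin (b * (2 * real k + 1)) = (-1) ^ (k + i)"
        unfolding e sin_add by (simp only: sin_pi_half cos_pi_half sin_npi cos_npi mult_1 mult_zero_left add_0_right)
      show "cos (b * (2 * real k + 1)) = 0"
        unfolding e cos_add by (simp only: cos_pi_half sin_npi mult_zero_left mult_zero_right diff_self)
    qed
    \<comment> \<open>The two terms of \<open>f k\<close> cover the two halves of one tile, so the
      integral is the increment of the primitive \<open>S\<close> over the tile, and the sum over k
      telescopes.\<close>
    have fI: "((\<lambda>x. f k x * cos (m * x)) has_integral (-1) ^ i * (pi / 2) * (S (2 * real (Suc k)) - S (2 * real k))) {0..pi / 2}" for k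
    proof -
      let ?Q = "\<lambda>x. (-1) ^ i * (pi / 2) * (S (2 * real k + 1 + 2 * x / pi) - S (2 * real k + 1 - 2 * x / pi))"
      have "((\<lambda>x. f k x * cos (m * x)) has_integral (?Q (pi / 2) - ?Q 0)) {0..pi / 2}"
      proof (rule fundamental_theorem_of_calculus)
        fix x assume x: "x \<in> {0..pi / 2}"
        have y: "0 \<le> 2 * x / pi" "2 * x / pi \<le> 1" using x by (auto simp: field_simps)
        let ?\<sigma> = "\<lambda>z. g z * sin (b * z)"
        have dp: "((\<lambda>x. S (2 * real k + 1 + 2 * x / pi)) has_real_derivative ?\<sigma> (2 * real k + 1 + 2 * x / pi) * (2 / pi)) (at x)"
        proof (rule DERIV_chain2[of S])
          show "(S has_real_derivative ?\<sigma> (2 * real k + 1 + 2 * x / pi)) (at (2 * real k + 1 + 2 * x / pi))"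
            unfolding g_def using y by (intro S) linarith
        qed (auto intro!: derivative_eq_intros)
        have dm: "((\<lambda>x. S (2 * real k + 1 - 2 * x / pi)) has_real_derivative ?\<sigma> (2 * real k + 1 - 2 * x / pi) * (- (2 / pi))) (at x)"
        proof (rule DERIV_chain2[of S])
          show "(S has_real_derivative ?\<sigma> (2 * real k + 1 - 2 * x / pi)) (at (2 * real k + 1 - 2 * x / pi))"
            unfolding g_def using y by (intro S) linarith
        qed (auto intro!: derivative_eq_intros)
        have "(?Q has_real_derivative (-1) ^ i * (pi / 2) *
           (?\<sigma> (2 * real k + 1 + 2 * x / pi) * (2 / pi) - ?\<sigma> (2 * real k + 1 - 2 * x / pi) * (- (2 / pi)))) (at x)"
          by (intro DERIV_cmult DERIV_diff dp dm)
        moreover have "(-1) ^ i * (pi / 2) *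
           (?\<sigma> (2 * real k + 1 + 2 * x / pi) * (2 / pi) - ?\<sigma> (2 * real k + 1 - 2 * x / pi) * (- (2 / pi))) = f k x * cos (m * x)"
        proof -
          have bx: "b * (2 * x / pi) = m * x" by (simp add: b_def)
          have "sin (b * (2 * real k + 1 + 2 * x / pi)) = sin (b * (2 * real k + 1) + m * x)"
            "sin (b * (2 * real k + 1 - 2 * x / pi)) = sin (b * (2 * real k + 1) - m * x)"
            using bx by (simp_all only: distrib_left right_diff_distrib)
          then have s: "sin (b * (2 * real k + 1 + 2 * x / pi)) = (-1) ^ (k + i) * cos (m * x)"
            "sin (b * (2 * real k + 1 - 2 * x / pi)) = (-1) ^ (k + i) * cos (m * x)"
            by (simp_all only: sin_add sin_diff sin_odd mult_zero_left add_0_right diff_0_right)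
          have ii: "(-1) ^ i * (-1) ^ (k + i) = ((-1) ^ k :: real)" by (simp add: power_add mult.left_commute)
          have "(-1) ^ i * (pi / 2) * (u * ((-1) ^ (k + i) * c) * (2 / pi) - v * ((-1) ^ (k + i) * c) * (- (2 / pi)))
              = ((-1) ^ i * (-1) ^ (k + i)) * (u + v) * c" for u v c :: real
            by (simp add: algebra_simps)
          then show ?thesis unfolding s f_def ii .
        qed
        ultimately show "(?Q has_vector_derivative f k x * cos (m * x)) (at x within {0..pi / 2})"
          by (simp only: has_real_derivative_iff_has_vector_derivative[symmetric] has_field_derivative_at_within)
      qed simp
      moreover have "?Q (pi / 2) - ?Q 0 = (-1) ^ i * (pi / 2) * (S (2 * real (Suc k)) - S (2 * real k))"
        by (simp add: algebra_simps)
      ultimately show ?thesis by (simp only:)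
    qed
    have uni: "uniform_limit {0..pi / 2} (\<lambda>n x. \<Sum>k<n. f k x * cos (m * x)) (\<lambda>x. \<Sum>k. f k x * cos (m * x)) sequentially"
    proof (rule Weierstrass_m_test[OF _ sumM])
      fix k x assume "x \<in> {0..pi / 2}"
      then have "norm (f k x) * norm (cos (m * x)) \<le> 2 * C * (1 / (1 + real k)\<^sup>2) * 1"
        using C(1) by (intro mult_mono f_bound) auto
      then show "norm (f k x * cos (m * x)) \<le> 2 * C * (1 / (1 + real k)\<^sup>2)" by (simp add: abs_mult)
    qed
    have cs: "continuous_on {0..pi / 2} (\<lambda>x. \<Sum>k<n. f k x * cos (m * x))" for n
      by (intro continuous_on_sum continuous_intros cf)
    obtain I' J' where IJ: "\<And>n. ((\<lambda>x. \<Sum>k<n. f k x * cos (m * x)) has_integral I' n) {0..pi / 2}"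
      "((\<lambda>x. \<Sum>k. f k x * cos (m * x)) has_integral J') {0..pi / 2}" "I' \<longlonglongrightarrow> J'"
      using uniform_limit_integral[OF uni cs sequentially_bot] by blast
    have "I' n = (-1) ^ i * (pi / 2) * (S (2 * real n) - S 0)" for n
    proof -
      have "((\<lambda>x. \<Sum>k<n. f k x * cos (m * x)) has_integral (\<Sum>k<n. (-1) ^ i * (pi / 2) * (S (2 * real (Suc k)) - S (2 * real k)))) {0..pi / 2}"
        by (intro has_integral_sum fI) auto
      also have "(\<Sum>k<n. (-1) ^ i * (pi / 2) * (S (2 * real (Suc k)) - S (2 * real k))) = (-1) ^ i * (pi / 2) * (S (2 * real n) - S (2 * real 0))"
        unfolding sum_distrib_left[symmetric] by (subst sum_lessThan_telescope) (rule refl)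
      finally show ?thesis using has_integral_unique[OF IJ(1)[of n]] by simp
    qed
    then have I': "I' = (\<lambda>n. (-1) ^ i * (pi / 2) * (S (2 * real n) - S 0))" by (rule ext)
    have top: "filterlim (\<lambda>n. 2 * real n) at_top sequentially" by real_asymp
    have "(\<lambda>n. (-1) ^ i * (pi / 2) * (S (2 * real n) - S 0)) \<longlonglongrightarrow> (-1) ^ i * (pi / 2) * (b / \<eta> ^ 3 * sqrt (pi / 2) * exp (- (b\<^sup>2 / (2 * \<eta>\<^sup>2))))"
      by (intro tendsto_mult_left filterlim_compose[OF S(2) top])
    then have J': "J' = (-1) ^ i * (pi / 2) * (b / \<eta> ^ 3 * sqrt (pi / 2) * exp (- (b\<^sup>2 / (2 * \<eta>\<^sup>2))))"
      using IJ(3) unfolding I' by (intro LIMSEQ_unique)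
    have "\<alpha> i = integral {0..pi / 2} (\<lambda>x. \<Sum>k. f k x * cos (m * x))"
      unfolding \<alpha>_def
    proof (rule integral_cong)
      fix x assume "x \<in> {0..pi / 2}"
      then have "summable (\<lambda>k. f k x)" using f_bound by (intro summable_comparison_test'[OF sumM]) auto
      then show "W x * cos (real (2 * i + 1) * x) = (\<Sum>k. f k x * cos (m * x))"
        unfolding W_def m_def by (rule suminf_mult2)
    qed
    also have "\<dots> = J'" using IJ(2) by (rule integral_unique)
    finally have "\<alpha> i = J'" .
    moreover have "(m * pi / 2)\<^sup>2 / (2 * \<eta>\<^sup>2) = (pi / (2 * \<eta>))\<^sup>2 * m\<^sup>2 / 2"
      using \<eta> by (simp add: power_mult_distrib power_divide)
    moreover have "(-1) ^ i * (pi / 2) * ((m * pi / 2) / \<eta> ^ 3 * sqrt (pi / 2) * E)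
        = pi / 2 * ((pi / 2) / \<eta> ^ 3 * sqrt (pi / 2)) * ((-1) ^ i * (m * E))" for E
      by simp
    moreover have "2 * real i + 1 = m" by (simp add: m_def)
    ultimately show ?thesis unfolding J' \<beta>_def b_def by (simp only:)
  qed
  have "summable (\<lambda>k. \<bar>\<beta> k\<bar>)"
    unfolding \<beta>_def abs_mult using summable_gauss_odd[of "pi / (2 * \<eta>)"] \<eta> by simp
  then have sb: "summable \<beta>" "summable (\<lambda>k. \<bar>\<alpha> k\<bar>)"
    unfolding \<alpha> abs_mult by (auto intro!: summable_mult dest: summable_rabs_cancel)
  have "W 0 = 4 / pi * (\<Sum>k. \<alpha> k)"
    by (rule odd_cosine_series_at_0[OF cW \<alpha>_def sb(2)])
  also have "(\<Sum>k. \<alpha> k) = pi / 2 * ((pi / 2) / \<eta> ^ 3 * sqrt (pi / 2)) * (\<Sum>k. \<beta> k)"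
    unfolding \<alpha> by (rule suminf_mult[OF sb(1)])
  also have "4 / pi * \<dots> = 2 * (pi / 2 * sqrt (pi / 2) / \<eta> ^ 3 * (\<Sum>k. \<beta> k))" by simp
  also have "W 0 = 2 * (\<Sum>k. (-1) ^ k * ((2 * real k + 1) * exp (- (\<eta>\<^sup>2 * (2 * real k + 1)\<^sup>2 / 2))))"
  proof -
    have "summable (\<lambda>k. \<bar>(-1) ^ k * ((2 * real k + 1) * exp (- (\<eta>\<^sup>2 * (2 * real k + 1)\<^sup>2 / 2)))\<bar>)"
      unfolding abs_mult using summable_gauss_odd[OF \<eta>] by simp
    then have "summable (\<lambda>k. (-1) ^ k * ((2 * real k + 1) * exp (- (\<eta>\<^sup>2 * (2 * real k + 1)\<^sup>2 / 2))))"
      by (rule summable_rabs_cancel)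
    from suminf_mult[OF this, of 2] show ?thesis
      unfolding W_def f_def g_def by (simp add: mult_ac)
  qed
  finally show ?thesis unfolding \<beta>_def by simp
qed

section \<open>Moments up to order two\<close>

lemma wclass_spectral: "wclass True 1 spectral"
  using wclass_mono[of True 1 0 1 0 0] by (simp add: spectral_def[abs_def])

lemma spectral_beyond: "n > 0 \<Longrightarrow> \<bar>x\<bar> \<ge> pi / 2 \<Longrightarrow> spectral n x = 0"
  by (simp add: spectral_def cos_cut_eq_0)

text \<open>Unnormalized, and taken of h + 1 instead of h: the barrier position h + 1 is the
  variable in which the spectral formula is homogeneous.\<close>

definition moment :: "nat \<Rightarrow> nat \<Rightarrow> real" where
  "moment r n = (\<Sum>h\<le>n. real (Suc h) ^ r * prob_max_at n h)"

lemma moment_0: "moment 0 n = prob_max n"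
  by (simp add: moment_def prob_max_eq_sum)

lemma radial_spectral:
  assumes "n > 0" "even (n + h)"
  shows "4 * radial (int r - 1) (spectral n) (real (Suc h)) = real (Suc h) ^ r * prob_max_at n h"
proof -
  have "real (Suc h) powi (int r - 1) = real (Suc h) powi int r / real (Suc h)"
    by (subst power_int_diff) auto
  then show ?thesis
    using assms by (simp add: radial_def prob_max_at_eq_alt_sum del: of_nat_Suc)
qed

text \<open>The spectral formula needs n + h even, so the barrier h + 1 has the parity opposite to
  n: the progression starts at 1 for even n and at 2 for odd n. Of each pair 2 k, 2 k + 1 only one
  height contributes.\<close>

lemma radial_spectral_sums:
  assumes "n > 0"
  shows "(\<lambda>m. \<Sum>k<m. radial (int r - 1) (spectral n) ((if even n then 1 else 2) + real k * 2))
    \<longlonglongrightarrow> moment r n / 4"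
proof (rule tendsto_eventually)
  define q where "q h = real (Suc h) ^ r * prob_max_at n h" for h
  show "\<forall>\<^sub>F m in sequentially. (\<Sum>k<m. radial (int r - 1) (spectral n) ((if even n then 1 else 2) + real k * 2)) = moment r n / 4"
    using eventually_gt_at_top[of n]
  proof eventually_elim
    case (elim m)
    have "(\<Sum>k<m. radial (int r - 1) (spectral n) ((if even n then 1 else 2) + real k * 2)) =
        (\<Sum>k<m. (q (2 * k) + q (2 * k + 1)) / 4)"
    proof (rule sum.cong)
      fix k
      show "radial (int r - 1) (spectral n) ((if even n then 1 else 2) + real k * 2) = (q (2 * k) + q (2 * k + 1)) / 4"
      proof (cases "even n")
        case True
        then have "q (2 * k + 1) = 0" using prob_max_at_eq_alt_sum[OF assms, of "2 * k + 1"] by (simp add: q_def)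
        moreover have "4 * radial (int r - 1) (spectral n) (real (Suc (2 * k))) = q (2 * k)"
          unfolding q_def using True assms by (intro radial_spectral) auto
        moreover have "real (Suc (2 * k)) = 1 + real k * 2" by simp
        ultimately show ?thesis using True by (simp add: mult.commute)
      next
        case False
        then have "q (2 * k) = 0" using prob_max_at_eq_alt_sum[OF assms, of "2 * k"] by (simp add: q_def)
        moreover have "4 * radial (int r - 1) (spectral n) (real (Suc (2 * k + 1))) = q (2 * k + 1)"
          unfolding q_def using False assms by (intro radial_spectral) auto
        moreover have "real (Suc (2 * k + 1)) = 2 + real k * 2" by simp
        ultimately show ?thesis using False by (simp add: mult.commute)
      qed
    qed simp
    also have "\<dots> = (\<Sum>h<2 * m. q h) / 4" by (simp only: sum_lessThan_double sum_divide_distrib)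
    also have "(\<Sum>h<2 * m. q h) = (\<Sum>h\<le>n. q h)"
      using elim by (intro sum.mono_neutral_right) (auto simp: q_def prob_max_at_eq_0)
    finally show ?case by (simp add: moment_def q_def)
  qed
qed

text \<open>The sum over the progression is a quarter of the moment and about half of the integral
  l, hence 2 l. Using K + r derivatives absorbs the growth of the r-th moment.\<close>

lemma moment_asymptotics:
  "\<exists>C\<ge>0. \<forall>\<^sub>F n in sequentially. \<forall>J l.
     (\<forall>x\<ge>0. (J has_real_derivative radial (int r - 1) (spectral n) x) (at x)) \<longrightarrow> J 0 = 0 \<longrightarrow> (J \<longlongrightarrow> l) at_top \<longrightarrow>
     \<bar>moment r n - 2 * l\<bar> \<le> C * sqrt n powi (- int K)"
proof -
  obtain C where C: "C \<ge> 0" "\<forall>\<^sub>F n in sequentially. \<forall>J l t A.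
     (\<forall>x\<ge>0. (J has_real_derivative radial (int r - 1) (spectral n) x) (at x)) \<longrightarrow> J 0 = 0 \<longrightarrow> (J \<longlongrightarrow> l) at_top \<longrightarrow>
     0 \<le> t \<longrightarrow> t \<le> 2 \<longrightarrow> (\<lambda>m. \<Sum>k<m. radial (int r - 1) (spectral n) (t + real k * 2)) \<longlonglongrightarrow> A \<longrightarrow>
     \<bar>A - l / 2\<bar> \<le> C * sqrt n powi (int r - 1 - 1 + 1 - int (K + r))"
    using radial_sum_asymptotics[OF wclass_spectral, of "int r - 1" "K + r"] by blast
  have "\<forall>\<^sub>F n in sequentially. \<forall>J l.
     (\<forall>x\<ge>0. (J has_real_derivative radial (int r - 1) (spectral n) x) (at x)) \<longrightarrow> J 0 = 0 \<longrightarrow> (J \<longlongrightarrow> l) at_top \<longrightarrow>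
     \<bar>moment r n - 2 * l\<bar> \<le> (4 * C) * sqrt n powi (- int K)"
    using C(2) eventually_gt_at_top[of 0]
  proof eventually_elim
    case (elim n)
    show ?case
    proof (intro allI impI)
      fix J l
      assume J: "\<forall>x\<ge>0. (J has_real_derivative radial (int r - 1) (spectral n) x) (at x)" "J 0 = 0" "(J \<longlongrightarrow> l) at_top"
      have "\<bar>moment r n / 4 - l / 2\<bar> \<le> C * sqrt n powi (int r - 1 - 1 + 1 - int (K + r))"
        using elim(1)[rule_format, OF _ J(2,3) _ _ radial_spectral_sums[OF elim(2)]] J(1) by simp
      also have "\<dots> \<le> C * sqrt n powi (- int K)"
        using C(1) elim(2) by (intro mult_left_mono power_int_increasing) auto
      finally show "\<bar>moment r n - 2 * l\<bar> \<le> (4 * C) * sqrt n powi (- int K)" by (simp add: abs_if split: if_splits)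
    qed
  qed
  moreover have "4 * C \<ge> 0" using C by simp
  ultimately show ?thesis by blast
qed

section \<open>Primitives in the barrier position\<close>

lemma smooth_chain:
  "smooth k f \<Longrightarrow> \<exists>D. D 0 = f \<and> (\<forall>i<k. \<forall>x. (D i has_real_derivative D (Suc i) x) (at x)) \<and> continuous_on UNIV (D k)"
proof (induction k arbitrary: f)
  case 0
  then show ?case by (intro exI[of _ "\<lambda>_. f"]) auto
next
  case (Suc k)
  from Suc.prems obtain f' where f': "\<forall>x. (f has_real_derivative f' x) (at x)" "smooth k f'" by auto
  obtain D where D: "D 0 = f'" "\<forall>i<k. \<forall>x. (D i has_real_derivative D (Suc i) x) (at x)" "continuous_on UNIV (D k)"
    using Suc.IH[OF f'(2)] by blast
  have "(case_nat f D i has_real_derivative case_nat f D (Suc i) x) (at x)" if "i < Suc k" for i x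
    using f'(1) D(1,2) that by (cases i) auto
  then show ?case using D(3) by (intro exI[of _ "case_nat f D"]) auto
qed

text \<open>As H grows the step pi / (2 H) tends to 0 and \<open>alt_sum_expansion\<close> applies.
  Its error is of third order in the step, which beats H^r because r is at most 2.\<close>

lemma radial_primitive_limit:
  assumes D: "\<And>i x. i < 4 \<Longrightarrow> (D i has_real_derivative D (Suc i) x) (at x)"
    and cont: "continuous_on UNIV (D 4)" and supp: "\<And>x. x \<ge> pi / 2 \<Longrightarrow> D 0 x = 0"
    and r: "r \<le> 2" and l: "((\<lambda>H. H ^ r * (D 0 0 / 2 - (pi / (2 * H))\<^sup>2 / 4 * D 2 0)) \<longlongrightarrow> l) at_top"
  shows "(radial (int r) (D 0) \<longlongrightarrow> l) at_top"
proof -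
  obtain B where B: "\<And>e. e > 0 \<Longrightarrow> e < 1 \<Longrightarrow> \<bar>alt_sum (D 0) e - (D 0 0 / 2 - e\<^sup>2 / 4 * D 2 0)\<bar> \<le> B * e ^ 3"
    using alt_sum_expansion[OF D cont supp] by blast
  let ?m = "\<lambda>H. H ^ r * (D 0 0 / 2 - (pi / (2 * H))\<^sup>2 / 4 * D 2 0)"
  have "((\<lambda>H. radial (int r) (D 0) H - ?m H) \<longlongrightarrow> 0) at_top"
  proof (rule Lim_null_comparison)
    show "\<forall>\<^sub>F H in at_top. norm (radial (int r) (D 0) H - ?m H) \<le> B * (H ^ r * (pi / (2 * H)) ^ 3)"
      using eventually_gt_at_top[of "2::real"]
    proof eventually_elim
      case (elim H)
      have "0 < pi / (2 * H)" "pi / (2 * H) < 1" using elim pi_less_4 by (auto simp: field_simps)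
      then have "\<bar>alt_sum (D 0) (pi / (2 * H)) - (D 0 0 / 2 - (pi / (2 * H))\<^sup>2 / 4 * D 2 0)\<bar> \<le> B * (pi / (2 * H)) ^ 3"
        by (rule B)
      then have "H ^ r * \<bar>alt_sum (D 0) (pi / (2 * H)) - (D 0 0 / 2 - (pi / (2 * H))\<^sup>2 / 4 * D 2 0)\<bar> \<le> H ^ r * (B * (pi / (2 * H)) ^ 3)"
        using elim by (intro mult_left_mono) auto
      moreover have "radial (int r) (D 0) H - ?m H = H ^ r * (alt_sum (D 0) (pi / (2 * H)) - (D 0 0 / 2 - (pi / (2 * H))\<^sup>2 / 4 * D 2 0))"
        using elim by (simp add: radial_def right_diff_distrib)
      moreover have "H ^ r \<ge> 0" using elim by simp
      ultimately show ?case by (simp add: abs_mult mult_ac)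
    qed
    have "r = 0 \<or> r = 1 \<or> r = 2" using r by auto
    then have "((\<lambda>H. H ^ r * (pi / (2 * H)) ^ 3) \<longlongrightarrow> 0) at_top"
      by (elim disjE) (simp only:, real_asymp)+
    then show "((\<lambda>H. B * (H ^ r * (pi / (2 * H)) ^ 3)) \<longlongrightarrow> 0) at_top" by (rule tendsto_mult_right_zero)
  qed
  from tendsto_add[OF this l] show ?thesis by simp
qed

lemma smooth_sinc_cos_cut: "n \<ge> k + 2 \<Longrightarrow> smooth k (\<lambda>x. sinc_deriv 0 x * cos_cut x ^ n)"
  by (intro smooth_mult smooth_sinc_deriv smooth_cos_cut_power)

lemma sinc_cos_int_cut:
  assumes "n > 0"
  shows "integral {0..pi / 2} (\<lambda>x. sinc_deriv 0 x * cos_cut x ^ n) = sinc_cos_int n"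
  unfolding sinc_cos_int_def
proof (rule integral_cong)
  fix x assume x: "x \<in> {0..pi / 2}"
  show "sinc_deriv 0 x * cos_cut x ^ n = sinc_deriv 0 x * cos x ^ n"
  proof (cases "x = pi / 2")
    case True
    have "cos_cut x = 0" "cos x = 0" unfolding True by (simp_all add: cos_cut_def)
    then show ?thesis by simp
  next
    case False
    then have "\<bar>x\<bar> < pi / 2" using x by auto
    then show ?thesis by (simp add: cos_cut_def)
  qed
qed

text \<open>For exponent 0 a kernel F differentiates to - x F', so F' must be - sin x cos^n x / x.
  The limit is half of F(0), the full integral.\<close>

lemma primitive_0:
  assumes "n \<ge> 5"
  shows "\<exists>J. (\<forall>x. (J has_real_derivative radial (int 0 - 1) (spectral n) x) (at x)) \<and> J 0 = 0 \<and> (J \<longlongrightarrow> sinc_cos_int n / 2) at_top"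
proof -
  define \<omega> where "\<omega> x = sinc_deriv 0 x * cos_cut x ^ n" for x
  have s: "smooth 3 \<omega>" unfolding \<omega>_def using assms by (intro smooth_sinc_cos_cut) auto
  have w0: "\<omega> x = 0" if "\<bar>x\<bar> \<ge> pi / 2" for x using that assms by (simp add: \<omega>_def cos_cut_eq_0)
  obtain F where F: "\<And>x. (F has_real_derivative - \<omega> x) (at x)" "\<And>x. x \<ge> pi / 2 \<Longrightarrow> F x = 0" "F 0 = integral {0..pi / 2} \<omega>"
    using tail_antiderivative[OF smooth_imp_continuous[OF s] w0] by blast
  have "smooth 3 (\<lambda>x. - \<omega> x)" using smooth_mult[OF smooth_const[of 3 "-1"] s] by simp
  then have "smooth (Suc 3) F" by (rule smooth_SucI[OF F(1)])
  then obtain D where D: "D 0 = F" "\<And>i x. i < Suc 3 \<Longrightarrow> (D i has_real_derivative D (Suc i) x) (at x)" "continuous_on UNIV (D (Suc 3))"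
    using smooth_chain by blast
  have "(radial (int 0) (D 0) \<longlongrightarrow> sinc_cos_int n / 2) at_top"
  proof (rule radial_primitive_limit)
    have "F 0 = sinc_cos_int n" unfolding F(3) \<omega>_def[abs_def] using assms by (intro sinc_cos_int_cut) auto
    moreover have "((\<lambda>H::real. H ^ 0 * (F 0 / 2 - (pi / (2 * H))\<^sup>2 / 4 * D 2 0)) \<longlongrightarrow> F 0 / 2) at_top" by real_asymp
    ultimately show "((\<lambda>H. H ^ 0 * (D 0 0 / 2 - (pi / (2 * H))\<^sup>2 / 4 * D 2 0)) \<longlongrightarrow> sinc_cos_int n / 2) at_top"
      by (simp add: D(1))
  qed (use D F(2) in \<open>auto simp: eval_nat_numeral\<close>)
  moreover have "(radial (int 0) F has_real_derivative radial (int 0 - 1) (spectral n) x) (at x)" for x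
  proof -
    have "(radial (int 0) F has_real_derivative radial (int 0 - 1) (\<lambda>x. of_int (int 0) * F x - x * - \<omega> x) x) (at x)"
      using F w0 by (intro DERIV_radial) auto
    moreover have "(\<lambda>x. of_int (int 0) * F x - x * - \<omega> x) = spectral n"
      by (simp add: fun_eq_iff \<omega>_def spectral_def x_times_sinc flip: mult.assoc)
    ultimately show ?thesis by simp
  qed
  moreover have "radial (int 0) F 0 = 0" by (simp add: radial_def)
  ultimately show ?thesis using D(1) by (intro exI[of _ "radial (int 0) F"]) auto
qed

lemma alt_sum_diff:
  assumes "\<And>x. x \<ge> c \<Longrightarrow> f x = 0" "\<And>x. x \<ge> c \<Longrightarrow> g x = 0" "e > 0"
  shows "alt_sum (\<lambda>x. f x - g x) e = alt_sum f e - alt_sum g e"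
proof -
  obtain N :: nat where "real N > c / e" using reals_Archimedean2 by blast
  then have "c \<le> real N * e" using assms(3) by (simp add: divide_less_eq less_imp_le)
  also have "\<dots> \<le> (2 * real N + 1) * e" using assms(3) by (intro mult_right_mono) auto
  finally have "c \<le> (2 * real N + 1) * e" .
  then show ?thesis
    using assms by (simp add: alt_sum_finite[where c = c and m = N] right_diff_distrib sum_subtractf)
qed

text \<open>A kernel x F with exponent 1 differentiates to - x^2 F'. For the spectral kernel alone
  F' would have a pole at 0. The difference of the kernels for n and n + 2 is sin^3 x cos^n x, so F'
  is the smooth function - (sin x / x)^2 sin x cos^n x. As x F vanishes at 0, only its second-order
  term remains, and this is too small for the single factor H.\<close>

lemma primitive_1_diff:
  assumes "n \<ge> 5"
  shows "\<exists>J. (\<forall>x. (J has_real_derivative radial 0 (spectral n) x - radial 0 (spectral (n + 2)) x) (at x))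
     \<and> J 0 = 0 \<and> (J \<longlongrightarrow> 0) at_top"
proof -
  define \<omega> where "\<omega> x = sinc_deriv 0 x * (sinc_deriv 0 x * (sin x * cos_cut x ^ n))" for x
  have s: "smooth 3 \<omega>" unfolding \<omega>_def using assms by (intro smooth_mult smooth_sinc_deriv smooth_sin smooth_cos_cut_power) auto
  have w0: "\<omega> x = 0" if "\<bar>x\<bar> \<ge> pi / 2" for x using that assms by (simp add: \<omega>_def cos_cut_eq_0)
  obtain F where F: "\<And>x. (F has_real_derivative - \<omega> x) (at x)" "\<And>x. x \<ge> pi / 2 \<Longrightarrow> F x = 0"
    using tail_antiderivative[OF smooth_imp_continuous[OF s] w0] by blast
  have "smooth 3 (\<lambda>x. - \<omega> x)" using smooth_mult[OF smooth_const[of 3 "-1"] s] by simp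
  then have "smooth (Suc 3) F" by (rule smooth_SucI[OF F(1)])
  then have "smooth (Suc 3) (\<lambda>x. x * F x)" by (intro smooth_mult smooth_id)
  then obtain D where D: "D 0 = (\<lambda>x. x * F x)" "\<And>i x. i < Suc 3 \<Longrightarrow> (D i has_real_derivative D (Suc i) x) (at x)" "continuous_on UNIV (D (Suc 3))"
    using smooth_chain by blast
  have "(radial (int 1) (D 0) \<longlongrightarrow> 0) at_top"
  proof (rule radial_primitive_limit)
    have "((\<lambda>H::real. H ^ 1 * (0 / 2 - (pi / (2 * H))\<^sup>2 / 4 * D 2 0)) \<longlongrightarrow> 0) at_top" by real_asymp
    then show "((\<lambda>H. H ^ 1 * (D 0 0 / 2 - (pi / (2 * H))\<^sup>2 / 4 * D 2 0)) \<longlongrightarrow> 0) at_top"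
      by (simp add: D(1))
  qed (use D F(2) in \<open>auto simp: eval_nat_numeral\<close>)
  moreover have "(radial (int 1) (\<lambda>x. x * F x) has_real_derivative radial 0 (spectral n) x - radial 0 (spectral (n + 2)) x) (at x)" for x
  proof -
    have dF: "((\<lambda>x. x * F x) has_real_derivative F x - x * \<omega> x) (at x)" for x
      using DERIV_mult'[OF DERIV_ident F(1)[of x]] by (simp add: algebra_simps)
    have "(radial (int 1) (\<lambda>x. x * F x) has_real_derivative radial (int 1 - 1) (\<lambda>x. of_int (int 1) * (x * F x) - x * (F x - x * \<omega> x)) x) (at x)"
      using dF F(2) w0 by (intro DERIV_radial) auto
    moreover have "(\<lambda>x. of_int (int 1) * (x * F x) - x * (F x - x * \<omega> x)) = (\<lambda>x. spectral n x - spectral (n + 2) x)"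
    proof
      fix x
      have "of_int (int 1) * (x * F x) - x * (F x - x * \<omega> x) = (x * sinc_deriv 0 x) * (x * sinc_deriv 0 x) * (sin x * cos_cut x ^ n)"
        by (simp add: \<omega>_def algebra_simps)
      also have "\<dots> = sin x * cos_cut x ^ n * (sin x)\<^sup>2" by (simp add: x_times_sinc power2_eq_square)
      also have "\<dots> = spectral n x - spectral (n + 2) x"
      proof (cases "\<bar>x\<bar> < pi / 2")
        case True
        have "(sin x)\<^sup>2 = 1 - (cos x)\<^sup>2" by (rule sin_squared_eq)
        then have "sin x * cos_cut x ^ n * (sin x)\<^sup>2 = sin x * cos_cut x ^ n * (1 - (cos_cut x)\<^sup>2)"
          using True by (simp add: cos_cut_def)
        then show ?thesis by (simp add: spectral_def power_add right_diff_distrib power2_eq_square)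
      qed (use assms in \<open>simp add: spectral_def cos_cut_def\<close>)
      finally show "of_int (int 1) * (x * F x) - x * (F x - x * \<omega> x) = spectral n x - spectral (n + 2) x" .
    qed
    moreover have "radial 0 (\<lambda>x. spectral n x - spectral (n + 2) x) x = radial 0 (spectral n) x - radial 0 (spectral (n + 2)) x"
      using assms spectral_beyond[of n] spectral_beyond[of "n + 2"]
      by (auto simp: radial_def intro!: alt_sum_diff[of "pi / 2"])
    ultimately show ?thesis by simp
  qed
  moreover have "radial (int 1) F 0 = 0" for F by (simp add: radial_def)
  ultimately show ?thesis using D(1) by (intro exI[of _ "radial (int 1) (\<lambda>x. x * F x)"]) auto
qed

text \<open>The kernel D with 2 D - x D' = f, where f is the spectral kernel, is x^2 times the
  integral of f(t) / t^3. Integrating by parts twice turns it into (f + x f' + x^2 F) / 2, with F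
  the tail integral of f''(t) / t, which is regular since f'' is odd. Then D vanishes at 0 and D'' =
  F, so the limit comes from the second-order term alone.\<close>

lemma primitive_2:
  assumes "n \<ge> 7"
  shows "\<exists>J. (\<forall>x. (J has_real_derivative radial (int 2 - 1) (spectral n) x) (at x)) \<and> J 0 = 0 \<and>
    (J \<longlongrightarrow> pi\<^sup>2 / 16 * ((real n + 1)\<^sup>2 * sinc_cos_int n - real n * (real n - 1) * sinc_cos_int (n - 2))) at_top"
proof -
  define f1 where "f1 x = cos_cut x ^ (n + 1) - real n * ((sin x)\<^sup>2 * cos_cut x ^ (n - 1))" for x
  \<comment> \<open>The second derivative of the spectral kernel is sin x times this function, so
    \<omega> is that derivative divided by x.\<close>
  define \<rho> where "\<rho> x = real n * (real n - 1) * cos_cut x ^ (n - 2) - (real n + 1)\<^sup>2 * cos_cut x ^ n" for x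
  define \<omega> where "\<omega> x = sinc_deriv 0 x * \<rho> x" for x
  have s: "smooth 1 \<omega>" unfolding \<omega>_def \<rho>_def
    using assms by (intro smooth_mult smooth_sinc_deriv smooth_diff smooth_const smooth_cos_cut_power) auto
  then obtain \<omega>1 where w1: "\<And>x. (\<omega> has_real_derivative \<omega>1 x) (at x)" "continuous_on UNIV \<omega>1" by (auto simp: One_nat_def)
  have z: "cos_cut x = 0" if "x \<ge> pi / 2" for x using that pi_gt_zero by (intro cos_cut_eq_0) linarith
  have w0: "\<omega> x = 0" if "\<bar>x\<bar> \<ge> pi / 2" for x
    using cos_cut_eq_0[OF that] assms by (simp add: \<omega>_def \<rho>_def power_0_left)
  obtain F where F: "\<And>x. (F has_real_derivative - \<omega> x) (at x)" "\<And>x. x \<ge> pi / 2 \<Longrightarrow> F x = 0" "F 0 = integral {0..pi / 2} \<omega>"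
    using tail_antiderivative[OF smooth_imp_continuous[OF s] w0] by blast
  have dp: "((\<lambda>x. cos_cut x ^ m) has_real_derivative - (real m * sin x * cos_cut x ^ (m - 1))) (at x)" if "m \<ge> 2" for m x
    using DERIV_cos_cut_power[OF that] .
  have cc: "cos x * cos_cut x ^ m = cos_cut x ^ (m + 1)" if "m \<ge> 1" for m x
    using cos_times_cos_cut_power[OF that] by simp
  have df: "(spectral n has_real_derivative f1 x) (at x)" for x
  proof -
    have "((\<lambda>x. sin x * cos_cut x ^ n) has_real_derivative sin x * - (real n * sin x * cos_cut x ^ (n - 1)) + cos x * cos_cut x ^ n) (at x)"
      using assms by (intro DERIV_mult' DERIV_sin dp) auto
    moreover have "sin x * - (real n * sin x * cos_cut x ^ (n - 1)) + cos x * cos_cut x ^ n = f1 x"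
      using cc[of n x] assms by (simp add: f1_def power2_eq_square algebra_simps)
    ultimately show ?thesis by (simp add: spectral_def[abs_def])
  qed
  have df1: "(f1 has_real_derivative x * \<omega> x) (at x)" for x
  proof -
    have s2: "((\<lambda>x. (sin x)\<^sup>2) has_real_derivative 2 * sin x * cos x) (at x)" by (auto intro!: derivative_eq_intros)
    have "(f1 has_real_derivative - (real (n + 1) * sin x * cos_cut x ^ (n + 1 - 1)) -
        real n * ((sin x)\<^sup>2 * - (real (n - 1) * sin x * cos_cut x ^ (n - 1 - 1)) + (2 * sin x * cos x) * cos_cut x ^ (n - 1))) (at x)"
      unfolding f1_def[abs_def] using assms by (intro DERIV_diff DERIV_cmult DERIV_mult' s2 dp) auto
    moreover have "- (real (n + 1) * sin x * cos_cut x ^ (n + 1 - 1)) -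
        real n * ((sin x)\<^sup>2 * - (real (n - 1) * sin x * cos_cut x ^ (n - 1 - 1)) + (2 * sin x * cos x) * cos_cut x ^ (n - 1)) = x * \<omega> x"
    proof -
      have e1: "(sin x)\<^sup>2 * cos_cut x ^ (n - 2) = cos_cut x ^ (n - 2) - cos_cut x ^ n"
      proof (cases "\<bar>x\<bar> < pi / 2")
        case True
        have "n = (n - 2) + 2" using assms by simp
        then have "cos_cut x ^ n = cos_cut x ^ (n - 2) * (cos_cut x)\<^sup>2" by (metis power_add)
        moreover have "(sin x)\<^sup>2 = 1 - (cos_cut x)\<^sup>2" using True by (simp add: cos_cut_def sin_squared_eq)
        ultimately show ?thesis by (simp add: left_diff_distrib mult.commute)
      qed (use assms in \<open>simp add: cos_cut_def power_0_left\<close>)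
      have e2: "cos x * cos_cut x ^ (n - 1) = cos_cut x ^ n" using cc[of "n - 1" x] assms by simp
      have e3: "x * \<omega> x = sin x * \<rho> x" by (simp add: \<omega>_def x_times_sinc flip: mult.assoc)
      have "real (n - 1) = real n - 1" "n - 1 - 1 = n - 2" using assms by auto
      then have "- (real (n + 1) * sin x * cos_cut x ^ (n + 1 - 1)) -
        real n * ((sin x)\<^sup>2 * - (real (n - 1) * sin x * cos_cut x ^ (n - 1 - 1)) + (2 * sin x * cos x) * cos_cut x ^ (n - 1))
        = sin x * (- (real n + 1) * cos_cut x ^ n + real n * (real n - 1) * ((sin x)\<^sup>2 * cos_cut x ^ (n - 2))
            - 2 * real n * (cos x * cos_cut x ^ (n - 1)))"
        by (simp add: algebra_simps)
      also have "\<dots> = sin x * \<rho> x" unfolding e1 e2 \<rho>_def by (simp add: algebra_simps power2_eq_square)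
      finally show ?thesis using e3 by simp
    qed
    ultimately show ?thesis by (simp only:)
  qed
  define D where "D i = (case i of 0 \<Rightarrow> (\<lambda>x. (spectral n x + x * f1 x + x * (x * F x)) / 2)
      | Suc 0 \<Rightarrow> (\<lambda>x. f1 x + x * F x) | Suc (Suc 0) \<Rightarrow> F | Suc (Suc (Suc 0)) \<Rightarrow> (\<lambda>x. - \<omega> x) | _ \<Rightarrow> (\<lambda>x. - \<omega>1 x))" for i :: nat
  have dxF: "((\<lambda>x. x * F x) has_real_derivative F x - x * \<omega> x) (at x)" for x
    using DERIV_mult'[OF DERIV_ident F(1)[of x]] by (simp add: algebra_simps)
  have d0: "((\<lambda>x. (spectral n x + x * f1 x + x * (x * F x)) / 2) has_real_derivative f1 x + x * F x) (at x)" for x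
  proof -
    have "((\<lambda>x. (spectral n x + x * f1 x + x * (x * F x)) / 2) has_real_derivative
       (f1 x + (x * (x * \<omega> x) + 1 * f1 x) + (x * (F x - x * \<omega> x) + 1 * (x * F x))) / 2) (at x)"
      by (intro DERIV_cdivide DERIV_add df DERIV_mult' DERIV_ident df1 dxF)
    moreover have "(f1 x + (x * (x * \<omega> x) + 1 * f1 x) + (x * (F x - x * \<omega> x) + 1 * (x * F x))) / 2 = f1 x + x * F x"
      by (simp add: field_simps)
    ultimately show ?thesis by (simp only:)
  qed
  have d1: "((\<lambda>x. f1 x + x * F x) has_real_derivative F x) (at x)" for x
    using DERIV_add[OF df1 dxF] by simp
  have supp0: "D 0 x = 0" "D 1 x = 0" if "x \<ge> pi / 2" for x
    using z[OF that] F(2)[OF that] assms by (simp_all add: D_def f1_def spectral_def power_0_left)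
  let ?l = "pi\<^sup>2 / 16 * ((real n + 1)\<^sup>2 * sinc_cos_int n - real n * (real n - 1) * sinc_cos_int (n - 2))"
  have "(radial (int 2) (D 0) \<longlongrightarrow> ?l) at_top"
  proof (rule radial_primitive_limit)
    fix i x assume "i < (4 :: nat)"
    then consider "i = 0" | "i = 1" | "i = 2" | "i = 3" by linarith
    then show "(D i has_real_derivative D (Suc i) x) (at x)"
      using d0 d1 F(1) w1(1) by cases (auto simp: D_def numeral_2_eq_2 numeral_3_eq_3 intro: DERIV_minus)
  next
    show "continuous_on UNIV (D 4)" using w1(2) by (simp add: D_def eval_nat_numeral continuous_on_minus)
    have "F 0 = real n * (real n - 1) * sinc_cos_int (n - 2) - (real n + 1)\<^sup>2 * sinc_cos_int n"
    proof -
      have i: "(\<lambda>x. sinc_deriv 0 x * cos_cut x ^ m) integrable_on {0..pi / 2}" if "m \<ge> 2" for m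
        using that by (intro integrable_continuous_interval continuous_on_subset[OF smooth_imp_continuous[OF smooth_sinc_cos_cut[of 0]]]) auto
      have "integral {0..pi / 2} \<omega> = integral {0..pi / 2} (\<lambda>x. real n * (real n - 1) * (sinc_deriv 0 x * cos_cut x ^ (n - 2))
          - (real n + 1)\<^sup>2 * (sinc_deriv 0 x * cos_cut x ^ n))"
        by (rule integral_cong) (simp add: \<omega>_def \<rho>_def algebra_simps)
      also have "\<dots> = real n * (real n - 1) * sinc_cos_int (n - 2) - (real n + 1)\<^sup>2 * sinc_cos_int n"
        using assms by (subst Henstock_Kurzweil_Integration.integral_diff)
          (auto intro!: integrable_on_mult_right i simp: integral_mult_right sinc_cos_int_cut)
      finally show ?thesis using F(3) by simp
    qed
    moreover have "D 0 0 = 0" "D 2 = F" by (simp_all add: D_def spectral_def numeral_2_eq_2)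
    moreover have "((\<lambda>H::real. H ^ 2 * (0 / 2 - (pi / (2 * H))\<^sup>2 / 4 * F 0)) \<longlongrightarrow> - (pi\<^sup>2 / 16) * F 0) at_top"
    proof (rule tendsto_eventually)
      show "\<forall>\<^sub>F H :: real in at_top. H ^ 2 * (0 / 2 - (pi / (2 * H))\<^sup>2 / 4 * F 0) = - (pi\<^sup>2 / 16) * F 0"
        using eventually_gt_at_top[of "0::real"] by eventually_elim (simp add: power_divide power_mult_distrib)
    qed
    moreover have "- (pi\<^sup>2 / 16) * (u - v) = pi\<^sup>2 / 16 * (v - u)" for u v :: real by (simp add: right_diff_distrib)
    ultimately show "((\<lambda>H. H ^ 2 * (D 0 0 / 2 - (pi / (2 * H))\<^sup>2 / 4 * D 2 0)) \<longlongrightarrow> ?l) at_top"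
      by (simp only:)
  qed (use supp0 in auto)
  moreover have "(radial (int 2) (D 0) has_real_derivative radial (int 2 - 1) (spectral n) x) (at x)" for x
  proof -
    have "(radial (int 2) (D 0) has_real_derivative radial (int 2 - 1) (\<lambda>x. of_int (int 2) * D 0 x - x * D 1 x) x) (at x)"
      using supp0 d0 by (intro DERIV_radial) (auto simp: D_def)
    moreover have "(\<lambda>x. of_int (int 2) * D 0 x - x * D 1 x) = spectral n"
      by (simp add: fun_eq_iff D_def algebra_simps)
    ultimately show ?thesis by simp
  qed
  moreover have "radial (int 2) (D 0) 0 = 0" by (simp add: radial_def)
  ultimately show ?thesis by (intro exI[of _ "radial (int 2) (D 0)"]) auto
qed

theorem prob_max_sinc_cos_int:
  "\<exists>C\<ge>0. \<forall>\<^sub>F n in sequentially. \<bar>prob_max n - sinc_cos_int n\<bar> \<le> C * sqrt n powi (- int K)"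
proof -
  obtain C where C: "C \<ge> 0" "\<forall>\<^sub>F n in sequentially. \<forall>J l.
     (\<forall>x\<ge>0. (J has_real_derivative radial (int 0 - 1) (spectral n) x) (at x)) \<longrightarrow> J 0 = 0 \<longrightarrow> (J \<longlongrightarrow> l) at_top \<longrightarrow>
     \<bar>moment 0 n - 2 * l\<bar> \<le> C * sqrt n powi (- int K)"
    using moment_asymptotics[of 0 K] by blast
  from C(2) eventually_ge_at_top[of 5]
  have "\<forall>\<^sub>F n in sequentially. \<bar>prob_max n - sinc_cos_int n\<bar> \<le> C * sqrt n powi (- int K)"
  proof eventually_elim
    case (elim n)
    obtain J where "\<forall>x. (J has_real_derivative radial (int 0 - 1) (spectral n) x) (at x)" "J 0 = 0" "(J \<longlongrightarrow> sinc_cos_int n / 2) at_top"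
      using primitive_0[OF elim(2)] by blast
    then have "\<bar>moment 0 n - 2 * (sinc_cos_int n / 2)\<bar> \<le> C * sqrt n powi (- int K)" using elim(1) by blast
    then show ?case by (simp add: moment_0)
  qed
  with C(1) show ?thesis by blast
qed

theorem moment_2_sinc_cos_int:
  "\<exists>C\<ge>0. \<forall>\<^sub>F n in sequentially. \<bar>moment 2 n -
     pi\<^sup>2 / 8 * ((real n + 1)\<^sup>2 * sinc_cos_int n - real n * (real n - 1) * sinc_cos_int (n - 2))\<bar> \<le> C * sqrt n powi (- int K)"
proof -
  obtain C where C: "C \<ge> 0" "\<forall>\<^sub>F n in sequentially. \<forall>J l.
     (\<forall>x\<ge>0. (J has_real_derivative radial (int 2 - 1) (spectral n) x) (at x)) \<longrightarrow> J 0 = 0 \<longrightarrow> (J \<longlongrightarrow> l) at_top \<longrightarrow>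
     \<bar>moment 2 n - 2 * l\<bar> \<le> C * sqrt n powi (- int K)"
    using moment_asymptotics[of 2 K] by blast
  from C(2) eventually_ge_at_top[of 7]
  have "\<forall>\<^sub>F n in sequentially. \<bar>moment 2 n -
     pi\<^sup>2 / 8 * ((real n + 1)\<^sup>2 * sinc_cos_int n - real n * (real n - 1) * sinc_cos_int (n - 2))\<bar> \<le> C * sqrt n powi (- int K)"
  proof eventually_elim
    case (elim n)
    let ?l = "pi\<^sup>2 / 16 * ((real n + 1)\<^sup>2 * sinc_cos_int n - real n * (real n - 1) * sinc_cos_int (n - 2))"
    obtain J where "\<forall>x. (J has_real_derivative radial (int 2 - 1) (spectral n) x) (at x)" "J 0 = 0" "(J \<longlongrightarrow> ?l) at_top"
      using primitive_2[OF elim(2)] by blast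
    then have "\<bar>moment 2 n - 2 * ?l\<bar> \<le> C * sqrt n powi (- int K)" using elim(1) by blast
    then show ?case by simp
  qed
  with C(1) show ?thesis by blast
qed

section \<open>The limit density\<close>

definition gauss :: "real \<Rightarrow> real" where "gauss x = x * exp (- (x\<^sup>2 / 2))"

lemma exp_minus_le_quadratic:
  assumes "(t :: real) \<ge> 0"
  shows "exp (- t) \<le> 1 - t + t\<^sup>2 / 2"
proof -
  have e: "1 + t + t\<^sup>2 / 2 \<le> exp t" using assms by (rule exp_lower_Taylor_quadratic)
  have "0 \<le> (t - 1)\<^sup>2 / 2 + 1 / 2" by simp
  then have q: "0 \<le> 1 - t + t\<^sup>2 / 2" by (simp add: power2_diff field_simps)
  have "1 \<le> 1 + t ^ 4 / 4" by simp
  also have "\<dots> = (1 + t + t\<^sup>2 / 2) * (1 - t + t\<^sup>2 / 2)" by (simp add: algebra_simps power2_eq_square power4_eq_xxxx)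
  also have "\<dots> \<le> exp t * (1 - t + t\<^sup>2 / 2)" using e q by (rule mult_right_mono)
  finally have "exp (- t) * 1 \<le> exp (- t) * (exp t * (1 - t + t\<^sup>2 / 2))" by (intro mult_left_mono) auto
  moreover have "exp (- t) * (exp t * q) = q" for q by (simp add: exp_minus)
  ultimately show ?thesis by (simp only: mult_1_right)
qed

lemma gauss_minus_cos_cut: "exp (- (x\<^sup>2 / 2)) - cos_cut x \<le> x ^ 4 / 8"
proof -
  have e: "exp (- (x\<^sup>2 / 2)) \<le> 1 - x\<^sup>2 / 2 + x ^ 4 / 8"
    using exp_minus_le_quadratic[of "x\<^sup>2 / 2"] by (simp add: power_divide)
  show ?thesis
  proof (cases "\<bar>x\<bar> < pi / 2")
    case True
    have "cos x = 1 - 2 * (sin (x / 2))\<^sup>2" using cos_double_sin[of "x / 2"] by simp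
    moreover have "\<bar>sin (x / 2)\<bar> \<le> \<bar>x / 2\<bar>" by (rule abs_sin_x_le_abs_x)
    then have "(sin (x / 2))\<^sup>2 \<le> (x / 2)\<^sup>2" using abs_le_square_iff by blast
    ultimately have "cos x \<ge> 1 - x\<^sup>2 / 2" by (simp add: power_divide)
    then show ?thesis using e True by (simp add: cos_cut_def)
  next
    case False
    have "(3 / 2)\<^sup>2 \<le> \<bar>x\<bar>\<^sup>2" using False pi_gt3 by (intro power_mono) linarith+
    then have "x\<^sup>2 \<ge> 9 / 4" by (simp add: power_divide)
    then show ?thesis using e False by (simp add: cos_cut_def)
  qed
qed

lemma power_Suc_diff_le:
  fixes a c :: real
  assumes "0 \<le> c" "c \<le> a"
  shows "a ^ Suc k - c ^ Suc k \<le> real (Suc k) * (a - c) * a ^ k"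
proof (induction k)
  case (Suc k)
  have "a ^ Suc (Suc k) - c ^ Suc (Suc k) = a * (a ^ Suc k - c ^ Suc k) + (a - c) * c ^ Suc k"
    by (simp add: algebra_simps)
  also have "\<dots> \<le> a * (real (Suc k) * (a - c) * a ^ k) + (a - c) * a ^ Suc k"
    using Suc assms by (intro add_mono mult_left_mono power_mono) auto
  also have "\<dots> = real (Suc (Suc k)) * (a - c) * a ^ Suc k" by (simp add: algebra_simps)
  finally show ?case .
qed simp

text \<open>At the angle \<theta> = x / sqrt n, replacing the sine by \<theta> costs \<theta>^3, and
  replacing n cosine factors by Gaussian ones costs \<theta>^4 each. The n - 1 factors left over, at
  least n / 2 of them, retain the Gaussian exp (- x^2 / 4).\<close>

lemma spectral_gauss_diff:
  assumes "n \<ge> 2" "x \<ge> 0"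
  shows "\<bar>sqrt n * spectral n (x / sqrt n) - gauss x\<bar> \<le> (x ^ 3 + x ^ 5) * exp (- (x\<^sup>2 / 4)) / n"
proof -
  define r where "r = sqrt n"
  define \<theta> where "\<theta> = x / r"
  define a where "a = exp (- (\<theta>\<^sup>2 / 2))"
  define c where "c = cos_cut \<theta>"
  have r: "r > 0" "r\<^sup>2 = real n" using assms by (auto simp: r_def)
  have \<theta>: "\<theta> \<ge> 0" using assms r by (simp add: \<theta>_def)
  have x: "x = r * \<theta>" using r by (simp add: \<theta>_def)
  have ca: "0 \<le> c" "c \<le> a" "a \<le> 1" "a \<ge> 0" unfolding c_def a_def by (simp_all add: cos_cut_nonneg cos_cut_le_exp)
  obtain k where k: "n = Suc k" "k \<ge> 1" using assms by (cases n) auto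
  have an: "a ^ m = exp (- (real m * \<theta>\<^sup>2 / 2))" for m by (simp add: a_def flip: exp_of_nat_mult)
  have g: "gauss x = r * (\<theta> * a ^ n)"
    unfolding gauss_def an x power_mult_distrib r(2) by simp
  have "\<bar>sin \<theta> - (\<Sum>m<3. sin_coeff m * \<theta> ^ m)\<bar> \<le> inverse (fact 3) * \<bar>\<theta>\<bar> ^ 3" by (rule Maclaurin_sin_bound)
  then have s: "\<bar>sin \<theta> - \<theta>\<bar> \<le> \<theta> ^ 3 / 6"
    using \<theta> by (simp add: eval_nat_numeral sin_coeff_def)
  have "\<bar>sin \<theta> * c ^ n - \<theta> * a ^ n\<bar> = \<bar>(sin \<theta> - \<theta>) * c ^ n + \<theta> * (c ^ n - a ^ n)\<bar>" by (simp add: algebra_simps)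
  also have "\<dots> \<le> \<bar>(sin \<theta> - \<theta>) * c ^ n\<bar> + \<bar>\<theta> * (c ^ n - a ^ n)\<bar>" by (rule abs_triangle_ineq)
  also have "\<dots> = \<bar>sin \<theta> - \<theta>\<bar> * c ^ n + \<theta> * (a ^ n - c ^ n)"
    using ca \<theta> power_mono[OF ca(2,1), of n] by (simp add: abs_mult)
  also have "\<dots> \<le> \<theta> ^ 3 * a ^ k + \<theta> * (real n * \<theta> ^ 4 * a ^ k)"
  proof (intro add_mono mult_mono mult_left_mono)
    show "\<bar>sin \<theta> - \<theta>\<bar> \<le> \<theta> ^ 3" using s zero_le_power[OF \<theta>, of 3] by linarith
    have "c ^ n \<le> a ^ n" using ca by (intro power_mono) auto
    also have "\<dots> \<le> a ^ k" using ca k by (intro power_decreasing) auto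
    finally show "c ^ n \<le> a ^ k" .
    have "a ^ n - c ^ n \<le> real n * (a - c) * a ^ k" unfolding k(1) using ca by (intro power_Suc_diff_le) auto
    also have "a - c \<le> \<theta> ^ 4" using gauss_minus_cos_cut[of \<theta>] zero_le_power[OF \<theta>, of 4] unfolding a_def c_def by linarith
    then have "real n * (a - c) * a ^ k \<le> real n * \<theta> ^ 4 * a ^ k" using ca by (intro mult_right_mono mult_left_mono) auto
    finally show "a ^ n - c ^ n \<le> real n * \<theta> ^ 4 * a ^ k" .
  qed (use \<theta> ca power_mono[OF ca(2,1), of n] in auto)
  also have "\<dots> = (\<theta> ^ 3 + real n * \<theta> ^ 5) * a ^ k" by (simp add: algebra_simps eval_nat_numeral)
  also have "\<dots> \<le> (\<theta> ^ 3 + real n * \<theta> ^ 5) * exp (- (x\<^sup>2 / 4))"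
  proof (intro mult_left_mono)
    have "real n * \<theta>\<^sup>2 \<le> 2 * real k * \<theta>\<^sup>2" using k by (intro mult_right_mono) auto
    then have "x\<^sup>2 / 4 \<le> real k * \<theta>\<^sup>2 / 2" unfolding x power_mult_distrib r(2) by simp
    then show "a ^ k \<le> exp (- (x\<^sup>2 / 4))" unfolding an by simp
  qed (use \<theta> in auto)
  finally have "r * \<bar>sin \<theta> * c ^ n - \<theta> * a ^ n\<bar> \<le> r * ((\<theta> ^ 3 + real n * \<theta> ^ 5) * exp (- (x\<^sup>2 / 4)))"
    using r by (intro mult_left_mono) auto
  moreover have "r * (\<theta> ^ 3 + real n * \<theta> ^ 5) = (x ^ 3 + x ^ 5) / n"
  proof -
    have "x ^ 3 = (r\<^sup>2) * (r * \<theta> ^ 3)" "x ^ 5 = (r\<^sup>2) * (r * (r\<^sup>2 * \<theta> ^ 5))" unfolding x by (simp_all add: eval_nat_numeral algebra_simps)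
    then have "x ^ 3 + x ^ 5 = real n * (r * (\<theta> ^ 3 + real n * \<theta> ^ 5))"
      unfolding r(2) by (simp only: distrib_left)
    then show ?thesis using assms by simp
  qed
  moreover have "\<bar>sqrt n * spectral n (x / sqrt n) - gauss x\<bar> = r * \<bar>sin \<theta> * c ^ n - \<theta> * a ^ n\<bar>"
    unfolding g using r by (simp add: spectral_def r_def[symmetric] \<theta>_def[symmetric] c_def[symmetric] abs_mult flip: right_diff_distrib)
  ultimately show ?thesis by (simp add: mult.assoc[symmetric])
qed

lemma summable_gauss_multiples:
  assumes "x > 0"
  shows "summable (\<lambda>k. (-1) ^ k * gauss ((2 * real k + 1) * x))"
proof (rule summable_rabs_cancel)
  have "summable (\<lambda>k. x * ((2 * real k + 1) * exp (- (x\<^sup>2 * (2 * real k + 1)\<^sup>2 / 2))))"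
    by (rule summable_mult[OF summable_gauss_odd[OF assms]])
  moreover have "x * ((2 * real k + 1) * exp (- (x\<^sup>2 * (2 * real k + 1)\<^sup>2 / 2))) = \<bar>(-1) ^ k * gauss ((2 * real k + 1) * x)\<bar>" for k
    using assms by (simp add: gauss_def abs_mult power_mult_distrib mult_ac)
  ultimately show "summable (\<lambda>k. \<bar>(-1) ^ k * gauss ((2 * real k + 1) * x)\<bar>)" by simp
qed

lemma abs_suminf_alt_le:
  fixes d :: "nat \<Rightarrow> real"
  assumes "\<And>k. \<bar>d k\<bar> \<le> B * (1 / (1 + real k)\<^sup>2)" "B \<ge> 0"
  shows "summable d" "\<bar>\<Sum>k. d k\<bar> \<le> 2 * B"
proof -
  have s: "summable (\<lambda>k. B * (1 / (1 + real k)\<^sup>2))" by (rule summable_mult[OF summable_inverse_squares(1)])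
  have s': "summable (\<lambda>k. \<bar>d k\<bar>)" by (rule summable_comparison_test'[OF s]) (use assms(1) in simp)
  then show "summable d" by (rule summable_rabs_cancel)
  have "\<bar>\<Sum>k. d k\<bar> \<le> (\<Sum>k. \<bar>d k\<bar>)" by (rule summable_rabs[OF s'])
  also have "\<dots> \<le> (\<Sum>k. B * (1 / (1 + real k)\<^sup>2))" by (rule suminf_le[OF assms(1) s' s])
  also have "\<dots> = B * (\<Sum>k. 1 / (1 + real k)\<^sup>2)" by (rule suminf_mult[OF summable_inverse_squares(1)])
  also have "\<dots> \<le> B * 2" using summable_inverse_squares(2) assms(2) by (rule mult_left_mono)
  finally show "\<bar>\<Sum>k. d k\<bar> \<le> 2 * B" by simp
qed

lemma inverse_odd_square_le: "1 / (2 * real k + 1)\<^sup>2 \<le> 1 / (1 + real k)\<^sup>2"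
  by (intro divide_left_mono power_mono mult_pos_pos zero_less_power) auto

lemma alt_sum_gauss_diff:
  obtains C where "C \<ge> 0" "\<And>n x. n \<ge> 2 \<Longrightarrow> x > 0 \<Longrightarrow>
    \<bar>sqrt n * alt_sum (spectral n) (x / sqrt n) - alt_sum gauss x\<bar> \<le> C / (n * x\<^sup>2)"
proof
  \<comment> \<open>The extra factor u^2 buys summability in k. The product (u^3 + u^5) u^2 is at
    most 2 (1 + u)^7, so the constant is that of \<open>power_times_gaussian_le\<close> for k =
    7.\<close>
  define D where "D = 2 * exp ((real 7)\<^sup>2)"
  show "2 * D \<ge> 0" by (simp add: D_def)
  fix n :: nat and x :: real assume n: "n \<ge> 2" and x: "x > 0"
  define d where "d k = (-1) ^ k * (sqrt n * spectral n ((2 * real k + 1) * (x / sqrt n)) - gauss ((2 * real k + 1) * x))" for k :: nat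
  have dk: "\<bar>d k\<bar> \<le> D / (n * x\<^sup>2) * (1 / (1 + real k)\<^sup>2)" for k
  proof -
    define u where "u = (2 * real k + 1) * x"
    have u: "u > 0" using x by (simp add: u_def)
    have "\<bar>d k\<bar> = \<bar>sqrt n * spectral n (u / sqrt n) - gauss u\<bar>" by (simp add: d_def abs_mult u_def)
    also have "\<dots> \<le> (u ^ 3 + u ^ 5) * exp (- (u\<^sup>2 / 4)) / n" using n u by (intro spectral_gauss_diff) auto
    also have "\<dots> \<le> (D / u\<^sup>2) / n"
    proof (intro divide_right_mono)
      have "(u ^ 3 + u ^ 5) * u\<^sup>2 = u ^ 5 + u ^ 7" by (simp add: algebra_simps eval_nat_numeral)
      also have "\<dots> \<le> (1 + u) ^ 5 + (1 + u) ^ 7" using u by (intro add_mono power_mono) auto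
      also have "(1 + u) ^ 5 \<le> (1 + u) ^ 7" using u by (intro power_increasing) auto
      finally have "(u ^ 3 + u ^ 5) * u\<^sup>2 * exp (- (u\<^sup>2 / 4)) \<le> (2 * (1 + u) ^ 7) * exp (- (u\<^sup>2 / 4))"
        by (intro mult_right_mono) auto
      also have "\<dots> = 2 * ((1 + u) ^ 7 * exp (- (u\<^sup>2 / 4)))" by simp
      also have "\<dots> \<le> D" unfolding D_def using u by (intro mult_left_mono power_times_gaussian_le) auto
      finally have "((u ^ 3 + u ^ 5) * exp (- (u\<^sup>2 / 4))) * u\<^sup>2 \<le> D" by (simp only: mult_ac)
      then show "(u ^ 3 + u ^ 5) * exp (- (u\<^sup>2 / 4)) \<le> D / u\<^sup>2" using u by (subst pos_le_divide_eq) auto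
    qed auto
    also have "\<dots> = D / (n * x\<^sup>2) * (1 / (2 * real k + 1)\<^sup>2)" by (simp add: u_def power_mult_distrib)
    also have "\<dots> \<le> D / (n * x\<^sup>2) * (1 / (1 + real k)\<^sup>2)"
      by (intro mult_left_mono inverse_odd_square_le) (simp add: D_def)
    finally show ?thesis .
  qed
  have D0: "D / (n * x\<^sup>2) \<ge> 0" by (simp add: D_def)
  note d = abs_suminf_alt_le[OF dk D0]
  have sg: "summable (\<lambda>k. (-1) ^ k * gauss ((2 * real k + 1) * x))" by (rule summable_gauss_multiples[OF x])
  have sum: "summable (\<lambda>k. d k + (-1) ^ k * gauss ((2 * real k + 1) * x))" by (rule summable_add[OF d(1) sg])
  have eq: "d k + (-1) ^ k * gauss ((2 * real k + 1) * x) = sqrt n * ((-1) ^ k * spectral n ((2 * real k + 1) * (x / sqrt n)))" for k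
    by (simp add: d_def algebra_simps)
  have "summable (\<lambda>k. 1 / sqrt n * (sqrt n * ((-1) ^ k * spectral n ((2 * real k + 1) * (x / sqrt n)))))"
    using sum unfolding eq by (rule summable_mult)
  then have ss: "summable (\<lambda>k. (-1) ^ k * spectral n ((2 * real k + 1) * (x / sqrt n)))" using n by simp
  have "sqrt n * alt_sum (spectral n) (x / sqrt n) = (\<Sum>k. d k + (-1) ^ k * gauss ((2 * real k + 1) * x))"
    unfolding alt_sum_def eq by (rule suminf_mult[OF ss, symmetric])
  also have "\<dots> = (\<Sum>k. d k) + alt_sum gauss x" unfolding alt_sum_def by (rule suminf_add[OF d(1) sg, symmetric])
  finally have "\<bar>sqrt n * alt_sum (spectral n) (x / sqrt n) - alt_sum gauss x\<bar> = \<bar>\<Sum>k. d k\<bar>" by simp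
  also have "\<dots> \<le> 2 * (D / (n * x\<^sup>2))" by (rule d(2))
  finally show "\<bar>sqrt n * alt_sum (spectral n) (x / sqrt n) - alt_sum gauss x\<bar> \<le> 2 * D / (n * x\<^sup>2)" by simp
qed

section \<open>The theta series behind the limit density\<close>

definition theta_odd :: "real \<Rightarrow> real" where
  "theta_odd q = (\<Sum>k. (-1) ^ k * ((2 * real k + 1) * exp (- (q * (2 * real k + 1)\<^sup>2))))"

text \<open>From q = 1 / 2 on the terms decrease in size, so the alternating series is at least its
  first term minus its second, and the second, 3 exp (- 9 q), is at most half of the first.\<close>

lemma theta_odd_lower_bound:
  assumes "q \<ge> 1 / 2"
  shows "theta_odd q \<ge> exp (- q) / 2"
proof -
  define a where "a k = (2 * real k + 1) * exp (- (q * (2 * real k + 1)\<^sup>2))" for k :: nat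
  have "sqrt (2 * q) > 0" "(sqrt (2 * q))\<^sup>2 = 2 * q" using assms by auto
  then have "summable a" using summable_gauss_odd[of "sqrt (2 * q)"] by (simp add: a_def[abs_def])
  then have "a \<longlonglongrightarrow> 0" by (rule summable_LIMSEQ_zero)
  moreover have "a k \<ge> 0" for k by (simp add: a_def)
  moreover have "a (Suc k) \<le> a k" for k
  proof -
    define t where "t = q * (8 * real k + 8)"
    have "1 / 2 * (8 * real k + 8) \<le> t" unfolding t_def using assms by (intro mult_right_mono) auto
    moreover have "1 / 2 * (8 * real k + 8) = 4 * real k + 4" by simp
    ultimately have t: "t \<ge> 4 * real k + 4" by (simp only:)
    have e: "q * (2 * real (Suc k) + 1)\<^sup>2 = q * (2 * real k + 1)\<^sup>2 + t" by (simp add: t_def power2_eq_square algebra_simps)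
    have "2 * real k + 3 \<le> (2 * real k + 1) * (4 * real k + 5)" by (simp add: algebra_simps)
    also have "\<dots> \<le> (2 * real k + 1) * exp t" using exp_ge_add_one_self[of t] t by (intro mult_left_mono) linarith+
    finally have "(2 * real k + 3) * exp (- t) \<le> ((2 * real k + 1) * exp t) * exp (- t)" by (intro mult_right_mono) auto
    moreover have "(w * exp t) * exp (- t) = w" for w by (simp add: exp_minus)
    ultimately have "(2 * real k + 3) * exp (- t) \<le> 2 * real k + 1" by (simp only:)
    then have "(2 * real k + 3) * exp (- t) * exp (- (q * (2 * real k + 1)\<^sup>2)) \<le> (2 * real k + 1) * exp (- (q * (2 * real k + 1)\<^sup>2))"
      by (intro mult_right_mono) auto
    moreover have "exp (- (q * (2 * real (Suc k) + 1)\<^sup>2)) = exp (- t) * exp (- (q * (2 * real k + 1)\<^sup>2))"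
      unfolding e by (simp flip: exp_add)
    moreover have "2 * real (Suc k) + 1 = 2 * real k + 3" by simp
    ultimately show ?thesis unfolding a_def by (simp only: mult.assoc)
  qed
  ultimately have "(\<Sum>i<2 * 1. (-1) ^ i * a i) \<le> (\<Sum>i. (-1) ^ i * a i)"
    by (intro summable_Leibniz'(2)) auto
  then have "a 0 - a 1 \<le> theta_odd q" by (simp add: theta_odd_def a_def numeral_2_eq_2)
  moreover have "a 1 \<le> exp (- q) / 2"
  proof -
    have "6 \<le> 1 + 8 * q + (8 * q)\<^sup>2 / 2"
    proof -
      have "(8 * (1 / 2))\<^sup>2 \<le> (8 * q)\<^sup>2" using assms by (intro power_mono) auto
      then show ?thesis using assms by simp
    qed
    also have "\<dots> \<le> exp (8 * q)" using assms by (intro exp_lower_Taylor_quadratic) auto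
    finally have "6 * exp (- (9 * q)) \<le> exp (8 * q) * exp (- (9 * q))" by (intro mult_right_mono) auto
    also have "\<dots> = exp (- q)" by (simp flip: exp_add)
    finally show ?thesis by (simp add: a_def power2_eq_square mult.commute)
  qed
  moreover have "a 0 = exp (- q)" by (simp add: a_def)
  ultimately show ?thesis by linarith
qed

lemma height_density_theta: "height_density \<eta> = 4 * \<eta> / pi * theta_odd (\<eta>\<^sup>2 / 2)"
  unfolding height_density_def theta_odd_def by (simp add: mult_ac)

lemma theta_odd_functional:
  assumes "\<eta> > 0"
  shows "theta_odd (\<eta>\<^sup>2 / 2) = pi / 2 * sqrt (pi / 2) / \<eta> ^ 3 * theta_odd ((pi / (2 * \<eta>))\<^sup>2 / 2)"
  using theta_functional_equation[OF assms] unfolding theta_odd_def by (simp add: mult_ac)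

lemma alt_sum_gauss: "x > 0 \<Longrightarrow> alt_sum gauss x = x * theta_odd (x\<^sup>2 / 2)"
proof -
  assume x: "x > 0"
  have "sqrt (x\<^sup>2) > 0" using x by simp
  have "summable (\<lambda>k. \<bar>(-1) ^ k * ((2 * real k + 1) * exp (- (x\<^sup>2 / 2 * (2 * real k + 1)\<^sup>2)))\<bar>)"
    unfolding abs_mult using summable_gauss_odd[OF x] by simp
  then have "summable (\<lambda>k. (-1) ^ k * ((2 * real k + 1) * exp (- (x\<^sup>2 / 2 * (2 * real k + 1)\<^sup>2))))"
    by (rule summable_rabs_cancel)
  from suminf_mult[OF this, of x] show ?thesis
    unfolding alt_sum_def theta_odd_def gauss_def by (simp add: power_mult_distrib mult_ac)
qed

text \<open>The functional equation brings the density to the shape of the spectral formula: an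
  alternating sum with step pi / (2 \<eta>), the rescaled smallest angle. Every comparison of walk
  and density uses this form.\<close>

lemma height_density_gauss:
  assumes "\<eta> > 0"
  shows "height_density \<eta> = 4 / pi * sqrt (pi / 2) / \<eta> * alt_sum gauss (pi / (2 * \<eta>))"
proof -
  have "alt_sum gauss (pi / (2 * \<eta>)) = pi / (2 * \<eta>) * theta_odd ((pi / (2 * \<eta>))\<^sup>2 / 2)"
    using assms by (intro alt_sum_gauss) auto
  then show ?thesis
    unfolding height_density_theta theta_odd_functional[OF assms] using assms by (simp add: power3_eq_cube)
qed

lemma height_density_dual:
  assumes "\<eta> > 0"
  shows "height_density \<eta> = sqrt (2 * pi) / \<eta>\<^sup>2 *
    (\<Sum>k. (-1) ^ k * (2 * real k + 1) * exp (- (pi\<^sup>2 * (2 * real k + 1)\<^sup>2 / (8 * \<eta>\<^sup>2))))"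
proof -
  have "sqrt (2 * pi) = sqrt (4 * (pi / 2))" by simp
  also have "\<dots> = 2 * sqrt (pi / 2)" unfolding real_sqrt_mult by simp
  finally have s: "sqrt (2 * pi) = 2 * sqrt (pi / 2)" .
  have "theta_odd ((pi / (2 * \<eta>))\<^sup>2 / 2) = (\<Sum>k. (-1) ^ k * (2 * real k + 1) * exp (- (pi\<^sup>2 * (2 * real k + 1)\<^sup>2 / (8 * \<eta>\<^sup>2))))"
    unfolding theta_odd_def by (simp add: power_divide power_mult_distrib mult_ac)
  then show ?thesis
    unfolding height_density_theta theta_odd_functional[OF assms] s using assms by (simp add: power3_eq_cube power2_eq_square)
qed

text \<open>For \<eta> at most 1 the series itself has an argument above 1 / 2; for larger \<eta>
  its transform under the functional equation does. So the preceding lower bound always applies to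
  one of them.\<close>

lemma alt_sum_gauss_lower_bound:
  assumes "\<eta> > 0"
  shows "alt_sum gauss (pi / (2 * \<eta>)) \<ge> 1 / 4 * min (exp (- (2 / \<eta>\<^sup>2))) (exp (- (\<eta>\<^sup>2 / 2)))"
proof (cases "\<eta> \<le> 1")
  case True
  define x where "x = pi / (2 * \<eta>)"
  have "pi / 2 / 1 \<le> pi / 2 / \<eta>" using True assms by (intro divide_left_mono) auto
  then have x: "x \<ge> 3 / 2" using pi_gt3 by (simp add: x_def)
  have "(3 / 2)\<^sup>2 \<le> x\<^sup>2" using x by (intro power_mono) auto
  then have "x\<^sup>2 / 2 \<ge> 1 / 2" by (simp add: power_divide)
  then have t: "theta_odd (x\<^sup>2 / 2) \<ge> exp (- (x\<^sup>2 / 2)) / 2" by (rule theta_odd_lower_bound)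
  have "x\<^sup>2 / 2 \<le> 2 / \<eta>\<^sup>2"
  proof -
    have "pi\<^sup>2 \<le> 4\<^sup>2" using pi_less_4 by (intro power_mono) auto
    then have "pi\<^sup>2 / (8 * \<eta>\<^sup>2) \<le> 4\<^sup>2 / (8 * \<eta>\<^sup>2)" by (intro divide_right_mono) auto
    then show ?thesis by (simp add: x_def power_divide power_mult_distrib)
  qed
  then have "exp (- (2 / \<eta>\<^sup>2)) \<le> exp (- (x\<^sup>2 / 2))" by simp
  also have "\<dots> / 4 \<le> 1 * theta_odd (x\<^sup>2 / 2)" using t exp_gt_zero[of "- (x\<^sup>2 / 2)"] by linarith
  also have "\<dots> \<le> x * theta_odd (x\<^sup>2 / 2)" using x t exp_gt_zero[of "- (x\<^sup>2 / 2)"] by (intro mult_right_mono) linarith+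
  also have "\<dots> = alt_sum gauss x" using x by (intro alt_sum_gauss[symmetric]) auto
  finally have "exp (- (2 / \<eta>\<^sup>2)) / 4 \<le> alt_sum gauss x" by simp
  moreover have "min (exp (- (2 / \<eta>\<^sup>2))) (exp (- (\<eta>\<^sup>2 / 2))) \<le> exp (- (2 / \<eta>\<^sup>2))" by simp
  ultimately show ?thesis unfolding x_def by linarith
next
  case False
  have "1\<^sup>2 \<le> \<eta>\<^sup>2" using False by (intro power_mono) auto
  then have t: "theta_odd (\<eta>\<^sup>2 / 2) \<ge> exp (- (\<eta>\<^sup>2 / 2)) / 2" by (intro theta_odd_lower_bound) simp
  then have t0: "theta_odd (\<eta>\<^sup>2 / 2) \<ge> 0" using exp_ge_zero[of "- (\<eta>\<^sup>2 / 2)"] by linarith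
  have "4 * \<eta> / pi * theta_odd (\<eta>\<^sup>2 / 2) = 4 / pi * sqrt (pi / 2) / \<eta> * alt_sum gauss (pi / (2 * \<eta>))"
    using height_density_gauss[OF assms] height_density_theta by simp
  then have e: "\<eta>\<^sup>2 * theta_odd (\<eta>\<^sup>2 / 2) = sqrt (pi / 2) * alt_sum gauss (pi / (2 * \<eta>))"
    using assms by (simp add: field_simps power2_eq_square)
  have s2: "sqrt (pi / 2) \<le> 2" using pi_less_4 by (intro real_le_lsqrt) auto
  have "exp (- (\<eta>\<^sup>2 / 2)) / 2 \<le> 1 * theta_odd (\<eta>\<^sup>2 / 2)" using t by simp
  also have "\<dots> \<le> \<eta>\<^sup>2 * theta_odd (\<eta>\<^sup>2 / 2)" using \<open>1\<^sup>2 \<le> \<eta>\<^sup>2\<close> t0 by (intro mult_right_mono) auto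
  finally have b: "exp (- (\<eta>\<^sup>2 / 2)) / 2 \<le> sqrt (pi / 2) * alt_sum gauss (pi / (2 * \<eta>))" unfolding e .
  have "0 < sqrt (pi / 2) * alt_sum gauss (pi / (2 * \<eta>))" using b exp_gt_zero[of "- (\<eta>\<^sup>2 / 2)"] by linarith
  then have "alt_sum gauss (pi / (2 * \<eta>)) > 0" by (simp add: zero_less_mult_iff)
  then have "sqrt (pi / 2) * alt_sum gauss (pi / (2 * \<eta>)) \<le> 2 * alt_sum gauss (pi / (2 * \<eta>))" using s2 by (intro mult_right_mono) auto
  then have "exp (- (\<eta>\<^sup>2 / 2)) / 4 \<le> alt_sum gauss (pi / (2 * \<eta>))" using b by linarith
  moreover have "min (exp (- (2 / \<eta>\<^sup>2))) (exp (- (\<eta>\<^sup>2 / 2))) \<le> exp (- (\<eta>\<^sup>2 / 2))" by simp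
  ultimately show ?thesis by linarith
qed

text \<open>This pays for the barrier standing at h + 1 while the density is evaluated at h: t will
  be h / (h + 1). By the mean value theorem each term changes by (1 - t) a times a derivative at a
  point above a / 2, and there the derivative is at most a constant times a^(-3). The factor 8 is
  the cube of 2.\<close>

lemma alt_sum_gauss_scale:
  obtains C where "C \<ge> 0" "\<And>x t. x > 0 \<Longrightarrow> 1 / 2 \<le> t \<Longrightarrow> t < 1 \<Longrightarrow>
    \<bar>alt_sum gauss x - alt_sum gauss (t * x)\<bar> \<le> C * (1 - t) / x\<^sup>2"
proof
  define D where "D = 8 * exp ((real 5)\<^sup>2)"
  show "2 * D \<ge> 0" by (simp add: D_def)
  fix x t :: real assume x: "x > 0" and t: "1 / 2 \<le> t" "t < 1"
  define d where "d k = (-1) ^ k * gauss ((2 * real k + 1) * x) - (-1) ^ k * gauss ((2 * real k + 1) * (t * x))" for k :: nat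
  have dk: "\<bar>d k\<bar> \<le> D * (1 - t) / x\<^sup>2 * (1 / (1 + real k)\<^sup>2)" for k
  proof -
    define a where "a = (2 * real k + 1) * x"
    have a: "a > 0" using x by (simp add: a_def)
    have "\<exists>\<xi>. t * a < \<xi> \<and> \<xi> < a \<and> gauss a - gauss (t * a) = (a - t * a) * ((1 - \<xi>\<^sup>2) * exp (- (\<xi>\<^sup>2 / 2)))"
    proof (rule MVT2)
      show "t * a < a" using t a by simp
      fix z show "(gauss has_real_derivative (1 - z\<^sup>2) * exp (- (z\<^sup>2 / 2))) (at z)"
        unfolding gauss_def[abs_def] by (auto intro!: derivative_eq_intros simp: algebra_simps power2_eq_square)
    qed
    then obtain \<xi> where \<xi>: "t * a < \<xi>" "gauss a - gauss (t * a) = (a - t * a) * ((1 - \<xi>\<^sup>2) * exp (- (\<xi>\<^sup>2 / 2)))" by blast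
    have "a / 2 \<le> t * a" using t a by simp
    then have xa: "\<xi> > 0" "a / 2 \<le> \<xi>" using \<xi>(1) a by linarith+
    have "\<bar>1 - \<xi>\<^sup>2\<bar> \<le> (1 + \<xi>)\<^sup>2" using xa by (simp add: power2_eq_square algebra_simps abs_le_iff)
    then have "\<xi> ^ 3 * \<bar>1 - \<xi>\<^sup>2\<bar> \<le> (1 + \<xi>) ^ 3 * (1 + \<xi>)\<^sup>2" using xa by (intro mult_mono power_mono) auto
    also have "\<dots> = (1 + \<xi>) ^ 5" by (simp add: eval_nat_numeral)
    finally have "\<xi> ^ 3 * \<bar>1 - \<xi>\<^sup>2\<bar> * exp (- (\<xi>\<^sup>2 / 2)) \<le> (1 + \<xi>) ^ 5 * exp (- (\<xi>\<^sup>2 / 4))"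
      using xa by (intro mult_mono) auto
    also have "\<dots> \<le> exp ((real 5)\<^sup>2)" using xa by (intro power_times_gaussian_le) auto
    finally have b1: "\<xi> ^ 3 * (\<bar>1 - \<xi>\<^sup>2\<bar> * exp (- (\<xi>\<^sup>2 / 2))) \<le> exp ((real 5)\<^sup>2)" by (simp only: mult.assoc)
    have "(a / 2) ^ 3 * (\<bar>1 - \<xi>\<^sup>2\<bar> * exp (- (\<xi>\<^sup>2 / 2))) \<le> \<xi> ^ 3 * (\<bar>1 - \<xi>\<^sup>2\<bar> * exp (- (\<xi>\<^sup>2 / 2)))"
      using xa a by (intro mult_right_mono power_mono) auto
    then have "(a / 2) ^ 3 * (\<bar>1 - \<xi>\<^sup>2\<bar> * exp (- (\<xi>\<^sup>2 / 2))) \<le> exp ((real 5)\<^sup>2)" using b1 by linarith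
    then have b2: "\<bar>1 - \<xi>\<^sup>2\<bar> * exp (- (\<xi>\<^sup>2 / 2)) \<le> D / a ^ 3"
      using a unfolding D_def by (simp add: power_divide field_simps)
    have "\<bar>d k\<bar> = \<bar>gauss a - gauss (t * a)\<bar>"
    proof -
      have "d k = (-1) ^ k * (gauss a - gauss (t * a))" unfolding d_def a_def by (simp add: right_diff_distrib mult_ac)
      then show ?thesis by (simp add: abs_mult)
    qed
    also have "\<dots> = ((1 - t) * a) * (\<bar>1 - \<xi>\<^sup>2\<bar> * exp (- (\<xi>\<^sup>2 / 2)))"
    proof -
      have "a - t * a = (1 - t) * a" by (simp add: algebra_simps)
      then show ?thesis unfolding \<xi>(2) using t a by (simp add: abs_mult)
    qed
    also have "\<dots> \<le> ((1 - t) * a) * (D / a ^ 3)" using b2 t a by (intro mult_left_mono) auto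
    also have "\<dots> = D * (1 - t) / x\<^sup>2 * (1 / (2 * real k + 1)\<^sup>2)"
    proof -
      have "((1 - t) * a) * (D / a ^ 3) = D * (1 - t) / a\<^sup>2" using a by (simp add: power2_eq_square power3_eq_cube)
      then show ?thesis by (simp add: a_def power_mult_distrib)
    qed
    also have "\<dots> \<le> D * (1 - t) / x\<^sup>2 * (1 / (1 + real k)\<^sup>2)"
      using t by (intro mult_left_mono inverse_odd_square_le) (simp add: D_def)
    finally show ?thesis .
  qed
  have D0: "D * (1 - t) / x\<^sup>2 \<ge> 0" using t by (simp add: D_def)
  have "alt_sum gauss x - alt_sum gauss (t * x) = (\<Sum>k. d k)"
    unfolding alt_sum_def d_def using x t by (intro suminf_diff summable_gauss_multiples) auto
  then show "\<bar>alt_sum gauss x - alt_sum gauss (t * x)\<bar> \<le> 2 * D * (1 - t) / x\<^sup>2"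
    using abs_suminf_alt_le(2)[OF dk D0] by simp
qed

section \<open>Moments of all orders\<close>

lemma gaussian_moment_Gamma:
  "has_bochner_integral lborel (\<lambda>x::real. indicator {0..} x *\<^sub>R (exp (- x\<^sup>2) * x ^ s)) (Gamma ((real s + 1) / 2) / 2)"
proof (cases "even s")
  case True
  then obtain k where s: "s = 2 * k" by blast
  have "Gamma (real k + 1 / 2) = sqrt pi * (fact (2 * k) / (2 ^ (2 * k) * fact k))"
  proof (induction k)
    case 0
    show ?case by (simp add: Gamma_one_half_real)
  next
    case (Suc k)
    have "real k + 1 / 2 \<notin> \<int>\<^sub>\<le>\<^sub>0" by (auto dest: nonpos_Ints_nonpos)
    then have "Gamma ((real k + 1 / 2) + 1) = (real k + 1 / 2) * Gamma (real k + 1 / 2)" by (rule Gamma_plus1)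
    moreover have "(real k + 1 / 2) + 1 = real (Suc k) + 1 / 2" by simp
    ultimately have "Gamma (real (Suc k) + 1 / 2) = (real k + 1 / 2) * (sqrt pi * (fact (2 * k) / (2 ^ (2 * k) * fact k)))"
      unfolding Suc by (simp only:)
    also have "\<dots> = sqrt pi * (((2 * real k + 2) * (2 * real k + 1) * fact (2 * k)) / (4 * 2 ^ (2 * k) * ((real k + 1) * fact k)))"
    proof -
      have "(a + 1 / 2) * (P * (F / (T * K))) = P * (((2 * a + 2) * (2 * a + 1) * F) / (4 * T * ((a + 1) * K)))"
        if "a + 1 \<noteq> 0" for a P F T K :: real
      proof -
        have "4 * T * ((a + 1) * K) = (4 * (a + 1)) * (T * K)" by (simp only: mult_ac)
        moreover have "(2 * a + 2) * (2 * a + 1) * F = (4 * (a + 1)) * ((a + 1 / 2) * F)" by (simp add: algebra_simps)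
        moreover have "((4 * (a + 1)) * ((a + 1 / 2) * F)) / ((4 * (a + 1)) * (T * K)) = ((a + 1 / 2) * F) / (T * K)"
          using that by (intro mult_divide_mult_cancel_left) simp
        ultimately have "((2 * a + 2) * (2 * a + 1) * F) / (4 * T * ((a + 1) * K)) = ((a + 1 / 2) * F) / (T * K)" by (simp only:)
        then show ?thesis by simp
      qed
      then show ?thesis by simp
    qed
    also have "(2 * real k + 2) * (2 * real k + 1) * fact (2 * k) = fact (2 * Suc k)" by (simp add: algebra_simps)
    also have "4 * 2 ^ (2 * k) * ((real k + 1) * fact k) = 2 ^ (2 * Suc k) * fact (Suc k)" by simp
    finally show ?case .
  qed
  moreover have "(real s + 1) / 2 = real k + 1 / 2" by (simp add: s add_divide_distrib)
  ultimately show ?thesis using gaussian_moment_even_pos[of k] by (simp only: s) (simp add: mult.commute)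
next
  case False
  then obtain k where s: "s = 2 * k + 1" by (elim oddE)
  have "(real s + 1) / 2 = 1 + real k" by (simp add: s)
  then show ?thesis using gaussian_moment_odd_pos[of k] by (simp only: Gamma_fact) (simp only: s)
qed

lemma has_bochner_integral_scaled_gauss:
  assumes "(m :: real) > 0"
  shows "has_bochner_integral lborel (\<lambda>y. if y > 0 then y ^ (r + 1) * (m * exp (- (m\<^sup>2 * y\<^sup>2 / 2))) else 0)
    (sqrt 2 ^ r * Gamma (real r / 2 + 1) / m ^ (r + 1))"
proof -
  define c where "c = m / sqrt 2"
  have c: "c > 0" "c\<^sup>2 = m\<^sup>2 / 2" using assms by (simp_all add: c_def power_divide)
  have "has_bochner_integral lborel (\<lambda>y. indicator {0..} (0 + c * y) *\<^sub>R (exp (- (0 + c * y)\<^sup>2) * (0 + c * y) ^ (r + 1)))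
    ((Gamma ((real (r + 1) + 1) / 2) / 2) /\<^sub>R \<bar>c\<bar>)"
    using c by (intro lborel_has_bochner_integral_real_affine_iff[THEN iffD1, OF _ gaussian_moment_Gamma]) simp
  then have "has_bochner_integral lborel (\<lambda>y. m / c ^ (r + 1) * (indicator {0..} (0 + c * y) *\<^sub>R (exp (- (0 + c * y)\<^sup>2) * (0 + c * y) ^ (r + 1))))
    (m / c ^ (r + 1) * ((Gamma ((real (r + 1) + 1) / 2) / 2) /\<^sub>R \<bar>c\<bar>))"
    by (rule has_bochner_integral_mult_right)
  moreover have "m / c ^ (r + 1) * (indicator {0..} (0 + c * y) *\<^sub>R (exp (- (0 + c * y)\<^sup>2) * (0 + c * y) ^ (r + 1)))
      = (if y > 0 then y ^ (r + 1) * (m * exp (- (m\<^sup>2 * y\<^sup>2 / 2))) else 0)" for y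
  proof (cases "y > 0")
    case True
    then have "c * y \<ge> 0" using c by simp
    moreover have "(c * y)\<^sup>2 = m\<^sup>2 * y\<^sup>2 / 2" by (simp add: power_mult_distrib c(2))
    moreover have "c ^ (r + 1) \<noteq> 0" using c by simp
    ultimately show ?thesis using True by (simp add: power_mult_distrib del: power_Suc)
  next
    case False
    then consider "y = 0" | "y < 0" by linarith
    then show ?thesis using c by cases (simp_all add: mult_pos_neg not_le indicator_def)
  qed
  moreover have "m / c ^ (r + 1) * ((Gamma ((real (r + 1) + 1) / 2) / 2) /\<^sub>R \<bar>c\<bar>) = sqrt 2 ^ r * Gamma (real r / 2 + 1) / m ^ (r + 1)"
  proof -
    have "(real (r + 1) + 1) / 2 = real r / 2 + 1" by simp
    moreover have "m / c ^ (r + 1) * ((\<Gamma> / 2) /\<^sub>R \<bar>c\<bar>) = sqrt 2 ^ r * \<Gamma> / m ^ (r + 1)" for \<Gamma>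
      using assms unfolding c_def by (simp add: power_divide field_simps)
    ultimately show ?thesis by (simp only:)
  qed
  ultimately show ?thesis by (simp only:)
qed

lemma dirichlet_beta_nat: "dirichlet_beta (real r + 1) = (\<Sum>k. (-1) ^ k * (1 / (2 * real k + 1) ^ (r + 1)))"
proof -
  have "(2 * real k + 1) powr (- (real r + 1)) = 1 / (2 * real k + 1) ^ (r + 1)" for k
  proof -
    have "(2 * real k + 1) powr (- (real r + 1)) = 1 / (2 * real k + 1) powr (real (r + 1))"
      unfolding powr_minus_divide by (simp add: add.commute)
    also have "(2 * real k + 1) powr (real (r + 1)) = (2 * real k + 1) ^ (r + 1)" by (intro powr_realpow) auto
    finally show ?thesis .
  qed
  then show ?thesis by (simp add: dirichlet_beta_def)
qed

lemma inverse_odd_power_le: "r \<ge> 1 \<Longrightarrow> 1 / (2 * real k + 1) ^ (r + 1) \<le> 1 / (1 + real k)\<^sup>2"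
proof -
  assume "r \<ge> 1"
  then have "(2 * real k + 1)\<^sup>2 \<le> (2 * real k + 1) ^ (r + 1)" by (intro power_increasing) auto
  then have "1 / (2 * real k + 1) ^ (r + 1) \<le> 1 / (2 * real k + 1)\<^sup>2" by (intro divide_left_mono mult_pos_pos zero_less_power) auto
  also have "\<dots> \<le> 1 / (1 + real k)\<^sup>2" by (rule inverse_odd_square_le)
  finally show ?thesis .
qed

text \<open>Termwise integration of the density series. The integral of the k-th absolute term is a
  constant times (2 k + 1)^(-(r + 1)), so \<open>r >= 1\<close> gives the summability needed for the
  interchange, and the signs turn these values into the beta series.\<close>

lemma integral_height_density:
  assumes "r \<ge> 1"
  shows "(\<integral>y. (if y > 0 then y ^ r * height_density y else 0) \<partial>lborel)
    = 4 / pi * (sqrt 2 ^ r * Gamma (real r / 2 + 1)) * dirichlet_beta (real r + 1)"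
proof -
  define A where "A = 4 / pi * (sqrt 2 ^ r * Gamma (real r / 2 + 1))"
  have A: "A > 0" unfolding A_def by (intro mult_pos_pos divide_pos_pos Gamma_real_pos zero_less_power) auto
  define u where "u k y = (if y > 0 then y ^ (r + 1) * ((2 * real k + 1) * exp (- ((2 * real k + 1)\<^sup>2 * y\<^sup>2 / 2))) else 0)" for k :: nat and y :: real
  define f where "f k y = 4 / pi * (-1) ^ k * u k y" for k y
  have u: "has_bochner_integral lborel (u k) (sqrt 2 ^ r * Gamma (real r / 2 + 1) / (2 * real k + 1) ^ (r + 1))" for k
    unfolding u_def by (rule has_bochner_integral_scaled_gauss) simp
  have u0: "u k y \<ge> 0" for k y by (simp add: u_def)
  have "has_bochner_integral lborel (f k) (4 / pi * (-1) ^ k * (sqrt 2 ^ r * Gamma (real r / 2 + 1) / (2 * real k + 1) ^ (r + 1)))" for k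
    unfolding f_def by (rule has_bochner_integral_mult_right[OF u])
  then have f: "has_bochner_integral lborel (f k) (A * ((-1) ^ k * (1 / (2 * real k + 1) ^ (r + 1))))" for k
    by (simp add: A_def mult_ac)
  have nf: "norm (f k y) = 4 / pi * u k y" for k y using u0 by (simp add: f_def abs_mult)
  have "has_bochner_integral lborel (\<lambda>y. 4 / pi * u k y) (4 / pi * (sqrt 2 ^ r * Gamma (real r / 2 + 1) / (2 * real k + 1) ^ (r + 1)))" for k
    by (rule has_bochner_integral_mult_right[OF u])
  then have inf: "(\<integral>y. norm (f k y) \<partial>lborel) = A * (1 / (2 * real k + 1) ^ (r + 1))" for k
    unfolding nf A_def by (simp add: has_bochner_integral_iff)
  have so: "summable (\<lambda>k. 1 / (2 * real k + 1) ^ (r + 1))"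
    by (rule summable_comparison_test'[OF summable_inverse_squares(1)]) (use inverse_odd_power_le[OF assms] in simp)
  have su: "summable (\<lambda>k. (2 * real k + 1) * exp (- ((2 * real k + 1)\<^sup>2 * y\<^sup>2 / 2)))" if "y > 0" for y
    using summable_gauss_odd[OF that] by (simp only: mult.commute)
  have sf: "summable (\<lambda>k. norm (f k y))" for y
    unfolding nf u_def using su[of y] by (cases "y > 0") (auto intro!: summable_mult)
  have "(\<integral>y. (\<Sum>k. f k y) \<partial>lborel) = (\<Sum>k. integral\<^sup>L lborel (f k))"
  proof (rule integral_suminf)
    show "integrable lborel (f k)" for k using f[of k] by (simp only: has_bochner_integral_iff)
    show "summable (\<lambda>k. \<integral>y. norm (f k y) \<partial>lborel)" unfolding inf by (rule summable_mult[OF so])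
  qed (use sf in simp)
  also have "\<dots> = (\<Sum>k. A * ((-1) ^ k * (1 / (2 * real k + 1) ^ (r + 1))))"
    using f by (simp add: has_bochner_integral_iff)
  also have "\<dots> = A * dirichlet_beta (real r + 1)"
    unfolding dirichlet_beta_nat
  proof (rule suminf_mult, rule summable_rabs_cancel)
    show "summable (\<lambda>k. \<bar>(-1) ^ k * (1 / (2 * real k + 1) ^ (r + 1))\<bar>)" using so by (simp add: abs_mult)
  qed
  also have "(\<lambda>y. \<Sum>k. f k y) = (\<lambda>y. if y > 0 then y ^ r * height_density y else 0)"
  proof
    fix y :: real
    show "(\<Sum>k. f k y) = (if y > 0 then y ^ r * height_density y else 0)"
    proof (cases "y > 0")
      case True
      have s: "summable (\<lambda>k. (-1) ^ k * (2 * real k + 1) * exp (- ((2 * real k + 1)\<^sup>2 * y\<^sup>2 / 2)))"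
        by (rule summable_rabs_cancel) (use su[OF True] in \<open>simp add: abs_mult\<close>)
      from suminf_mult[OF this, of "y ^ r * (4 * y / pi)"] True show ?thesis
        unfolding f_def u_def height_density_def by (simp add: mult_ac)
    qed (simp add: f_def u_def)
  qed
  finally show ?thesis by (simp add: A_def)
qed

section \<open>Passage to the limit in the moment integrals\<close>

lemma radial_spectral_continuous: "\<forall>\<^sub>F n in sequentially. continuous_on UNIV (radial e (spectral n))"
proof -
  obtain g' where g': "wclass False 0 g'" "\<forall>\<^sub>F n in sequentially. \<forall>x. (spectral n has_real_derivative g' n x) (at x)"
    using wclass_deriv[OF wclass_spectral] by auto
  show ?thesis
    using g'(2) wclass_support[OF g'(1)] eventually_gt_at_top[of 0]
  proof eventually_elim
    case (elim n)
    have "(radial e (spectral n) has_real_derivative radial (e - 1) (\<lambda>x. of_int e * spectral n x - x * g' n x) H) (at H)" for H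
    proof (rule DERIV_radial)
      show "spectral n x = 0" if "x \<ge> pi / 2" for x using that elim(3) by (intro spectral_beyond) auto
      show "g' n x = 0" if "x \<ge> pi / 2" for x using that elim(2) by auto
      show "(spectral n has_real_derivative g' n x) (at x)" for x using elim(1) by blast
    qed
    then show ?case by (intro continuous_of_DERIV)
  qed
qed

lemma radial_nonpos: "H \<le> 0 \<Longrightarrow> radial e g H = 0"
  by (simp add: radial_def)

lemma integrable_inverse_quadratic: "integrable lborel (\<lambda>y::real. B * inverse (1 + y\<^sup>2))"
  using integrable_inverse_1_plus_square by (intro integrable_mult_right) (simp add: set_integrable_def)

lemma inverse_square_le: "(y::real) \<ge> 0 \<Longrightarrow> 1 / (1 + y)\<^sup>2 \<le> inverse (1 + y\<^sup>2)"
  unfolding inverse_eq_divide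
proof (intro divide_left_mono mult_pos_pos)
  assume y: "y \<ge> 0"
  show "1 + y\<^sup>2 \<le> (1 + y)\<^sup>2" using y by (simp add: power2_eq_square algebra_simps)
  show "0 < 1 + y\<^sup>2" by (intro add_pos_nonneg) auto
  show "0 < (1 + y)\<^sup>2" using y by simp
qed simp

lemma radial_spectral_primitive:
  "\<forall>\<^sub>F n in sequentially. \<exists>J. (\<forall>x\<ge>0. (J has_real_derivative radial e (spectral n) x) (at x)) \<and> J 0 = 0
     \<and> (J \<longlongrightarrow> integral\<^sup>L lborel (radial e (spectral n))) at_top"
proof -
  obtain B where B: "B \<ge> 0" "\<forall>\<^sub>F n in sequentially. \<forall>H>0.
      \<bar>radial e (spectral n) H\<bar> \<le> B * sqrt n powi (e - 1) * (1 / (1 + H / sqrt n)\<^sup>2)"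
    using radial_bound[OF wclass_spectral, of e] by blast
  show ?thesis using radial_spectral_continuous[of e] B(2) eventually_gt_at_top[of 0]
  proof eventually_elim
    case (elim n)
    define R where "R = radial e (spectral n)"
    define q where "q = sqrt (real n)"
    have q: "q > 0" using elim(3) by (simp add: q_def)
    have R0: "R H = 0" if "H \<le> 0" for H using that by (simp add: R_def radial_nonpos)
    define K where "K = B * q powi (e - 1)"
    have K: "K \<ge> 0" using B(1) q by (simp add: K_def)
    have "norm (R H) \<le> K * inverse (1 + (0 + 1 / q * H)\<^sup>2)" for H
    proof (cases "H > 0")
      case True
      then have "\<bar>R H\<bar> \<le> K * (1 / (1 + H / q)\<^sup>2)" using elim(2) by (simp add: R_def K_def q_def)
      also have "\<dots> \<le> K * inverse (1 + (H / q)\<^sup>2)" using True q by (intro mult_left_mono inverse_square_le K) auto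
      finally show ?thesis by simp
    qed (use R0 K in simp)
    moreover have "integrable lborel (\<lambda>H. K * inverse (1 + (0 + 1 / q * H)\<^sup>2))"
      by (rule lborel_integrable_real_affine[OF integrable_inverse_quadratic]) (use q in simp)
    moreover have "R \<in> borel_measurable lborel"
      using borel_measurable_continuous_onI[OF elim(1)] by (simp add: R_def)
    moreover have "norm (K * inverse (1 + (0 + 1 / q * H)\<^sup>2)) = K * inverse (1 + (0 + 1 / q * H)\<^sup>2)" for H
      using K by (simp add: abs_of_nonneg)
    ultimately have int: "integrable lborel R" by (intro Bochner_Integration.integrable_bound[of lborel "\<lambda>H. K * inverse (1 + (0 + 1 / q * H)\<^sup>2)" R]) auto
    \<comment> \<open>The base point -1 makes \<open>J\<close> differentiable at 0, and
      \<open>J 0 = 0\<close> still holds since the integrand vanishes on the negative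
      half-line.\<close>
    define J where "J x = integral {-1..x} R" for x
    have "\<forall>x\<ge>0. (J has_real_derivative R x) (at x)"
      unfolding J_def using elim(1) by (intro allI impI DERIV_integral_lower) (auto simp: R_def)
    moreover have "J 0 = 0" unfolding J_def using R0 by (subst integral_cong[where g = "\<lambda>_. 0"]) auto
    moreover have "(J \<longlongrightarrow> integral\<^sup>L lborel R) at_top"
    proof (rule Lim_transform_eventually)
      show "((\<lambda>y. \<integral>x. indicator {..y} x *\<^sub>R R x \<partial>lborel) \<longlongrightarrow> integral\<^sup>L lborel R) at_top"
        by (rule tendsto_integral_at_top[OF _ int]) simp
      show "\<forall>\<^sub>F y in at_top. (\<integral>x. indicator {..y} x *\<^sub>R R x \<partial>lborel) = J y"
        using eventually_ge_at_top[of "0 :: real"]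
      proof eventually_elim
        case (elim y)
        have "indicator {..y} x *\<^sub>R R x = indicator {-1..y} x *\<^sub>R R x" for x
          using elim R0[of x] by (auto simp: indicator_def)
        moreover have "set_integrable lborel {-1..y} R"
          unfolding set_integrable_def by (rule integrable_mult_indicator[OF _ int]) simp
        then have "(LINT x:{-1..y}|lborel. R x) = J y"
          unfolding J_def by (rule set_borel_integral_eq_integral)
        ultimately show ?case unfolding set_lebesgue_integral_def by (simp only:)
      qed
    qed
    ultimately show ?case unfolding R_def by blast
  qed
qed

lemma moment_integral:
  "\<exists>C\<ge>0. \<forall>\<^sub>F n in sequentially. \<bar>moment r n - 2 * integral\<^sup>L lborel (radial (int r - 1) (spectral n))\<bar> \<le> C * sqrt n powi (- int K)"
proof -
  obtain C where C: "C \<ge> 0" "\<forall>\<^sub>F n in sequentially. \<forall>J l.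
     (\<forall>x\<ge>0. (J has_real_derivative radial (int r - 1) (spectral n) x) (at x)) \<longrightarrow> J 0 = 0 \<longrightarrow> (J \<longlongrightarrow> l) at_top \<longrightarrow>
     \<bar>moment r n - 2 * l\<bar> \<le> C * sqrt n powi (- int K)"
    using moment_asymptotics[of r K] by blast
  have "\<forall>\<^sub>F n in sequentially. \<bar>moment r n - 2 * integral\<^sup>L lborel (radial (int r - 1) (spectral n))\<bar> \<le> C * sqrt n powi (- int K)"
    using C(2) radial_spectral_primitive[of "int r - 1"] by eventually_elim blast
  then show ?thesis using C(1) by blast
qed

text \<open>After substituting H = sqrt n y the integrand converges pointwise by
  \<open>alt_sum_gauss_diff\<close> and is dominated by B / (1 + y^2) by
  \<open>radial_bound\<close>. Through \<open>height_density_gauss\<close> twice the limit is sqrt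
  (pi / 2) y^r times the density.\<close>

lemma moment_limit:
  assumes "r \<ge> 1"
  shows "(\<lambda>n. moment r n / sqrt n ^ (r - 1)) \<longlonglongrightarrow>
    sqrt (pi / 2) * (4 / pi * (sqrt 2 ^ r * Gamma (real r / 2 + 1)) * dirichlet_beta (real r + 1))"
proof -
  define d where "d = r - 1"
  have e: "int r - 1 = int d" "r = Suc d" using assms by (simp_all add: d_def)
  define R where "R n = radial (int r - 1) (spectral n)" for n
  define A where "A y = alt_sum gauss (pi / (2 * y))" for y
  define f where "f y = (if y > 0 then y ^ d * A y else 0)" for y
  define s where "s n y = sqrt (real n) / sqrt (real n) ^ d * R n (0 + sqrt (real n) * y)" for n :: nat and y
  obtain B where B: "B \<ge> 0" "\<forall>\<^sub>F n in sequentially. \<forall>H>0. \<bar>R n H\<bar> \<le> B * sqrt n powi (int r - 1 - 1) * (1 / (1 + H / sqrt n)\<^sup>2)"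
    using radial_bound[OF wclass_spectral, of "int r - 1"] unfolding R_def by blast
  obtain C where C: "C \<ge> 0" "\<forall>\<^sub>F n in sequentially. \<bar>moment r n - 2 * integral\<^sup>L lborel (R n)\<bar> \<le> C * sqrt n powi (- int r)"
    using moment_integral[of r r] unfolding R_def by blast
  have R0: "R n H = 0" if "H \<le> 0" for n H using that by (simp add: R_def radial_nonpos)
  have "\<forall>\<^sub>F n in sequentially. n \<ge> 2 \<and> continuous_on UNIV (R n) \<and>
      (\<forall>H>0. \<bar>R n H\<bar> \<le> B * sqrt n powi (int r - 1 - 1) * (1 / (1 + H / sqrt n)\<^sup>2)) \<and>
      \<bar>moment r n - 2 * integral\<^sup>L lborel (R n)\<bar> \<le> C * sqrt n powi (- int r)"
    unfolding R_def by (intro eventually_conj eventually_ge_at_top radial_spectral_continuous B(2)[unfolded R_def] C(2)[unfolded R_def])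
  then obtain N where N: "\<And>n. n \<ge> N \<Longrightarrow> n \<ge> 2" "\<And>n. n \<ge> N \<Longrightarrow> continuous_on UNIV (R n)"
      "\<And>n H. n \<ge> N \<Longrightarrow> H > 0 \<Longrightarrow> \<bar>R n H\<bar> \<le> B * sqrt n powi (int r - 1 - 1) * (1 / (1 + H / sqrt n)\<^sup>2)"
      "\<And>n. n \<ge> N \<Longrightarrow> \<bar>moment r n - 2 * integral\<^sup>L lborel (R n)\<bar> \<le> C * sqrt n powi (- int r)"
    unfolding eventually_sequentially by blast
  have meas: "R n \<in> borel_measurable borel" if "n \<ge> N" for n
    using N(2)[OF that] by (rule borel_measurable_continuous_onI)
  have meas_s: "s n \<in> borel_measurable lborel" if "n \<ge> N" for n
    unfolding s_def using meas[OF that] by measurable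
  have s_bound: "norm (s n y) \<le> B * inverse (1 + y\<^sup>2)" if "n \<ge> N" for n y
  proof (cases "y > 0")
    case True
    have n: "sqrt (real n) > 0" using N(1)[OF that] by simp
    define q where "q = sqrt (real n)"
    have q: "q > 0" using n by (simp add: q_def)
    have p: "q powi (int r - 1 - 1) = q ^ d / q" unfolding e(1) using q by (simp add: power_int_diff)
    have "\<bar>R n (q * y)\<bar> \<le> B * q powi (int r - 1 - 1) * (1 / (1 + q * y / q)\<^sup>2)"
      unfolding q_def by (rule N(3)[OF that]) (use n True in simp)
    also have "\<dots> = B * (q ^ d / q) * (1 / (1 + y)\<^sup>2)" unfolding p using q by simp
    finally have "q / q ^ d * \<bar>R n (q * y)\<bar> \<le> q / q ^ d * (B * (q ^ d / q) * (1 / (1 + y)\<^sup>2))" using q by (intro mult_left_mono) auto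
    also have "\<dots> = B * (1 / (1 + y)\<^sup>2)" using q by simp
    also have "\<dots> \<le> B * inverse (1 + y\<^sup>2)" using True by (intro mult_left_mono inverse_square_le B(1)) auto
    finally show ?thesis using q unfolding s_def q_def[symmetric] by (simp add: abs_mult)
  next
    case False
    then have "sqrt n * y \<le> 0" by (simp add: mult_nonneg_nonpos)
    then show ?thesis using B(1) R0 by (simp add: s_def)
  qed
  obtain D where D: "D \<ge> 0" "\<And>n x. n \<ge> 2 \<Longrightarrow> x > 0 \<Longrightarrow>
    \<bar>sqrt n * alt_sum (spectral n) (x / sqrt n) - alt_sum gauss x\<bar> \<le> D / (n * x\<^sup>2)"
    using alt_sum_gauss_diff by blast
  \<comment> \<open>Measurability and domination are known only from \<open>N\<close> on; the shift
    lets dominated convergence see just those indices.\<close>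
  have s_lim: "(\<lambda>n. s (n + N) y) \<longlonglongrightarrow> f y" for y
  proof (cases "y > 0")
    case True
    define x where "x = pi / (2 * y)"
    have x: "x > 0" using True by (simp add: x_def)
    have "(\<lambda>n. sqrt n * alt_sum (spectral n) (x / sqrt n) - alt_sum gauss x) \<longlonglongrightarrow> 0"
    proof (rule Lim_null_comparison)
      show "\<forall>\<^sub>F n in sequentially. norm (sqrt (real n) * alt_sum (spectral n) (x / sqrt (real n)) - alt_sum gauss x) \<le> D / x\<^sup>2 / real n"
        using eventually_ge_at_top[of 2]
      proof eventually_elim
        case (elim n)
        then show ?case using D(2)[OF _ x, of n] by (simp add: mult.commute)
      qed
      show "(\<lambda>n. D / x\<^sup>2 / real n) \<longlonglongrightarrow> 0" by real_asymp
    qed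
    from tendsto_add[OF this tendsto_const[of "alt_sum gauss x"]]
    have "(\<lambda>n. y ^ d * (sqrt n * alt_sum (spectral n) (x / sqrt n))) \<longlonglongrightarrow> y ^ d * alt_sum gauss x"
      by (intro tendsto_mult_left) simp
    moreover have "\<forall>\<^sub>F n in sequentially. y ^ d * (sqrt n * alt_sum (spectral n) (x / sqrt n)) = s n y"
      using eventually_gt_at_top[of 0]
    proof eventually_elim
      case (elim n)
      define q where "q = sqrt (real n)"
      have q: "q > 0" using elim by (simp add: q_def)
      have "q * y > 0" using q True by simp
      moreover have "pi / (2 * (q * y)) = x / q" by (simp add: x_def)
      ultimately have "R n (q * y) = (q * y) ^ d * alt_sum (spectral n) (x / q)"
        unfolding R_def radial_def e(1) by (simp only: if_True power_int_of_nat)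
      then show ?case using q unfolding s_def q_def[symmetric] by (simp add: power_mult_distrib)
    qed
    ultimately have "(\<lambda>n. s n y) \<longlonglongrightarrow> y ^ d * alt_sum gauss x" by (rule Lim_transform_eventually)
    then have "(\<lambda>n. s (n + N) y) \<longlonglongrightarrow> y ^ d * alt_sum gauss x" by (rule LIMSEQ_ignore_initial_segment)
    then show ?thesis using True by (simp add: f_def A_def x_def)
  next
    case False
    then have "sqrt n * y \<le> 0" for n :: nat by (simp add: mult_nonneg_nonpos)
    then have "s n y = 0" for n using R0 by (simp add: s_def)
    then show ?thesis using False by (simp add: f_def)
  qed
  have meas_f: "f \<in> borel_measurable lborel"
    by (rule borel_measurable_LIMSEQ_real[OF s_lim]) (rule meas_s, simp)
  have dom: "(\<lambda>n. integral\<^sup>L lborel (s (n + N))) \<longlonglongrightarrow> integral\<^sup>L lborel f"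
    by (rule integral_dominated_convergence[OF meas_f meas_s integrable_inverse_quadratic AE_I2[OF s_lim] AE_I2[OF s_bound]]) auto
  have approx: "\<bar>moment r n / sqrt n ^ d - 2 * integral\<^sup>L lborel (s n)\<bar> \<le> C / sqrt n" if n: "n \<ge> N" for n
  proof -
    define q where "q = sqrt (real n)"
    have q: "q \<ge> 1" using N(1)[OF n] by (simp add: q_def)
    have "integral\<^sup>L lborel (R n) = \<bar>q\<bar> *\<^sub>R (\<integral>y. R n (0 + q * y) \<partial>lborel)"
      using q by (intro lborel_integral_real_affine) auto
    then have l: "integral\<^sup>L lborel (R n) = q ^ d * integral\<^sup>L lborel (s n)"
      using q unfolding s_def q_def[symmetric] by simp
    have "\<bar>moment r n - 2 * integral\<^sup>L lborel (R n)\<bar> \<le> C * sqrt n powi (- int r)" by (rule N(4)[OF n])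
    then have "\<bar>moment r n - 2 * (q ^ d * integral\<^sup>L lborel (s n))\<bar> \<le> C * (1 / q ^ r)"
      unfolding l q_def[symmetric] by (simp add: power_int_minus inverse_eq_divide)
    also have "\<dots> \<le> C * (q ^ d / q)"
    proof (intro mult_left_mono C(1))
      have "q ^ 1 \<le> q ^ r" using q assms by (intro power_increasing) auto
      then have "1 / q ^ r \<le> 1 / q" using q by (intro divide_left_mono) auto
      also have "\<dots> \<le> q ^ d / q" using q by (intro divide_right_mono) auto
      finally show "1 / q ^ r \<le> q ^ d / q" .
    qed
    finally have "\<bar>moment r n - 2 * (q ^ d * integral\<^sup>L lborel (s n))\<bar> / q ^ d \<le> C * (q ^ d / q) / q ^ d"
      using q by (intro divide_right_mono) auto
    moreover have "\<bar>moment r n - 2 * (q ^ d * integral\<^sup>L lborel (s n))\<bar> / q ^ d = \<bar>moment r n / q ^ d - 2 * integral\<^sup>L lborel (s n)\<bar>"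
    proof -
      have "\<bar>moment r n - 2 * (q ^ d * integral\<^sup>L lborel (s n))\<bar> / q ^ d = \<bar>(moment r n - 2 * (q ^ d * integral\<^sup>L lborel (s n))) / q ^ d\<bar>"
        using q by simp
      also have "(moment r n - 2 * (q ^ d * integral\<^sup>L lborel (s n))) / q ^ d = moment r n / q ^ d - 2 * integral\<^sup>L lborel (s n)"
        using q by (simp add: diff_divide_distrib)
      finally show ?thesis .
    qed
    moreover have "C * (q ^ d / q) / q ^ d = C / q" using q by simp
    ultimately show ?thesis by (simp only: q_def)
  qed
  have "(\<lambda>n. moment r n / sqrt n ^ d - 2 * integral\<^sup>L lborel (s n)) \<longlonglongrightarrow> 0"
  proof (rule Lim_null_comparison)
    show "\<forall>\<^sub>F n in sequentially. norm (moment r n / sqrt n ^ d - 2 * integral\<^sup>L lborel (s n)) \<le> C / sqrt n"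
      using eventually_ge_at_top[of N] by eventually_elim (use approx in simp)
    show "(\<lambda>n. C / sqrt (real n)) \<longlonglongrightarrow> 0" by real_asymp
  qed
  moreover have "(\<lambda>n. integral\<^sup>L lborel (s n)) \<longlonglongrightarrow> integral\<^sup>L lborel f" using dom by (rule LIMSEQ_offset)
  then have "(\<lambda>n. 2 * integral\<^sup>L lborel (s n)) \<longlonglongrightarrow> 2 * integral\<^sup>L lborel f" by (rule tendsto_mult_left)
  ultimately have "(\<lambda>n. (moment r n / sqrt n ^ d - 2 * integral\<^sup>L lborel (s n)) + 2 * integral\<^sup>L lborel (s n)) \<longlonglongrightarrow> 0 + 2 * integral\<^sup>L lborel f"
    by (rule tendsto_add)
  then have "(\<lambda>n. moment r n / sqrt n ^ d) \<longlonglongrightarrow> 2 * integral\<^sup>L lborel f" by simp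
  also have "2 * integral\<^sup>L lborel f = sqrt (pi / 2) * (\<integral>y. (if y > 0 then y ^ r * height_density y else 0) \<partial>lborel)"
  proof -
    have "2 * f y = sqrt (pi / 2) * (if y > 0 then y ^ r * height_density y else 0)" for y
    proof (cases "y > 0")
      case True
      have "p * (y ^ r * (4 / pi * p / y * a)) = 4 / pi * (p * p) * (y ^ d * a)" for p a
        using True by (simp add: e(2))
      from this[of "sqrt (pi / 2)" "A y"] show ?thesis
        using True unfolding f_def A_def height_density_gauss[OF True] by simp
    qed (simp add: f_def)
    then have "(\<integral>y. 2 * f y \<partial>lborel) = (\<integral>y. sqrt (pi / 2) * (if y > 0 then y ^ r * height_density y else 0) \<partial>lborel)" by simp
    then show ?thesis by (simp only: integral_mult_right_zero)
  qed
  finally show ?thesis unfolding integral_height_density[OF assms] d_def .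
qed

section \<open>From moments to the law of the height\<close>

lemma bigo_of_powi_bound:
  assumes "\<exists>C\<ge>0. \<forall>\<^sub>F n in sequentially. \<bar>f n\<bar> \<le> C * sqrt (real n) powi (- int K)"
  shows "f \<in> O(\<lambda>n. 1 / sqrt (real n) ^ K)"
proof -
  obtain C where "\<forall>\<^sub>F n in sequentially. \<bar>f n\<bar> \<le> C * sqrt (real n) powi (- int K)" using assms by blast
  then show ?thesis
    by (intro bigoI[of _ C]) (simp add: power_int_minus inverse_eq_divide)
qed

lemma sqrt_power_11: "sqrt (real n) ^ 11 = sqrt (real n) * real n ^ 5"
proof -
  have "sqrt (real n) ^ 11 = sqrt (real n) * (sqrt (real n))\<^sup>2 ^ 5" by (simp add: eval_nat_numeral)
  then show ?thesis by (simp only: real_sqrt_pow2 of_nat_0_le_iff)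
qed

lemma prob_max_expansion:
  "(\<lambda>n. prob_max n - sqrt (pi / 2) * prob_max_approx n) \<in> O(\<lambda>n. 1 / sqrt (real n) ^ 11)"
proof -
  have "(\<lambda>n. prob_max n - sinc_cos_int n) \<in> O(\<lambda>n. 1 / sqrt (real n) ^ 11)"
    by (rule bigo_of_powi_bound[OF prob_max_sinc_cos_int])
  moreover have "(\<lambda>n. sinc_cos_int n - sqrt (pi / 2) * prob_max_approx n) \<in> O(\<lambda>n. 1 / sqrt (real n) ^ 11)"
    unfolding sqrt_power_11 by (rule sinc_cos_int_expansion)
  ultimately have "(\<lambda>n. (prob_max n - sinc_cos_int n) + (sinc_cos_int n - sqrt (pi / 2) * prob_max_approx n)) \<in> O(\<lambda>n. 1 / sqrt (real n) ^ 11)"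
    by (rule sum_in_bigo)
  then show ?thesis by simp
qed

lemma sqrt_times_prob_max_limit: "(\<lambda>n. sqrt (real n) * prob_max n) \<longlonglongrightarrow> sqrt (pi / 2)"
proof -
  have "(\<lambda>n. sqrt (real n) * (prob_max n - sqrt (pi / 2) * prob_max_approx n)) \<in> O(\<lambda>n. sqrt (real n) * (1 / sqrt (real n) ^ 11))"
    by (intro landau_o.big.mult landau_o.big_refl prob_max_expansion)
  also have "(\<lambda>n. sqrt (real n) * (1 / sqrt (real n) ^ 11)) \<in> o(\<lambda>_. 1)" by real_asymp
  finally have "(\<lambda>n. sqrt (real n) * (prob_max n - sqrt (pi / 2) * prob_max_approx n)) \<longlonglongrightarrow> 0"
    by (auto dest: smalloD_tendsto)
  moreover have "(\<lambda>n. sqrt (real n) * prob_max_approx n) \<longlonglongrightarrow> 1"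
    unfolding prob_max_approx_def by real_asymp
  then have "(\<lambda>n. sqrt (pi / 2) * (sqrt (real n) * prob_max_approx n)) \<longlonglongrightarrow> sqrt (pi / 2) * 1" by (rule tendsto_mult_left)
  ultimately have "(\<lambda>n. sqrt (real n) * (prob_max n - sqrt (pi / 2) * prob_max_approx n) + sqrt (pi / 2) * (sqrt (real n) * prob_max_approx n)) \<longlonglongrightarrow> 0 + sqrt (pi / 2) * 1"
    by (rule tendsto_add)
  then show ?thesis by (simp add: algebra_simps)
qed

lemma expectation_height:
  fixes f :: "nat \<Rightarrow> real"
  shows "measure_pmf.expectation (height_pmf n) f = (\<Sum>h\<le>n. f h * prob_max_at n h) / prob_max n"
proof -
  have "measure_pmf.expectation (height_pmf n) f = (\<Sum>h\<le>n. f h * pmf (height_pmf n) h)"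
  proof (rule integral_measure_pmf_real)
    fix h assume "h \<in> set_pmf (height_pmf n)"
    then have "prob_max_at n h \<noteq> 0" by (auto simp: set_pmf_iff pmf_height_pmf)
    then show "h \<in> {..n}" using prob_max_at_eq_0[of n h] by (cases "h \<le> n") auto
  qed simp
  then show ?thesis by (simp add: pmf_height_pmf sum_divide_distrib)
qed

lemma E_height_moment: "E_height n = moment 1 n / prob_max n - 1"
proof -
  have "(\<Sum>h\<le>n. real h * prob_max_at n h) = moment 1 n - prob_max n"
    unfolding moment_def prob_max_eq_sum by (simp add: algebra_simps sum.distrib)
  then show ?thesis using prob_max_pos[of n] by (simp add: expectation_height diff_divide_distrib)
qed

lemma Var_height_moment: "Var_height n = moment 2 n / prob_max n - (moment 1 n / prob_max n)\<^sup>2"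
proof -
  define p where "p = prob_max n"
  have p: "p > 0" using prob_max_pos by (simp add: p_def)
  define m where "m = moment 1 n / p"
  have E: "E_height n = m - 1" by (simp add: E_height_moment m_def p_def)
  have "(\<Sum>h\<le>n. (real h - (m - 1))\<^sup>2 * prob_max_at n h) =
      (\<Sum>h\<le>n. real (Suc h) ^ 2 * prob_max_at n h - 2 * m * (real (Suc h) ^ 1 * prob_max_at n h) + m\<^sup>2 * prob_max_at n h)"
    by (intro sum.cong refl) (simp add: power2_eq_square algebra_simps)
  also have "\<dots> = moment 2 n - 2 * m * moment 1 n + m\<^sup>2 * p"
    unfolding moment_def p_def prob_max_eq_sum sum_distrib_left by (simp add: sum.distrib sum_subtractf)
  finally have "Var_height n = (moment 2 n - 2 * m * moment 1 n + m\<^sup>2 * p) / p"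
    unfolding E by (simp add: expectation_height p_def)
  also have "moment 1 n = m * p" using p by (simp add: m_def)
  also have "(moment 2 n - 2 * m * (m * p) + m\<^sup>2 * p) / p = moment 2 n / p - m\<^sup>2"
    using p by (simp add: field_simps power2_eq_square)
  finally show ?thesis by (simp add: m_def p_def)
qed

text \<open>Passing from powers of h + 1 to powers of h costs at most r times the moment of order r
  - 1, which is of smaller order in n.\<close>

lemma height_power_sum_bounds:
  assumes "r \<ge> 1"
  shows "moment r n - real r * moment (r - 1) n \<le> (\<Sum>h\<le>n. real h ^ r * prob_max_at n h)"
    "(\<Sum>h\<le>n. real h ^ r * prob_max_at n h) \<le> moment r n"
proof -
  obtain k where r: "r = Suc k" using assms by (cases r) auto
  have "(real (Suc h)) ^ r - real h ^ r \<le> real r * real (Suc h) ^ k" for h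
    using power_Suc_diff_le[of "real h" "real (Suc h)" k] by (simp add: r)
  then have "real (Suc h) ^ r * prob_max_at n h - real r * (real (Suc h) ^ k * prob_max_at n h) \<le> real h ^ r * prob_max_at n h" for h
    using mult_right_mono[OF _ prob_max_at_nonneg, of "real (Suc h) ^ r - real h ^ r" "real r * real (Suc h) ^ k" n h]
    by (simp add: algebra_simps)
  then have "(\<Sum>h\<le>n. real (Suc h) ^ r * prob_max_at n h - real r * (real (Suc h) ^ k * prob_max_at n h)) \<le> (\<Sum>h\<le>n. real h ^ r * prob_max_at n h)"
    by (intro sum_mono)
  then show "moment r n - real r * moment (r - 1) n \<le> (\<Sum>h\<le>n. real h ^ r * prob_max_at n h)"
    unfolding moment_def sum_distrib_left sum_subtractf by (simp add: r)
  show "(\<Sum>h\<le>n. real h ^ r * prob_max_at n h) \<le> moment r n"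
    unfolding moment_def by (intro sum_mono mult_right_mono power_mono prob_max_at_nonneg) auto
qed

lemma lower_moment_limit:
  assumes "r \<ge> 1"
  shows "(\<lambda>n. moment (r - 1) n / sqrt n ^ (r - 1)) \<longlonglongrightarrow> 0"
proof (cases "r = 1")
  case True
  have "(\<lambda>n. (sqrt n * prob_max n) * (1 / sqrt n)) \<longlonglongrightarrow> sqrt (pi / 2) * 0"
    by (intro tendsto_mult sqrt_times_prob_max_limit) real_asymp
  moreover have "\<forall>\<^sub>F n in sequentially. (sqrt n * prob_max n) * (1 / sqrt n) = prob_max n"
    using eventually_gt_at_top[of 0] by eventually_elim simp
  ultimately have "prob_max \<longlonglongrightarrow> sqrt (pi / 2) * 0" by (rule Lim_transform_eventually)
  then show ?thesis by (simp add: True moment_0)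
next
  case False
  then obtain k where r: "r = Suc (Suc k)" using assms by (cases r rule: nat.exhaust; cases "r - 1") auto
  obtain l where l: "(\<lambda>n. moment (Suc k) n / sqrt n ^ k) \<longlonglongrightarrow> l" using moment_limit[of "Suc k"] by auto
  have "(\<lambda>n. moment (Suc k) n / sqrt n ^ k * (1 / sqrt n)) \<longlonglongrightarrow> l * 0"
    by (intro tendsto_mult l) real_asymp
  then show ?thesis by (simp add: r mult.commute)
qed

lemma dirichlet_beta_pos: "dirichlet_beta (real r + 1) > 0"
proof -
  define a where "a k = 1 / (2 * real k + 1) ^ (r + 1)" for k :: nat
  have "a k \<le> 1 / (2 * real k + 1)" for k
    unfolding a_def by (intro divide_left_mono) (auto intro: self_le_power)
  moreover have a0: "a k \<ge> 0" for k by (simp add: a_def)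
  ultimately have "\<forall>\<^sub>F k in sequentially. norm (a k) \<le> 1 / (2 * real k + 1)" by simp
  moreover have "(\<lambda>k. 1 / (2 * real k + 1)) \<longlonglongrightarrow> 0" by real_asymp
  ultimately have "a \<longlonglongrightarrow> 0" by (rule Lim_null_comparison)
  moreover have "a (Suc k) \<le> a k" for k
    unfolding a_def by (intro divide_left_mono power_mono mult_pos_pos zero_less_power) auto
  ultimately have "(\<Sum>i<2 * 1. (-1) ^ i * a i) \<le> (\<Sum>i. (-1) ^ i * a i)"
    using a0 by (intro summable_Leibniz'(2)) auto
  then have "a 0 - a 1 \<le> dirichlet_beta (real r + 1)" unfolding dirichlet_beta_nat a_def by (simp add: numeral_2_eq_2)
  moreover have "(3::real) ^ 1 \<le> 3 ^ (r + 1)" by (intro power_increasing) auto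
  then have "a 1 \<le> 1 / 3" unfolding a_def by (intro divide_left_mono) auto
  moreover have "a 0 = 1" by (simp add: a_def)
  ultimately show ?thesis by linarith
qed

lemma E_height_power_limit:
  assumes "r \<ge> 1"
  shows "(\<lambda>n. E_height_power n r / sqrt n ^ r) \<longlonglongrightarrow> 4 / pi * (sqrt 2 ^ r * Gamma (real r / 2 + 1)) * dirichlet_beta (real r + 1)"
proof -
  define L where "L = 4 / pi * (sqrt 2 ^ r * Gamma (real r / 2 + 1)) * dirichlet_beta (real r + 1)"
  define Q where "Q n = (\<Sum>h\<le>n. real h ^ r * prob_max_at n h)" for n
  have up: "(\<lambda>n. moment r n / sqrt n ^ (r - 1)) \<longlonglongrightarrow> sqrt (pi / 2) * L"
    unfolding L_def by (rule moment_limit[OF assms])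
  have "(\<lambda>n. moment r n / sqrt n ^ (r - 1) - real r * (moment (r - 1) n / sqrt n ^ (r - 1))) \<longlonglongrightarrow> sqrt (pi / 2) * L - real r * 0"
    by (intro tendsto_diff tendsto_mult_left up lower_moment_limit[OF assms])
  then have low: "(\<lambda>n. (moment r n - real r * moment (r - 1) n) / sqrt n ^ (r - 1)) \<longlonglongrightarrow> sqrt (pi / 2) * L"
    by (simp add: diff_divide_distrib)
  have "(\<lambda>n. Q n / sqrt n ^ (r - 1)) \<longlonglongrightarrow> sqrt (pi / 2) * L"
    unfolding Q_def
    by (intro tendsto_sandwich[OF _ _ low up] always_eventually allI divide_right_mono height_power_sum_bounds[OF assms]) auto
  then have "(\<lambda>n. (Q n / sqrt n ^ (r - 1)) / (sqrt n * prob_max n)) \<longlonglongrightarrow> (sqrt (pi / 2) * L) / sqrt (pi / 2)"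
    by (intro tendsto_divide sqrt_times_prob_max_limit) auto
  moreover have "(Q n / sqrt n ^ (r - 1)) / (sqrt n * prob_max n) = E_height_power n r / sqrt n ^ r" for n
  proof -
    have "sqrt n ^ r = sqrt n * sqrt n ^ (r - 1)" using assms by (cases r) auto
    then show ?thesis unfolding expectation_height Q_def by (simp add: mult_ac)
  qed
  ultimately show ?thesis by (simp add: L_def)
qed

lemma E_height_power_asymp:
  "(\<lambda>n. E_height_power n r) \<sim>[at_top]
    (\<lambda>n. 2 powr (real r / 2 + 2) / pi * Gamma (real r / 2 + 1) * dirichlet_beta (real r + 1) * real n powr (real r / 2))"
proof (cases "r = 0")
  case True
  \<comment> \<open>For r = 0 the expectation is 1, and by the Leibniz series for pi the right side
    is 1 too, except at n = 0, where \<open>0 powr 0 = 0\<close>.\<close>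
  have "dirichlet_beta 1 = pi / 4"
    using dirichlet_beta_nat[of 0] unfolding pi_series by (simp add: mult.commute add.commute)
  then show ?thesis
    using eventually_gt_at_top[of "0 :: nat"]
    by (intro asymp_equiv_refl_ev) (auto simp: True elim!: eventually_mono)
next
  case False
  then have r: "r \<ge> 1" by simp
  define L where "L = 4 / pi * (sqrt 2 ^ r * Gamma (real r / 2 + 1)) * dirichlet_beta (real r + 1)"
  have L: "L > 0" unfolding L_def by (intro mult_pos_pos divide_pos_pos Gamma_real_pos zero_less_power dirichlet_beta_pos) auto
  have p: "x powr (real r / 2) = sqrt x ^ r" if "x > 0" for x
    using that by (simp add: powr_half_sqrt[symmetric] powr_powr flip: powr_realpow)
  have c: "2 powr (real r / 2 + 2) / pi * Gamma (real r / 2 + 1) * dirichlet_beta (real r + 1) = L"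
    unfolding powr_add p[of 2, simplified] L_def by simp
  have "(\<lambda>n. E_height_power n r / sqrt n ^ r / L) \<longlonglongrightarrow> L / L"
    using E_height_power_limit[OF r] L unfolding L_def[symmetric] by (intro tendsto_divide tendsto_const) auto
  then have "(\<lambda>n. E_height_power n r / sqrt n ^ r / L) \<longlonglongrightarrow> 1" using L by simp
  moreover have "\<forall>\<^sub>F n in sequentially. E_height_power n r / sqrt n ^ r / L = E_height_power n r / (L * real n powr (real r / 2))"
    using eventually_gt_at_top[of 0]
  proof eventually_elim
    case (elim n)
    then show ?case using p[of "real n"] by (simp only: of_nat_0_less_iff) (simp add: mult.commute)
  qed
  ultimately have "(\<lambda>n. E_height_power n r / (L * real n powr (real r / 2))) \<longlonglongrightarrow> 1" by (rule Lim_transform_eventually)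
  then show ?thesis unfolding c by (rule asymp_equivI')
qed

section \<open>The first moment\<close>

text \<open>The primitives for n and n + 2 differ by that of \<open>primitive_1_diff\<close>, since
  all three vanish at 0. That primitive tends to 0 at infinity, so the two integrals
  coincide.\<close>

lemma integral_radial_spectral_shift:
  "\<forall>\<^sub>F n in sequentially. integral\<^sup>L lborel (radial 0 (spectral (n + 2))) = integral\<^sup>L lborel (radial 0 (spectral n))"
proof -
  let ?P = "\<lambda>n. \<exists>J. (\<forall>x\<ge>0. (J has_real_derivative radial 0 (spectral n) x) (at x)) \<and> J 0 = 0
     \<and> (J \<longlongrightarrow> integral\<^sup>L lborel (radial 0 (spectral n))) at_top"
  have "\<forall>\<^sub>F n in sequentially. ?P (n + 2)"
    using radial_spectral_primitive[of 0] by (rule sequentially_offset)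
  with radial_spectral_primitive[of 0] show ?thesis
    using eventually_ge_at_top[of 5]
  proof eventually_elim
    case (elim n)
    obtain J where J: "\<forall>x\<ge>0. (J has_real_derivative radial 0 (spectral n) x) (at x)" "J 0 = 0"
      "(J \<longlongrightarrow> integral\<^sup>L lborel (radial 0 (spectral n))) at_top" using elim(1) by blast
    obtain J' where J': "\<forall>x\<ge>0. (J' has_real_derivative radial 0 (spectral (n + 2)) x) (at x)" "J' 0 = 0"
      "(J' \<longlongrightarrow> integral\<^sup>L lborel (radial 0 (spectral (n + 2)))) at_top" using elim(2) by blast
    obtain D where D: "\<forall>x. (D has_real_derivative radial 0 (spectral n) x - radial 0 (spectral (n + 2)) x) (at x)"
      "D 0 = 0" "(D \<longlongrightarrow> 0) at_top" using primitive_1_diff[OF elim(3)] by blast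
    define F where "F x = J x - J' x - D x" for x
    have dF: "(F has_real_derivative 0) (at x)" if "x \<ge> 0" for x
    proof -
      have "(F has_real_derivative radial 0 (spectral n) x - radial 0 (spectral (n + 2)) x - (radial 0 (spectral n) x - radial 0 (spectral (n + 2)) x)) (at x)"
        unfolding F_def using that by (intro DERIV_diff J(1)[rule_format] J'(1)[rule_format] D(1)[rule_format])
      then show ?thesis by simp
    qed
    have F0: "F x = 0" if "x \<ge> 0" for x
    proof (cases "x = 0")
      case False
      have "F x = F 0"
      proof (rule DERIV_isconst_end[of 0 x F])
        show "continuous_on {0..x} F"
          by (intro continuous_at_imp_continuous_on ballI) (rule DERIV_isCont[OF dF], simp)
        show "(F has_real_derivative 0) (at z)" if "0 < z" "z < x" for z by (rule dF) (use that in simp)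
      qed (use that False in simp)
      then show ?thesis by (simp add: F_def J J' D)
    qed (simp add: F_def J J' D)
    have "(F \<longlongrightarrow> integral\<^sup>L lborel (radial 0 (spectral n)) - integral\<^sup>L lborel (radial 0 (spectral (n + 2))) - 0) at_top"
      unfolding F_def by (intro tendsto_diff J J' D)
    moreover have "(F \<longlongrightarrow> 0) at_top"
    proof (rule Lim_transform_eventually[OF tendsto_const])
      show "\<forall>\<^sub>F x in at_top. 0 = F x" using eventually_ge_at_top[of "0 :: real"] by eventually_elim (simp add: F0)
    qed
    ultimately have "integral\<^sup>L lborel (radial 0 (spectral n)) - integral\<^sup>L lborel (radial 0 (spectral (n + 2))) - 0 = 0"
      by (rule tendsto_unique[OF trivial_limit_at_top_linorder])
    then show ?case by simp
  qed
qed

lemma moment_1_limit: "moment 1 \<longlonglongrightarrow> 2 * catalan_const"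
proof -
  have "Gamma (1 / 2 + 1 :: real) = 1 / 2 * Gamma (1 / 2)"
    by (rule Gamma_plus1) (auto dest: nonpos_Ints_nonpos)
  then have G: "Gamma (1 / 2 + 1 :: real) = sqrt pi / 2" by (simp add: Gamma_one_half_real)
  have p: "sqrt (pi / 2) * sqrt 2 = sqrt pi" by (simp flip: real_sqrt_mult)
  have "x * (4 / pi * (y * (z / 2)) * b) = 2 / pi * ((x * y) * z) * b" for x y z b :: real by simp
  then have "sqrt (pi / 2) * (4 / pi * (sqrt 2 * (sqrt pi / 2)) * b) = 2 / pi * (sqrt pi * sqrt pi) * b" for b
    by (simp only: p)
  moreover have "2 / pi * (sqrt pi * sqrt pi) * b = 2 * b" for b by simp
  moreover have "moment 1 \<longlonglongrightarrow> sqrt (pi / 2) * (4 / pi * (sqrt 2 * (sqrt pi / 2)) * dirichlet_beta 2)"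
    by (rule moment_limit[of 1, unfolded of_nat_1 G power_one_right one_add_one diff_self_eq_0 power_0 div_by_1, OF order_refl])
  ultimately show ?thesis unfolding catalan_const_def by (simp only:)
qed

text \<open>The integral is eventually constant along each parity class, so the merely qualitative
  limit \<open>moment_1_limit\<close> determines it exactly. The only error left is the rapidly
  decaying one between sum and integral.\<close>

lemma moment_1_catalan:
  "\<exists>C\<ge>0. \<forall>\<^sub>F n in sequentially. \<bar>moment 1 n - 2 * catalan_const\<bar> \<le> C * sqrt n powi (- int K)"
proof -
  define l where "l n = integral\<^sup>L lborel (radial 0 (spectral n))" for n
  obtain N where N: "\<And>n. n \<ge> N \<Longrightarrow> l (n + 2) = l n"
    using integral_radial_spectral_shift unfolding l_def eventually_sequentially by blast
  have shift: "l (n + 2 * k) = l n" if "n \<ge> N" for n k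
  proof (induction k)
    case (Suc k)
    have "l (n + 2 * Suc k) = l ((n + 2 * k) + 2)" by (simp add: add_ac)
    also have "\<dots> = l n" using N[of "n + 2 * k"] that Suc by simp
    finally show ?case .
  qed simp
  have m: "\<exists>C\<ge>0. \<forall>\<^sub>F n in sequentially. \<bar>moment 1 n - 2 * l n\<bar> \<le> C * sqrt n powi (- int K)" for K
    using moment_integral[of 1 K] by (simp add: l_def)
  have "(\<lambda>n. moment 1 n - 2 * l n) \<in> O(\<lambda>n. 1 / sqrt (real n) ^ 1)" by (rule bigo_of_powi_bound[OF m])
  also have "(\<lambda>n. 1 / sqrt (real n) ^ 1) \<in> o(\<lambda>_. 1)" by real_asymp
  finally have "(\<lambda>n. moment 1 n - 2 * l n) \<longlonglongrightarrow> 0" by (auto dest: smalloD_tendsto)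
  from tendsto_diff[OF moment_1_limit this] have "(\<lambda>n. 2 * l n) \<longlonglongrightarrow> 2 * catalan_const" by simp
  from tendsto_mult_left[OF this, of "1 / 2"] have lim: "l \<longlonglongrightarrow> catalan_const" by simp
  have "l n = catalan_const" if "n \<ge> N" for n
  proof -
    have "filterlim (\<lambda>k. n + 2 * k) sequentially sequentially"
      by (rule filterlim_subseq) (simp add: strict_mono_def)
    then have "(\<lambda>k. l (n + 2 * k)) \<longlonglongrightarrow> catalan_const" by (rule filterlim_compose[OF lim])
    then show ?thesis unfolding shift[OF that] by (simp add: LIMSEQ_const_iff)
  qed
  then have ev: "\<forall>\<^sub>F n in sequentially. l n = catalan_const" unfolding eventually_sequentially by blast
  obtain C where C: "C \<ge> 0" "\<forall>\<^sub>F n in sequentially. \<bar>moment 1 n - 2 * l n\<bar> \<le> C * sqrt n powi (- int K)" using m by blast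
  have "\<forall>\<^sub>F n in sequentially. \<bar>moment 1 n - 2 * catalan_const\<bar> \<le> C * sqrt n powi (- int K)"
    using C(2) ev by eventually_elim simp
  then show ?thesis using C(1) by blast
qed

section \<open>Asymptotic expansions\<close>

lemma inverse_prob_max_bigo: "(\<lambda>n. 1 / prob_max n) \<in> O(\<lambda>n. sqrt (real n))"
proof (rule bigoI_tendsto)
  have "(\<lambda>n. 1 / (sqrt (real n) * prob_max n)) \<longlonglongrightarrow> 1 / sqrt (pi / 2)"
    by (intro tendsto_divide tendsto_const sqrt_times_prob_max_limit) auto
  then show "(\<lambda>n. 1 / prob_max n / sqrt (real n)) \<longlonglongrightarrow> 1 / sqrt (pi / 2)" by (simp add: mult.commute)
  show "\<forall>\<^sub>F n in sequentially. sqrt (real n) \<noteq> 0" using eventually_gt_at_top[of 0] by eventually_elim simp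
qed

lemma inverse_prob_max_approx_bigo: "(\<lambda>n. 1 / prob_max_approx (real n)) \<in> O(\<lambda>n. sqrt (real n))"
  unfolding prob_max_approx_def by real_asymp

text \<open>A difference of reciprocals is the difference of the values times both reciprocals. Each
  reciprocal is of order sqrt n, so the exponent drops from 11 to 9.\<close>

lemma inverse_prob_max_expansion:
  "(\<lambda>n. 1 / prob_max n - 1 / (sqrt (pi / 2) * prob_max_approx (real n))) \<in> O(\<lambda>n. 1 / sqrt (real n) ^ 9)"
proof -
  define s where "s = sqrt (pi / 2)"
  have s: "s > 0" by (simp add: s_def)
  have "(\<lambda>n. (prob_max n - s * prob_max_approx n) * (- (1 / s) * (1 / prob_max n) * (1 / prob_max_approx n)))
      \<in> O(\<lambda>n. 1 / sqrt (real n) ^ 11 * (1 * sqrt (real n) * sqrt (real n)))"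
    unfolding s_def
    by (intro landau_o.big.mult prob_max_expansion inverse_prob_max_bigo inverse_prob_max_approx_bigo bigo_const)
  also have "(\<lambda>n. 1 / sqrt (real n) ^ 11 * (1 * sqrt (real n) * sqrt (real n))) \<in> O(\<lambda>n. 1 / sqrt (real n) ^ 9)" by real_asymp
  finally have "(\<lambda>n. (prob_max n - s * prob_max_approx n) * (- (1 / s) * (1 / prob_max n) * (1 / prob_max_approx n))) \<in> O(\<lambda>n. 1 / sqrt (real n) ^ 9)" .
  moreover have "\<forall>\<^sub>F n in sequentially. prob_max_approx (real n) > 0"
    unfolding prob_max_approx_def by real_asymp
  then have "\<forall>\<^sub>F n in sequentially. (prob_max n - s * prob_max_approx n) * (- (1 / s) * (1 / prob_max n) * (1 / prob_max_approx n))
      = 1 / prob_max n - 1 / (s * prob_max_approx n)"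
  proof eventually_elim
    case (elim n)
    have "(p - s * A) * (- (1 / s) * (1 / p) * (1 / A)) = 1 / p - 1 / (s * A)" if "p > 0" "A > 0" for p A
      using that s by (simp add: field_simps)
    then show ?case using prob_max_pos elim by blast
  qed
  ultimately show ?thesis unfolding s_def by (simp only: landau_o.big.in_cong)
qed

lemma moment_1_ratio:
  "(\<lambda>n. moment 1 n / prob_max n - 2 * catalan_const / sqrt (pi / 2) * (1 / prob_max_approx (real n))) \<in> O(\<lambda>n. 1 / sqrt (real n) ^ 9)"
proof -
  have "(\<lambda>n. (moment 1 n - 2 * catalan_const) * (1 / prob_max n)) \<in> O(\<lambda>n. 1 / sqrt (real n) ^ 10 * sqrt (real n))"
    by (intro landau_o.big.mult bigo_of_powi_bound[OF moment_1_catalan] inverse_prob_max_bigo)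
  also have "(\<lambda>n. 1 / sqrt (real n) ^ 10 * sqrt (real n)) \<in> O(\<lambda>n. 1 / sqrt (real n) ^ 9)" by real_asymp
  finally have 1: "(\<lambda>n. (moment 1 n - 2 * catalan_const) * (1 / prob_max n)) \<in> O(\<lambda>n. 1 / sqrt (real n) ^ 9)" .
  have "(\<lambda>n. 2 * catalan_const * (1 / prob_max n - 1 / (sqrt (pi / 2) * prob_max_approx (real n)))) \<in> O(\<lambda>n. 1 * (1 / sqrt (real n) ^ 9))"
    by (intro landau_o.big.mult bigo_const inverse_prob_max_expansion)
  then have "(\<lambda>n. 2 * catalan_const * (1 / prob_max n - 1 / (sqrt (pi / 2) * prob_max_approx (real n)))) \<in> O(\<lambda>n. 1 / sqrt (real n) ^ 9)" by simp
  from sum_in_bigo(1)[OF 1 this] show ?thesis by (simp add: algebra_simps)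
qed

text \<open>The bracket of \<open>moment_2_sinc_cos_int\<close> with the expansion inserted. Its two
  terms of order x^(3/2) cancel, leaving order sqrt x, so that division by
  \<open>prob_max_approx\<close> gives linear growth.\<close>

definition moment_2_approx :: "real \<Rightarrow> real" where
  "moment_2_approx x = (x + 1)\<^sup>2 * prob_max_approx x - x * (x - 1) * prob_max_approx (x - 2)"

text \<open>The quadratic factors amplify the error n^(-11/2) to n^(-7/2). After division by
  \<open>prob_max n\<close> this is n^(-3), exactly the accuracy claimed for the variance.\<close>

lemma moment_2_expansion:
  "(\<lambda>n. moment 2 n - pi\<^sup>2 / 8 * (sqrt (pi / 2) * moment_2_approx (real n))) \<in> O(\<lambda>n. 1 / sqrt (real n) ^ 7)"
proof -
  define s where "s = sqrt (pi / 2)"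
  have e: "(\<lambda>n. sinc_cos_int n - s * prob_max_approx (real n)) \<in> O(\<lambda>n. 1 / (sqrt (real n) * real n ^ 5))"
    unfolding s_def by (rule sinc_cos_int_expansion)
  have "(\<lambda>n. pi\<^sup>2 / 8 * ((real n + 1)\<^sup>2 * (sinc_cos_int n - s * prob_max_approx (real n)))) \<in> O(\<lambda>n. 1 * ((real n + 1)\<^sup>2 * (1 / (sqrt (real n) * real n ^ 5))))"
    by (intro landau_o.big.mult bigo_const landau_o.big_refl e)
  also have "(\<lambda>n. 1 * ((real n + 1)\<^sup>2 * (1 / (sqrt (real n) * real n ^ 5)))) \<in> O(\<lambda>n. 1 / sqrt (real n) ^ 7)" by real_asymp
  finally have 1: "(\<lambda>n. pi\<^sup>2 / 8 * ((real n + 1)\<^sup>2 * (sinc_cos_int n - s * prob_max_approx (real n)))) \<in> O(\<lambda>n. 1 / sqrt (real n) ^ 7)" .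
  have sub: "\<forall>\<^sub>F n in sequentially. real (n - 2) = real n - 2"
    using eventually_ge_at_top[of 2] by eventually_elim (simp add: of_nat_diff)
  have "filterlim (\<lambda>n::nat. n - 2) sequentially sequentially" by (rule filterlim_minus_const_nat_at_top)
  then have "(\<lambda>n. sinc_cos_int (n - 2) - s * prob_max_approx (real (n - 2))) \<in> O(\<lambda>n. 1 / (sqrt (real (n - 2)) * real (n - 2) ^ 5))"
    by (rule landau_o.big.compose[OF e])
  then have "(\<lambda>n. pi\<^sup>2 / 8 * (real n * (real n - 1) * (sinc_cos_int (n - 2) - s * prob_max_approx (real (n - 2)))))
      \<in> O(\<lambda>n. 1 * (real n * (real n - 1) * (1 / (sqrt (real (n - 2)) * real (n - 2) ^ 5))))"
    by (intro landau_o.big.mult bigo_const landau_o.big_refl)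
  also have "(\<lambda>n. 1 * (real n * (real n - 1) * (1 / (sqrt (real (n - 2)) * real (n - 2) ^ 5))))
      \<in> O(\<lambda>n. 1 * (real n * (real n - 1) * (1 / (sqrt (real n - 2) * (real n - 2) ^ 5))))"
    by (intro bigthetaD1 bigthetaI_cong) (use sub in eventually_elim, simp only:)
  also have "(\<lambda>n. 1 * (real n * (real n - 1) * (1 / (sqrt (real n - 2) * (real n - 2) ^ 5)))) \<in> O(\<lambda>n. 1 / sqrt (real n) ^ 7)"
    by real_asymp
  finally have 2: "(\<lambda>n. pi\<^sup>2 / 8 * (real n * (real n - 1) * (sinc_cos_int (n - 2) - s * prob_max_approx (real (n - 2))))) \<in> O(\<lambda>n. 1 / sqrt (real n) ^ 7)" .
  have 3: "(\<lambda>n. moment 2 n - pi\<^sup>2 / 8 * ((real n + 1)\<^sup>2 * sinc_cos_int n - real n * (real n - 1) * sinc_cos_int (n - 2))) \<in> O(\<lambda>n. 1 / sqrt (real n) ^ 7)"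
    by (rule bigo_of_powi_bound[OF moment_2_sinc_cos_int])
  note sum_in_bigo(2)[OF sum_in_bigo(1)[OF 3 1] 2]
  moreover have "\<forall>\<^sub>F n in sequentially. moment 2 n - pi\<^sup>2 / 8 * ((real n + 1)\<^sup>2 * sinc_cos_int n - real n * (real n - 1) * sinc_cos_int (n - 2))
      + pi\<^sup>2 / 8 * ((real n + 1)\<^sup>2 * (sinc_cos_int n - s * prob_max_approx (real n)))
      - pi\<^sup>2 / 8 * (real n * (real n - 1) * (sinc_cos_int (n - 2) - s * prob_max_approx (real (n - 2))))
      = moment 2 n - pi\<^sup>2 / 8 * (s * moment_2_approx (real n))"
    using sub
  proof eventually_elim
    case (elim n)
    have "M - c * (x * a - y * b) + c * (x * (a - s * a')) - c * (y * (b - s * b')) = M - c * (s * (x * a' - y * b'))"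
      for M c x y a b a' b' :: real by (simp add: algebra_simps)
    then show ?case unfolding elim moment_2_approx_def by blast
  qed
  ultimately show ?thesis unfolding s_def by (simp only: landau_o.big.in_cong)
qed

lemma moment_2_ratio:
  "(\<lambda>n. moment 2 n / prob_max n - pi\<^sup>2 / 8 * (moment_2_approx (real n) / prob_max_approx (real n))) \<in> O(\<lambda>n. 1 / real n ^ 3)"
proof -
  define s where "s = sqrt (pi / 2)"
  have s: "s > 0" by (simp add: s_def)
  have "(\<lambda>n. (moment 2 n - pi\<^sup>2 / 8 * (s * moment_2_approx (real n))) * (1 / prob_max n)) \<in> O(\<lambda>n. 1 / sqrt (real n) ^ 7 * sqrt (real n))"
    unfolding s_def by (intro landau_o.big.mult moment_2_expansion inverse_prob_max_bigo)
  also have "(\<lambda>n. 1 / sqrt (real n) ^ 7 * sqrt (real n)) \<in> O(\<lambda>n. 1 / real n ^ 3)" by real_asymp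
  finally have 1: "(\<lambda>n. (moment 2 n - pi\<^sup>2 / 8 * (s * moment_2_approx (real n))) * (1 / prob_max n)) \<in> O(\<lambda>n. 1 / real n ^ 3)" .
  have "(\<lambda>n. moment_2_approx (real n)) \<in> O(\<lambda>n. real n)"
    unfolding moment_2_approx_def prob_max_approx_def by real_asymp
  then have "(\<lambda>n. (pi\<^sup>2 / 8 * s) * (moment_2_approx (real n) * (1 / prob_max n - 1 / (s * prob_max_approx (real n))))) \<in> O(\<lambda>n. 1 * (real n * (1 / sqrt (real n) ^ 9)))"
    unfolding s_def by (intro landau_o.big.mult bigo_const inverse_prob_max_expansion)
  also have "(\<lambda>n. 1 * (real n * (1 / sqrt (real n) ^ 9))) \<in> O(\<lambda>n. 1 / real n ^ 3)" by real_asymp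
  finally have 2: "(\<lambda>n. (pi\<^sup>2 / 8 * s) * (moment_2_approx (real n) * (1 / prob_max n - 1 / (s * prob_max_approx (real n))))) \<in> O(\<lambda>n. 1 / real n ^ 3)" .
  have "(M - c * (s * Q)) * (1 / p) + (c * s) * (Q * (1 / p - 1 / (s * A))) = M / p - c * (Q / A)" for M c Q p A :: real
    using s by (simp add: algebra_simps diff_divide_distrib)
  with sum_in_bigo(1)[OF 1 2] show ?thesis by (simp only:)
qed

lemma moment_1_ratio_square:
  "(\<lambda>n. (moment 1 n / prob_max n)\<^sup>2 - 8 * catalan_const\<^sup>2 / pi * (1 / prob_max_approx (real n))\<^sup>2) \<in> O(\<lambda>n. 1 / real n ^ 3)"
proof -
  define c where "c = 2 * catalan_const / sqrt (pi / 2)"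
  have c2: "c\<^sup>2 = 8 * catalan_const\<^sup>2 / pi" by (simp add: c_def power_divide power_mult_distrib)
  define V where "V n = moment 1 n / prob_max n - c * (1 / prob_max_approx (real n))" for n
  have V: "V \<in> O(\<lambda>n. 1 / sqrt (real n) ^ 9)" unfolding V_def c_def by (rule moment_1_ratio)
  also have "(\<lambda>n. 1 / sqrt (real n) ^ 9) \<in> O(\<lambda>n. sqrt (real n))" by real_asymp
  finally have "V \<in> O(\<lambda>n. sqrt (real n))" .
  moreover have "(\<lambda>n. (2 * c) * (1 / prob_max_approx (real n))) \<in> O(\<lambda>n. 1 * sqrt (real n))"
    by (intro landau_o.big.mult bigo_const inverse_prob_max_approx_bigo)
  then have "(\<lambda>n. (2 * c) * (1 / prob_max_approx (real n))) \<in> O(\<lambda>n. sqrt (real n))" by simp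
  ultimately have "(\<lambda>n. V n * (V n + (2 * c) * (1 / prob_max_approx (real n)))) \<in> O(\<lambda>n. 1 / sqrt (real n) ^ 9 * sqrt (real n))"
    by (intro landau_o.big.mult V sum_in_bigo(1))
  also have "(\<lambda>n. 1 / sqrt (real n) ^ 9 * sqrt (real n)) \<in> O(\<lambda>n. 1 / real n ^ 3)" by real_asymp
  finally have "(\<lambda>n. V n * (V n + (2 * c) * (1 / prob_max_approx (real n)))) \<in> O(\<lambda>n. 1 / real n ^ 3)" .
  moreover have "V n * (V n + (2 * c) * (1 / prob_max_approx (real n))) = (moment 1 n / prob_max n)\<^sup>2 - c\<^sup>2 * (1 / prob_max_approx (real n))\<^sup>2" for n
  proof -
    have "(m - c * a) * ((m - c * a) + (2 * c) * a) = m\<^sup>2 - c\<^sup>2 * a\<^sup>2" for m a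
      by (simp add: power2_eq_square algebra_simps)
    then show ?thesis unfolding V_def .
  qed
  ultimately show ?thesis unfolding c2[symmetric] by (simp only:)
qed

lemma prob_max_approx_inverse:
  "(\<lambda>n. 1 / prob_max_approx (real n) - sqrt (real n) * (1 + 5 / (12 * real n) - 131 / (1440 * real n ^ 2) + 1129 / (24192 * real n ^ 3)))
    \<in> O(\<lambda>n. 1 / sqrt (real n) ^ 7)"
  unfolding prob_max_approx_def by real_asymp

lemma prob_max_approx_inverse_square:
  "(\<lambda>n. (1 / prob_max_approx (real n))\<^sup>2 - (real n + 5 / 6 - 1 / (120 * real n) + 53 / (3024 * real n ^ 2)))
    \<in> O(\<lambda>n. 1 / real n ^ 3)"
  unfolding prob_max_approx_def by real_asymp

lemma moment_2_approx_ratio: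
  "(\<lambda>n. moment_2_approx (real n) / prob_max_approx (real n) - (2 * real n + 4 / 3 - 2 / (45 * real n) + 44 / (945 * real n ^ 2)))
    \<in> O(\<lambda>n. 1 / real n ^ 3)"
  unfolding moment_2_approx_def prob_max_approx_def by real_asymp

section \<open>Local limit\<close>

lemma abs_mult_diff_1_le: "\<bar>a * b - 1\<bar> \<le> (1 + \<bar>a - 1\<bar>) * (1 + \<bar>b - 1\<bar>) - (1 :: real)"
proof -
  have "a * b - 1 = (a - 1) * (b - 1) + (a - 1) + (b - 1)" by (simp add: algebra_simps)
  moreover have "\<bar>x + y + z\<bar> \<le> \<bar>x\<bar> + \<bar>y\<bar> + \<bar>z\<bar>" for x y z :: real by linarith
  ultimately have "\<bar>a * b - 1\<bar> \<le> \<bar>(a - 1) * (b - 1)\<bar> + \<bar>a - 1\<bar> + \<bar>b - 1\<bar>" by (simp only:)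
  also have "\<dots> = (1 + \<bar>a - 1\<bar>) * (1 + \<bar>b - 1\<bar>) - 1"   proof -
    have "(1 + x) * (1 + y) - 1 = x * y + x + y" for x y :: real by (simp add: algebra_simps)
    then show ?thesis by (simp only: abs_mult)
  qed
  finally show ?thesis .
qed

text \<open>The quotient factors into \<psi>' / \<psi>, t and \<open>v n\<close>: the spectral sum
  at h + 1 against the Gaussian sum at h, the ratio h / (h + 1), and the normalization. The bounds
  \<open>d1\<close> and \<open>d2\<close> for the first two depend on n only, which makes the limit
  uniform in h.\<close>

theorem local_limit:
  assumes "\<epsilon> > 0"
  shows "\<forall>\<^sub>F n in sequentially. \<forall>h::nat.
        3 / sqrt (ln (real n)) < real h / sqrt (real n) \<longrightarrow>
        real h / sqrt (real n) < sqrt (ln (real n)) / 2 \<longrightarrow>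
        h mod 2 = n mod 2 \<longrightarrow>
        \<bar>pmf (height_pmf n) h / (2 * height_density (real h / sqrt (real n)) / sqrt (real n)) - 1\<bar> < \<epsilon>"
proof -
  define c where "c = sqrt (pi / 2)"
  have c: "c > 0" "c * c = pi / 2" by (simp_all add: c_def)
  obtain D where D: "D \<ge> 0" "\<And>n x. n \<ge> 2 \<Longrightarrow> x > 0 \<Longrightarrow>
    \<bar>sqrt n * alt_sum (spectral n) (x / sqrt n) - alt_sum gauss x\<bar> \<le> D / (n * x\<^sup>2)"
    using alt_sum_gauss_diff by blast
  obtain C where C: "C \<ge> 0" "\<And>x t. x > 0 \<Longrightarrow> 1 / 2 \<le> t \<Longrightarrow> t < 1 \<Longrightarrow>
    \<bar>alt_sum gauss x - alt_sum gauss (t * x)\<bar> \<le> C * (1 - t) / x\<^sup>2"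
    using alt_sum_gauss_scale by blast
  define d1 where "d1 n = 4 * (C + D) * ln (real n) * exp (ln (real n) / 4) / sqrt (real n)" for n :: nat
  define d2 where "d2 n = ln (real n) / sqrt (real n)" for n :: nat
  define v where "v n = c / (sqrt n * prob_max n)" for n :: nat
  have "d1 \<longlonglongrightarrow> 0"
  proof -
    have "(\<lambda>n. ln (real n) * exp (ln (real n) / 4) / sqrt (real n)) \<longlonglongrightarrow> 0" by real_asymp
    then have "(\<lambda>n. (4 * (C + D)) * (ln (real n) * exp (ln (real n) / 4) / sqrt (real n))) \<longlonglongrightarrow> (4 * (C + D)) * 0" by (rule tendsto_mult_left)
    then show ?thesis by (simp add: d1_def[abs_def] mult.assoc)
  qed
  moreover have "d2 \<longlonglongrightarrow> 0" unfolding d2_def by real_asymp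
  moreover have "v \<longlonglongrightarrow> c / c" unfolding v_def using c(1) by (intro tendsto_divide tendsto_const sqrt_times_prob_max_limit[folded c_def]) auto
  then have "v \<longlonglongrightarrow> 1" using c by simp
  ultimately have "(\<lambda>n. (1 + d1 n) * (1 + d2 n) * (1 + \<bar>v n - 1\<bar>) - 1) \<longlonglongrightarrow> (1 + 0) * (1 + 0) * (1 + \<bar>1 - 1\<bar>) - 1"
    by (intro tendsto_intros)
  then have "\<forall>\<^sub>F n in sequentially. (1 + d1 n) * (1 + d2 n) * (1 + \<bar>v n - 1\<bar>) - 1 < \<epsilon>"
    using assms by (intro order_tendstoD(2)) auto
  moreover have "\<forall>\<^sub>F n in sequentially. ln (real n) \<ge> 1" by real_asymp
  ultimately show ?thesis using eventually_ge_at_top[of 2]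
  proof eventually_elim
    case (elim n)
    define L where "L = ln (real n)"
    define q where "q = sqrt (real n)"
    have L: "L \<ge> 1" using elim(2) by (simp add: L_def)
    have q: "q > 0" "q\<^sup>2 = real n" using elim(3) by (simp_all add: q_def)
    define l where "l = sqrt L"
    have l: "l \<ge> 1" "l\<^sup>2 = L" using L by (simp_all add: l_def)
    have "l * 1 \<le> l * l" using l by (intro mult_left_mono) auto
    then have lL: "l \<le> L" by (simp only: mult_1_right l(2)[unfolded power2_eq_square])
    show ?case
    proof (intro allI impI)
      fix h :: nat
      define \<eta> where "\<eta> = real h / q"
      assume "3 / sqrt (ln (real n)) < real h / sqrt (real n)" "real h / sqrt (real n) < sqrt (ln (real n)) / 2"
        and parity: "h mod 2 = n mod 2"
      then have e: "3 / l < \<eta>" "\<eta> < l / 2" by (simp_all add: \<eta>_def q_def l_def L_def)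
      have "3 / l > 0" using l by simp
      then have \<eta>: "\<eta> > 0" using e by linarith
      then have h: "h > 0" using q by (simp add: \<eta>_def zero_less_divide_iff)
      define H where "H = real h + 1"
      define t where "t = real h / H"
      have H: "H > 0" by (simp add: H_def)
      have t: "1 / 2 \<le> t" "t < 1" "1 - t = 1 / H" using h by (simp_all add: t_def H_def field_simps)
      define x where "x = pi / (2 * \<eta>)"
      have x: "x > 0" using \<eta> by (simp add: x_def)
      have tx: "t * x > 0" using t x by simp
      define \<psi> where "\<psi> = alt_sum gauss x"
      define \<psi>' where "\<psi>' = q * alt_sum (spectral n) (t * x / q)"
      have ev: "even (n + h)" using parity by presburger
      have "t * x / q = pi / (2 * H)" using q h \<eta> H unfolding t_def x_def \<eta>_def by (simp add: field_simps)
      then have p: "prob_max_at n h = 4 / (H * q) * \<psi>'"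
        using prob_max_at_eq_alt_sum[of n h] ev elim(3) q unfolding \<psi>'_def H_def by (simp add: add.commute)
      have inv: "1 / x\<^sup>2 \<le> \<eta>\<^sup>2"
      proof -
        have "1 / x\<^sup>2 = (2 / pi)\<^sup>2 * \<eta>\<^sup>2" using \<eta> by (simp add: x_def power_divide power_mult_distrib)
        also have "\<dots> \<le> 1\<^sup>2 * \<eta>\<^sup>2" using pi_gt3 by (intro mult_right_mono power_mono) auto
        finally show ?thesis by simp
      qed
      have \<eta>2: "\<eta>\<^sup>2 \<le> L / 4"
      proof -
        have "\<eta>\<^sup>2 \<le> (l / 2)\<^sup>2" using e \<eta> by (intro power_mono) auto
        then show ?thesis by (simp add: power_divide l)
      qed
      have qn: "q \<le> real n"
      proof -
        have "1 \<le> q" using elim(3) by (simp add: q_def)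
        then have "q * 1 \<le> q * q" using q by (intro mult_left_mono) auto
        then show ?thesis using q(2) by (simp add: power2_eq_square)
      qed
      have "\<bar>\<psi>' - \<psi>\<bar> \<le> \<bar>\<psi>' - alt_sum gauss (t * x)\<bar> + \<bar>\<psi> - alt_sum gauss (t * x)\<bar>" by linarith
      also have "\<dots> \<le> D / (real n * (t * x)\<^sup>2) + C * (1 - t) / x\<^sup>2"
        unfolding \<psi>'_def \<psi>_def q_def by (intro add_mono D C x t tx elim)
      also have "\<dots> \<le> D * L / q + C * L / q"
      proof (intro add_mono)
        have "1 / (t * x)\<^sup>2 \<le> 4 * (1 / x\<^sup>2)"
        proof -
          have "(1 / 2)\<^sup>2 \<le> t\<^sup>2" using t by (intro power_mono) auto
          then have "1 / t\<^sup>2 \<le> 1 / (1 / 2)\<^sup>2" using t by (intro divide_left_mono mult_pos_pos zero_less_power) auto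
          then have "1 / t\<^sup>2 * (1 / x\<^sup>2) \<le> 4 * (1 / x\<^sup>2)" by (intro mult_right_mono) (auto simp: power_divide)
          then show ?thesis by (simp add: power_mult_distrib)
        qed
        then have "1 / (t * x)\<^sup>2 \<le> L" using inv \<eta>2 by linarith
        then have "D / real n * (1 / (t * x)\<^sup>2) \<le> D / real n * L" using D(1) by (intro mult_left_mono) auto
        also have "\<dots> = D * L / real n" by simp
        also have "\<dots> \<le> D * L / q" using D(1) L q qn by (intro divide_left_mono) auto
        finally show "D / (real n * (t * x)\<^sup>2) \<le> D * L / q" by simp
        have "C * (1 - t) / x\<^sup>2 = C * (1 / H) * (1 / x\<^sup>2)" using t by simp
        also have "\<dots> \<le> C * (1 / real h) * \<eta>\<^sup>2"
          using C(1) h inv H unfolding H_def by (intro mult_mono divide_left_mono) auto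
        also have "\<dots> = C * (\<eta> / q)" using h q by (simp add: \<eta>_def power2_eq_square)
        also have "\<dots> \<le> C * (L / q)" using e lL C(1) q l by (intro mult_left_mono divide_right_mono) auto
        finally show "C * (1 - t) / x\<^sup>2 \<le> C * L / q" by simp
      qed
      finally have diff: "\<bar>\<psi>' - \<psi>\<bar> \<le> (C + D) * L / q" by (simp add: algebra_simps add_divide_distrib)
      \<comment> \<open>Here the range of \<eta> enters: 2 / \<eta>^2 is below 2 L / 9 and \<eta>^2
        / 2 below L / 8, both at most L / 4. So \<psi> is at least n^(-1/4) / 4, which dominates the
        error of order L n^(-1/2).\<close>
      have \<psi>: "\<psi> \<ge> 1 / 4 * exp (- (L / 4))"
      proof -
        have "(3 / l)\<^sup>2 \<le> \<eta>\<^sup>2" using e l by (intro power_mono) auto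
        then have "9 / L \<le> \<eta>\<^sup>2" by (simp add: power_divide l)
        then have "2 / \<eta>\<^sup>2 \<le> 2 / (9 / L)" using L \<eta> by (intro divide_left_mono) auto
        also have "\<dots> \<le> L / 4" using L by simp
        finally have "exp (- (L / 4)) \<le> exp (- (2 / \<eta>\<^sup>2))" by simp
        moreover have "\<eta>\<^sup>2 / 2 \<le> L / 4" using \<eta>2 L by linarith
        then have "exp (- (L / 4)) \<le> exp (- (\<eta>\<^sup>2 / 2))" by simp
        ultimately have "1 / 4 * exp (- (L / 4)) \<le> 1 / 4 * min (exp (- (2 / \<eta>\<^sup>2))) (exp (- (\<eta>\<^sup>2 / 2)))" by simp
        also have "\<dots> \<le> \<psi>" unfolding \<psi>_def x_def by (rule alt_sum_gauss_lower_bound[OF \<eta>])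
        finally show ?thesis .
      qed
      have \<psi>0: "\<psi> > 0" using \<psi> exp_gt_zero[of "- (L / 4)"] by linarith
      have "1 / \<psi> \<le> 1 / (1 / 4 * exp (- (L / 4)))" using \<psi> \<psi>0 by (intro divide_left_mono) auto
      also have "1 / (1 / 4 * exp (- z)) = 4 * exp z" for z :: real by (simp add: exp_minus inverse_eq_divide)
      finally have inv\<psi>: "1 / \<psi> \<le> 4 * exp (L / 4)" .
      have b1: "\<bar>\<psi>' / \<psi> - 1\<bar> \<le> d1 n"
      proof -
        have "\<psi>' / \<psi> - 1 = (\<psi>' - \<psi>) * (1 / \<psi>)" using \<psi>0 by (simp add: diff_divide_distrib)
        then have "\<bar>\<psi>' / \<psi> - 1\<bar> = \<bar>\<psi>' - \<psi>\<bar> * (1 / \<psi>)" using \<psi>0 by (simp add: abs_mult)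
        also have "\<dots> \<le> ((C + D) * L / q) * (4 * exp (L / 4))"
          using diff inv\<psi> \<psi>0 C(1) D(1) L q by (intro mult_mono) auto
        also have "\<dots> = d1 n" unfolding d1_def L_def[symmetric] q_def[symmetric] by simp
        finally show ?thesis .
      qed
      have b2: "\<bar>t - 1\<bar> \<le> d2 n"
      proof -
        have "1 / H \<le> 1 / real h" using h unfolding H_def by (intro divide_left_mono) auto
        also have "\<dots> = 1 / \<eta> * (1 / q)" using q by (simp add: \<eta>_def)
        also have "\<dots> \<le> L * (1 / q)"
        proof (intro mult_right_mono)
          have "1 / \<eta> \<le> 1 / (3 / l)" using e \<eta> l by (intro divide_left_mono) auto
          then show "1 / \<eta> \<le> L" using lL l by simp
        qed (use q in auto)
        also have "\<dots> = d2 n" by (simp add: d2_def L_def q_def)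
        finally show ?thesis using t by simp
      qed
      have "\<bar>\<psi>' / \<psi> * t - 1\<bar> \<le> (1 + \<bar>\<psi>' / \<psi> - 1\<bar>) * (1 + \<bar>t - 1\<bar>) - 1" by (rule abs_mult_diff_1_le)
      also have "\<dots> \<le> (1 + d1 n) * (1 + d2 n) - 1" using b1 b2 by (intro diff_right_mono mult_mono) auto
      finally have b12: "1 + \<bar>\<psi>' / \<psi> * t - 1\<bar> \<le> (1 + d1 n) * (1 + d2 n)" by simp
      have "\<bar>(\<psi>' / \<psi> * t) * v n - 1\<bar> \<le> (1 + \<bar>\<psi>' / \<psi> * t - 1\<bar>) * (1 + \<bar>v n - 1\<bar>) - 1" by (rule abs_mult_diff_1_le)
      also have "\<dots> \<le> (1 + d1 n) * (1 + d2 n) * (1 + \<bar>v n - 1\<bar>) - 1" using b12 by (intro diff_right_mono mult_right_mono) auto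
      also have "\<dots> < \<epsilon>" by (rule elim(1))
      finally have "\<bar>(\<psi>' / \<psi> * t) * v n - 1\<bar> < \<epsilon>" .
      moreover have "pmf (height_pmf n) h / (2 * height_density \<eta> / q) = (\<psi>' / \<psi> * t) * v n"
      proof -
        define P where "P = prob_max n"
        have P: "P > 0" using prob_max_pos by (simp add: P_def)
        have hd: "height_density \<eta> = 4 / pi * c / \<eta> * \<psi>" unfolding \<psi>_def x_def c_def by (rule height_density_gauss[OF \<eta>])
        have pc: "2 * (c * c) = pi" using c by simp
        have "2 * (4 / (2 * (c * c)) * c / \<eta> * \<psi>) / q = 4 * \<psi> / (c * \<eta> * q)" using c(1) by simp
        then have "2 * (4 / pi * c / \<eta> * \<psi>) / q = 4 * \<psi> / (c * \<eta> * q)" unfolding pc .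
        also have "\<dots> = 4 * \<psi> / (c * real h)" using q by (simp add: \<eta>_def)
        finally have den: "2 * height_density \<eta> / q = 4 * \<psi> / (c * real h)" unfolding hd .
        have "4 / (H * q) * \<psi>' / P / (4 * \<psi> / (c * real h)) = (\<psi>' / \<psi> * t) * (c / (q * P))"
          using c(1) q P \<psi>0 h H unfolding t_def by (simp add: field_simps)
        then show ?thesis unfolding den pmf_height_pmf p v_def by (simp only: P_def q_def)
      qed
      ultimately show "\<bar>pmf (height_pmf n) h / (2 * height_density (real h / sqrt (real n)) / sqrt (real n)) - 1\<bar> < \<epsilon>"
        by (simp only: \<eta>_def q_def)
    qed
  qed
qed

section \<open>The expansions in their stated form\<close>

lemma prob_max_asymptotics:
  "(\<lambda>n. prob_max n -
        (sqrt (pi / (2 * real n))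
         - 5 * sqrt (2 * pi) / (24 * sqrt (real n ^ 3))
         + 127 * sqrt (2 * pi) / (960 * sqrt (real n ^ 5))
         - 1571 * sqrt (2 * pi) / (16128 * sqrt (real n ^ 7))
         + 43661 * sqrt (2 * pi) / (552960 * sqrt (real n ^ 9))))
       \<in> O(\<lambda>n. 1 / sqrt (real n ^ 11))"
proof -
  define s where "s = sqrt (pi / 2)"
  have s2: "sqrt (2 * pi) = 2 * s"
  proof -
    have "sqrt (2 * pi) = sqrt (2\<^sup>2 * (pi / 2))" by simp
    then show ?thesis unfolding real_sqrt_mult s_def by simp
  qed
  have "sqrt (pi / (2 * real n)) - 5 * sqrt (2 * pi) / (24 * sqrt (real n ^ 3)) + 127 * sqrt (2 * pi) / (960 * sqrt (real n ^ 5))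
      - 1571 * sqrt (2 * pi) / (16128 * sqrt (real n ^ 7)) + 43661 * sqrt (2 * pi) / (552960 * sqrt (real n ^ 9))
      = s * prob_max_approx (real n)" for n
  proof (cases "n = 0")
    \<comment> \<open>Division by 0 gives 0, so both sides vanish and the identity holds for every
      n, not just eventually.\<close>
    case True
    then show ?thesis by (simp add: prob_max_approx_def)
  next
    case False
    define q where "q = sqrt (real n)"
    have q: "q > 0" "real n = q\<^sup>2" using False by (simp_all add: q_def)
    have "pi / (2 * real n) = (pi / 2) / real n" by simp
    then have 1: "sqrt (pi / (2 * real n)) = s / q" unfolding s_def q_def by (simp only: real_sqrt_divide)
    have 2: "sqrt (real n ^ k) = q ^ k" for k by (simp add: real_sqrt_power q_def)
    have "s / q - 5 * (2 * s) / (24 * q ^ 3) + 127 * (2 * s) / (960 * q ^ 5) - 1571 * (2 * s) / (16128 * q ^ 7) + 43661 * (2 * s) / (552960 * q ^ 9)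
        = s * ((1 - 5 / (12 * q\<^sup>2) + 127 / (480 * (q\<^sup>2)\<^sup>2) - 1571 / (8064 * (q\<^sup>2) ^ 3) + 43661 / (276480 * (q\<^sup>2) ^ 4)) / q)"
      using q(1) by (simp add: field_simps eval_nat_numeral)
    then show ?thesis unfolding 1 2 s2 prob_max_approx_def using q by (simp add: real_sqrt_unique)
  qed
  then show ?thesis using prob_max_expansion unfolding s_def[symmetric] real_sqrt_power by (simp only:)
qed

lemma E_height_asymptotics:
  "(\<lambda>n. E_height n -
        (2 * catalan_const * sqrt (2 * real n / pi)
         - 1
         + 5 * sqrt 2 * catalan_const / (6 * sqrt (pi * real n))
         - 131 * sqrt 2 * catalan_const / (720 * sqrt (pi * real n ^ 3))
         + 1129 * sqrt 2 * catalan_const / (12096 * sqrt (pi * real n ^ 5))))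
       \<in> O(\<lambda>n. 1 / sqrt (real n ^ 7))"
proof -
  define G where "G = catalan_const"
  define c where "c = 2 * G / sqrt (pi / 2)"
  define B where "B x = sqrt x * (1 + 5 / (12 * x) - 131 / (1440 * x ^ 2) + 1129 / (24192 * x ^ 3))" for x :: real
  have c: "c = 2 * G * sqrt 2 / sqrt pi" unfolding c_def by (simp add: real_sqrt_divide)
  have "(\<lambda>n. moment 1 n / prob_max n - c * (1 / prob_max_approx (real n))) \<in> O(\<lambda>n. 1 / sqrt (real n) ^ 9)"
    unfolding c_def G_def by (rule moment_1_ratio)
  also have "(\<lambda>n. 1 / sqrt (real n) ^ 9) \<in> O(\<lambda>n. 1 / sqrt (real n) ^ 7)" by real_asymp
  finally have 1: "(\<lambda>n. moment 1 n / prob_max n - c * (1 / prob_max_approx (real n))) \<in> O(\<lambda>n. 1 / sqrt (real n) ^ 7)" .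
  have "(\<lambda>n. c * (1 / prob_max_approx (real n) - B (real n))) \<in> O(\<lambda>n. 1 * (1 / sqrt (real n) ^ 7))"
    unfolding B_def by (intro landau_o.big.mult bigo_const prob_max_approx_inverse)
  then have 2: "(\<lambda>n. c * (1 / prob_max_approx (real n) - B (real n))) \<in> O(\<lambda>n. 1 / sqrt (real n) ^ 7)" by simp
  have "moment 1 n / prob_max n - c * (1 / prob_max_approx (real n)) + c * (1 / prob_max_approx (real n) - B (real n))
      = E_height n - (2 * G * sqrt (2 * real n / pi) - 1 + 5 * sqrt 2 * G / (6 * sqrt (pi * real n))
        - 131 * sqrt 2 * G / (720 * sqrt (pi * real n ^ 3)) + 1129 * sqrt 2 * G / (12096 * sqrt (pi * real n ^ 5)))" for n
  proof -
    have "c * B (real n) = 2 * G * sqrt (2 * real n / pi) + 5 * sqrt 2 * G / (6 * sqrt (pi * real n))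
        - 131 * sqrt 2 * G / (720 * sqrt (pi * real n ^ 3)) + 1129 * sqrt 2 * G / (12096 * sqrt (pi * real n ^ 5))"
    proof (cases "n = 0")
      case True
      then show ?thesis by (simp add: B_def)
    next
      case False
      define q where "q = sqrt (real n)"
      have q: "q > 0" "real n = q\<^sup>2" using False by (simp_all add: q_def)
      define w where "w = sqrt pi"
      have w: "w > 0" by (simp add: w_def)
      have r: "sqrt (2 * real n / pi) = sqrt 2 * q / w" "sqrt (pi * real n) = w * q" "\<And>k. sqrt (pi * real n ^ k) = w * q ^ k"
        by (simp_all add: real_sqrt_power real_sqrt_mult real_sqrt_divide q_def w_def)
      have "2 * G * t / w * (q * (1 + 5 / (12 * q\<^sup>2) - 131 / (1440 * (q\<^sup>2)\<^sup>2) + 1129 / (24192 * (q\<^sup>2) ^ 3)))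
        = 2 * G * (t * q / w) + 5 * t * G / (6 * (w * q)) - 131 * t * G / (720 * (w * q ^ 3)) + 1129 * t * G / (12096 * (w * q ^ 5))" for t
        using q(1) w by (simp add: field_simps eval_nat_numeral)
      then show ?thesis unfolding r c w_def[symmetric] B_def using q by (simp add: real_sqrt_unique)
    qed
    then show ?thesis unfolding E_height_moment by (simp add: algebra_simps)
  qed
  then show ?thesis using sum_in_bigo(1)[OF 1 2] unfolding G_def real_sqrt_power by (simp only: real_sqrt_power)
qed

lemma Var_height_asymptotics:
  "(\<lambda>n. Var_height n -
        ((pi ^ 3 - 32 * catalan_const\<^sup>2) / (4 * pi) * real n
         + (pi ^ 3 - 40 * catalan_const\<^sup>2) / (6 * pi)
         - (pi ^ 3 - 12 * catalan_const\<^sup>2) / (180 * pi * real n)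
         + (11 * pi ^ 3 - 265 * catalan_const\<^sup>2) / (1890 * pi * (real n)\<^sup>2)))
       \<in> O(\<lambda>n. 1 / real n ^ 3)"
proof -
  define G where "G = catalan_const\<^sup>2"
  define A1 where "A1 x = x + 5 / 6 - 1 / (120 * x) + 53 / (3024 * x ^ 2)" for x :: real
  define A2 where "A2 x = 2 * x + 4 / 3 - 2 / (45 * x) + 44 / (945 * x ^ 2)" for x :: real
  define P where "P n = 1 / prob_max_approx (real n)" for n :: nat
  define Q where "Q n = moment_2_approx (real n) / prob_max_approx (real n)" for n :: nat
  have "(\<lambda>n. pi\<^sup>2 / 8 * (Q n - A2 (real n))) \<in> O(\<lambda>n. 1 * (1 / real n ^ 3))"
    unfolding A2_def Q_def by (intro landau_o.big.mult bigo_const moment_2_approx_ratio)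
  then have 2: "(\<lambda>n. pi\<^sup>2 / 8 * (Q n - A2 (real n))) \<in> O(\<lambda>n. 1 / real n ^ 3)" by simp
  have "(\<lambda>n. 8 * G / pi * ((P n)\<^sup>2 - A1 (real n))) \<in> O(\<lambda>n. 1 * (1 / real n ^ 3))"
    unfolding A1_def P_def by (intro landau_o.big.mult bigo_const prob_max_approx_inverse_square)
  then have 1: "(\<lambda>n. 8 * G / pi * ((P n)\<^sup>2 - A1 (real n))) \<in> O(\<lambda>n. 1 / real n ^ 3)" by simp
  note sum_in_bigo(2)[OF sum_in_bigo(1)[OF moment_2_ratio[folded Q_def] 2] sum_in_bigo(1)[OF moment_1_ratio_square[folded P_def G_def] 1]]
  moreover have "moment 2 n / prob_max n - pi\<^sup>2 / 8 * Q n + pi\<^sup>2 / 8 * (Q n - A2 (real n))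
      - ((moment 1 n / prob_max n)\<^sup>2 - 8 * G / pi * (P n)\<^sup>2 + 8 * G / pi * ((P n)\<^sup>2 - A1 (real n)))
      = Var_height n - ((pi ^ 3 - 32 * G) / (4 * pi) * real n + (pi ^ 3 - 40 * G) / (6 * pi)
         - (pi ^ 3 - 12 * G) / (180 * pi * real n) + (11 * pi ^ 3 - 265 * G) / (1890 * pi * (real n)\<^sup>2))" for n
  proof -
    have "pi\<^sup>2 / 8 * A2 x - 8 * G / pi * A1 x = (pi ^ 3 - 32 * G) / (4 * pi) * x + (pi ^ 3 - 40 * G) / (6 * pi)
         - (pi ^ 3 - 12 * G) / (180 * pi * x) + (11 * pi ^ 3 - 265 * G) / (1890 * pi * x\<^sup>2)" for x
    proof (cases "x = 0")
      \<comment> \<open>With division by 0 equal to 0, only the constant terms remain to be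
        compared.\<close>
      case True
      have "pi\<^sup>2 / 8 * (4 / 3) - 8 * G / pi * (5 / 6) = (pi ^ 3 - 40 * G) / (6 * pi)" by (simp add: field_simps eval_nat_numeral)
      then show ?thesis by (simp add: True A1_def A2_def)
    next
      case False
      then show ?thesis by (simp add: A1_def A2_def field_simps eval_nat_numeral)
    qed
    moreover have "m - c * q + c * (q - a) - (m' - d * p + d * (p - a')) = m - m' - (c * a - d * a')" for m c q a m' d p a' :: real
      by (simp add: algebra_simps)
    ultimately show ?thesis unfolding Var_height_moment by (simp only:)
  qed
  ultimately show ?thesis unfolding G_def by (simp only:)
qed

theorem theorem3p5:
  shows
    "(\<lambda>n. prob_max n -
        (sqrt (pi / (2 * real n))
         - 5 * sqrt (2 * pi) / (24 * sqrt (real n ^ 3))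
         + 127 * sqrt (2 * pi) / (960 * sqrt (real n ^ 5))
         - 1571 * sqrt (2 * pi) / (16128 * sqrt (real n ^ 7))
         + 43661 * sqrt (2 * pi) / (552960 * sqrt (real n ^ 9))))
       \<in> O(\<lambda>n. 1 / sqrt (real n ^ 11))
     \<and>
     (\<lambda>n. E_height n -
        (2 * catalan_const * sqrt (2 * real n / pi)
         - 1
         + 5 * sqrt 2 * catalan_const / (6 * sqrt (pi * real n))
         - 131 * sqrt 2 * catalan_const / (720 * sqrt (pi * real n ^ 3))
         + 1129 * sqrt 2 * catalan_const / (12096 * sqrt (pi * real n ^ 5))))
       \<in> O(\<lambda>n. 1 / sqrt (real n ^ 7))
     \<and>
     (\<lambda>n. Var_height n -
        ((pi ^ 3 - 32 * catalan_const\<^sup>2) / (4 * pi) * real n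
         + (pi ^ 3 - 40 * catalan_const\<^sup>2) / (6 * pi)
         - (pi ^ 3 - 12 * catalan_const\<^sup>2) / (180 * pi * real n)
         + (11 * pi ^ 3 - 265 * catalan_const\<^sup>2) / (1890 * pi * (real n)\<^sup>2)))
       \<in> O(\<lambda>n. 1 / real n ^ 3)
     \<and>
     (\<forall>r::nat.
        (\<lambda>n. E_height_power n r) \<sim>[at_top]
        (\<lambda>n. 2 powr (real r / 2 + 2) / pi * Gamma (real r / 2 + 1)
              * dirichlet_beta (real r + 1) * real n powr (real r / 2)))
     \<and>
     (\<forall>\<epsilon>>0. \<forall>\<^sub>F n in sequentially. \<forall>h::nat.
        3 / sqrt (ln (real n)) < real h / sqrt (real n) \<longrightarrow>
        real h / sqrt (real n) < sqrt (ln (real n)) / 2 \<longrightarrow>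
        h mod 2 = n mod 2 \<longrightarrow>
        \<bar>pmf (height_pmf n) h / (2 * height_density (real h / sqrt (real n)) / sqrt (real n)) - 1\<bar> < \<epsilon>)
     \<and>
     (\<forall>\<eta>::real. \<eta> > 0 \<longrightarrow>
        height_density \<eta> =
          sqrt (2 * pi) / \<eta>\<^sup>2 *
          (\<Sum>k. (-1) ^ k * (2 * real k + 1) * exp (- (pi\<^sup>2 * (2 * real k + 1)\<^sup>2 / (8 * \<eta>\<^sup>2)))))"
  by (intro conjI allI impI prob_max_asymptotics E_height_asymptotics Var_height_asymptotics
      E_height_power_asymp local_limit height_density_dual)

end
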